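(* Let $(N^T_t)_{t\in[0,T]}$, $T>0$, be the collection of locally stationary Hawkes processes with baseline $\mu:[0,1]\to[0,\infty)^p$, reproduction function $g:[0,1]\to[0,\infty)$ and kernel $\varphi=(\varphi_{kl}):[0,\infty)\to\mathcal M_p([0,\infty))$. Suppose that $\mu$ is continuous and $g$ is continuously differentiable on $[0,1]$, that $\int_0^\infty\varphi_{kl}(t)\,dt<\infty$ for all $k,l$, and that the matrix with coefficients $\|g\|_{L^\infty}\int_0^\infty\varphi_{kl}(t)\,dt$ has spectral radius less than $1$. Then, as $T\to\infty$, $$\sup_{u\in[0,1]}\Big\|\frac1T N^T_{Tu}-\int_0^u(\mathbf{Id}-\mathbf K(x))^{-1}\mu(x)\,dx\Big\|\to 0$$ in $L^2(\mathbb P)$ and $\mathbb P$-almost surely, where $\mathbf K(x)=g(x)\int_0^\infty\varphi(s)\,ds$.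
   Context: Fix $p\ge1$; $\mathcal M_p(E)$ denotes the $p\times p$ matrices with entries in $E$, $\mathbf{Id}$ the identity matrix, $\|g\|_{L^\infty}=\sup_{[0,1]}g$, and $\|\cdot\|$ is a norm on $\mathbb R^p$. On a probability space $(\Omega,\mathcal F,\mathbb P)$ let $\pi_1,\dots,\pi_p$ be independent Poisson random measures on $\mathbb R^2$ with unit intensity (the same for all $T$). For each $T>0$, the locally stationary Hawkes process $N^T=(N^T_1,\dots,N^T_p)$ with baseline $\mu$, reproduction function $g$ and kernel $\varphi$ (measurable) is the $p$-variate point process on $[0,T]$ defined recursively by $$N^T_{k,t}=\int_0^t\int_0^\infty \mathbf 1_{\{x\le\lambda^T_{k,s}\}}\,\pi_k(dx,ds),\qquad \lambda^T_{k,t}=\mu_k\big(\tfrac tT\big)+\sum_{l=1}^p\int_{[0,t)}g\big(\tfrac tT\big)\varphi_{kl}(t-s)\,dN^T_{l,s},\quad k=1,\dots,p .$$ Thus $\lambda^T=(\lambda^T_1,\dots,\lambda^T_p)$ is the intensity of $N^T$. *)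

theory Defs
  imports "HOL-Probability.Probability"
begin

text \<open>The norm on \<open>\<real>\<^sup>p\<close> is arbitrary, so it is a function rather than the Euclidean
  \<^const>\<open>norm\<close> of the type \<open>real ^ 'p\<close>.\<close>

definition is_norm :: "('a::real_vector \<Rightarrow> real) \<Rightarrow> bool" where
  "is_norm \<nu> \<longleftrightarrow>
     (\<forall>x. 0 \<le> \<nu> x) \<and> (\<forall>x. \<nu> x = 0 \<longrightarrow> x = 0) \<and>
     (\<forall>c x. \<nu> (c *\<^sub>R x) = \<bar>c\<bar> * \<nu> x) \<and>
     (\<forall>x y. \<nu> (x + y) \<le> \<nu> x + \<nu> y)"

definition C1_on_interval :: "real \<Rightarrow> real \<Rightarrow> (real \<Rightarrow> real) \<Rightarrow> bool" where
  "C1_on_interval a b f \<longleftrightarrow>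
     (\<exists>f'. (\<forall>x\<in>{a..b}. (f has_real_derivative f' x) (at x within {a..b})) \<and>
           continuous_on {a..b} f')"

text \<open>Eigenvalues are taken over \<open>\<complex>\<close>.\<close>

definition cart_eigenvalues :: "real ^ 'n ^ 'n \<Rightarrow> complex set" where
  "cart_eigenvalues A =
     {z. \<exists>v :: complex ^ 'n. v \<noteq> 0 \<and> (\<chi> i j. complex_of_real (A $ i $ j)) *v v = z *s v}"

definition cart_spectral_radius :: "real ^ 'n ^ 'n \<Rightarrow> real" where
  "cart_spectral_radius A = Max (cmod ` cart_eigenvalues A)"

text \<open>Values in \<open>\<nat> \<union> {\<infinity>}\<close> are required for every outcome, the Poisson law and the
  independence over disjoint sets being those of the standard definition. That the value is
  almost surely infinite on sets of infinite intensity is then a consequence for \<open>\<sigma>\<close>-finite \<open>\<nu>\<close>. The Poisson weights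
  are written out because \<^const>\<open>poisson_pmf\<close> is only specified for a positive rate, whereas
  \<open>\<nu> A = 0\<close> is included here.\<close>

definition poisson_random_measure ::
  "'w measure \<Rightarrow> 'e measure \<Rightarrow> ('w \<Rightarrow> 'e measure) \<Rightarrow> bool" where
  "poisson_random_measure M \<nu> \<pi> \<longleftrightarrow>
     (\<forall>\<omega>\<in>space M. sets (\<pi> \<omega>) = sets \<nu>) \<and>
     (\<forall>\<omega>\<in>space M. \<forall>A\<in>sets \<nu>. \<exists>n::enat. emeasure (\<pi> \<omega>) A = ennreal_of_enat n) \<and>
     (\<forall>A\<in>sets \<nu>. (\<lambda>\<omega>. emeasure (\<pi> \<omega>) A) \<in> borel_measurable M) \<and>
     (\<forall>A\<in>sets \<nu>. emeasure \<nu> A < \<infinity> \<longrightarrow>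
        (\<forall>n. measure M {\<omega>\<in>space M. emeasure (\<pi> \<omega>) A = of_nat n} =
             measure \<nu> A ^ n / fact n * exp (- measure \<nu> A))) \<and>
     (\<forall>A :: nat \<Rightarrow> 'e set. range A \<subseteq> sets \<nu> \<longrightarrow> disjoint_family A \<longrightarrow>
        prob_space.indep_vars M (\<lambda>_. borel) (\<lambda>i \<omega>. emeasure (\<pi> \<omega>) (A i)) UNIV)"

text \<open>Independence of random measures: each one is the random element \<open>(\<pi>\<^sub>k(A))\<^sub>A\<close> of a product
  space indexed by the measurable sets \<open>A\<close>.\<close>

definition indep_random_measures ::
  "'w measure \<Rightarrow> 'e measure \<Rightarrow> ('k \<Rightarrow> 'w \<Rightarrow> 'e measure) \<Rightarrow> bool" where
  "indep_random_measures M \<nu> \<pi> \<longleftrightarrow>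
     prob_space.indep_vars M (\<lambda>_. Pi\<^sub>M (sets \<nu>) (\<lambda>_. borel))
       (\<lambda>k \<omega>. \<lambda>A\<in>sets \<nu>. emeasure (\<pi> k \<omega>) A) UNIV"

text \<open>A point process on \<open>[0,T]\<close> is a random finite counting measure \<open>N\<close>, the measure \<open>dN\<close> of the
  counting path \<open>t \<mapsto> N[0,t]\<close>.\<close>

definition point_process_on :: "'w measure \<Rightarrow> real \<Rightarrow> ('w \<Rightarrow> real measure) \<Rightarrow> bool" where
  "point_process_on M T N \<longleftrightarrow>
     (\<forall>\<omega>\<in>space M. sets (N \<omega>) = sets borel \<and> emeasure (N \<omega>) (- {0..T}) = 0 \<and>
        (\<forall>A\<in>sets borel. \<exists>n::nat. emeasure (N \<omega>) A = of_nat n)) \<and>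
     (\<forall>A\<in>sets borel. (\<lambda>\<omega>. emeasure (N \<omega>) A) \<in> borel_measurable M)"

definition hawkes_intensity ::
  "real \<Rightarrow> (real \<Rightarrow> real ^ 'p) \<Rightarrow> (real \<Rightarrow> real) \<Rightarrow> (real \<Rightarrow> real ^ 'p ^ 'p) \<Rightarrow>
   ('p \<Rightarrow> real measure) \<Rightarrow> 'p \<Rightarrow> real \<Rightarrow> ennreal" where
  "hawkes_intensity T \<mu> g \<phi> n k t =
     ennreal (\<mu> (t / T) $ k) +
     (\<Sum>l\<in>UNIV. \<integral>\<^sup>+ s\<in>{0..<t}. ennreal (g (t / T) * \<phi> (t - s) $ k $ l) \<partial>n l)"

text \<open>A point of \<open>\<pi> k \<omega>\<close> is a pair \<open>(x, s)\<close> of a level and a time. The equations hold almost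
  surely, with an exceptional null set that does not depend on \<open>T\<close>: changing each \<open>N\<^sup>T\<close> on a null
  set of its own could destroy almost sure convergence as \<open>T \<rightarrow> \<infinity>\<close> through the reals.\<close>

definition hawkes_family ::
  "'w measure \<Rightarrow> ('p \<Rightarrow> 'w \<Rightarrow> (real \<times> real) measure) \<Rightarrow>
   (real \<Rightarrow> real ^ 'p) \<Rightarrow> (real \<Rightarrow> real) \<Rightarrow> (real \<Rightarrow> real ^ 'p ^ 'p) \<Rightarrow>
   (real \<Rightarrow> 'p \<Rightarrow> 'w \<Rightarrow> real measure) \<Rightarrow> bool" where
  "hawkes_family M \<pi> \<mu> g \<phi> N \<longleftrightarrow>
     (\<forall>T>0. \<forall>k. point_process_on M T (N T k)) \<and>
     (AE \<omega> in M. \<forall>T>0. \<forall>k. \<forall>t\<in>{0..T}.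
        emeasure (N T k \<omega>) {0..t} =
        emeasure (\<pi> k \<omega>) {(x, s). 0 \<le> s \<and> s \<le> t \<and> 0 \<le> x \<and>
          ennreal x \<le> hawkes_intensity T \<mu> g \<phi> (\<lambda>l. N T l \<omega>) k s})"

definition kernel_integral :: "(real \<Rightarrow> real ^ 'p ^ 'p) \<Rightarrow> real ^ 'p ^ 'p" where
  "kernel_integral \<phi> = (\<chi> k l. LBINT t:{0..}. \<phi> t $ k $ l)"

definition hawkes_deviation ::
  "(real ^ 'p \<Rightarrow> real) \<Rightarrow> (real \<Rightarrow> real ^ 'p) \<Rightarrow> (real \<Rightarrow> real) \<Rightarrow> (real \<Rightarrow> real ^ 'p ^ 'p) \<Rightarrow>
   (real \<Rightarrow> 'p \<Rightarrow> 'w \<Rightarrow> real measure) \<Rightarrow> real \<Rightarrow> 'w \<Rightarrow> real" where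
  "hawkes_deviation \<nu> \<mu> g \<phi> N T \<omega> =
     (SUP u\<in>{0..1}. \<nu> ((1 / T) *\<^sub>R (\<chi> k. measure (N T k \<omega>) {0..T * u}) -
        (LBINT x:{0..u}. matrix_inv (mat 1 - g x *\<^sub>R kernel_integral \<phi>) *v \<mu> x)))"

definition tendsto_L2_zero :: "'w measure \<Rightarrow> (real \<Rightarrow> 'w \<Rightarrow> real) \<Rightarrow> bool" where
  "tendsto_L2_zero M X \<longleftrightarrow>
     (\<forall>T>0. X T \<in> borel_measurable M \<and> integrable M (\<lambda>\<omega>. (X T \<omega>)\<^sup>2)) \<and>
     ((\<lambda>T. \<integral>\<omega>. (X T \<omega>)\<^sup>2 \<partial>M) \<longlongrightarrow> 0) at_top"

end

theory Submission
  imports Defs "HOL-Computational_Algebra.Polynomial" "HOL-Real_Asymp.Real_Asymp"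
begin

text \<open>Monotonicity in the data compares \<open>N\<^sup>T\<close>, for all \<open>T\<close> in a window \<open>[H / b, H]\<close> at once, with two
  minimal Hawkes processes at the single scale \<open>H\<close> whose baseline and reproduction function are
  shifted by \<open>\<plusminus>\<delta>\<close>. For a minimal process the mean solves a renewal equation, whose solution is asymptotically
  \<open>(Id - K(t / H))\<^sup>-\<^sup>1 \<mu>(t / H)\<close> in mean over \<open>[0, H]\<close>. Testing the intensity equation
  with the solution of the adjoint renewal equation writes the centred count as a compensated Poisson
  integral, so that its variance is \<open>O(H)\<close>; subcriticality enters through a weight \<open>\<zeta> \<ge> 1 + \<zeta> B\<close>.
  With \<open>H = T\<close> this is convergence in \<open>L\<^sup>2\<close>. Along \<open>H = b\<^sup>n\<close> the variances of \<open>N / H\<close> are summable and the windows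
  cover all large \<open>T\<close>, which gives almost sure convergence.\<close>

text \<open>Nothing is known about the adaptedness of the given processes:
  \<open>hawkes_family\<close> supplies an almost sure pathwise equation. Moments are therefore
  computed for minimal processes, which Picard iteration from zero makes predictable, and they reach
  \<open>N T\<close> through pathwise comparison on the same Poisson points. The lower comparison is
  an induction along the iteration. The upper one has to bound an arbitrary solution, whose
  acceptance rule is non-strict, by the smallest solution of a system with a strict rule; a strictly
  larger baseline, produced by the upward shift, settles both points. The shift must not destroy
  subcriticality, so the weights \<open>\<zeta>\<close> and the bound \<open>c\<close> on the
  reproduction function are chosen with a margin \<open>\<delta>0\<close> and are then shared by all
  perturbed data. In place of martingale theory there are two identities for nonnegative predictable
  integrands. They are stated without subtraction, as identities of extended nonnegative numbers, so
  that it suffices to check them on rectangles.\<close>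

section \<open>Spectral radius and weights for subcritical matrices\<close>

text \<open>Add up the moduli of the coordinates of the eigenvalue equation and divide by the l1
  norm of \<open>v\<close>. The bound serves to exhibit a number that is not an eigenvalue.\<close>

lemma eigenvalue_le_sum_entries:
  fixes A :: "complex ^ 'n ^ 'n"
  assumes v: "v \<noteq> 0" and eq: "A *v v = z *s v"
  shows "cmod z \<le> (\<Sum>i\<in>UNIV. \<Sum>j\<in>UNIV. cmod (A $ i $ j))"
proof -
  let ?C = "\<Sum>i\<in>UNIV. \<Sum>j\<in>UNIV. cmod (A $ i $ j)"
  let ?S = "\<Sum>i\<in>UNIV. cmod (v $ i)"
  obtain i0 where i0: "v $ i0 \<noteq> 0" using v by (auto simp: vec_eq_iff)
  have pos: "0 < ?S"
    by (rule sum_pos2[of _ i0]) (use i0 in auto)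
  have "cmod z * ?S = (\<Sum>i\<in>UNIV. cmod ((A *v v) $ i))"
    by (simp add: eq sum_distrib_left norm_mult)
  also have "\<dots> \<le> (\<Sum>i\<in>UNIV. \<Sum>j\<in>UNIV. cmod (A $ i $ j) * cmod (v $ j))"
    by (intro sum_mono) (auto simp: matrix_vector_mult_def norm_mult intro!: order.trans[OF norm_sum])
  also have "\<dots> \<le> (\<Sum>i\<in>UNIV. \<Sum>j\<in>UNIV. cmod (A $ i $ j) * ?S)"
    by (intro sum_mono mult_left_mono member_le_sum) auto
  also have "\<dots> = ?C * ?S" by (simp add: sum_distrib_right)
  finally show ?thesis using pos by simp
qed

text \<open>The eigenvalues are the roots of the characteristic polynomial. Finiteness gives meaning
  to the \<open>Max\<close> in \<open>cart_spectral_radius\<close>.\<close>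

lemma finite_cart_eigenvalues: "finite (cart_eigenvalues (A :: real ^ 'n ^ 'n))"
proof -
  define B :: "complex ^ 'n ^ 'n" where "B = (\<chi> i j. complex_of_real (A $ i $ j))"
  \<comment> \<open>Leibniz expansion of the determinant of \<open>B - mat z\<close>, read as a
    polynomial in \<open>z\<close>; only diagonal factors are of degree one.\<close>
  define P :: "complex poly" where
    "P = (\<Sum>p\<in>{p. p permutes (UNIV :: 'n set)}. smult (of_int (sign p))
           (\<Prod>i\<in>UNIV. [:B $ i $ p i, if i = p i then - 1 else 0:]))"
  have P: "poly P z = det (B - mat z)" for z
    unfolding P_def det_def poly_sum
    by (intro sum.cong refl) (auto simp: poly_prod mat_def intro!: prod.cong)
  have det0: "det (B - mat z) = 0 \<longleftrightarrow> (\<exists>v. v \<noteq> 0 \<and> B *v v = z *s v)" for z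
  proof -
    have "mat z *v v = z *s v" for v :: "complex ^ 'n"
      by (simp add: vec_eq_iff matrix_vector_mult_def mat_def if_distrib[of "\<lambda>c. c * _"] cong: if_cong)
    then have "(B - mat z) *v v = 0 \<longleftrightarrow> B *v v = z *s v" for v
      by (simp add: matrix_vector_mult_diff_rdistrib)
    then show ?thesis
      by (metis invertible_det_nz invertible_left_inverse matrix_left_invertible_ker)
  qed
  have "P \<noteq> 0"
  proof
    assume "P = 0"
    \<comment> \<open>A point just beyond the eigenvalue bound: the determinant cannot vanish
      there.\<close>
    let ?z = "complex_of_real ((\<Sum>i\<in>UNIV. \<Sum>j\<in>UNIV. cmod (B $ i $ j)) + 1)"
    have "det (B - mat ?z) = 0" using P[of ?z] \<open>P = 0\<close> by simp
    then obtain v where "v \<noteq> 0" "B *v v = ?z *s v" using det0 by blast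
    from eigenvalue_le_sum_entries[OF this]
    have "\<bar>(\<Sum>i\<in>UNIV. \<Sum>j\<in>UNIV. cmod (B $ i $ j)) + 1\<bar> \<le> (\<Sum>i\<in>UNIV. \<Sum>j\<in>UNIV. cmod (B $ i $ j))"
      by (simp only: norm_of_real)
    then show False by linarith
  qed
  have "cart_eigenvalues A = {z. poly P z = 0}"
    using det0 by (simp add: cart_eigenvalues_def P flip: B_def)
  then show ?thesis using poly_roots_finite[OF \<open>P \<noteq> 0\<close>] by simp
qed

lemma real_eigenvalue_le_spectral_radius:
  fixes A :: "real ^ 'n ^ 'n"
  assumes "v \<noteq> 0" "A *v v = r *s v"
  shows "\<bar>r\<bar> \<le> cart_spectral_radius A"
proof -
  let ?v = "(\<chi> i. complex_of_real (v $ i)) :: complex ^ 'n"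
  have "?v \<noteq> 0" using assms(1) by (auto simp: vec_eq_iff)
  moreover have "(\<chi> i j. complex_of_real (A $ i $ j)) *v ?v = complex_of_real r *s ?v"
  proof -
    have "(\<Sum>j\<in>UNIV. A $ i $ j * v $ j) = r * v $ i" for i
      using assms(2) by (auto simp: vec_eq_iff matrix_vector_mult_def)
    then have "complex_of_real (\<Sum>j\<in>UNIV. A $ i $ j * v $ j) = complex_of_real (r * v $ i)" for i
      by simp
    then show ?thesis by (simp add: vec_eq_iff matrix_vector_mult_def)
  qed
  ultimately have "complex_of_real r \<in> cart_eigenvalues A"
    by (auto simp: cart_eigenvalues_def)
  then have "cmod (complex_of_real r) \<le> cart_spectral_radius A"
    unfolding cart_spectral_radius_def by (intro Max_ge finite_imageI finite_cart_eigenvalues imageI)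
  then show ?thesis by simp
qed

text \<open>Follow the solution of \<open>\<zeta> (Id - t B) = 1\<close> from \<open>t = 0\<close> to \<open>t = 1\<close>: it is continuous, and
  as soon as it is nonnegative it is at least \<open>1\<close>, so by connectedness it cannot change sign.
  This replaces Perron-Frobenius theory.\<close>

lemma subcritical_weights:
  fixes B :: "real ^ 'n ^ 'n"
  assumes nonneg: "\<And>i j. 0 \<le> B $ i $ j" and rad: "cart_spectral_radius B < 1"
  obtains \<zeta> :: "'n \<Rightarrow> real" where "\<And>l. 1 + (\<Sum>k\<in>UNIV. \<zeta> k * B $ k $ l) \<le> \<zeta> l" "\<And>l. 0 \<le> \<zeta> l"
proof -
  define C where "C t = mat 1 - t *\<^sub>R transpose B" for t
  \<comment> \<open>A kernel vector of \<open>mat 1 - t *\<^sub>R B\<close> would be an eigenvector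
    of \<open>B\<close> with eigenvalue \<open>1 / t\<close>, which is at least one.\<close>
  have det: "det (C t) \<noteq> 0" if t: "t \<in> {0..1}" for t
  proof
    assume "det (C t) = 0"
    then have "det (transpose (C t)) = 0" by simp
    moreover have tr: "transpose (C t) = mat 1 - t *\<^sub>R B"
      by (simp add: C_def transpose_def vec_eq_iff mat_def)
    ultimately obtain v where v: "v \<noteq> 0" "(mat 1 - t *\<^sub>R B) *v v = 0"
      by (metis invertible_det_nz invertible_left_inverse matrix_left_invertible_ker)
    have v': "v = t *s (B *v v)"
      using v(2) by (simp add: matrix_vector_mult_diff_rdistrib scaleR_matrix_vector_assoc[symmetric]
          scalar_mult_eq_scaleR)
    then have "t \<noteq> 0" using v(1) by auto
    then have "B *v v = (1 / t) *s v" by (subst (2) v') (simp add: vec_eq_iff)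
    from real_eigenvalue_le_spectral_radius[OF v(1) this] rad have "1 / t < 1" by linarith
    then show False using t \<open>t \<noteq> 0\<close> by (auto simp: field_simps)
  qed
  \<comment> \<open>Cramer's rule displays the solution as a quotient of polynomials in
    \<open>t\<close>, so that continuity is immediate.\<close>
  define Z where "Z t k = det (\<chi> i j. if j = k then 1 else C t $ i $ j) / det (C t)" for t k
  have Z_eq: "Z t l = 1 + t * (\<Sum>k\<in>UNIV. Z t k * B $ k $ l)" if t: "t \<in> {0..1}" for t l
  proof -
    have "C t *v (\<chi> k. Z t k) = (\<chi> i. 1)"
      by (subst cramer[OF det[OF t]]) (simp add: Z_def vec_eq_iff cong: if_cong)
    then have "(\<Sum>k\<in>UNIV. C t $ l $ k * Z t k) = 1"
      by (simp add: vec_eq_iff matrix_vector_mult_def)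
    moreover have "(\<Sum>k\<in>UNIV. C t $ l $ k * Z t k) =
        (\<Sum>k\<in>UNIV. (if l = k then Z t k else 0)) - (\<Sum>k\<in>UNIV. t * (Z t k * B $ k $ l))"
      unfolding sum_subtractf[symmetric]
      by (intro sum.cong) (auto simp: C_def mat_def transpose_def algebra_simps)
    ultimately show ?thesis by (simp add: sum_distrib_left)
  qed
  have cont: "continuous_on {0..1} (\<lambda>t. Z t k)" for k
  proof -
    have c: "continuous_on {0..1} (\<lambda>t. if j = k then 1 else C t $ i $ j)" for i j
      by (cases "j = k") (auto simp: C_def intro!: continuous_intros)
    show ?thesis unfolding Z_def
      by (rule continuous_on_divide) (use det c in \<open>auto simp: det_def C_def intro!: continuous_intros\<close>)
  qed
  \<comment> \<open>Two disjoint closed sets covering the connected interval; \<open>0\<close> lies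
    in \<open>?P\<close> because every \<open>Z 0 l\<close> is one, hence \<open>?Q\<close> misses
    the interval.\<close>
  let ?P = "\<Inter>l. {t\<in>{0..1}. 1 \<le> Z t l}" and ?Q = "\<Union>l. {t\<in>{0..1}. Z t l \<le> 0}"
  have closed_le: "closed {t\<in>{0..1}. 1 \<le> Z t l}" "closed {t\<in>{0..1}. Z t l \<le> 0}" for l
    using continuous_closed_preimage[OF cont[of l], where T="{1..}"]
      continuous_closed_preimage[OF cont[of l], where T="{..0}"]
    by (simp_all add: vimage_def Int_def)
  have closed: "closed ?P" "closed ?Q" using closed_le by (auto intro!: closed_INT closed_UN)
  have cover: "{0..1} \<subseteq> ?P \<union> ?Q"
  proof
    fix t :: real assume t: "t \<in> {0..1}"
    show "t \<in> ?P \<union> ?Q"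
    proof (cases "\<exists>l. Z t l \<le> 0")
      case False
      then have "0 \<le> t * (\<Sum>k\<in>UNIV. Z t k * B $ k $ l)" for l
        using t nonneg by (intro mult_nonneg_nonneg sum_nonneg) (auto simp: not_le less_imp_le)
      then have "1 \<le> Z t l" for l using Z_eq[OF t, of l] by simp
      then show ?thesis using t by auto
    qed (use t in auto)
  qed
  have disj: "?P \<inter> ?Q \<inter> {0..1} = {}"
  proof -
    { fix t l assume "1 \<le> Z t l" "Z t l \<le> 0" then have False by simp }
    then show ?thesis by blast
  qed
  have "0 \<in> ?P" using Z_eq[of 0] by auto
  then have "?P \<inter> {0..1} \<noteq> {}" by auto
  moreover have "\<not> (\<exists>A B. closed A \<and> closed B \<and> {0..1::real} \<subseteq> A \<union> B \<and> A \<inter> B \<inter> {0..1} = {} \<and>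
      A \<inter> {0..1} \<noteq> {} \<and> B \<inter> {0..1} \<noteq> {})"
    using connected_Icc[of "0::real" 1] unfolding connected_closed .
  ultimately have Q: "?Q \<inter> {0..1} = {}"
    using closed cover disj by meson
  have "1 \<in> ?P \<union> ?Q" using cover by (rule subsetD) simp
  moreover have "1 \<notin> ?Q"
  proof
    assume "1 \<in> ?Q"
    then have "1 \<in> ?Q \<inter> {0..1}" by (rule IntI) simp
    then show False unfolding Q by (rule emptyE)
  qed
  ultimately have "1 \<in> ?P" unfolding Un_iff by - (erule disjE, assumption, erule (1) notE)
  then have ge: "1 \<le> Z 1 l" for l by auto
  show ?thesis
  proof (rule that[of "Z 1"])
    show "1 + (\<Sum>k\<in>UNIV. Z 1 k * B $ k $ l) \<le> Z 1 l" for l using Z_eq[of 1 l] by simp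
    show "0 \<le> Z 1 l" for l using ge[of l] by simp
  qed
qed

text \<open>Pair the inequality with \<open>\<zeta>\<close>. Since
  \<open>\<zeta> B \<le> \<zeta> - 1\<close>, the weighted sum of the \<open>\<bar>d l\<bar>\<close>
  cancels and their plain sum is left. This plays the part of a norm bound for the inverse of
  \<open>Id - B\<close>.\<close>

lemma weighted_sum_bound:
  fixes \<zeta> d r :: "'n::finite \<Rightarrow> real"
  assumes d: "\<And>k. \<bar>d k\<bar> \<le> r k + (\<Sum>l\<in>UNIV. B k l * \<bar>d l\<bar>)"
    and \<zeta>: "\<And>l. 1 + (\<Sum>k\<in>UNIV. \<zeta> k * B k l) \<le> \<zeta> l" "\<And>l. 0 \<le> \<zeta> l"
  shows "(\<Sum>l\<in>UNIV. \<bar>d l\<bar>) \<le> (\<Sum>k\<in>UNIV. \<zeta> k * r k)"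
proof -
  have "(\<Sum>k\<in>UNIV. \<zeta> k * \<bar>d k\<bar>) \<le> (\<Sum>k\<in>UNIV. \<zeta> k * (r k + (\<Sum>l\<in>UNIV. B k l * \<bar>d l\<bar>)))"
    by (intro sum_mono mult_left_mono d \<zeta>)
  also have "\<dots> = (\<Sum>k\<in>UNIV. \<zeta> k * r k) + (\<Sum>k\<in>UNIV. \<Sum>l\<in>UNIV. \<zeta> k * B k l * \<bar>d l\<bar>)"
    by (simp add: distrib_left sum.distrib sum_distrib_left mult.assoc)
  also have "(\<Sum>k\<in>UNIV. \<Sum>l\<in>UNIV. \<zeta> k * B k l * \<bar>d l\<bar>) = (\<Sum>l\<in>UNIV. (\<Sum>k\<in>UNIV. \<zeta> k * B k l) * \<bar>d l\<bar>)"
    by (subst sum.swap) (simp add: sum_distrib_right)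
  also have "\<dots> \<le> (\<Sum>l\<in>UNIV. (\<zeta> l - 1) * \<bar>d l\<bar>)"
    by (intro sum_mono mult_right_mono) (use \<zeta> in \<open>auto simp: algebra_simps\<close>)
  also have "\<dots> = (\<Sum>l\<in>UNIV. \<zeta> l * \<bar>d l\<bar>) - (\<Sum>l\<in>UNIV. \<bar>d l\<bar>)"
    by (simp add: left_diff_distrib sum_subtractf)
  finally show ?thesis by simp
qed

text \<open>A kernel vector satisfies the hypothesis of \<open>weighted_sum_bound\<close> with
  residual zero, so it vanishes.\<close>

lemma invertible_of_weights:
  fixes K :: "real ^ 'n ^ 'n" and \<zeta> :: "'n \<Rightarrow> real"
  assumes nonneg: "\<And>i j. 0 \<le> K $ i $ j" and c: "0 \<le> c"
    and \<zeta>: "\<And>l. 1 + (\<Sum>k\<in>UNIV. \<zeta> k * (c * K $ k $ l)) \<le> \<zeta> l" "\<And>l. 0 \<le> \<zeta> l"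
  shows "invertible (mat 1 - c *\<^sub>R K)"
proof -
  have "v = 0" if v: "(mat 1 - c *\<^sub>R K) *v v = 0" for v
  proof -
    have "v = c *\<^sub>R (K *v v)"
      using v by (simp add: matrix_vector_mult_diff_rdistrib scaleR_matrix_vector_assoc[symmetric])
    then have "v $ k = (\<Sum>l\<in>UNIV. c * K $ k $ l * v $ l)" for k
    proof -
      have "v $ k = (c *\<^sub>R (K *v v)) $ k" using \<open>v = _\<close> by (rule arg_cong)
      also have "\<dots> = (\<Sum>l\<in>UNIV. c * K $ k $ l * v $ l)"
        by (simp add: matrix_vector_mult_def sum_distrib_left mult.assoc)
      finally show ?thesis .
    qed
    then have "\<bar>v $ k\<bar> \<le> 0 + (\<Sum>l\<in>UNIV. c * K $ k $ l * \<bar>v $ l\<bar>)" for k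
      using nonneg c
      by (metis (no_types, lifting) abs_mult abs_of_nonneg add_0 mult_nonneg_nonneg sum.cong sum_abs)
    from weighted_sum_bound[OF this \<zeta>] have "(\<Sum>l\<in>UNIV. \<bar>v $ l\<bar>) \<le> 0" by simp
    then have "\<forall>l. \<bar>v $ l\<bar> = 0"
      by (metis (mono_tags, lifting) UNIV_I abs_ge_zero finite order_antisym sum_nonneg sum_nonneg_0)
    then show "v = 0" by (simp add: vec_eq_iff)
  qed
  then show ?thesis
    by (auto simp: invertible_left_inverse matrix_left_invertible_ker)
qed

section \<open>Positive functionals and measurable kernels\<close>

text \<open>An integral reduced to its axioms. The sides of the moment formulas are sums of iterated
  integrals against random kernels; once such a sum is known to be of this kind, it can be compared
  with another one on rectangles.\<close>

definition nn_functional :: "'a measure \<Rightarrow> (('a \<Rightarrow> ennreal) \<Rightarrow> ennreal) \<Rightarrow> bool" where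
  "nn_functional S \<Phi> \<longleftrightarrow>
     (\<forall>f\<in>borel_measurable S. \<forall>g\<in>borel_measurable S. (\<forall>x\<in>space S. f x = g x) \<longrightarrow> \<Phi> f = \<Phi> g) \<and>
     (\<forall>f\<in>borel_measurable S. \<forall>c. \<Phi> (\<lambda>x. c * f x) = c * \<Phi> f) \<and>
     (\<forall>f\<in>borel_measurable S. \<forall>g\<in>borel_measurable S. \<Phi> (\<lambda>x. f x + g x) = \<Phi> f + \<Phi> g) \<and>
     (\<forall>U. (\<forall>i::nat. U i \<in> borel_measurable S) \<longrightarrow> incseq U \<longrightarrow>
        \<Phi> (\<lambda>x. SUP i. U i x) = (SUP i. \<Phi> (U i)))"

lemma nn_functionalD:
  assumes "nn_functional S \<Phi>"
  shows nn_functional_cong: "\<And>f g. f \<in> borel_measurable S \<Longrightarrow> g \<in> borel_measurable S \<Longrightarrow>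
      (\<And>x. x \<in> space S \<Longrightarrow> f x = g x) \<Longrightarrow> \<Phi> f = \<Phi> g"
    and nn_functional_cmult: "\<And>f c. f \<in> borel_measurable S \<Longrightarrow> \<Phi> (\<lambda>x. c * f x) = c * \<Phi> f"
    and nn_functional_plus: "\<And>f g. f \<in> borel_measurable S \<Longrightarrow> g \<in> borel_measurable S \<Longrightarrow>
      \<Phi> (\<lambda>x. f x + g x) = \<Phi> f + \<Phi> g"
    and nn_functional_SUP: "\<And>U. (\<And>i::nat. U i \<in> borel_measurable S) \<Longrightarrow> incseq U \<Longrightarrow>
      \<Phi> (\<lambda>x. SUP i. U i x) = (SUP i. \<Phi> (U i))"
  using assms unfolding nn_functional_def by blast+

lemma nn_functional_zero: "nn_functional S \<Phi> \<Longrightarrow> \<Phi> (\<lambda>x. 0) = 0"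
  using nn_functional_cmult[of S \<Phi> "\<lambda>x. 0" 0] by simp

lemma nn_functional_sum:
  assumes "nn_functional S \<Phi>" "\<And>i. i < n \<Longrightarrow> f i \<in> borel_measurable S"
  shows "\<Phi> (\<lambda>x. \<Sum>i<n. f i x) = (\<Sum>i<n::nat. \<Phi> (f i))"
  using assms(2)
proof (induction n)
  case (Suc n)
  then show ?case
    by (simp add: nn_functional_plus[OF assms(1), of "\<lambda>x. \<Sum>i<n. f i x" "f n"])
qed (simp add: nn_functional_zero[OF assms(1)])

text \<open>Monotonicity is not among the axioms. It comes from continuity along the sequence that
  equals \<open>U i\<close> at first and \<open>U (Suc i)\<close> ever after.\<close>

lemma nn_functional_mono:
  assumes \<Phi>: "nn_functional S \<Phi>" and U: "\<And>i::nat. U i \<in> borel_measurable S" "incseq U"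
  shows "incseq (\<lambda>i. \<Phi> (U i))"
proof (rule incseq_SucI)
  fix i
  define V where "V n = (if n = 0 then U i else U (Suc i))" for n :: nat
  have le: "U i x \<le> U (Suc i) x" for x using U(2) by (auto simp: incseq_def le_fun_def)
  have V: "V n \<in> borel_measurable S" "incseq V" for n
    using U le by (auto simp: V_def incseq_def le_fun_def)
  have eq: "(\<lambda>x. SUP n. V n x) = U (Suc i)"
  proof
    fix x
    show "(SUP n. V n x) = U (Suc i) x"
      by (rule antisym) (auto simp: V_def le intro!: SUP_least SUP_upper2[of 1])
  qed
  have "\<Phi> (V 0) \<le> (SUP n. \<Phi> (V n))" by (rule SUP_upper) simp
  also have "\<dots> = \<Phi> (U (Suc i))"
    using nn_functional_SUP[OF \<Phi> V] by (simp add: eq)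
  finally show "\<Phi> (U i) \<le> \<Phi> (U (Suc i))" by (simp add: V_def)
qed

text \<open>On indicators the functional is a measure, countable additivity being finite additivity
  together with the supremum axiom. The standard induction over measurable functions extends the
  representation.\<close>

lemma nn_functional_measure:
  assumes \<Phi>: "nn_functional S \<Phi>"
  obtains \<mu> where "sets \<mu> = sets S" "\<And>f. f \<in> borel_measurable S \<Longrightarrow> \<Phi> f = (\<integral>\<^sup>+x. f x \<partial>\<mu>)"
    "\<And>X. X \<in> sets S \<Longrightarrow> emeasure \<mu> X = \<Phi> (indicator X)"
proof -
  define \<mu> where "\<mu> = measure_of (space S) (sets S) (\<lambda>X. \<Phi> (indicator X))"
  have [simp]: "sets \<mu> = sets S" "space \<mu> = space S"
    by (auto simp: \<mu>_def sets.space_closed)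
  have em: "emeasure \<mu> X = \<Phi> (indicator X)" if "X \<in> sets S" for X
  proof (rule emeasure_measure_of[OF \<mu>_def])
    show "sets S \<subseteq> Pow (space S)" by (rule sets.space_closed)
    show "positive (sets \<mu>) (\<lambda>X. \<Phi> (indicator X))"
      using nn_functional_zero[OF \<Phi>] by (simp add: positive_def indicator_def[abs_def])
    show "countably_additive (sets \<mu>) (\<lambda>X. \<Phi> (indicator X))"
    proof (rule countably_additiveI)
      fix A :: "nat \<Rightarrow> 'a set"
      assume A: "range A \<subseteq> sets \<mu>" "disjoint_family A" "(\<Union>i. A i) \<in> sets \<mu>"
      have [measurable]: "A i \<in> sets S" for i using A by auto
      have "indicator (\<Union>i. A i) = (\<lambda>x. SUP n. \<Sum>i<n. indicator (A i) x :: ennreal)"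
        by (simp add: fun_eq_iff suminf_indicator[OF A(2), symmetric] suminf_eq_SUP)
      then have "\<Phi> (indicator (\<Union>i. A i)) = (SUP n. \<Phi> (\<lambda>x. \<Sum>i<n. indicator (A i) x))"
        by (simp add: nn_functional_SUP[OF \<Phi>] incseq_def le_fun_def sum_mono2)
      also have "\<dots> = (SUP n. \<Sum>i<n. \<Phi> (indicator (A i)))"
        by (subst nn_functional_sum[OF \<Phi>]) auto
      finally show "(\<Sum>i. \<Phi> (indicator (A i))) = \<Phi> (indicator (\<Union>i. A i))"
        by (simp add: suminf_eq_SUP)
    qed
  qed (use that in auto)
  have "\<Phi> f = (\<integral>\<^sup>+x. f x \<partial>\<mu>)" if "f \<in> borel_measurable S" for f
    using that
  proof (induction rule: borel_measurable_induct)
    case (cong f g)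
    have "\<Phi> f = \<Phi> g" by (rule nn_functional_cong[OF \<Phi>]) (use cong in auto)
    moreover have "(\<integral>\<^sup>+x. f x \<partial>\<mu>) = (\<integral>\<^sup>+x. g x \<partial>\<mu>)" by (rule nn_integral_cong) (use cong in auto)
    ultimately show ?case using cong by simp
  next
    case (set A)
    then show ?case by (simp add: em)
  next
    case (mult u c)
    then show ?case by (simp add: nn_functional_cmult[OF \<Phi>] nn_integral_cmult measurable_cong_sets[of \<mu> S])
  next
    case (add u v)
    then show ?case by (simp add: nn_functional_plus[OF \<Phi>] nn_integral_add measurable_cong_sets[of \<mu> S])
  next
    case (seq U)
    have "(\<integral>\<^sup>+x. (SUP i. U i) x \<partial>\<mu>) = (SUP i. \<integral>\<^sup>+x. U i x \<partial>\<mu>)"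
      unfolding SUP_apply
      by (rule nn_integral_monotone_convergence_SUP) (use seq in \<open>auto simp: measurable_cong_sets[of \<mu> S]\<close>)
    moreover have "\<Phi> (SUP i. U i) = (SUP i. \<Phi> (U i))"
      using nn_functional_SUP[OF \<Phi>, of U] seq by (simp add: SUP_apply[abs_def] image_comp)
    ultimately show ?case by (simp only: seq.IH)
  qed
  with em that[of \<mu>] show ?thesis by simp
qed

text \<open>Dynkin's uniqueness theorem applied to the two representing measures. Finiteness on the
  exhausting sets is asked of \<open>\<Phi>\<close>; the agreement on \<open>E\<close> passes it on
  to \<open>\<Psi>\<close>.\<close>

lemma nn_functional_unique:
  assumes \<Phi>: "nn_functional S \<Phi>" and \<Psi>: "nn_functional S \<Psi>"
    and E: "Int_stable E" "E \<subseteq> Pow (space S)" "sets S = sigma_sets (space S) E"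
    and A: "range A \<subseteq> E" "(\<Union>i::nat. A i) = space S" "\<And>i. \<Phi> (indicator (A i)) < \<infinity>"
    and eq: "\<And>X. X \<in> E \<Longrightarrow> \<Phi> (indicator X) = \<Psi> (indicator X)"
    and f: "f \<in> borel_measurable S"
  shows "\<Phi> f = \<Psi> f"
proof -
  obtain \<mu> where \<mu>: "sets \<mu> = sets S" "\<And>f. f \<in> borel_measurable S \<Longrightarrow> \<Phi> f = (\<integral>\<^sup>+x. f x \<partial>\<mu>)"
    "\<And>X. X \<in> sets S \<Longrightarrow> emeasure \<mu> X = \<Phi> (indicator X)"
    using nn_functional_measure[OF \<Phi>] by blast
  obtain \<mu>' where \<mu>': "sets \<mu>' = sets S" "\<And>f. f \<in> borel_measurable S \<Longrightarrow> \<Psi> f = (\<integral>\<^sup>+x. f x \<partial>\<mu>')"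
    "\<And>X. X \<in> sets S \<Longrightarrow> emeasure \<mu>' X = \<Psi> (indicator X)"
    using nn_functional_measure[OF \<Psi>] by blast
  have ES: "E \<subseteq> sets S" using E(3) by auto
  have "\<mu> = \<mu>'"
  proof (rule measure_eqI_generator_eq[OF E(1,2)])
    show "emeasure \<mu> X = emeasure \<mu>' X" if "X \<in> E" for X
      using that ES eq \<mu>(3) \<mu>'(3) by auto
    show "emeasure \<mu> (A i) \<noteq> \<infinity>" for i
    proof -
      have "A i \<in> sets S" using A(1) ES by blast
      then have "emeasure \<mu> (A i) < \<infinity>" using A(3)[of i] \<mu>(3) by simp
      then show ?thesis by simp
    qed
  qed (use E A \<mu> \<mu>' in auto)
  then show ?thesis using \<mu>(2)[OF f] \<mu>'(2)[OF f] by simp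
qed

lemma nn_functional_eval: "s \<in> space S \<Longrightarrow> nn_functional S (\<lambda>f. f s)"
  by (auto simp: nn_functional_def)

lemma nn_functional_add:
  fixes S :: "'a measure"
  assumes \<Phi>: "nn_functional S \<Phi>" and \<Psi>: "nn_functional S \<Psi>"
  shows "nn_functional S (\<lambda>f. \<Phi> f + \<Psi> f)"
  unfolding nn_functional_def
proof (intro conjI ballI allI impI)
  fix U :: "nat \<Rightarrow> 'a \<Rightarrow> ennreal" assume U: "\<forall>i. U i \<in> borel_measurable S" "incseq U"
  then have "\<Phi> (\<lambda>x. SUP i. U i x) = (SUP i. \<Phi> (U i))" "\<Psi> (\<lambda>x. SUP i. U i x) = (SUP i. \<Psi> (U i))"
    by (auto intro!: nn_functional_SUP[OF \<Phi>] nn_functional_SUP[OF \<Psi>])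
  moreover have "(SUP i. \<Phi> (U i) + \<Psi> (U i)) = (SUP i. \<Phi> (U i)) + (SUP i. \<Psi> (U i))"
    using U by (intro ennreal_SUP_add nn_functional_mono[OF \<Phi>] nn_functional_mono[OF \<Psi>]) auto
  ultimately show "\<Phi> (\<lambda>x. SUP i. U i x) + \<Psi> (\<lambda>x. SUP i. U i x) = (SUP i. \<Phi> (U i) + \<Psi> (U i))"
    by simp
next
  fix f g :: "'a \<Rightarrow> ennreal" assume *: "f \<in> borel_measurable S" "g \<in> borel_measurable S" "\<forall>x\<in>space S. f x = g x"
  have "\<Phi> f = \<Phi> g" by (rule nn_functional_cong[OF \<Phi>]) (use * in auto)
  moreover have "\<Psi> f = \<Psi> g" by (rule nn_functional_cong[OF \<Psi>]) (use * in auto)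
  ultimately show "\<Phi> f + \<Psi> f = \<Phi> g + \<Psi> g" by simp
qed (use \<Phi> \<Psi> in \<open>auto simp: nn_functional_plus nn_functional_cmult distrib_left ac_simps\<close>)

lemma nn_functional_integral:
  fixes S :: "'b measure"
  assumes \<Phi>: "\<And>x. x \<in> space N \<Longrightarrow> nn_functional S (\<Phi> x)"
    and meas: "\<And>f. f \<in> borel_measurable S \<Longrightarrow> (\<lambda>x. \<Phi> x f) \<in> borel_measurable N"
  shows "nn_functional S (\<lambda>f. \<integral>\<^sup>+x. \<Phi> x f \<partial>N)"
  unfolding nn_functional_def
proof (intro conjI ballI allI impI)
  fix f g :: "'b \<Rightarrow> ennreal" assume *: "f \<in> borel_measurable S" "g \<in> borel_measurable S" "\<forall>x\<in>space S. f x = g x"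
  show "(\<integral>\<^sup>+x. \<Phi> x f \<partial>N) = (\<integral>\<^sup>+x. \<Phi> x g \<partial>N)"
    by (rule nn_integral_cong, rule nn_functional_cong[OF \<Phi>]) (use * in auto)
next
  fix f :: "'b \<Rightarrow> ennreal" and c assume f: "f \<in> borel_measurable S"
  have "(\<integral>\<^sup>+x. \<Phi> x (\<lambda>x. c * f x) \<partial>N) = (\<integral>\<^sup>+x. c * \<Phi> x f \<partial>N)"
    by (rule nn_integral_cong) (rule nn_functional_cmult[OF \<Phi> f])
  then show "(\<integral>\<^sup>+x. \<Phi> x (\<lambda>x. c * f x) \<partial>N) = c * (\<integral>\<^sup>+x. \<Phi> x f \<partial>N)"
    by (simp add: nn_integral_cmult meas f)
next
  fix f g :: "'b \<Rightarrow> ennreal" assume fg: "f \<in> borel_measurable S" "g \<in> borel_measurable S"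
  have "(\<integral>\<^sup>+x. \<Phi> x (\<lambda>x. f x + g x) \<partial>N) = (\<integral>\<^sup>+x. \<Phi> x f + \<Phi> x g \<partial>N)"
    by (rule nn_integral_cong) (rule nn_functional_plus[OF \<Phi> fg])
  then show "(\<integral>\<^sup>+x. \<Phi> x (\<lambda>x. f x + g x) \<partial>N) = (\<integral>\<^sup>+x. \<Phi> x f \<partial>N) + (\<integral>\<^sup>+x. \<Phi> x g \<partial>N)"
    by (simp add: nn_integral_add meas fg)
next
  fix U :: "nat \<Rightarrow> 'b \<Rightarrow> ennreal" assume U: "\<forall>i. U i \<in> borel_measurable S" "incseq U"
  then have U': "\<And>i. U i \<in> borel_measurable S" by simp
  have "(\<integral>\<^sup>+x. \<Phi> x (\<lambda>x. SUP i. U i x) \<partial>N) = (\<integral>\<^sup>+x. (SUP i. \<Phi> x (U i)) \<partial>N)"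
    by (rule nn_integral_cong) (rule nn_functional_SUP[OF \<Phi> U' U(2)])
  also have "\<dots> = (SUP i. \<integral>\<^sup>+x. \<Phi> x (U i) \<partial>N)"
    using nn_functional_mono[OF \<Phi> U' U(2)]
    by (intro nn_integral_monotone_convergence_SUP_AE meas U') (auto simp: incseq_Suc_iff)
  finally show "(\<integral>\<^sup>+x. \<Phi> x (\<lambda>x. SUP i. U i x) \<partial>N) = (SUP i. \<integral>\<^sup>+x. \<Phi> x (U i) \<partial>N)" .
qed

text \<open>The kernels may be infinite. Restricted to \<open>B i\<close> and normalised they become
  subprobability kernels, for which measurability of the integral is known; undo the normalisation
  and let \<open>i\<close> increase.\<close>

lemma nn_integral_kernel_measurable:
  fixes K :: "'a \<Rightarrow> 'b measure"
  assumes E: "sets N = sigma_sets (space N) E" "Int_stable E" "E \<subseteq> Pow (space N)"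
    and K: "\<And>a. a \<in> space A \<Longrightarrow> sets (K a) = sets N"
    and meas: "\<And>X. X \<in> E \<Longrightarrow> (\<lambda>a. emeasure (K a) X) \<in> borel_measurable A"
    and B: "\<And>i::nat. B i \<in> E" "incseq B" "(\<Union>i. B i) = space N"
      "\<And>a i. a \<in> space A \<Longrightarrow> emeasure (K a) (B i) < \<infinity>"
    and f[measurable]: "(\<lambda>(a, z). f a z) \<in> borel_measurable (A \<Otimes>\<^sub>M N)"
  shows "(\<lambda>a. \<integral>\<^sup>+z. f a z \<partial>K a) \<in> borel_measurable A"
proof (cases "space N = {}")
  case True
  then have "(\<integral>\<^sup>+z. f a z \<partial>K a) = 0" if "a \<in> space A" for a
    using sets_eq_imp_space_eq[OF K[OF that]] by (simp add: nn_integral_empty)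
  then show ?thesis by (simp cong: measurable_cong)
next
  case ne: False
  have EN: "X \<in> sets N" if "X \<in> E" for X using E(1) that by auto
  have BN[measurable]: "B i \<in> sets N" for i using B(1) EN by auto
  have spK: "space (K a) = space N" if "a \<in> space A" for a
    using sets_eq_imp_space_eq[OF K[OF that]] .
  have mK: "borel_measurable (K a) = borel_measurable N" if "a \<in> space A" for a
    using K[OF that] by (rule measurable_cong_sets) simp
  \<comment> \<open>The \<open>1 +\<close> avoids a division by zero and keeps the total mass below
    one.\<close>
  define c where "c i a = 1 / (1 + emeasure (K a) (B i))" for i a
  define L where "L i a = density (K a) (\<lambda>z. c i a * indicator (B i) z)" for i a
  have fm: "f a \<in> borel_measurable N" if "a \<in> space A" for a
    using measurable_compose[OF measurable_Pair1'[OF that] f] by simp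
  have c1: "(1 + emeasure (K a) (B i)) * c i a = 1" if "a \<in> space A" for i a
    using B(4)[OF that, of i] by (auto simp: c_def ennreal_times_divide intro!: ennreal_divide_self)
  have cm[measurable]: "c i \<in> borel_measurable A" for i
    unfolding c_def using meas[OF B(1)] by measurable
  have emL: "emeasure (L i a) X = c i a * emeasure (K a) (B i \<inter> X)" if "a \<in> space A" "X \<in> sets N" for i a X
  proof -
    have "emeasure (L i a) X = (\<integral>\<^sup>+z. c i a * indicator (B i) z * indicator X z \<partial>K a)"
      unfolding L_def by (rule emeasure_density) (use that BN K in \<open>auto simp: mK\<close>)
    also have "\<dots> = (\<integral>\<^sup>+z. c i a * indicator (B i \<inter> X) z \<partial>K a)"
      by (intro nn_integral_cong) (auto split: split_indicator)
    also have "\<dots> = c i a * emeasure (K a) (B i \<inter> X)"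
      by (rule nn_integral_cmult_indicator) (use that BN K in auto)
    finally show ?thesis .
  qed
  have Lsub: "L i \<in> measurable A (subprob_algebra N)" for i
  proof (rule measurable_subprob_algebra_generated[OF E])
    fix a assume a: "a \<in> space A"
    show "sets (L i a) = sets N" using K[OF a] by (simp add: L_def)
    have "emeasure (L i a) (space (L i a)) = c i a * emeasure (K a) (B i)"
      using emL[OF a sets.top, of i] sets.sets_into_space[OF BN[of i]]
      by (simp add: L_def spK[OF a] Int_absorb2)
    also have "\<dots> \<le> (1 + emeasure (K a) (B i)) * c i a"
      by (subst mult.commute) (auto intro!: mult_right_mono)
    finally show "subprob_space (L i a)"
      using ne by (intro subprob_spaceI) (auto simp: c1[OF a] L_def spK[OF a])
  next
    fix X assume X: "X \<in> E"
    have "B i \<inter> X \<in> E" using E(2) B(1) X by (auto simp: Int_stable_def)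
    from meas[OF this] have "(\<lambda>a. c i a * emeasure (K a) (B i \<inter> X)) \<in> borel_measurable A"
      by measurable
    then show "(\<lambda>a. emeasure (L i a) X) \<in> borel_measurable A"
      using emL[OF _ EN[OF X]] by (simp cong: measurable_cong)
  next
    have "(\<lambda>a. c i a * emeasure (K a) (B i)) \<in> borel_measurable A"
      using meas[OF B(1)] by measurable
    then show "(\<lambda>a. emeasure (L i a) (space N)) \<in> borel_measurable A"
      using emL[OF _ sets.top, of _ i] sets.sets_into_space[OF BN[of i]]
      by (simp add: Int_absorb2 cong: measurable_cong)
  qed
  have "(\<integral>\<^sup>+z. f a z \<partial>K a) = (SUP i. (1 + emeasure (K a) (B i)) * (\<integral>\<^sup>+z. f a z \<partial>L i a))"
    if a: "a \<in> space A" for a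
  proof -
    have "(1 + emeasure (K a) (B i)) * (\<integral>\<^sup>+z. f a z \<partial>L i a) = (\<integral>\<^sup>+z. f a z * indicator (B i) z \<partial>K a)" for i
    proof -
      have "(\<integral>\<^sup>+z. f a z \<partial>L i a) = (\<integral>\<^sup>+z. c i a * indicator (B i) z * f a z \<partial>K a)"
        unfolding L_def by (rule nn_integral_density) (use fm[OF a] BN in \<open>auto simp: mK[OF a]\<close>)
      also have "\<dots> = c i a * (\<integral>\<^sup>+z. f a z * indicator (B i) z \<partial>K a)"
        by (subst nn_integral_cmult[symmetric])
          (use fm[OF a] BN in \<open>auto simp: mK[OF a] ac_simps\<close>)
      finally show ?thesis by (simp add: mult.assoc[symmetric] c1[OF a])
    qed
    moreover have "(\<integral>\<^sup>+z. f a z \<partial>K a) = (SUP i. \<integral>\<^sup>+z. f a z * indicator (B i) z \<partial>K a)"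
    proof -
      have "(\<integral>\<^sup>+z. f a z \<partial>K a) = (\<integral>\<^sup>+z. (SUP i. f a z * indicator (B i) z) \<partial>K a)"
      proof (rule nn_integral_cong)
        fix z assume "z \<in> space (K a)"
        then obtain i where "z \<in> B i" using B(3) spK[OF a] by auto
        then show "f a z = (SUP i. f a z * indicator (B i) z)"
          by (intro antisym SUP_least SUP_upper2[of i]) (auto split: split_indicator)
      qed
      also have "\<dots> = (SUP i. \<integral>\<^sup>+z. f a z * indicator (B i) z \<partial>K a)"
        using B(2) fm[OF a] BN
        by (intro nn_integral_monotone_convergence_SUP)
          (auto simp: mK[OF a] incseq_def le_fun_def split: split_indicator)
      finally show ?thesis .
    qed
    ultimately show ?thesis by simp
  qed
  moreover have "(\<lambda>a. SUP i. (1 + emeasure (K a) (B i)) * (\<integral>\<^sup>+z. f a z \<partial>L i a)) \<in> borel_measurable A"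
    using nn_integral_measurable_subprob_algebra2[OF f Lsub] meas[OF B(1)] by measurable
  ultimately show ?thesis by (simp cong: measurable_cong)
qed

section \<open>Predictable integrands and the first two moments of an adapted random measure\<close>

text \<open>A bounded exhaustion of the plane. It is half-open in order to have the shape of the
  generating rectangles below.\<close>

definition cube :: "nat \<Rightarrow> (real \<times> real) set" where
  "cube n = {- real n<..real n} \<times> {- real n<..real n}"

lemma cube_sets [measurable, simp]: "cube n \<in> sets borel"
  by (simp add: cube_def borel_Times)

lemma bounded_rectangle: "bounded ({c<..d::real} \<times> {a<..b::real})"
  by (rule bounded_subset[OF bounded_Times[OF bounded_closed_interval[of c d] bounded_closed_interval[of a b]]])
    auto

lemma bounded_cube [simp]: "bounded (cube n)"
  unfolding cube_def by (rule bounded_rectangle)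

lemma incseq_cube: "incseq cube"
  by (auto simp: incseq_def cube_def)

lemma UN_cube: "(\<Union>n. cube n) = UNIV"
proof -
  have "\<exists>n. z \<in> cube n" for z
  proof -
    obtain n where "max \<bar>fst z\<bar> \<bar>snd z\<bar> < real n" using reals_Archimedean2 by blast
    then show ?thesis by (intro exI[of _ n]) (auto simp: cube_def mem_Times_iff)
  qed
  then show ?thesis by auto
qed

text \<open>What is kept of the Poisson measures: given \<open>F a\<close>, counts after time
  \<open>a\<close> have the Poisson mean and covariance. Conditioning is expressed by a nonnegative
  \<open>F a\<close>-measurable factor \<open>Y\<close>. Times are second coordinates, and
  finiteness on cubes holds for every outcome.\<close>

locale adapted_kernel = prob_space M for M :: "'w measure" +
  fixes \<kappa> :: "'k \<Rightarrow> 'w \<Rightarrow> (real \<times> real) measure" and F :: "real \<Rightarrow> 'w measure"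
  assumes sets_\<kappa>: "\<omega> \<in> space M \<Longrightarrow> sets (\<kappa> k \<omega>) = sets borel"
    and \<kappa>_cube: "\<omega> \<in> space M \<Longrightarrow> emeasure (\<kappa> k \<omega>) (cube n) < \<infinity>"
    and \<kappa>_measurable: "A \<in> sets borel \<Longrightarrow> (\<lambda>\<omega>. emeasure (\<kappa> k \<omega>) A) \<in> borel_measurable M"
    and space_F: "space (F a) = space M"
    and F_sub: "sets (F a) \<subseteq> sets M"
    and F_mono: "a \<le> b \<Longrightarrow> sets (F a) \<subseteq> sets (F b)"
    and adapted: "A \<in> sets borel \<Longrightarrow> A \<subseteq> UNIV \<times> {..a} \<Longrightarrow>
      (\<lambda>\<omega>. emeasure (\<kappa> k \<omega>) A) \<in> borel_measurable (F a)"
    and future_mean: "Y \<in> borel_measurable (F a) \<Longrightarrow> D \<in> sets borel \<Longrightarrow> bounded D \<Longrightarrow>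
      D \<subseteq> UNIV \<times> {a<..} \<Longrightarrow>
      (\<integral>\<^sup>+\<omega>. Y \<omega> * emeasure (\<kappa> k \<omega>) D \<partial>M) = (\<integral>\<^sup>+\<omega>. Y \<omega> \<partial>M) * emeasure lborel D"
    and future_cov: "Y \<in> borel_measurable (F a) \<Longrightarrow> D \<in> sets borel \<Longrightarrow> bounded D \<Longrightarrow>
      D \<subseteq> UNIV \<times> {a<..} \<Longrightarrow> D' \<in> sets borel \<Longrightarrow> bounded D' \<Longrightarrow> D' \<subseteq> UNIV \<times> {a<..} \<Longrightarrow>
      (\<integral>\<^sup>+\<omega>. Y \<omega> * (emeasure (\<kappa> k \<omega>) D * emeasure (\<kappa> k \<omega>) D') \<partial>M) =
        (\<integral>\<^sup>+\<omega>. Y \<omega> \<partial>M) * (emeasure lborel D * emeasure lborel D' + emeasure lborel (D \<inter> D'))"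
begin

lemma F_measurable_M: "Y \<in> borel_measurable (F a) \<Longrightarrow> Y \<in> borel_measurable M"
  using F_sub[of a] space_F by (auto simp: measurable_def)

text \<open>The usual generator of the predictable \<sigma>-algebra: the event \<open>G\<close> is
  known at the left end of a left-open time interval.\<close>

definition pred_gen :: "('w \<times> real) set set" where
  "pred_gen = {G \<times> {a<..b} | G a b. G \<in> sets (F a)}"

definition Pred :: "('w \<times> real) measure" where
  "Pred = sigma (space M \<times> UNIV) pred_gen"

definition mark_gen :: "(('w \<times> real) \<times> real) set set" where
  "mark_gen = {A \<times> {c<..d} | A c d. A \<in> pred_gen}"

abbreviation "MPred \<equiv> Pred \<Otimes>\<^sub>M (borel :: real measure)"

text \<open>A point \<open>(x, s)\<close> of the random measure, seen in the product of the predictable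
  \<open>\<sigma>\<close>-algebra and the Borel \<open>\<sigma>\<close>-algebra of levels.\<close>

definition mark :: "'w \<Rightarrow> real \<times> real \<Rightarrow> ('w \<times> real) \<times> real" where
  "mark \<omega> z = ((\<omega>, snd z), fst z)"

lemma pred_gen_subset: "pred_gen \<subseteq> Pow (space M \<times> UNIV)"
proof
  fix A assume "A \<in> pred_gen"
  then obtain G a b where A: "A = G \<times> {a<..b}" "G \<in> sets (F a)"
    unfolding pred_gen_def by (elim CollectE exE conjE)
  from A(2) have "G \<subseteq> space M" using sets.sets_into_space space_F by metis
  then show "A \<in> Pow (space M \<times> UNIV)" unfolding A(1) PowD by (intro PowI Sigma_mono subset_UNIV)
qed

lemma space_Pred [simp]: "space Pred = space M \<times> UNIV"
  unfolding Pred_def using pred_gen_subset by (rule space_measure_of)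

lemma sets_Pred: "sets Pred = sigma_sets (space M \<times> UNIV) pred_gen"
  unfolding Pred_def using pred_gen_subset by (rule sets_measure_of)

lemma space_M_F: "space M \<in> sets (F a)"
  by (metis sets.top space_F)

lemma Int_stable_pred_gen: "Int_stable pred_gen"
  unfolding Int_stable_def
proof (intro ballI)
  fix A B assume "A \<in> pred_gen" "B \<in> pred_gen"
  then obtain G a b G' a' b' where *: "A = G \<times> {a<..b}" "G \<in> sets (F a)" "B = G' \<times> {a'<..b'}" "G' \<in> sets (F a')"
    by (auto simp: pred_gen_def)
  have "G \<inter> G' \<in> sets (F (max a a'))"
    using * F_mono[of a "max a a'"] F_mono[of a' "max a a'"] by (intro sets.Int) auto
  moreover have "A \<inter> B = (G \<inter> G') \<times> {max a a'<..min b b'}" using * by auto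
  ultimately show "A \<inter> B \<in> pred_gen" by (auto simp: pred_gen_def)
qed

lemma UN_pred_gen: "(\<Union>n. space M \<times> {- real n<..real n}) = space M \<times> UNIV"
proof -
  have "\<exists>n. - real n < t \<and> t \<le> real n" for t
  proof -
    obtain n where "\<bar>t\<bar> < real n" using reals_Archimedean2 by blast
    then show ?thesis by (intro exI[of _ n]) auto
  qed
  then show ?thesis by auto
qed

lemma mark_gen_subset: "mark_gen \<subseteq> Pow (space MPred)"
proof
  fix B assume "B \<in> mark_gen"
  then obtain A c d where B: "B = A \<times> {c<..d}" "A \<in> pred_gen"
    unfolding mark_gen_def by (elim CollectE exE conjE)
  then have "A \<subseteq> space M \<times> UNIV" using pred_gen_subset by (meson PowD subsetD)
  then show "B \<in> Pow (space MPred)"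
    unfolding B(1) space_pair_measure space_Pred space_borel by (intro PowI Sigma_mono subset_UNIV)
qed

lemma sets_MPred: "sets MPred = sigma_sets (space MPred) mark_gen"
proof -
  let ?C = "range (\<lambda>(a, b). {a<..b :: real})"
  have "sets MPred = sets (sigma (space Pred \<times> space (borel :: real measure)) {a \<times> b |a b. a \<in> pred_gen \<and> b \<in> ?C})"
  proof (rule sets_pair_eq)
    show "pred_gen \<subseteq> Pow (space Pred)" "sets Pred = sigma_sets (space Pred) pred_gen"
      using pred_gen_subset by (auto simp: sets_Pred)
    show "?C \<subseteq> Pow (space borel)" by auto
    have "sets (borel :: real measure) = sets (sigma UNIV ?C)" by (simp only: borel_sigma_sets_Ioc)
    then show "sets (borel :: real measure) = sigma_sets (space borel) ?C" by simp
    show "countable (range (\<lambda>n::nat. space M \<times> {- real n<..real n}))" by simp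
    show "range (\<lambda>n::nat. space M \<times> {- real n<..real n}) \<subseteq> pred_gen"
      using space_M_F by (auto simp: pred_gen_def)
    show "\<Union> (range (\<lambda>n::nat. space M \<times> {- real n<..real n})) = space Pred"
      using UN_pred_gen by simp
    show "countable (range (\<lambda>n::nat. {- real n<..real n}))" by simp
    show "range (\<lambda>n::nat. {- real n<..real n}) \<subseteq> ?C" by auto
    show "\<Union> (range (\<lambda>n::nat. {- real n<..real n})) = space borel"
      using UN_cube by (auto simp: cube_def set_eq_iff)
  qed
  also have "{a \<times> b |a b. a \<in> pred_gen \<and> b \<in> ?C} = mark_gen"
    by (auto simp: mark_gen_def)
  also have "mark_gen \<subseteq> Pow (space Pred \<times> space (borel :: real measure))"
    using mark_gen_subset by (simp add: space_pair_measure)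
  then have "sets (sigma (space Pred \<times> space (borel :: real measure)) mark_gen) =
      sigma_sets (space Pred \<times> space (borel :: real measure)) mark_gen"
    by (rule sets_measure_of)
  finally show ?thesis by (simp add: space_pair_measure)
qed

lemma Int_stable_mark_gen: "Int_stable mark_gen"
  unfolding Int_stable_def
proof (intro ballI)
  fix A B assume "A \<in> mark_gen" "B \<in> mark_gen"
  then obtain U c d U' c' d' where *: "A = U \<times> {c<..d}" "U \<in> pred_gen" "B = U' \<times> {c'<..d'}" "U' \<in> pred_gen"
    by (auto simp: mark_gen_def)
  then have "U \<inter> U' \<in> pred_gen" using Int_stable_pred_gen by (auto simp: Int_stable_def)
  moreover have "A \<inter> B = (U \<inter> U') \<times> {max c c'<..min d d'}" using * by auto
  ultimately show "A \<inter> B \<in> mark_gen" by (auto simp: mark_gen_def)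
qed

definition mark_cube :: "nat \<Rightarrow> (('w \<times> real) \<times> real) set" where
  "mark_cube n = (space M \<times> {- real n<..real n}) \<times> {- real n<..real n}"

lemma mark_cube_gen: "mark_cube n \<in> mark_gen"
  using space_M_F by (auto simp: mark_cube_def mark_gen_def pred_gen_def)

lemma incseq_mark_cube: "incseq mark_cube"
  by (auto simp: incseq_def mark_cube_def)

lemma UN_mark_cube: "(\<Union>n. mark_cube n) = space MPred"
proof -
  have "((\<omega>, t), x) \<in> (\<Union>n. mark_cube n)" if "\<omega> \<in> space M" for \<omega> t x
    using that UN_cube unfolding cube_def mark_cube_def set_eq_iff by (auto simp: mem_Times_iff)
  then show ?thesis by (auto simp: space_pair_measure mark_cube_def)
qed

lemma mark_vimage:
  "mark \<omega> z \<in> (G \<times> {a<..b}) \<times> {c<..d} \<longleftrightarrow> \<omega> \<in> G \<and> z \<in> {c<..d} \<times> {a<..b}"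
  by (auto simp: mark_def mem_Times_iff)

lemma measurable_Pred_id: "(\<lambda>p. p) \<in> measurable (M \<Otimes>\<^sub>M borel) Pred"
  unfolding Pred_def
proof (rule measurable_measure_of[OF pred_gen_subset])
  show "(\<lambda>x. x) \<in> space (M \<Otimes>\<^sub>M borel) \<rightarrow> space M \<times> UNIV" by (simp add: space_pair_measure)
  fix y assume "y \<in> pred_gen"
  then obtain G a b where "y = G \<times> {a<..b}" "G \<in> sets (F a)"
    by (auto simp: pred_gen_def)
  with F_sub[of a] have "y = G \<times> {a<..b}" "G \<in> sets M" by auto
  then have "y \<in> sets (M \<Otimes>\<^sub>M borel)" by simp
  then show "(\<lambda>x. x) -` y \<inter> space (M \<Otimes>\<^sub>M borel) \<in> sets (M \<Otimes>\<^sub>M borel)" by simp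
qed

lemma measurable_mark_pair: "(\<lambda>(\<omega>, z). mark \<omega> z) \<in> measurable (M \<Otimes>\<^sub>M borel) MPred"
proof -
  have "(\<lambda>p. ((fst p, snd (snd p)), fst (snd p))) \<in> measurable (M \<Otimes>\<^sub>M borel) MPred"
    by (rule measurable_Pair[OF measurable_compose[OF _ measurable_Pred_id]]) (simp_all flip: borel_prod)
  then show ?thesis by (simp add: mark_def case_prod_beta')
qed

lemma measurable_mark:
  assumes "\<omega> \<in> space M" shows "mark \<omega> \<in> measurable borel MPred"
proof -
  have pair: "Pair \<omega> \<in> measurable (borel :: (real \<times> real) measure) (M \<Otimes>\<^sub>M borel)"
    by (rule measurable_Pair1') (rule assms)
  have "(\<lambda>(\<omega>, z). mark \<omega> z) \<circ> Pair \<omega> \<in> measurable borel MPred"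
    by (rule measurable_comp, rule pair, rule measurable_mark_pair)
  moreover have "(\<lambda>(\<omega>, z). mark \<omega> z) \<circ> Pair \<omega> = mark \<omega>" by (rule ext) simp
  ultimately show ?thesis by (simp only:)
qed

lemma mark_space: "\<omega> \<in> space M \<Longrightarrow> mark \<omega> z \<in> space MPred"
  by (auto simp: mark_def space_pair_measure)

text \<open>Covers both the random measures and constant Lebesgue measure, so that a measure and its
  compensator are handled by the same lemmas.\<close>

definition fin_kernel :: "('w \<Rightarrow> (real \<times> real) measure) \<Rightarrow> bool" where
  "fin_kernel K \<longleftrightarrow> (\<forall>\<omega>\<in>space M. sets (K \<omega>) = sets borel \<and> (\<forall>n. emeasure (K \<omega>) (cube n) < \<infinity>)) \<and>
     (\<forall>A\<in>sets borel. (\<lambda>\<omega>. emeasure (K \<omega>) A) \<in> borel_measurable M)"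

lemma fin_kernel_\<kappa>: "fin_kernel (\<kappa> k)"
  using sets_\<kappa> \<kappa>_cube \<kappa>_measurable by (auto simp: fin_kernel_def)

lemma fin_kernel_lborel: "fin_kernel (\<lambda>_. lborel)"
  using emeasure_bounded_finite[OF bounded_cube] by (auto simp: fin_kernel_def)

lemma fin_kernelD:
  assumes "fin_kernel K"
  shows "\<omega> \<in> space M \<Longrightarrow> sets (K \<omega>) = sets borel" "\<omega> \<in> space M \<Longrightarrow> emeasure (K \<omega>) (cube n) < \<infinity>"
    "A \<in> sets borel \<Longrightarrow> (\<lambda>\<omega>. emeasure (K \<omega>) A) \<in> borel_measurable M"
  using assms unfolding fin_kernel_def by blast+

lemma fin_kernel_measurable:
  assumes K: "fin_kernel K" and p: "p \<in> measurable N M"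
    and f: "(\<lambda>(y, z). f y z) \<in> borel_measurable (N \<Otimes>\<^sub>M borel)"
  shows "(\<lambda>y. \<integral>\<^sup>+z. f y z \<partial>K (p y)) \<in> borel_measurable N"
proof (rule nn_integral_kernel_measurable[where E="sets borel" and B=cube and N=borel])
  show "(\<lambda>a. emeasure (K (p a)) X) \<in> borel_measurable N" if "X \<in> sets borel" for X
    by (rule measurable_compose[OF p fin_kernelD(3)[OF K that]])
  show "sets (K (p a)) = sets borel" if "a \<in> space N" for a
    by (rule fin_kernelD(1)[OF K measurable_space[OF p that]])
  show "emeasure (K (p a)) (cube i) < \<infinity>" if "a \<in> space N" for a i
    by (rule fin_kernelD(2)[OF K measurable_space[OF p that]])
  show "sets borel = sigma_sets (space borel) (sets borel)" by (rule sets.sigma_sets_eq[symmetric])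
  show "Int_stable (sets borel :: (real \<times> real) set set)" by (rule sets.Int_stable)
  show "sets borel \<subseteq> Pow (space borel :: (real \<times> real) set)" by simp
  show "\<Union> (range cube) = space borel" using UN_cube by simp
qed (use f incseq_cube in simp_all)

lemma nn_functional_mean:
  assumes K: "fin_kernel K"
  shows "nn_functional MPred (\<lambda>f. \<integral>\<^sup>+\<omega>. \<integral>\<^sup>+z. f (mark \<omega> z) \<partial>K \<omega> \<partial>M)"
proof (rule nn_functional_integral[OF nn_functional_integral[OF nn_functional_eval]])
  show "mark \<omega> z \<in> space MPred" if "\<omega> \<in> space M" for \<omega> z using mark_space[OF that] .
  show "(\<lambda>z. f (mark \<omega> z)) \<in> borel_measurable (K \<omega>)"
    if "\<omega> \<in> space M" "f \<in> borel_measurable MPred" for \<omega> and f :: "_ \<Rightarrow> ennreal"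
    using measurable_compose[OF measurable_mark that(2)] that(1) K
    by (simp add: fin_kernel_def measurable_cong_sets[of "K \<omega>" borel])
  show "(\<lambda>\<omega>. \<integral>\<^sup>+z. f (mark \<omega> z) \<partial>K \<omega>) \<in> borel_measurable M"
    if "f \<in> borel_measurable MPred" for f :: "_ \<Rightarrow> ennreal"
    by (rule fin_kernel_measurable[OF K measurable_ident_sets[OF refl]])
      (use measurable_compose[OF measurable_mark_pair that] in \<open>simp add: case_prod_beta'\<close>)
qed

text \<open>Lebesgue measure is the compensator. On a rectangle over
  \<open>G \<times> {a<..b}\<close> the claim is \<open>future_mean\<close> with the indicator of
  \<open>G\<close> as \<open>Y\<close>, and \<open>nn_functional_unique\<close> does the
  rest.\<close>

theorem first_moment:
  assumes f: "f \<in> borel_measurable MPred"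
  shows "(\<integral>\<^sup>+\<omega>. \<integral>\<^sup>+z. f (mark \<omega> z) \<partial>\<kappa> k \<omega> \<partial>M) = (\<integral>\<^sup>+\<omega>. \<integral>\<^sup>+z. f (mark \<omega> z) \<partial>lborel \<partial>M)"
proof (rule nn_functional_unique[OF nn_functional_mean[OF fin_kernel_\<kappa>] nn_functional_mean[OF fin_kernel_lborel]
      Int_stable_mark_gen mark_gen_subset sets_MPred _ UN_mark_cube _ _ f])
  have eq: "(\<integral>\<^sup>+\<omega>. \<integral>\<^sup>+z. indicator ((G \<times> {a<..b}) \<times> {c<..d}) (mark \<omega> z) \<partial>K \<omega> \<partial>M) =
      (\<integral>\<^sup>+\<omega>. indicator G \<omega> * emeasure (K \<omega>) ({c<..d} \<times> {a<..b}) \<partial>M)" if "fin_kernel K" for K G a b c d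
  proof (rule nn_integral_cong)
    fix \<omega> assume \<omega>: "\<omega> \<in> space M"
    have "indicator ((G \<times> {a<..b}) \<times> {c<..d}) (mark \<omega> z) =
        (indicator G \<omega> * indicator ({c<..d} \<times> {a<..b}) z :: ennreal)" for z
      using mark_vimage[of \<omega> z G a b c d] by (auto split: split_indicator)
    then show "(\<integral>\<^sup>+z. indicator ((G \<times> {a<..b}) \<times> {c<..d}) (mark \<omega> z) \<partial>K \<omega>) =
        indicator G \<omega> * emeasure (K \<omega>) ({c<..d} \<times> {a<..b})"
      using that \<omega> by (simp add: fin_kernel_def nn_integral_cmult_indicator borel_Times)
  qed
  have lhs: "(\<integral>\<^sup>+\<omega>. \<integral>\<^sup>+z. indicator ((G \<times> {a<..b}) \<times> {c<..d}) (mark \<omega> z) \<partial>\<kappa> k \<omega> \<partial>M) =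
      emeasure M G * emeasure lborel ({c<..d} \<times> {a<..b})" if "G \<in> sets (F a)" for G a b c d
    unfolding eq[OF fin_kernel_\<kappa>]
    by (subst future_mean[of _ a]) (use that F_sub[of a] in \<open>auto simp: borel_Times bounded_rectangle\<close>)
  have rhs: "(\<integral>\<^sup>+\<omega>. \<integral>\<^sup>+z. indicator ((G \<times> {a<..b}) \<times> {c<..d}) (mark \<omega> z) \<partial>lborel \<partial>M) =
      emeasure M G * emeasure lborel ({c<..d} \<times> {a<..b})" if "G \<in> sets (F a)" for G a b c d
    unfolding eq[OF fin_kernel_lborel]
    by (subst nn_integral_multc) (use that F_sub[of a] in auto)
  show "(\<integral>\<^sup>+\<omega>. \<integral>\<^sup>+z. indicator X (mark \<omega> z) \<partial>\<kappa> k \<omega> \<partial>M) = (\<integral>\<^sup>+\<omega>. \<integral>\<^sup>+z. indicator X (mark \<omega> z) \<partial>lborel \<partial>M)"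
    if "X \<in> mark_gen" for X
    using that lhs rhs by (auto simp: mark_gen_def pred_gen_def)
  show "range mark_cube \<subseteq> mark_gen" using mark_cube_gen by auto
  show "(\<integral>\<^sup>+\<omega>. \<integral>\<^sup>+z. indicator (mark_cube n) (mark \<omega> z) \<partial>\<kappa> k \<omega> \<partial>M) < \<infinity>" for n
    unfolding mark_cube_def lhs[OF space_M_F]
    using emeasure_bounded_finite[OF bounded_cube[of n]] by (simp add: emeasure_space_1 cube_def)
qed

lemma nn_functional_pair:
  assumes K: "fin_kernel K" and L: "fin_kernel L"
  shows "nn_functional (MPred \<Otimes>\<^sub>M MPred)
    (\<lambda>f. \<integral>\<^sup>+\<omega>. \<integral>\<^sup>+z. \<integral>\<^sup>+z'. f (mark \<omega> z, mark \<omega> z') \<partial>L \<omega> \<partial>K \<omega> \<partial>M)"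
proof (rule nn_functional_integral[OF nn_functional_integral[OF nn_functional_integral[OF nn_functional_eval]]])
  show "(mark \<omega> z, mark \<omega> z') \<in> space (MPred \<Otimes>\<^sub>M MPred)" if "\<omega> \<in> space M" for \<omega> z z'
    using mark_space[OF that] by (simp add: space_pair_measure)
  have mK: "borel_measurable (K \<omega>) = (borel_measurable borel :: (_ \<Rightarrow> ennreal) set)"
    "borel_measurable (L \<omega>) = (borel_measurable borel :: (_ \<Rightarrow> ennreal) set)" if "\<omega> \<in> space M" for \<omega>
    using K L that by (auto simp: fin_kernel_def intro!: measurable_cong_sets)
  fix f :: "_ \<Rightarrow> ennreal" assume f: "f \<in> borel_measurable (MPred \<Otimes>\<^sub>M MPred)"
  have m: "(\<lambda>p. f (mark (fst (fst p)) (snd (fst p)), mark (fst (fst p)) (snd p))) \<in>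
      borel_measurable ((M \<Otimes>\<^sub>M borel) \<Otimes>\<^sub>M borel)"
  proof (rule measurable_compose[OF _ f], rule measurable_Pair)
    have 1: "(\<lambda>p. (fst (fst p), snd (fst p))) \<in> measurable ((M \<Otimes>\<^sub>M borel) \<Otimes>\<^sub>M borel) (M \<Otimes>\<^sub>M borel)"
      by measurable
    have 2: "(\<lambda>p. (fst (fst p), snd p)) \<in> measurable ((M \<Otimes>\<^sub>M borel) \<Otimes>\<^sub>M borel) (M \<Otimes>\<^sub>M borel)"
      by measurable
    show "(\<lambda>p. mark (fst (fst p)) (snd (fst p))) \<in> measurable ((M \<Otimes>\<^sub>M borel) \<Otimes>\<^sub>M borel) MPred"
      using measurable_compose[OF 1 measurable_mark_pair] by (simp add: case_prod_beta')
    show "(\<lambda>p. mark (fst (fst p)) (snd p)) \<in> measurable ((M \<Otimes>\<^sub>M borel) \<Otimes>\<^sub>M borel) MPred"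
      using measurable_compose[OF 2 measurable_mark_pair] by (simp add: case_prod_beta')
  qed
  have inner: "(\<lambda>y. \<integral>\<^sup>+z'. f (mark (fst y) (snd y), mark (fst y) z') \<partial>L (fst y)) \<in> borel_measurable (M \<Otimes>\<^sub>M borel)"
    by (rule fin_kernel_measurable[OF L]) (use m in \<open>simp_all add: case_prod_beta'\<close>)
  show "(\<lambda>\<omega>. \<integral>\<^sup>+z. \<integral>\<^sup>+z'. f (mark \<omega> z, mark \<omega> z') \<partial>L \<omega> \<partial>K \<omega>) \<in> borel_measurable M"
    by (rule fin_kernel_measurable[OF K measurable_ident_sets[OF refl]])
      (use inner in \<open>simp add: case_prod_beta'\<close>)
  fix \<omega> assume \<omega>: "\<omega> \<in> space M"
  show "(\<lambda>z. \<integral>\<^sup>+z'. f (mark \<omega> z, mark \<omega> z') \<partial>L \<omega>) \<in> borel_measurable (K \<omega>)"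
    using measurable_compose[OF measurable_Pair1'[OF \<omega>] inner] by (simp add: mK[OF \<omega>])
  show "(\<lambda>z'. f (mark \<omega> z, mark \<omega> z')) \<in> borel_measurable (L \<omega>)" for z
    unfolding mK[OF \<omega>]
    by (rule measurable_compose[OF _ f]) (use measurable_mark[OF \<omega>] mark_space[OF \<omega>] in auto)
qed

lemma nn_functional_diag:
  "nn_functional (MPred \<Otimes>\<^sub>M MPred) (\<lambda>f. \<integral>\<^sup>+\<omega>. \<integral>\<^sup>+z. f (mark \<omega> z, mark \<omega> z) \<partial>lborel \<partial>M)"
proof (rule nn_functional_integral[OF nn_functional_integral[OF nn_functional_eval]])
  show "(mark \<omega> z, mark \<omega> z) \<in> space (MPred \<Otimes>\<^sub>M MPred)" if "\<omega> \<in> space M" for \<omega> z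
    using mark_space[OF that] by (simp add: space_pair_measure)
  fix f :: "_ \<Rightarrow> ennreal" assume f: "f \<in> borel_measurable (MPred \<Otimes>\<^sub>M MPred)"
  have m: "(\<lambda>p. f (mark (fst p) (snd p), mark (fst p) (snd p))) \<in> borel_measurable (M \<Otimes>\<^sub>M borel)"
    by (rule measurable_compose[OF _ f]) (use measurable_mark_pair in \<open>simp add: case_prod_beta'\<close>)
  show "(\<lambda>\<omega>. \<integral>\<^sup>+z. f (mark \<omega> z, mark \<omega> z) \<partial>lborel) \<in> borel_measurable M"
    by (rule fin_kernel_measurable[OF fin_kernel_lborel measurable_ident_sets[OF refl]])
      (use m in \<open>simp add: case_prod_beta'\<close>)
  show "(\<lambda>z. f (mark \<omega> z, mark \<omega> z)) \<in> borel_measurable lborel" if "\<omega> \<in> space M" for \<omega>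
    using measurable_compose[OF measurable_Pair1'[OF that] m] by simp
qed

text \<open>This says that the product of the two compensated counts has conditional mean
  \<open>emeasure lborel (D \<inter> D')\<close>, with the negative terms moved to the other side.
  \<open>D'\<close> lies after time \<open>a\<close> but \<open>D\<close> may straddle it: the part
  of \<open>D\<close> up to \<open>a\<close> joins the \<open>F a\<close>-measurable factor, and the
  part after \<open>a\<close> is handled by \<open>future_cov\<close>.\<close>

lemma covariance_rectangle:
  assumes T: "T \<in> borel_measurable (F a)"
    and D: "D \<in> sets borel" "bounded D" and D': "D' \<in> sets borel" "bounded D'" "D' \<subseteq> UNIV \<times> {a<..}"
  shows "(\<integral>\<^sup>+\<omega>. T \<omega> * (emeasure (\<kappa> k \<omega>) D * emeasure (\<kappa> k \<omega>) D') \<partial>M) +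
      (\<integral>\<^sup>+\<omega>. T \<omega> * (emeasure lborel D * emeasure lborel D') \<partial>M) =
    (\<integral>\<^sup>+\<omega>. T \<omega> * (emeasure (\<kappa> k \<omega>) D * emeasure lborel D') \<partial>M) +
      (\<integral>\<^sup>+\<omega>. T \<omega> * (emeasure lborel D * emeasure (\<kappa> k \<omega>) D') \<partial>M) +
      (\<integral>\<^sup>+\<omega>. T \<omega> * emeasure lborel (D \<inter> D') \<partial>M)"
proof -
  define D1 where "D1 = D \<inter> UNIV \<times> {..a}"
  define D2 where "D2 = D \<inter> UNIV \<times> {a<..}"
  have meas: "D1 \<in> sets borel" "D2 \<in> sets borel"
    unfolding D1_def D2_def using D(1) by (auto intro!: sets.Int borel_Times)
  have bdd: "bounded D1" "bounded D2" "D1 \<subseteq> UNIV \<times> {..a}" "D2 \<subseteq> UNIV \<times> {a<..}" and disj: "D1 \<inter> D2 = {}"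
    unfolding D1_def D2_def using D(2) by (auto intro: bounded_subset)
  have un: "D = D1 \<union> D2" by (auto simp: D1_def D2_def)
  have D2D': "D2 \<inter> D' = D \<inter> D'" using D'(3) by (auto simp: D2_def)
  have \<kappa>D: "emeasure (\<kappa> k \<omega>) D = emeasure (\<kappa> k \<omega>) D1 + emeasure (\<kappa> k \<omega>) D2" if "\<omega> \<in> space M" for \<omega>
    unfolding un using meas disj sets_\<kappa>[OF that] by (intro plus_emeasure[symmetric]) auto
  have \<nu>D: "emeasure lborel D = emeasure lborel D1 + emeasure lborel D2"
    unfolding un using meas disj by (intro plus_emeasure[symmetric]) auto
  note [measurable] = F_measurable_M[OF T] \<kappa>_measurable[OF meas(1)] \<kappa>_measurable[OF meas(2)] \<kappa>_measurable[OF D'(1)]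
  define x where "x = (\<integral>\<^sup>+\<omega>. T \<omega> * emeasure (\<kappa> k \<omega>) D1 \<partial>M)"
  define P where "P = (\<integral>\<^sup>+\<omega>. T \<omega> \<partial>M)"
  \<comment> \<open>The count of the past part is known at time \<open>a\<close>, so it may be
    absorbed into the factor to which \<open>future_mean\<close> applies.\<close>
  have T1: "(\<lambda>\<omega>. T \<omega> * emeasure (\<kappa> k \<omega>) D1) \<in> borel_measurable (F a)"
    using T adapted[OF meas(1) bdd(3)] by measurable
  have h1: "(\<integral>\<^sup>+\<omega>. T \<omega> * emeasure (\<kappa> k \<omega>) D1 * emeasure (\<kappa> k \<omega>) D' \<partial>M) = x * emeasure lborel D'"
    unfolding x_def by (rule future_mean[OF T1 D'])
  have h2: "(\<integral>\<^sup>+\<omega>. T \<omega> * (emeasure (\<kappa> k \<omega>) D2 * emeasure (\<kappa> k \<omega>) D') \<partial>M) =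
      P * (emeasure lborel D2 * emeasure lborel D' + emeasure lborel (D \<inter> D'))"
    unfolding P_def future_cov[OF T meas(2) bdd(2,4) D'] D2D' ..
  have h3: "(\<integral>\<^sup>+\<omega>. T \<omega> * emeasure (\<kappa> k \<omega>) D2 \<partial>M) = P * emeasure lborel D2"
    unfolding P_def by (rule future_mean[OF T meas(2) bdd(2,4)])
  have h4: "(\<integral>\<^sup>+\<omega>. T \<omega> * emeasure (\<kappa> k \<omega>) D' \<partial>M) = P * emeasure lborel D'"
    unfolding P_def by (rule future_mean[OF T D'])
  have "(\<integral>\<^sup>+\<omega>. T \<omega> * (emeasure (\<kappa> k \<omega>) D * emeasure (\<kappa> k \<omega>) D') \<partial>M) =
      (\<integral>\<^sup>+\<omega>. T \<omega> * emeasure (\<kappa> k \<omega>) D1 * emeasure (\<kappa> k \<omega>) D' +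
         T \<omega> * (emeasure (\<kappa> k \<omega>) D2 * emeasure (\<kappa> k \<omega>) D') \<partial>M)"
    by (rule nn_integral_cong) (simp add: \<kappa>D distrib_left distrib_right ac_simps)
  also have "\<dots> = x * emeasure lborel D' + P * (emeasure lborel D2 * emeasure lborel D' + emeasure lborel (D \<inter> D'))"
    by (subst nn_integral_add) (simp_all add: h1 h2)
  finally have e1: "(\<integral>\<^sup>+\<omega>. T \<omega> * (emeasure (\<kappa> k \<omega>) D * emeasure (\<kappa> k \<omega>) D') \<partial>M) = \<dots>" .
  have "(\<integral>\<^sup>+\<omega>. T \<omega> * (emeasure (\<kappa> k \<omega>) D * emeasure lborel D') \<partial>M) =
      (\<integral>\<^sup>+\<omega>. (T \<omega> * emeasure (\<kappa> k \<omega>) D1 + T \<omega> * emeasure (\<kappa> k \<omega>) D2) * emeasure lborel D' \<partial>M)"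
    by (rule nn_integral_cong) (simp add: \<kappa>D distrib_left distrib_right ac_simps)
  also have "\<dots> = (x + P * emeasure lborel D2) * emeasure lborel D'"
    by (subst nn_integral_multc, measurable, subst nn_integral_add) (simp_all add: h3 x_def)
  finally have e2: "(\<integral>\<^sup>+\<omega>. T \<omega> * (emeasure (\<kappa> k \<omega>) D * emeasure lborel D') \<partial>M) = \<dots>" .
  have "(\<integral>\<^sup>+\<omega>. T \<omega> * (emeasure lborel D * emeasure (\<kappa> k \<omega>) D') \<partial>M) =
      (\<integral>\<^sup>+\<omega>. emeasure lborel D * (T \<omega> * emeasure (\<kappa> k \<omega>) D') \<partial>M)"
    by (rule nn_integral_cong) (simp add: ac_simps)
  also have "\<dots> = emeasure lborel D * (P * emeasure lborel D')"
    by (subst nn_integral_cmult) (simp_all add: h4)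
  finally have e3: "(\<integral>\<^sup>+\<omega>. T \<omega> * (emeasure lborel D * emeasure (\<kappa> k \<omega>) D') \<partial>M) = \<dots>" .
  have e4: "(\<integral>\<^sup>+\<omega>. T \<omega> * c \<partial>M) = P * c" for c
    unfolding P_def by (rule nn_integral_multc) measurable
  show ?thesis
    unfolding e1 e2 e3 e4 by (simp add: \<nu>D distrib_left distrib_right ac_simps)
qed

end

section \<open>Second moment of compensated integrals\<close>

context adapted_kernel
begin

text \<open>The isometry for compensated integrals in polarised form: integrating \<open>f\<close>
  twice against measure minus compensator has the mean of the diagonal integral. Written without
  subtraction, it holds for all nonnegative \<open>f\<close>, finite or not, and follows from the
  case of products of rectangles.\<close>

theorem second_moment:
  assumes f: "f \<in> borel_measurable (MPred \<Otimes>\<^sub>M MPred)"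
  shows "(\<integral>\<^sup>+\<omega>. \<integral>\<^sup>+z. \<integral>\<^sup>+z'. f (mark \<omega> z, mark \<omega> z') \<partial>\<kappa> k \<omega> \<partial>\<kappa> k \<omega> \<partial>M) +
      (\<integral>\<^sup>+\<omega>. \<integral>\<^sup>+z. \<integral>\<^sup>+z'. f (mark \<omega> z, mark \<omega> z') \<partial>lborel \<partial>lborel \<partial>M) =
    (\<integral>\<^sup>+\<omega>. \<integral>\<^sup>+z. \<integral>\<^sup>+z'. f (mark \<omega> z, mark \<omega> z') \<partial>lborel \<partial>\<kappa> k \<omega> \<partial>M) +
      (\<integral>\<^sup>+\<omega>. \<integral>\<^sup>+z. \<integral>\<^sup>+z'. f (mark \<omega> z, mark \<omega> z') \<partial>\<kappa> k \<omega> \<partial>lborel \<partial>M) +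
      (\<integral>\<^sup>+\<omega>. \<integral>\<^sup>+z. f (mark \<omega> z, mark \<omega> z) \<partial>lborel \<partial>M)"
proof -
  let ?E = "{X \<times> Y | X Y. X \<in> mark_gen \<and> Y \<in> mark_gen}"
  let ?S = "MPred \<Otimes>\<^sub>M MPred"
  have sets_S: "sets ?S = sigma_sets (space ?S) ?E"
  proof -
    have "sets ?S = sets (sigma (space MPred \<times> space MPred) ?E)"
      by (rule sets_pair_eq[where Ca="range mark_cube" and Cb="range mark_cube"])
        (use mark_gen_subset sets_MPred mark_cube_gen UN_mark_cube in auto)
    also have "\<dots> = sigma_sets (space MPred \<times> space MPred) ?E"
      by (rule sets_measure_of) (use mark_gen_subset in blast)
    finally show ?thesis by (simp add: space_pair_measure)
  qed
  have rect_eq: "(\<integral>\<^sup>+\<omega>. \<integral>\<^sup>+z. \<integral>\<^sup>+z'. indicator (((G \<times> {a<..b}) \<times> {c<..d}) \<times> ((G' \<times> {a'<..b'}) \<times> {c'<..d'}))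
        (mark \<omega> z, mark \<omega> z') \<partial>L \<omega> \<partial>K \<omega> \<partial>M) =
      (\<integral>\<^sup>+\<omega>. indicator (G \<inter> G') \<omega> * (emeasure (K \<omega>) ({c<..d} \<times> {a<..b}) * emeasure (L \<omega>) ({c'<..d'} \<times> {a'<..b'})) \<partial>M)"
    if "fin_kernel K" "fin_kernel L" for K L G a b c d G' a' b' c' d'
  proof (rule nn_integral_cong)
    fix \<omega> assume \<omega>: "\<omega> \<in> space M"
    let ?D = "{c<..d} \<times> {a<..b}" and ?D' = "{c'<..d'} \<times> {a'<..b'}"
    have [measurable_cong]: "sets (K \<omega>) = sets borel" "sets (L \<omega>) = sets borel"
      using that \<omega> by (auto simp: fin_kernel_def)
    have D: "?D \<in> sets (K \<omega>)" "?D' \<in> sets (L \<omega>)"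
      using that \<omega> by (auto simp: fin_kernel_def borel_Times)
    have ind: "indicator (((G \<times> {a<..b}) \<times> {c<..d}) \<times> ((G' \<times> {a'<..b'}) \<times> {c'<..d'})) (mark \<omega> z, mark \<omega> z') =
        (indicator (G \<inter> G') \<omega> * indicator ?D z * indicator ?D' z' :: ennreal)" for z z'
      using mark_vimage[of \<omega> z G a b c d] mark_vimage[of \<omega> z' G' a' b' c' d'] by (auto split: split_indicator)
    have "(\<integral>\<^sup>+z. \<integral>\<^sup>+z'. indicator (((G \<times> {a<..b}) \<times> {c<..d}) \<times> ((G' \<times> {a'<..b'}) \<times> {c'<..d'}))
        (mark \<omega> z, mark \<omega> z') \<partial>L \<omega> \<partial>K \<omega>) =
        (\<integral>\<^sup>+z. indicator (G \<inter> G') \<omega> * emeasure (L \<omega>) ?D' * indicator ?D z \<partial>K \<omega>)"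
    proof (rule nn_integral_cong)
      fix z
      have "(\<integral>\<^sup>+z'. indicator (G \<inter> G') \<omega> * indicator ?D z * indicator ?D' z' \<partial>L \<omega>) =
          indicator (G \<inter> G') \<omega> * indicator ?D z * emeasure (L \<omega>) ?D'"
        by (rule nn_integral_cmult_indicator[OF D(2)])
      then show "(\<integral>\<^sup>+z'. indicator (((G \<times> {a<..b}) \<times> {c<..d}) \<times> ((G' \<times> {a'<..b'}) \<times> {c'<..d'}))
          (mark \<omega> z, mark \<omega> z') \<partial>L \<omega>) = indicator (G \<inter> G') \<omega> * emeasure (L \<omega>) ?D' * indicator ?D z"
        unfolding ind by (simp only: mult.assoc mult.commute mult.left_commute)
    qed
    also have "\<dots> = indicator (G \<inter> G') \<omega> * emeasure (L \<omega>) ?D' * emeasure (K \<omega>) ?D"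
      by (rule nn_integral_cmult_indicator[OF D(1)])
    finally show "(\<integral>\<^sup>+z. \<integral>\<^sup>+z'. indicator (((G \<times> {a<..b}) \<times> {c<..d}) \<times> ((G' \<times> {a'<..b'}) \<times> {c'<..d'}))
        (mark \<omega> z, mark \<omega> z') \<partial>L \<omega> \<partial>K \<omega>) =
        indicator (G \<inter> G') \<omega> * (emeasure (K \<omega>) ?D * emeasure (L \<omega>) ?D')"
      by (simp add: ac_simps)
  qed
  have diag_eq: "(\<integral>\<^sup>+\<omega>. \<integral>\<^sup>+z. indicator (((G \<times> {a<..b}) \<times> {c<..d}) \<times> ((G' \<times> {a'<..b'}) \<times> {c'<..d'}))
        (mark \<omega> z, mark \<omega> z) \<partial>lborel \<partial>M) =
      (\<integral>\<^sup>+\<omega>. indicator (G \<inter> G') \<omega> * emeasure lborel (({c<..d} \<times> {a<..b}) \<inter> ({c'<..d'} \<times> {a'<..b'})) \<partial>M)"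
    for G a b c d G' a' b' c' d'
  proof (rule nn_integral_cong)
    fix \<omega>
    have ind: "indicator (((G \<times> {a<..b}) \<times> {c<..d}) \<times> ((G' \<times> {a'<..b'}) \<times> {c'<..d'})) (mark \<omega> z, mark \<omega> z) =
        (indicator (G \<inter> G') \<omega> * indicator (({c<..d} \<times> {a<..b}) \<inter> ({c'<..d'} \<times> {a'<..b'})) z :: ennreal)" for z
      using mark_vimage[of \<omega> z G a b c d] mark_vimage[of \<omega> z G' a' b' c' d'] by (auto split: split_indicator)
    show "(\<integral>\<^sup>+z. indicator (((G \<times> {a<..b}) \<times> {c<..d}) \<times> ((G' \<times> {a'<..b'}) \<times> {c'<..d'}))
        (mark \<omega> z, mark \<omega> z) \<partial>lborel) =
      indicator (G \<inter> G') \<omega> * emeasure lborel (({c<..d} \<times> {a<..b}) \<inter> ({c'<..d'} \<times> {a'<..b'}))"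
      unfolding ind by (rule nn_integral_cmult_indicator) (auto intro!: sets.Int simp: borel_Times)
  qed
  have box: "{c<..d::real} \<times> {a<..b::real} \<in> sets borel" for a b c d
    by (simp add: borel_Times)
  note bdd = bounded_rectangle
  show ?thesis
  proof (rule nn_functional_unique[OF
        nn_functional_add[OF nn_functional_pair[OF fin_kernel_\<kappa> fin_kernel_\<kappa>]
          nn_functional_pair[OF fin_kernel_lborel fin_kernel_lborel]]
        nn_functional_add[OF nn_functional_add[OF nn_functional_pair[OF fin_kernel_\<kappa> fin_kernel_lborel]
          nn_functional_pair[OF fin_kernel_lborel fin_kernel_\<kappa>]] nn_functional_diag]
        _ _ sets_S _ _ _ _ f])
    show "Int_stable ?E"
      unfolding Int_stable_def
    proof (intro ballI)
      fix A B assume "A \<in> ?E" "B \<in> ?E"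
      then obtain X Y X' Y' where AB: "A = X \<times> Y" "B = X' \<times> Y'"
        and g: "X \<in> mark_gen" "Y \<in> mark_gen" "X' \<in> mark_gen" "Y' \<in> mark_gen"
        by (elim CollectE exE conjE)
      have "X \<inter> X' \<in> mark_gen" "Y \<inter> Y' \<in> mark_gen"
        using Int_stable_mark_gen g by (auto simp: Int_stable_def)
      moreover have "A \<inter> B = (X \<inter> X') \<times> (Y \<inter> Y')" unfolding AB by (rule Times_Int_Times)
      ultimately show "A \<inter> B \<in> ?E" by (intro CollectI exI conjI)
    qed
    show "?E \<subseteq> Pow (space ?S)"
    proof
      fix A assume "A \<in> ?E"
      then obtain X Y where A: "A = X \<times> Y" "X \<in> mark_gen" "Y \<in> mark_gen"
        by (elim CollectE exE conjE)
      then have "X \<subseteq> space MPred" "Y \<subseteq> space MPred" using mark_gen_subset by (meson PowD subsetD)+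
      then show "A \<in> Pow (space ?S)"
        unfolding A(1) space_pair_measure[of MPred] by (intro PowI Sigma_mono)
    qed
    show "range (\<lambda>n. mark_cube n \<times> mark_cube n) \<subseteq> ?E" using mark_cube_gen by blast
    show "(\<Union>n. mark_cube n \<times> mark_cube n) = space ?S"
    proof (intro equalityI subsetI)
      fix p assume "p \<in> space ?S"
      then have "fst p \<in> (\<Union>n. mark_cube n)" "snd p \<in> (\<Union>n. mark_cube n)"
        unfolding UN_mark_cube space_pair_measure[of MPred] by (auto simp: mem_Times_iff)
      then obtain n m where "fst p \<in> mark_cube n" "snd p \<in> mark_cube m" by (elim UN_E)
      then have "p \<in> mark_cube (max n m) \<times> mark_cube (max n m)"
        using incseqD[OF incseq_mark_cube, of n "max n m"] incseqD[OF incseq_mark_cube, of m "max n m"]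
        by (auto simp: mem_Times_iff)
      then show "p \<in> (\<Union>n. mark_cube n \<times> mark_cube n)" by blast
    next
      fix p assume "p \<in> (\<Union>n. mark_cube n \<times> mark_cube n)"
      then obtain n where "fst p \<in> mark_cube n" "snd p \<in> mark_cube n" by (auto simp: mem_Times_iff)
      then have "fst p \<in> space MPred" "snd p \<in> space MPred" unfolding UN_mark_cube[symmetric] by blast+
      then show "p \<in> space ?S" unfolding space_pair_measure[of MPred] by (simp only: mem_Times_iff simp_thms)
    qed
    show "(\<integral>\<^sup>+\<omega>. \<integral>\<^sup>+z. \<integral>\<^sup>+z'. indicator (mark_cube n \<times> mark_cube n) (mark \<omega> z, mark \<omega> z') \<partial>\<kappa> k \<omega> \<partial>\<kappa> k \<omega> \<partial>M) +
      (\<integral>\<^sup>+\<omega>. \<integral>\<^sup>+z. \<integral>\<^sup>+z'. indicator (mark_cube n \<times> mark_cube n) (mark \<omega> z, mark \<omega> z') \<partial>lborel \<partial>lborel \<partial>M) < \<infinity>" for n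
    proof -
      have "emeasure lborel ({- real n<..real n} \<times> {- real n<..real n}) < \<infinity>"
        using emeasure_bounded_finite[OF bdd] .
      then show ?thesis
        unfolding mark_cube_def rect_eq[OF fin_kernel_\<kappa> fin_kernel_\<kappa>] rect_eq[OF fin_kernel_lborel fin_kernel_lborel]
        by (subst future_cov[of _ "- real n"])
          (use space_M_F in \<open>auto simp: box bdd emeasure_space_1 ennreal_mult_less_top nn_integral_multc\<close>)
    qed
    fix XY assume "XY \<in> ?E"
    then obtain G a b c d G' a' b' c' d' where XY:
      "XY = ((G \<times> {a<..b}) \<times> {c<..d}) \<times> ((G' \<times> {a'<..b'}) \<times> {c'<..d'})" and G: "G \<in> sets (F a)" "G' \<in> sets (F a')"
      unfolding mark_gen_def pred_gen_def by (elim CollectE exE conjE) simp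
    let ?D = "{c<..d} \<times> {a<..b}" and ?D' = "{c'<..d'} \<times> {a'<..b'}"
    have GG: "indicator (G \<inter> G') \<in> borel_measurable (F m)" if "a \<le> m" "a' \<le> m" for m
      using G F_mono[OF that(1)] F_mono[OF that(2)] by (intro borel_measurable_indicator sets.Int) auto
    show "(\<integral>\<^sup>+\<omega>. \<integral>\<^sup>+z. \<integral>\<^sup>+z'. indicator XY (mark \<omega> z, mark \<omega> z') \<partial>\<kappa> k \<omega> \<partial>\<kappa> k \<omega> \<partial>M) +
      (\<integral>\<^sup>+\<omega>. \<integral>\<^sup>+z. \<integral>\<^sup>+z'. indicator XY (mark \<omega> z, mark \<omega> z') \<partial>lborel \<partial>lborel \<partial>M) =
    (\<integral>\<^sup>+\<omega>. \<integral>\<^sup>+z. \<integral>\<^sup>+z'. indicator XY (mark \<omega> z, mark \<omega> z') \<partial>lborel \<partial>\<kappa> k \<omega> \<partial>M) +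
      (\<integral>\<^sup>+\<omega>. \<integral>\<^sup>+z. \<integral>\<^sup>+z'. indicator XY (mark \<omega> z, mark \<omega> z') \<partial>\<kappa> k \<omega> \<partial>lborel \<partial>M) +
      (\<integral>\<^sup>+\<omega>. \<integral>\<^sup>+z. indicator XY (mark \<omega> z, mark \<omega> z) \<partial>lborel \<partial>M)"
      unfolding XY rect_eq[OF fin_kernel_\<kappa> fin_kernel_\<kappa>] rect_eq[OF fin_kernel_lborel fin_kernel_lborel]
        rect_eq[OF fin_kernel_\<kappa> fin_kernel_lborel] rect_eq[OF fin_kernel_lborel fin_kernel_\<kappa>] diag_eq
    \<comment> \<open>\<open>covariance_rectangle\<close> wants one rectangle entirely after the
      conditioning time, so the condition is put at the later of the two starting times.\<close>
    proof (cases "a \<le> a'")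
      case True
      then show "(\<integral>\<^sup>+\<omega>. indicator (G \<inter> G') \<omega> * (emeasure (\<kappa> k \<omega>) ?D * emeasure (\<kappa> k \<omega>) ?D') \<partial>M) +
        (\<integral>\<^sup>+\<omega>. indicator (G \<inter> G') \<omega> * (emeasure lborel ?D * emeasure lborel ?D') \<partial>M) =
        (\<integral>\<^sup>+\<omega>. indicator (G \<inter> G') \<omega> * (emeasure (\<kappa> k \<omega>) ?D * emeasure lborel ?D') \<partial>M) +
        (\<integral>\<^sup>+\<omega>. indicator (G \<inter> G') \<omega> * (emeasure lborel ?D * emeasure (\<kappa> k \<omega>) ?D') \<partial>M) +
        (\<integral>\<^sup>+\<omega>. indicator (G \<inter> G') \<omega> * emeasure lborel (?D \<inter> ?D') \<partial>M)"
        by (intro covariance_rectangle[where a=a'] GG box bdd) auto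
    next
      case False
      then show "(\<integral>\<^sup>+\<omega>. indicator (G \<inter> G') \<omega> * (emeasure (\<kappa> k \<omega>) ?D * emeasure (\<kappa> k \<omega>) ?D') \<partial>M) +
        (\<integral>\<^sup>+\<omega>. indicator (G \<inter> G') \<omega> * (emeasure lborel ?D * emeasure lborel ?D') \<partial>M) =
        (\<integral>\<^sup>+\<omega>. indicator (G \<inter> G') \<omega> * (emeasure (\<kappa> k \<omega>) ?D * emeasure lborel ?D') \<partial>M) +
        (\<integral>\<^sup>+\<omega>. indicator (G \<inter> G') \<omega> * (emeasure lborel ?D * emeasure (\<kappa> k \<omega>) ?D') \<partial>M) +
        (\<integral>\<^sup>+\<omega>. indicator (G \<inter> G') \<omega> * emeasure lborel (?D \<inter> ?D') \<partial>M)"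
      proof -
        have "(\<integral>\<^sup>+\<omega>. indicator (G \<inter> G') \<omega> * (emeasure (\<kappa> k \<omega>) ?D' * emeasure (\<kappa> k \<omega>) ?D) \<partial>M) +
          (\<integral>\<^sup>+\<omega>. indicator (G \<inter> G') \<omega> * (emeasure lborel ?D' * emeasure lborel ?D) \<partial>M) =
          (\<integral>\<^sup>+\<omega>. indicator (G \<inter> G') \<omega> * (emeasure (\<kappa> k \<omega>) ?D' * emeasure lborel ?D) \<partial>M) +
          (\<integral>\<^sup>+\<omega>. indicator (G \<inter> G') \<omega> * (emeasure lborel ?D' * emeasure (\<kappa> k \<omega>) ?D) \<partial>M) +
          (\<integral>\<^sup>+\<omega>. indicator (G \<inter> G') \<omega> * emeasure lborel (?D' \<inter> ?D) \<partial>M)"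
          using False by (intro covariance_rectangle[where a=a] GG box bdd) auto
        then show ?thesis
          by (simp only: mult.commute[of "emeasure _ ?D"] Int_commute[of ?D] add.commute add.left_commute)
      qed
    qed
  qed
qed

lemma mark_integrand_measurable:
  assumes f: "f \<in> borel_measurable MPred" and K: "fin_kernel K"
  shows "\<omega> \<in> space M \<Longrightarrow> (\<lambda>z. f (mark \<omega> z)) \<in> borel_measurable (K \<omega>)"
    and "(\<lambda>\<omega>. \<integral>\<^sup>+z. f (mark \<omega> z) \<partial>K \<omega>) \<in> borel_measurable M"
proof -
  show "(\<lambda>z. f (mark \<omega> z)) \<in> borel_measurable (K \<omega>)" if "\<omega> \<in> space M"
    unfolding measurable_cong_sets[OF fin_kernelD(1)[OF K that] refl]
    by (rule measurable_compose[OF measurable_mark[OF that] f])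
  show "(\<lambda>\<omega>. \<integral>\<^sup>+z. f (mark \<omega> z) \<partial>K \<omega>) \<in> borel_measurable M"
    by (rule fin_kernel_measurable[OF K measurable_ident_sets[OF refl]])
      (use measurable_compose[OF measurable_mark_pair f] in \<open>simp add: case_prod_beta'\<close>)
qed

lemma second_moment_product:
  assumes f: "f \<in> borel_measurable MPred"
  shows "(\<integral>\<^sup>+\<omega>. (\<integral>\<^sup>+z. f (mark \<omega> z) \<partial>\<kappa> k \<omega>)\<^sup>2 \<partial>M) + (\<integral>\<^sup>+\<omega>. (\<integral>\<^sup>+z. f (mark \<omega> z) \<partial>lborel)\<^sup>2 \<partial>M) =
    2 * (\<integral>\<^sup>+\<omega>. (\<integral>\<^sup>+z. f (mark \<omega> z) \<partial>\<kappa> k \<omega>) * (\<integral>\<^sup>+z. f (mark \<omega> z) \<partial>lborel) \<partial>M) +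
    (\<integral>\<^sup>+\<omega>. \<integral>\<^sup>+z. (f (mark \<omega> z))\<^sup>2 \<partial>lborel \<partial>M)"
proof -
  have prod: "(\<integral>\<^sup>+\<omega>. \<integral>\<^sup>+z. \<integral>\<^sup>+z'. f (mark \<omega> z) * f (mark \<omega> z') \<partial>L \<omega> \<partial>K \<omega> \<partial>M) =
      (\<integral>\<^sup>+\<omega>. (\<integral>\<^sup>+z. f (mark \<omega> z) \<partial>K \<omega>) * (\<integral>\<^sup>+z. f (mark \<omega> z) \<partial>L \<omega>) \<partial>M)"
    if "fin_kernel K" "fin_kernel L" for K L
  proof (rule nn_integral_cong)
    fix \<omega> assume \<omega>: "\<omega> \<in> space M"
    have "(\<integral>\<^sup>+z'. f (mark \<omega> z) * f (mark \<omega> z') \<partial>L \<omega>) = f (mark \<omega> z) * (\<integral>\<^sup>+z'. f (mark \<omega> z') \<partial>L \<omega>)" for z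
      by (rule nn_integral_cmult) (rule mark_integrand_measurable(1)[OF f that(2) \<omega>])
    then show "(\<integral>\<^sup>+z. \<integral>\<^sup>+z'. f (mark \<omega> z) * f (mark \<omega> z') \<partial>L \<omega> \<partial>K \<omega>) =
      (\<integral>\<^sup>+z. f (mark \<omega> z) \<partial>K \<omega>) * (\<integral>\<^sup>+z. f (mark \<omega> z) \<partial>L \<omega>)"
      by (simp only:) (rule nn_integral_multc, rule mark_integrand_measurable(1)[OF f that(1) \<omega>])
  qed
  have m: "(\<lambda>p. f (fst p) * f (snd p)) \<in> borel_measurable (MPred \<Otimes>\<^sub>M MPred)"
    using f by measurable
  show ?thesis
    using second_moment[OF m, of k]
    unfolding fst_conv snd_conv prod[OF fin_kernel_\<kappa> fin_kernel_\<kappa>] prod[OF fin_kernel_lborel fin_kernel_lborel]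
      prod[OF fin_kernel_\<kappa> fin_kernel_lborel] prod[OF fin_kernel_lborel fin_kernel_\<kappa>]
    unfolding power2_eq_square mult_2
    by (simp only: mult.commute[of "\<integral>\<^sup>+z. f (mark _ z) \<partial>\<kappa> k _" "\<integral>\<^sup>+z. f (mark _ z) \<partial>lborel"])
qed

lemma square_diff_ennreal:
  assumes "x < \<infinity>" "y < \<infinity>"
  shows "ennreal ((enn2real x - enn2real y)\<^sup>2) + 2 * (x * y) = x\<^sup>2 + y\<^sup>2"
proof -
  obtain a b where [simp]: "x = ennreal a" "y = ennreal b" and nn: "0 \<le> a" "0 \<le> b"
    using assms by (cases x; cases y) auto
  have "ennreal ((a - b)\<^sup>2) + 2 * (ennreal a * ennreal b) = ennreal ((a - b)\<^sup>2 + 2 * (a * b))"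
    using nn by (simp add: ennreal_plus ennreal_mult)
  also have "(a - b)\<^sup>2 + 2 * (a * b) = a\<^sup>2 + b\<^sup>2" by (simp add: power2_diff)
  also have "ennreal (a\<^sup>2 + b\<^sup>2) = (ennreal a)\<^sup>2 + (ennreal b)\<^sup>2"
    using nn by (simp add: ennreal_plus ennreal_power)
  finally show ?thesis using nn by simp
qed

text \<open>The isometry carries the mixed term \<open>2 * E(X A)\<close> on both sides. For bounded
  \<open>f\<close> supported in a cube the compensator \<open>A\<close> is bounded by a constant, so
  the mixed term is finite and can be cancelled.\<close>

lemma compensated_second_moment_bounded:
  assumes f: "f \<in> borel_measurable MPred" and b: "\<And>p. f p \<le> of_nat n * indicator (mark_cube n) p"
  shows "(\<integral>\<^sup>+\<omega>. ennreal ((enn2real (\<integral>\<^sup>+z. f (mark \<omega> z) \<partial>\<kappa> k \<omega>) -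
      enn2real (\<integral>\<^sup>+z. f (mark \<omega> z) \<partial>lborel))\<^sup>2) \<partial>M) \<le> (\<integral>\<^sup>+\<omega>. \<integral>\<^sup>+z. (f (mark \<omega> z))\<^sup>2 \<partial>lborel \<partial>M)"
proof -
  define X where "X \<omega> = (\<integral>\<^sup>+z. f (mark \<omega> z) \<partial>\<kappa> k \<omega>)" for \<omega>
  define A where "A \<omega> = (\<integral>\<^sup>+z. f (mark \<omega> z) \<partial>lborel)" for \<omega>
  have [measurable]: "X \<in> borel_measurable M" "A \<in> borel_measurable M"
    unfolding X_def[abs_def] A_def[abs_def]
    by (rule mark_integrand_measurable(2)[OF f fin_kernel_\<kappa>], rule mark_integrand_measurable(2)[OF f fin_kernel_lborel])
  have ind: "indicator (mark_cube n) (mark \<omega> z) \<le> (indicator (cube n) z :: ennreal)" for \<omega> z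
    by (auto simp: mark_cube_def mark_def cube_def mem_Times_iff split: split_indicator)
  have bK: "(\<integral>\<^sup>+z. f (mark \<omega> z) \<partial>K \<omega>) \<le> of_nat n * emeasure (K \<omega>) (cube n)"
    if "fin_kernel K" "\<omega> \<in> space M" for K \<omega>
  proof -
    have "(\<integral>\<^sup>+z. f (mark \<omega> z) \<partial>K \<omega>) \<le> (\<integral>\<^sup>+z. of_nat n * indicator (cube n) z \<partial>K \<omega>)"
      by (rule nn_integral_mono, rule order.trans[OF b], rule mult_left_mono[OF ind]) simp
    also have "\<dots> = of_nat n * emeasure (K \<omega>) (cube n)"
      by (rule nn_integral_cmult_indicator) (simp add: fin_kernelD(1)[OF that])
    finally show ?thesis .
  qed
  have X_fin: "X \<omega> < \<infinity>" if "\<omega> \<in> space M" for \<omega>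
    unfolding X_def using fin_kernelD(2)[OF fin_kernel_\<kappa>[of k] that]
    by (intro order.strict_trans1[OF bK[OF fin_kernel_\<kappa> that]]) (simp add: ennreal_mult_less_top of_nat_less_top)
  have A_le: "A \<omega> \<le> of_nat n * emeasure lborel (cube n)" if "\<omega> \<in> space M" for \<omega>
    unfolding A_def using bK[OF fin_kernel_lborel that] .
  have cf: "emeasure lborel (cube n) < \<infinity>" by (rule emeasure_bounded_finite) simp
  then have A_fin: "A \<omega> < \<infinity>" if "\<omega> \<in> space M" for \<omega>
    by (intro order.strict_trans1[OF A_le[OF that]]) (simp add: ennreal_mult_less_top of_nat_less_top)
  have mean: "(\<integral>\<^sup>+\<omega>. X \<omega> \<partial>M) < \<infinity>"
  proof -
    have "(\<integral>\<^sup>+\<omega>. X \<omega> \<partial>M) = (\<integral>\<^sup>+\<omega>. A \<omega> \<partial>M)" unfolding X_def A_def by (rule first_moment[OF f])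
    also have "\<dots> \<le> (\<integral>\<^sup>+\<omega>. of_nat n * emeasure lborel (cube n) \<partial>M)"
      by (rule nn_integral_mono) (rule A_le)
    also have "\<dots> < \<infinity>" using cf by (simp add: emeasure_space_1 ennreal_mult_less_top of_nat_less_top)
    finally show ?thesis .
  qed
  have XA: "(\<integral>\<^sup>+\<omega>. X \<omega> * A \<omega> \<partial>M) < \<infinity>"
  proof -
    have "(\<integral>\<^sup>+\<omega>. X \<omega> * A \<omega> \<partial>M) \<le> (\<integral>\<^sup>+\<omega>. X \<omega> * (of_nat n * emeasure lborel (cube n)) \<partial>M)"
      by (rule nn_integral_mono) (rule mult_left_mono[OF A_le], simp_all)
    also have "\<dots> = (\<integral>\<^sup>+\<omega>. X \<omega> \<partial>M) * (of_nat n * emeasure lborel (cube n))"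
      by (rule nn_integral_multc) simp
    also have "\<dots> < \<infinity>" using mean cf by (simp add: ennreal_mult_less_top of_nat_less_top)
    finally show ?thesis .
  qed
  have "(\<integral>\<^sup>+\<omega>. ennreal ((enn2real (X \<omega>) - enn2real (A \<omega>))\<^sup>2) \<partial>M) + 2 * (\<integral>\<^sup>+\<omega>. X \<omega> * A \<omega> \<partial>M) =
      (\<integral>\<^sup>+\<omega>. ennreal ((enn2real (X \<omega>) - enn2real (A \<omega>))\<^sup>2) + 2 * (X \<omega> * A \<omega>) \<partial>M)"
    by (subst nn_integral_add) (simp_all add: nn_integral_cmult)
  also have "\<dots> = (\<integral>\<^sup>+\<omega>. (X \<omega>)\<^sup>2 + (A \<omega>)\<^sup>2 \<partial>M)"
    by (rule nn_integral_cong) (rule square_diff_ennreal[OF X_fin A_fin])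
  also have "\<dots> = (\<integral>\<^sup>+\<omega>. (X \<omega>)\<^sup>2 \<partial>M) + (\<integral>\<^sup>+\<omega>. (A \<omega>)\<^sup>2 \<partial>M)"
    by (rule nn_integral_add) simp_all
  also have "\<dots> = 2 * (\<integral>\<^sup>+\<omega>. X \<omega> * A \<omega> \<partial>M) + (\<integral>\<^sup>+\<omega>. \<integral>\<^sup>+z. (f (mark \<omega> z))\<^sup>2 \<partial>lborel \<partial>M)"
    unfolding X_def A_def by (rule second_moment_product[OF f])
  finally have "2 * (\<integral>\<^sup>+\<omega>. X \<omega> * A \<omega> \<partial>M) + (\<integral>\<^sup>+\<omega>. ennreal ((enn2real (X \<omega>) - enn2real (A \<omega>))\<^sup>2) \<partial>M) =
      2 * (\<integral>\<^sup>+\<omega>. X \<omega> * A \<omega> \<partial>M) + (\<integral>\<^sup>+\<omega>. \<integral>\<^sup>+z. (f (mark \<omega> z))\<^sup>2 \<partial>lborel \<partial>M)"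
    by (simp add: add.commute)
  moreover have "2 * (\<integral>\<^sup>+\<omega>. X \<omega> * A \<omega> \<partial>M) \<noteq> \<infinity>"
    using XA by (simp add: ennreal_mult_eq_top_iff less_top)
  ultimately show ?thesis
    unfolding ennreal_add_left_cancel X_def A_def by simp
qed

text \<open>Truncate \<open>f\<close> in height and in space, use the bounded case, and pass to the
  limit by Fatou's lemma. The hypothesis \<open>fin\<close> makes both integrals almost surely
  finite, so the real differences converge.\<close>

theorem compensated_second_moment:
  assumes f: "f \<in> borel_measurable MPred" and fin: "(\<integral>\<^sup>+\<omega>. \<integral>\<^sup>+z. f (mark \<omega> z) \<partial>lborel \<partial>M) < \<infinity>"
  shows "(\<integral>\<^sup>+\<omega>. ennreal ((enn2real (\<integral>\<^sup>+z. f (mark \<omega> z) \<partial>\<kappa> k \<omega>) -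
      enn2real (\<integral>\<^sup>+z. f (mark \<omega> z) \<partial>lborel))\<^sup>2) \<partial>M) \<le> (\<integral>\<^sup>+\<omega>. \<integral>\<^sup>+z. (f (mark \<omega> z))\<^sup>2 \<partial>lborel \<partial>M)"
proof -
  define fn where "fn n p = min (f p) (of_nat n) * indicator (mark_cube n) p" for n p
  have mc: "mark_cube n \<in> sets MPred" for n
    unfolding sets_MPred using mark_cube_gen by (rule sigma_sets.Basic)
  have fn: "fn n \<in> borel_measurable MPred" for n
    unfolding fn_def using f mc by measurable
  have fn_b: "fn n p \<le> of_nat n * indicator (mark_cube n) p" "fn n p \<le> f p" for n p
    by (auto simp: fn_def split: split_indicator)
  have inc: "fn n p \<le> fn m p" if "n \<le> m" for n m p
    using incseqD[OF incseq_mark_cube that] that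
    by (auto simp: fn_def split: split_indicator intro: min.coboundedI2)
  have sup: "(SUP n. fn n p) = f p" if p: "p \<in> space MPred" for p
  proof (rule antisym)
    show "(SUP n. fn n p) \<le> f p" by (rule SUP_least) (rule fn_b(2))
    obtain n0 where n0: "p \<in> mark_cube n0" using p unfolding UN_mark_cube[symmetric] by blast
    have "min (f p) (of_nat n) \<le> (SUP n. fn n p)" for n
    proof -
      have "p \<in> mark_cube (max n n0)" using incseqD[OF incseq_mark_cube, of n0 "max n n0"] n0 by auto
      then have "min (f p) (of_nat n) \<le> fn (max n n0) p"
        using of_nat_mono[of n "max n n0", where 'a=ennreal] by (simp add: fn_def min.coboundedI2)
      also have "\<dots> \<le> (SUP n. fn n p)" by (rule SUP_upper) simp
      finally show ?thesis .
    qed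
    then have "(SUP n. min (f p) (of_nat n)) \<le> (SUP n. fn n p)" by (rule SUP_least)
    moreover have "(SUP n. min (f p) (of_nat n)) = min (f p) (SUP n. of_nat n)"
      by (simp flip: inf_ennreal_def inf_min add: inf_SUP)
    ultimately show "f p \<le> (SUP n. fn n p)"
      by (simp add: ennreal_SUP_of_nat_eq_top)
  qed
  define X where "X \<omega> = (\<integral>\<^sup>+z. f (mark \<omega> z) \<partial>\<kappa> k \<omega>)" for \<omega>
  define A where "A \<omega> = (\<integral>\<^sup>+z. f (mark \<omega> z) \<partial>lborel)" for \<omega>
  define Xn where "Xn n \<omega> = (\<integral>\<^sup>+z. fn n (mark \<omega> z) \<partial>\<kappa> k \<omega>)" for n \<omega>
  define An where "An n \<omega> = (\<integral>\<^sup>+z. fn n (mark \<omega> z) \<partial>lborel)" for n \<omega>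
  have [measurable]: "X \<in> borel_measurable M" "A \<in> borel_measurable M"
    "Xn n \<in> borel_measurable M" "An n \<in> borel_measurable M" for n
    unfolding X_def[abs_def] A_def[abs_def] Xn_def[abs_def] An_def[abs_def]
    by (rule mark_integrand_measurable(2)[OF f fin_kernel_\<kappa>], rule mark_integrand_measurable(2)[OF f fin_kernel_lborel],
      rule mark_integrand_measurable(2)[OF fn fin_kernel_\<kappa>], rule mark_integrand_measurable(2)[OF fn fin_kernel_lborel])
  have lim: "(\<lambda>n. \<integral>\<^sup>+z. fn n (mark \<omega> z) \<partial>K \<omega>) \<longlonglongrightarrow> (\<integral>\<^sup>+z. f (mark \<omega> z) \<partial>K \<omega>)"
    if K: "fin_kernel K" and \<omega>: "\<omega> \<in> space M" for K \<omega>
  proof -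
    have "(\<integral>\<^sup>+z. f (mark \<omega> z) \<partial>K \<omega>) = (\<integral>\<^sup>+z. (SUP n. fn n (mark \<omega> z)) \<partial>K \<omega>)"
      by (rule nn_integral_cong) (rule sup[OF mark_space[OF \<omega>], symmetric])
    also have "\<dots> = (SUP n. \<integral>\<^sup>+z. fn n (mark \<omega> z) \<partial>K \<omega>)"
      by (rule nn_integral_monotone_convergence_SUP)
        (use inc mark_integrand_measurable(1)[OF fn K \<omega>] in \<open>auto simp: incseq_def le_fun_def\<close>)
    finally have "(\<integral>\<^sup>+z. f (mark \<omega> z) \<partial>K \<omega>) = (SUP n. \<integral>\<^sup>+z. fn n (mark \<omega> z) \<partial>K \<omega>)" .
    then show ?thesis
      by (simp only:) (rule LIMSEQ_SUP, auto simp: incseq_def inc intro!: nn_integral_mono)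
  qed
  have "(\<integral>\<^sup>+\<omega>. X \<omega> \<partial>M) < \<infinity>" "(\<integral>\<^sup>+\<omega>. A \<omega> \<partial>M) < \<infinity>"
    using fin first_moment[OF f, of k] unfolding X_def A_def by simp_all
  then have "AE \<omega> in M. X \<omega> \<noteq> \<infinity> \<and> A \<omega> \<noteq> \<infinity>"
    by (intro AE_conjI nn_integral_PInf_AE) auto
  then have conv: "AE \<omega> in M. ennreal ((enn2real (X \<omega>) - enn2real (A \<omega>))\<^sup>2) =
      liminf (\<lambda>n. ennreal ((enn2real (Xn n \<omega>) - enn2real (An n \<omega>))\<^sup>2))"
  proof (rule AE_mp, intro AE_I2 impI)
    fix \<omega> assume \<omega>: "\<omega> \<in> space M" and fin': "X \<omega> \<noteq> \<infinity> \<and> A \<omega> \<noteq> \<infinity>"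
    have "(\<lambda>n. Xn n \<omega>) \<longlonglongrightarrow> X \<omega>" "(\<lambda>n. An n \<omega>) \<longlonglongrightarrow> A \<omega>"
      unfolding X_def A_def Xn_def An_def by (rule lim[OF fin_kernel_\<kappa> \<omega>], rule lim[OF fin_kernel_lborel \<omega>])
    then have "(\<lambda>n. ennreal ((enn2real (Xn n \<omega>) - enn2real (An n \<omega>))\<^sup>2)) \<longlonglongrightarrow>
        ennreal ((enn2real (X \<omega>) - enn2real (A \<omega>))\<^sup>2)"
      using fin' by (intro tendsto_intros) (auto intro!: tendsto_enn2real simp: less_top)
    then show "ennreal ((enn2real (X \<omega>) - enn2real (A \<omega>))\<^sup>2) =
        liminf (\<lambda>n. ennreal ((enn2real (Xn n \<omega>) - enn2real (An n \<omega>))\<^sup>2))"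
      by (rule lim_imp_Liminf[OF trivial_limit_sequentially, symmetric])
  qed
  have "(\<integral>\<^sup>+\<omega>. ennreal ((enn2real (X \<omega>) - enn2real (A \<omega>))\<^sup>2) \<partial>M) =
      (\<integral>\<^sup>+\<omega>. liminf (\<lambda>n. ennreal ((enn2real (Xn n \<omega>) - enn2real (An n \<omega>))\<^sup>2)) \<partial>M)"
    by (rule nn_integral_cong_AE[OF conv])
  also have "\<dots> \<le> liminf (\<lambda>n. \<integral>\<^sup>+\<omega>. ennreal ((enn2real (Xn n \<omega>) - enn2real (An n \<omega>))\<^sup>2) \<partial>M)"
    by (rule nn_integral_liminf) measurable
  also have "\<dots> \<le> liminf (\<lambda>n::nat. \<integral>\<^sup>+\<omega>. \<integral>\<^sup>+z. (f (mark \<omega> z))\<^sup>2 \<partial>lborel \<partial>M)"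
  proof (intro Liminf_mono always_eventually allI)
    fix n
    have "(\<integral>\<^sup>+\<omega>. ennreal ((enn2real (Xn n \<omega>) - enn2real (An n \<omega>))\<^sup>2) \<partial>M) \<le>
        (\<integral>\<^sup>+\<omega>. \<integral>\<^sup>+z. (fn n (mark \<omega> z))\<^sup>2 \<partial>lborel \<partial>M)"
      unfolding Xn_def An_def by (rule compensated_second_moment_bounded[OF fn fn_b(1)])
    also have "\<dots> \<le> (\<integral>\<^sup>+\<omega>. \<integral>\<^sup>+z. (f (mark \<omega> z))\<^sup>2 \<partial>lborel \<partial>M)"
      by (intro nn_integral_mono power_mono fn_b) simp
    finally show "(\<integral>\<^sup>+\<omega>. ennreal ((enn2real (Xn n \<omega>) - enn2real (An n \<omega>))\<^sup>2) \<partial>M) \<le>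
        (\<integral>\<^sup>+\<omega>. \<integral>\<^sup>+z. (f (mark \<omega> z))\<^sup>2 \<partial>lborel \<partial>M)" .
  qed
  also have "\<dots> = (\<integral>\<^sup>+\<omega>. \<integral>\<^sup>+z. (f (mark \<omega> z))\<^sup>2 \<partial>lborel \<partial>M)"
    by (rule Liminf_const) simp
  finally show ?thesis unfolding X_def A_def .
qed

end

section \<open>Predictability of integrals over the strict past\<close>

context adapted_kernel
begin

lemma Pred_after_set:
  assumes G: "G \<in> sets (F q)"
  shows "G \<times> {q<..} \<in> sets Pred"
proof -
  have "G \<times> {q<..} = (\<Union>n::nat. G \<times> {q<..q + real n})"
  proof -
    have "\<exists>n::nat. t \<le> q + real n" for t
    proof -
      obtain n where "t - q < real n" using reals_Archimedean2 by blast
      then show ?thesis by (intro exI[of _ n]) simp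
    qed
    then show ?thesis by auto
  qed
  also have "\<dots> \<in> sets Pred"
  proof (rule sets.countable_UN)
    show "range (\<lambda>n::nat. G \<times> {q<..q + real n}) \<subseteq> sets Pred"
      unfolding sets_Pred using G by (auto simp: pred_gen_def intro!: sigma_sets.Basic)
  qed
  finally show ?thesis .
qed

text \<open>A quantity known at time \<open>q\<close> and switched on after \<open>q\<close> is
  predictable. Suprema of such functions over rational \<open>q\<close> are the source of
  predictability for running counts.\<close>

lemma Pred_after:
  fixes Y :: "'w \<Rightarrow> ennreal"
  assumes Y: "Y \<in> borel_measurable (F q)"
  shows "(\<lambda>p. Y (fst p) * indicator {q<..} (snd p)) \<in> borel_measurable Pred"
proof -
  have S: "space M \<times> {q<..} \<in> sets Pred" by (rule Pred_after_set[OF space_M_F])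
  have "fst \<in> measurable (restrict_space Pred (space M \<times> {q<..})) (F q)"
  proof (rule measurableI)
    show "fst p \<in> space (F q)" if "p \<in> space (restrict_space Pred (space M \<times> {q<..}))" for p
      using that by (auto simp: space_restrict_space space_F)
    fix G assume G: "G \<in> sets (F q)"
    then have "fst -` G \<inter> space (restrict_space Pred (space M \<times> {q<..})) = G \<times> {q<..}"
      using sets.sets_into_space[OF G] by (auto simp: space_restrict_space space_F)
    moreover have "G \<times> {q<..} \<in> sets (restrict_space Pred (space M \<times> {q<..}))"
      using Pred_after_set[OF G] sets.sets_into_space[OF G] sets.Int[OF S sets.top]
      by (subst sets_restrict_space_iff) (auto simp: space_F)
    ultimately show "fst -` G \<inter> space (restrict_space Pred (space M \<times> {q<..})) \<in>
        sets (restrict_space Pred (space M \<times> {q<..}))" by simp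
  qed
  then have "(\<lambda>p. Y (fst p)) \<in> borel_measurable (restrict_space Pred (space M \<times> {q<..}))"
    by (rule measurable_compose[OF _ Y])
  then have meas: "(\<lambda>p. Y (fst p) * indicator (space M \<times> {q<..}) p) \<in> borel_measurable Pred"
    using sets.Int[OF S sets.top] by (subst (asm) borel_measurable_restrict_space_iff_ennreal) simp_all
  have eq: "Y (fst p) * indicator (space M \<times> {q<..}) p = Y (fst p) * indicator {q<..} (snd p)"
    if "p \<in> space Pred" for p
    using that by (auto split: split_indicator)
  show ?thesis by (rule measurable_cong[THEN iffD1, OF eq meas])
qed

text \<open>A count of points strictly before the current time is left-continuous, hence the
  supremum over rational \<open>r\<close> below that time of the count up to
  \<open>r\<close>.\<close>

lemma predictable_rectangle:
  assumes G: "G \<in> sets (F a)"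
  shows "(\<lambda>p. indicator G (fst p) * emeasure (\<kappa> k (fst p)) ({c<..d} \<times> ({a<..b} \<inter> {..<snd p})))
    \<in> borel_measurable Pred"
proof -
  \<comment> \<open>The value is zero for \<open>r \<le> a\<close>, where \<open>G\<close> need not
    be known yet; the rectangle contains no point up to time \<open>a\<close> anyway.\<close>
  define Y where "Y r \<omega> = (if r \<le> a then 0 else indicator G \<omega> * emeasure (\<kappa> k \<omega>) ({c<..d} \<times> {a<..min b r}))"
    for r \<omega>
  have Y: "Y r \<in> borel_measurable (F r)" for r
  proof (cases "r \<le> a")
    case False
    then have "G \<in> sets (F r)" using F_mono[of a r] G by auto
    moreover have "(\<lambda>\<omega>. emeasure (\<kappa> k \<omega>) ({c<..d} \<times> {a<..min b r})) \<in> borel_measurable (F r)"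
      by (rule adapted) (auto simp: borel_Times)
    ultimately show ?thesis unfolding Y_def using False by simp
  qed (simp add: Y_def[abs_def])
  have eq: "indicator G (fst p) * emeasure (\<kappa> k (fst p)) ({c<..d} \<times> ({a<..b} \<inter> {..<snd p})) =
      (SUP r::rat. Y (of_rat r) (fst p) * indicator {of_rat r<..} (snd p))" if p: "p \<in> space Pred" for p
  proof (rule antisym)
    obtain \<omega> t where p': "p = (\<omega>, t)" "\<omega> \<in> space M" using p by auto
    note sets = sets_\<kappa>[OF p'(2), of k]
    let ?S = "SUP r::rat. Y (of_rat r) (fst p) * indicator {of_rat r<..} (snd p)"
    show "?S \<le> indicator G (fst p) * emeasure (\<kappa> k (fst p)) ({c<..d} \<times> ({a<..b} \<inter> {..<snd p}))"
    proof (rule SUP_least)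
      fix r :: rat
      have "emeasure (\<kappa> k \<omega>) ({c<..d} \<times> {a<..min b (of_rat r)}) \<le>
          emeasure (\<kappa> k \<omega>) ({c<..d} \<times> ({a<..b} \<inter> {..<t}))" if "of_rat r < t"
        using that by (intro emeasure_mono) (auto simp: sets borel_Times)
      then show "Y (of_rat r) (fst p) * indicator {of_rat r<..} (snd p) \<le>
          indicator G (fst p) * emeasure (\<kappa> k (fst p)) ({c<..d} \<times> ({a<..b} \<inter> {..<snd p}))"
        by (auto simp: p' Y_def split: split_indicator)
    qed
    define I where "I n = {c<..d} \<times> {a<..min b (t - 1 / real (Suc n))}" for n
    have "incseq I"
    proof (rule incseq_SucI)
      fix n
      have "1 / real (Suc (Suc n)) \<le> 1 / real (Suc n)" by (rule frac_le) auto
      then show "I n \<subseteq> I (Suc n)" unfolding I_def by (intro Sigma_mono order.refl) auto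
    qed
    moreover have "range I \<subseteq> sets (\<kappa> k \<omega>)" by (auto simp: I_def sets borel_Times)
    ultimately have "(SUP n. emeasure (\<kappa> k \<omega>) (I n)) = emeasure (\<kappa> k \<omega>) (\<Union>n. I n)"
      by (intro SUP_emeasure_incseq)
    also have "(\<Union>n. I n) = {c<..d} \<times> ({a<..b} \<inter> {..<t})"
    proof (intro equalityI subsetI)
      fix z assume "z \<in> {c<..d} \<times> ({a<..b} \<inter> {..<t})"
      then have z: "c < fst z" "fst z \<le> d" "a < snd z" "snd z \<le> b" "0 < t - snd z"
        by (auto simp: mem_Times_iff)
      obtain n where "inverse (real (Suc n)) < t - snd z" using reals_Archimedean[OF z(5)] by blast
      then have "z \<in> I n" using z by (auto simp: I_def mem_Times_iff inverse_eq_divide)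
      then show "z \<in> (\<Union>n. I n)" by blast
    next
      fix z assume "z \<in> (\<Union>n. I n)"
      then obtain n where "z \<in> I n" by blast
      moreover have "t - 1 / real (Suc n) < t" by simp
      ultimately show "z \<in> {c<..d} \<times> ({a<..b} \<inter> {..<t})"
        using le_less_trans[of "snd z" "t - 1 / real (Suc n)" t] unfolding I_def mem_Times_iff by auto
    qed
    finally have eq': "emeasure (\<kappa> k \<omega>) ({c<..d} \<times> ({a<..b} \<inter> {..<t})) = (SUP n. emeasure (\<kappa> k \<omega>) (I n))" ..
    have "indicator G \<omega> * emeasure (\<kappa> k \<omega>) (I n) \<le> ?S" for n
    proof -
      have "t - 1 / real (Suc n) < t" by simp
      then obtain r where r: "t - 1 / real (Suc n) < of_rat r" "of_rat r < t" using of_rat_dense by blast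
      have "I n \<subseteq> {c<..d} \<times> {a<..min b (of_rat r)}" using r by (auto simp: I_def)
      then have le: "emeasure (\<kappa> k \<omega>) (I n) \<le> emeasure (\<kappa> k \<omega>) ({c<..d} \<times> {a<..min b (of_rat r)})"
        by (intro emeasure_mono) (auto simp: sets borel_Times)
      have "indicator G \<omega> * emeasure (\<kappa> k \<omega>) (I n) \<le> Y (of_rat r) \<omega>"
      proof (cases "of_rat r \<le> a")
        case True
        then have "I n = {}" using r by (auto simp: I_def)
        then show ?thesis by simp
      next
        case False
        then show ?thesis using le by (auto simp: Y_def split: split_indicator)
      qed
      also have "\<dots> = Y (of_rat r) (fst p) * indicator {of_rat r<..} (snd p)" using r by (simp add: p')
      also have "\<dots> \<le> ?S" by (rule SUP_upper) simp
      finally show ?thesis .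
    qed
    then have "(SUP n. indicator G \<omega> * emeasure (\<kappa> k \<omega>) (I n)) \<le> ?S" by (rule SUP_least)
    then show "indicator G (fst p) * emeasure (\<kappa> k (fst p)) ({c<..d} \<times> ({a<..b} \<inter> {..<snd p})) \<le> ?S"
      by (simp add: p'(1) eq' SUP_mult_left_ennreal)
  qed
  have meas: "(\<lambda>p. SUP r::rat. Y (of_rat r) (fst p) * indicator {of_rat r<..} (snd p)) \<in> borel_measurable Pred"
    by (rule borel_measurable_SUP) (auto intro: Pred_after[OF Y])
  show ?thesis by (rule measurable_cong[THEN iffD2, OF eq meas])
qed

text \<open>Integration over the strict past preserves predictability, which keeps the Picard
  iteration below inside \<open>Pred\<close>. The integral is taken against a kernel from
  \<open>Pred\<close> to \<open>MPred\<close>; its values on generating rectangles are the counts of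
  \<open>predictable_rectangle\<close>.\<close>

theorem predictable_integral:
  assumes h: "(\<lambda>(p, q). h p q) \<in> borel_measurable (Pred \<Otimes>\<^sub>M MPred)"
  shows "(\<lambda>p. \<integral>\<^sup>+z. indicator {..<snd p} (snd z) * h p (mark (fst p) z) \<partial>\<kappa> k (fst p)) \<in> borel_measurable Pred"
proof -
  \<comment> \<open>The points strictly before the time of \<open>p\<close>, each carried to its
    place in \<open>MPred\<close> together with the outcome.\<close>
  define K where "K p = distr (density (\<kappa> k (fst p)) (\<lambda>z. indicator {..<snd p} (snd z))) MPred (mark (fst p))" for p
  have bK: "borel_measurable (\<kappa> k \<omega>) = borel_measurable borel" if "\<omega> \<in> space M" for \<omega>
    by (rule measurable_cong_sets[OF sets_\<kappa>[OF that] refl])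
  have ind: "(\<lambda>z. indicator {..<t} (snd z) :: ennreal) \<in> borel_measurable (\<kappa> k \<omega>)" if "\<omega> \<in> space M" for t \<omega>
    unfolding bK[OF that]
    by (rule measurable_compose[of snd borel borel, OF _ borel_measurable_indicator])
      (auto intro!: borel_measurable_continuous_onI continuous_intros)
  have K_int: "(\<integral>\<^sup>+q. f q \<partial>K p) = (\<integral>\<^sup>+z. indicator {..<snd p} (snd z) * f (mark (fst p) z) \<partial>\<kappa> k (fst p))"
    if p: "p \<in> space Pred" and f: "f \<in> borel_measurable MPred" for p f
  proof -
    have \<omega>: "fst p \<in> space M" using p by auto
    have m: "mark (fst p) \<in> measurable (density (\<kappa> k (fst p)) (\<lambda>z. indicator {..<snd p} (snd z))) MPred"
      using measurable_mark[OF \<omega>] by (simp add: measurable_cong_sets[OF sets_\<kappa>[OF \<omega>] refl])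
    have "(\<integral>\<^sup>+q. f q \<partial>K p) = (\<integral>\<^sup>+z. f (mark (fst p) z) \<partial>density (\<kappa> k (fst p)) (\<lambda>z. indicator {..<snd p} (snd z)))"
      unfolding K_def by (rule nn_integral_distr[OF m]) (simp add: f)
    also have "\<dots> = (\<integral>\<^sup>+z. indicator {..<snd p} (snd z) * f (mark (fst p) z) \<partial>\<kappa> k (fst p))"
      by (rule nn_integral_density[OF ind[OF \<omega>] mark_integrand_measurable(1)[OF f fin_kernel_\<kappa> \<omega>]])
    finally show ?thesis .
  qed
  have gen: "X \<in> sets MPred" if "X \<in> mark_gen" for X
    unfolding sets_MPred using that by (rule sigma_sets.Basic)
  have K_rect: "emeasure (K p) ((G \<times> {a<..b}) \<times> {c<..d}) =
      indicator G (fst p) * emeasure (\<kappa> k (fst p)) ({c<..d} \<times> ({a<..b} \<inter> {..<snd p}))"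
    if p: "p \<in> space Pred" and X: "(G \<times> {a<..b}) \<times> {c<..d} \<in> sets MPred" for p G a b c d
  proof -
    have \<omega>: "fst p \<in> space M" using p by auto
    have "emeasure (K p) ((G \<times> {a<..b}) \<times> {c<..d}) = (\<integral>\<^sup>+q. indicator ((G \<times> {a<..b}) \<times> {c<..d}) q \<partial>K p)"
      by (rule nn_integral_indicator[symmetric]) (simp add: K_def X)
    also have "\<dots> = (\<integral>\<^sup>+z. indicator {..<snd p} (snd z) * indicator ((G \<times> {a<..b}) \<times> {c<..d}) (mark (fst p) z) \<partial>\<kappa> k (fst p))"
      by (rule K_int[OF p]) (rule borel_measurable_indicator[OF X])
    also have "\<dots> = (\<integral>\<^sup>+z. indicator G (fst p) * indicator ({c<..d} \<times> ({a<..b} \<inter> {..<snd p})) z \<partial>\<kappa> k (fst p))"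
      using mark_vimage[of "fst p" _ G a b c d]
      by (intro nn_integral_cong) (auto simp: mem_Times_iff split: split_indicator)
    also have "\<dots> = indicator G (fst p) * emeasure (\<kappa> k (fst p)) ({c<..d} \<times> ({a<..b} \<inter> {..<snd p}))"
      by (rule nn_integral_cmult_indicator) (auto simp: sets_\<kappa>[OF \<omega>] intro!: borel_Times)
    finally show ?thesis .
  qed
  have meas: "(\<lambda>p. \<integral>\<^sup>+q. h p q \<partial>K p) \<in> borel_measurable Pred"
  proof (rule nn_integral_kernel_measurable[OF sets_MPred Int_stable_mark_gen mark_gen_subset _ _
        mark_cube_gen incseq_mark_cube UN_mark_cube _ h])
    show "sets (K p) = sets MPred" for p by (simp add: K_def)
    show "(\<lambda>p. emeasure (K p) X) \<in> borel_measurable Pred" if X: "X \<in> mark_gen" for X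
    proof -
      obtain G a b c d where X': "X = (G \<times> {a<..b}) \<times> {c<..d}" and G: "G \<in> sets (F a)"
        using X unfolding mark_gen_def pred_gen_def by (elim CollectE exE conjE) simp
      have "(\<lambda>p. indicator G (fst p) * emeasure (\<kappa> k (fst p)) ({c<..d} \<times> ({a<..b} \<inter> {..<snd p})))
          \<in> borel_measurable Pred" by (rule predictable_rectangle[OF G])
      then show ?thesis
        by (rule measurable_cong[THEN iffD2, rotated]) (rule K_rect[OF _ gen[OF X, unfolded X'], folded X'])
    qed
    fix p n assume p: "p \<in> space Pred"
    then have \<omega>: "fst p \<in> space M" by auto
    have "emeasure (K p) (mark_cube n) \<le> 1 * emeasure (\<kappa> k (fst p)) (cube n)"
      unfolding mark_cube_def K_rect[OF p gen[OF mark_cube_gen, unfolded mark_cube_def]]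
      by (intro mult_mono emeasure_mono) (auto simp: cube_def sets_\<kappa>[OF \<omega>] borel_Times split: split_indicator)
    also have "\<dots> < \<infinity>" using \<kappa>_cube[OF \<omega>] by simp
    finally show "emeasure (K p) (mark_cube n) < \<infinity>" .
  qed
  have eq: "(\<integral>\<^sup>+q. h p q \<partial>K p) =
      (\<integral>\<^sup>+z. indicator {..<snd p} (snd z) * h p (mark (fst p) z) \<partial>\<kappa> k (fst p))" if p: "p \<in> space Pred" for p
    by (rule K_int[OF p]) (rule measurable_compose[OF measurable_Pair1'[OF p] h, simplified])
  show ?thesis by (rule measurable_cong[THEN iffD1, OF eq meas])
qed

end

section \<open>Moments and independence of Poisson counts\<close>

context prob_space
begin

lemma nn_integral_nat_valued:
  fixes X :: "'a \<Rightarrow> ennreal" and f :: "ennreal \<Rightarrow> ennreal"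
  assumes X[measurable]: "X \<in> borel_measurable M" and nat: "AE \<omega> in M. \<exists>n::nat. X \<omega> = of_nat n"
  shows "(\<integral>\<^sup>+\<omega>. f (X \<omega>) \<partial>M) = (\<Sum>n::nat. f (of_nat n) * emeasure M {\<omega>\<in>space M. X \<omega> = of_nat n})"
proof -
  have "(\<integral>\<^sup>+\<omega>. f (X \<omega>) \<partial>M) = (\<integral>\<^sup>+\<omega>. (\<Sum>n. f (of_nat n) * indicator {\<omega>\<in>space M. X \<omega> = of_nat n} \<omega>) \<partial>M)"
  proof (rule nn_integral_cong_AE)
    show "AE \<omega> in M. f (X \<omega>) = (\<Sum>n. f (of_nat n) * indicator {\<omega>\<in>space M. X \<omega> = of_nat n} \<omega>)"
      using nat
    proof (rule AE_mp, intro AE_I2 impI)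
      fix \<omega> assume \<omega>: "\<omega> \<in> space M" and "\<exists>n::nat. X \<omega> = of_nat n"
      then obtain n :: nat where n: "X \<omega> = of_nat n" by blast
      have "(\<Sum>m. f (of_nat m) * indicator {\<omega>\<in>space M. X \<omega> = of_nat m} \<omega>) =
          (\<Sum>m\<in>{n}. f (of_nat m) * indicator {\<omega>\<in>space M. X \<omega> = of_nat m} \<omega>)"
        by (rule suminf_finite) (auto simp: n)
      also have "\<dots> = f (X \<omega>)" using \<omega> by (simp add: n)
      finally show "f (X \<omega>) = (\<Sum>n. f (of_nat n) * indicator {\<omega>\<in>space M. X \<omega> = of_nat n} \<omega>)" ..
    qed
  qed
  also have "\<dots> = (\<Sum>n. \<integral>\<^sup>+\<omega>. f (of_nat n) * indicator {\<omega>\<in>space M. X \<omega> = of_nat n} \<omega> \<partial>M)"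
    by (rule nn_integral_suminf) measurable
  also have "\<dots> = (\<Sum>n. f (of_nat n) * emeasure M {\<omega>\<in>space M. X \<omega> = of_nat n})"
    by (subst nn_integral_cmult_indicator) simp_all
  finally show ?thesis .
qed

text \<open>The prescribed weights sum to one, so \<open>X\<close> is almost surely a finite integer
  and its moments are series, summed by shifting the index with
  \<open>n * p n = v * p (n - 1)\<close>.\<close>

lemma poisson_moments:
  fixes X :: "'a \<Rightarrow> ennreal"
  assumes X[measurable]: "X \<in> borel_measurable M" and v: "0 \<le> v"
    and law: "\<And>n. prob {\<omega>\<in>space M. X \<omega> = of_nat n} = v ^ n / fact n * exp (- v)"
  shows "AE \<omega> in M. \<exists>n::nat. X \<omega> = of_nat n"
    and "(\<integral>\<^sup>+\<omega>. X \<omega> \<partial>M) = ennreal v"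
    and "(\<integral>\<^sup>+\<omega>. (X \<omega>)\<^sup>2 \<partial>M) = ennreal (v + v\<^sup>2)"
proof -
  let ?p = "\<lambda>n. v ^ n / fact n * exp (- v)"
  have p: "?p sums 1"
  proof -
    have "(\<lambda>n. v ^ n / fact n) sums exp v" using exp_converges[of v] by (simp add: field_simps)
    from sums_mult2[OF this, of "exp (- v)"] show ?thesis by (simp flip: exp_add)
  qed
  have p1: "(\<lambda>n. real n * ?p n) sums v"
  proof -
    have "real (Suc n) * ?p (Suc n) = v * ?p n" for n
      by (simp add: field_simps del: of_nat_Suc)
    then have "(\<lambda>n. real (Suc n) * ?p (Suc n)) = (\<lambda>n. v * ?p n)" by (rule ext)
    then have "(\<lambda>n. real (Suc n) * ?p (Suc n)) sums v"
      using sums_mult[OF p, of v] by (simp only: mult_1_right)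
    from sums_Suc[OF this] show ?thesis by simp
  qed
  have p2: "(\<lambda>n. (real n)\<^sup>2 * ?p n) sums (v + v\<^sup>2)"
  proof -
    have "(real (Suc n))\<^sup>2 * ?p (Suc n) = v * (real n * ?p n) + v * ?p n" for n
    proof -
      have "real (Suc n) * ?p (Suc n) = v * ?p n" by (simp add: field_simps del: of_nat_Suc)
      then have "(real (Suc n))\<^sup>2 * ?p (Suc n) = real (Suc n) * (v * ?p n)"
        by (simp only: power2_eq_square mult.assoc)
      moreover have "real (Suc n) * (v * q) = v * (real n * q) + v * q" for q by (simp add: algebra_simps)
      ultimately show ?thesis by (simp only:)
    qed
    moreover have "(\<lambda>n. v * (real n * ?p n) + v * ?p n) sums (v * v + v * 1)"
      by (intro sums_add sums_mult p1 p)
    ultimately have "(\<lambda>n. (real (Suc n))\<^sup>2 * ?p (Suc n)) sums (v * v + v)" by (simp only: mult_1_right)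
    from sums_Suc[OF this] show ?thesis by (simp add: power2_eq_square add.commute)
  qed
  have em: "emeasure M {\<omega>\<in>space M. X \<omega> = of_nat n} = ennreal (?p n)" for n
    unfolding emeasure_eq_measure law ..
  have disj: "disjoint_family (\<lambda>n::nat. {\<omega>\<in>space M. X \<omega> = of_nat n})"
    by (auto simp: disjoint_family_on_def)
  have "emeasure M (\<Union>n::nat. {\<omega>\<in>space M. X \<omega> = of_nat n}) = (\<Sum>n. ennreal (?p n))"
    by (subst suminf_emeasure[OF _ disj, symmetric]) (auto simp: em)
  also have "\<dots> = ennreal 1"
    by (rule suminf_ennreal_eq[OF _ p]) (use v in simp)
  finally have "prob (\<Union>n::nat. {\<omega>\<in>space M. X \<omega> = of_nat n}) = 1"
    by (simp add: emeasure_eq_measure)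
  then have "AE \<omega> in M. \<omega> \<in> (\<Union>n::nat. {\<omega>\<in>space M. X \<omega> = of_nat n})"
    by (subst (asm) prob_eq_1) auto
  then show nat: "AE \<omega> in M. \<exists>n::nat. X \<omega> = of_nat n" by (rule AE_mp) (auto intro!: AE_I2)
  have "(\<integral>\<^sup>+\<omega>. X \<omega> \<partial>M) = (\<Sum>n::nat. of_nat n * ennreal (?p n))"
    using nn_integral_nat_valued[OF X nat, of "\<lambda>x. x"] by (simp add: em)
  also have "\<dots> = (\<Sum>n. ennreal (real n * ?p n))"
    using v by (intro suminf_cong) (simp add: ennreal_of_nat_eq_real_of_nat flip: ennreal_mult)
  also have "\<dots> = ennreal v" by (rule suminf_ennreal_eq[OF _ p1]) (use v in simp)
  finally show "(\<integral>\<^sup>+\<omega>. X \<omega> \<partial>M) = ennreal v" .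
  have "(\<integral>\<^sup>+\<omega>. (X \<omega>)\<^sup>2 \<partial>M) = (\<Sum>n::nat. (of_nat n)\<^sup>2 * ennreal (?p n))"
    using nn_integral_nat_valued[OF X nat, of "\<lambda>x. x\<^sup>2"] by (simp add: em)
  also have "\<dots> = (\<Sum>n. ennreal ((real n)\<^sup>2 * ?p n))"
    using v by (intro suminf_cong) (simp add: ennreal_of_nat_eq_real_of_nat ennreal_power flip: ennreal_mult)
  also have "\<dots> = ennreal (v + v\<^sup>2)" by (rule suminf_ennreal_eq[OF _ p2]) (use v in simp)
  finally show "(\<integral>\<^sup>+\<omega>. (X \<omega>)\<^sup>2 \<partial>M) = ennreal (v + v\<^sup>2)" .
qed

lemma indep_set_nn_integral:
  assumes ind: "indep_set (sigma_sets (space M) A) (sigma_sets (space M) B)"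
    and X: "X \<in> borel_measurable (sigma (space M) A)" "A \<subseteq> Pow (space M)"
    and Y: "Y \<in> borel_measurable (sigma (space M) B)" "B \<subseteq> Pow (space M)"
  shows "(\<integral>\<^sup>+\<omega>. X \<omega> * Y \<omega> \<partial>M) = (\<integral>\<^sup>+\<omega>. X \<omega> \<partial>M) * (\<integral>\<^sup>+\<omega>. Y \<omega> \<partial>M :: ennreal)"
proof -
  have sub: "sigma_sets (space M) A \<subseteq> events" "sigma_sets (space M) B \<subseteq> events"
    using ind by (auto simp: indep_sets2_eq)
  have Xs: "X -` S \<inter> space M \<in> sigma_sets (space M) A" if "S \<in> sets borel" for S
    using measurable_sets[OF X(1) that] X(2) by (simp add: sets_measure_of)
  have Ys: "Y -` S \<inter> space M \<in> sigma_sets (space M) B" if "S \<in> sets borel" for S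
    using measurable_sets[OF Y(1) that] Y(2) by (simp add: sets_measure_of)
  have rv: "X \<in> borel_measurable M" "Y \<in> borel_measurable M"
    using Xs Ys sub by (auto intro!: measurableI)
  have "sigma_sets (space M) {X -` S \<inter> space M |S. S \<in> sets borel} \<subseteq> sigma_sets (space M) A"
    by (rule sigma_sets_mono) (use Xs in blast)
  moreover have "sigma_sets (space M) {Y -` S \<inter> space M |S. S \<in> sets borel} \<subseteq> sigma_sets (space M) B"
    by (rule sigma_sets_mono) (use Ys in blast)
  ultimately have "indep_var borel X borel Y"
    unfolding indep_var_eq indep_sets2_eq
    using rv sub ind[unfolded indep_sets2_eq] by (meson order.trans subsetD)
  then have "indep_vars (\<lambda>_. borel) (case_bool X Y) UNIV"
    unfolding indep_var_def by (rule back_subst[where P="\<lambda>m. indep_vars m _ _"]) (auto split: bool.split)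
  from indep_vars_nn_integral[OF _ this] show ?thesis by (simp add: UNIV_bool mult.commute)
qed

end

definition past :: "real \<Rightarrow> (real \<times> real) set" where "past a = UNIV \<times> {..a}"
definition future :: "real \<Rightarrow> (real \<times> real) set" where "future a = UNIV \<times> {a<..}"

locale prm_family = prob_space M for M :: "'w measure" +
  fixes \<pi> :: "'k::finite \<Rightarrow> 'w \<Rightarrow> (real \<times> real) measure"
  assumes prm: "\<And>k. poisson_random_measure M lborel (\<pi> k)"
    and indep: "indep_random_measures M (lborel :: (real \<times> real) measure) \<pi>"
begin

abbreviation points :: "'k \<Rightarrow> (real \<times> real) set \<Rightarrow> 'w \<Rightarrow> ennreal" where
  "points k A \<omega> \<equiv> emeasure (\<pi> k \<omega>) A"

lemma sets_\<pi>: "\<omega> \<in> space M \<Longrightarrow> sets (\<pi> k \<omega>) = sets borel"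
  using prm[of k] by (simp add: poisson_random_measure_def)

lemma points_measurable: "A \<in> sets borel \<Longrightarrow> points k A \<in> borel_measurable M"
  using prm[of k] by (simp add: poisson_random_measure_def)

lemma points_law:
  "A \<in> sets borel \<Longrightarrow> emeasure lborel A < \<infinity> \<Longrightarrow>
    prob {\<omega>\<in>space M. points k A \<omega> = of_nat n} = measure lborel A ^ n / fact n * exp (- measure lborel A)"
  using prm[of k] by (simp add: poisson_random_measure_def)

lemma points_indep:
  "range A \<subseteq> sets borel \<Longrightarrow> disjoint_family (A :: nat \<Rightarrow> _) \<Longrightarrow> indep_vars (\<lambda>_. borel) (\<lambda>i. points k (A i)) UNIV"
  using prm[of k] by (simp add: poisson_random_measure_def)

lemma points_moments:
  assumes A: "A \<in> sets borel" "emeasure lborel A < \<infinity>"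
  shows "AE \<omega> in M. \<exists>n::nat. points k A \<omega> = of_nat n"
    and "(\<integral>\<^sup>+\<omega>. points k A \<omega> \<partial>M) = emeasure lborel A"
    and "(\<integral>\<^sup>+\<omega>. (points k A \<omega>)\<^sup>2 \<partial>M) = emeasure lborel A + (emeasure lborel A)\<^sup>2"
proof -
  note * = poisson_moments[OF points_measurable[OF A(1)] measure_nonneg points_law[OF A], of k]
  have eq: "emeasure lborel A = ennreal (measure lborel A)"
    by (rule emeasure_eq_ennreal_measure) (use A in auto)
  show "AE \<omega> in M. \<exists>n::nat. points k A \<omega> = of_nat n" by (rule *(1))
  show "(\<integral>\<^sup>+\<omega>. points k A \<omega> \<partial>M) = emeasure lborel A" unfolding eq by (rule *(2))
  show "(\<integral>\<^sup>+\<omega>. (points k A \<omega>)\<^sup>2 \<partial>M) = emeasure lborel A + (emeasure lborel A)\<^sup>2"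
    unfolding *(3) unfolding eq by (simp add: ennreal_plus ennreal_power)
qed

lemma points_indep_pair:
  assumes AB: "A \<in> sets borel" "B \<in> sets borel" "A \<inter> B = {}"
  shows "(\<integral>\<^sup>+\<omega>. points k A \<omega> * points k B \<omega> \<partial>M) = (\<integral>\<^sup>+\<omega>. points k A \<omega> \<partial>M) * (\<integral>\<^sup>+\<omega>. points k B \<omega> \<partial>M)"
proof -
  \<comment> \<open>Independence is given for sequences of disjoint sets, so the pair is padded with
    empty sets.\<close>
  define C where "C i = (if i = 0 then A else if i = 1 then B else {})" for i :: nat
  have "indep_vars (\<lambda>_. borel) (\<lambda>i. points k (C i)) UNIV"
    by (rule points_indep) (use AB in \<open>auto simp: C_def disjoint_family_on_def\<close>)
  then have "indep_vars (\<lambda>_. borel) (\<lambda>i. points k (C i)) {0, 1}"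
    by (rule indep_vars_subset) simp
  from indep_vars_nn_integral[OF _ this] show ?thesis by (simp add: C_def)
qed

text \<open>Split into \<open>D - D'\<close>, \<open>D' - D\<close> and
  \<open>D \<inter> D'\<close>, whose counts are uncorrelated. The variance of the common part is
  what exceeds the product of the means.\<close>

lemma points_covariance:
  assumes D: "D \<in> sets borel" "emeasure lborel D < \<infinity>" and D': "D' \<in> sets borel" "emeasure lborel D' < \<infinity>"
  shows "(\<integral>\<^sup>+\<omega>. points k D \<omega> * points k D' \<omega> \<partial>M) =
    emeasure lborel D * emeasure lborel D' + emeasure lborel (D \<inter> D')"
proof -
  define A where "A = D - D'" define B where "B = D' - D" define C where "C = D \<inter> D'"
  have un: "D = A \<union> C" "D' = B \<union> C" and dis: "A \<inter> C = {}" "B \<inter> C = {}" "A \<inter> B = {}" "C \<inter> A = {}"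
    by (auto simp: A_def B_def C_def)
  have m: "A \<in> sets borel" "B \<in> sets borel" "C \<in> sets borel" using D D' by (auto simp: A_def B_def C_def)
  have fin: "emeasure lborel A < \<infinity>" "emeasure lborel B < \<infinity>" "emeasure lborel C < \<infinity>"
    unfolding A_def B_def C_def
    using D D' by (auto intro: order.strict_trans1[OF emeasure_mono])
  note [measurable] = points_measurable[OF m(1)] points_measurable[OF m(2)] points_measurable[OF m(3)]
  have split: "emeasure N D = emeasure N A + emeasure N C" "emeasure N D' = emeasure N B + emeasure N C"
    if "sets N = sets borel" for N
    unfolding un using m dis that by (auto intro!: plus_emeasure[symmetric])
  have "(\<integral>\<^sup>+\<omega>. points k D \<omega> * points k D' \<omega> \<partial>M) =
      (\<integral>\<^sup>+\<omega>. (points k A \<omega> * points k B \<omega> + points k A \<omega> * points k C \<omega>) +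
        (points k B \<omega> * points k C \<omega> + (points k C \<omega>)\<^sup>2) \<partial>M)"
    by (rule nn_integral_cong)
      (simp add: split[OF sets_\<pi>] distrib_left distrib_right power2_eq_square ac_simps)
  also have "\<dots> = (emeasure lborel A * emeasure lborel B + emeasure lborel A * emeasure lborel C) +
      (emeasure lborel B * emeasure lborel C + (emeasure lborel C + (emeasure lborel C)\<^sup>2))"
    using m dis fin
    by (simp add: nn_integral_add points_indep_pair points_moments(2,3))
  also have "\<dots> = emeasure lborel D * emeasure lborel D' + emeasure lborel C"
    by (simp add: split distrib_left distrib_right power2_eq_square ac_simps)
  finally show ?thesis by (simp add: C_def)
qed

text \<open>Sets of one finite family lie in \<open>P\<close>, those of the other in the disjoint set \<open>Q\<close>. Decompose
  both families into the atoms they generate; the point counts of the atoms are independent.\<close>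

lemma finite_families_indep:
  assumes A: "finite \<A>" "\<A> \<subseteq> sets borel" "\<And>A. A \<in> \<A> \<Longrightarrow> A \<subseteq> P"
    and B: "finite \<B>" "\<B> \<subseteq> sets borel" "\<And>B. B \<in> \<B> \<Longrightarrow> B \<subseteq> Q"
    and PQ: "P \<inter> Q = {}" and b: "\<And>A. b A \<in> sets borel" "\<And>A. b' A \<in> sets borel"
  shows "prob {\<omega>\<in>space M. (\<forall>A\<in>\<A>. points k A \<omega> \<in> b A) \<and> (\<forall>B\<in>\<B>. points k B \<omega> \<in> b' B)} =
    prob {\<omega>\<in>space M. \<forall>A\<in>\<A>. points k A \<omega> \<in> b A} * prob {\<omega>\<in>space M. \<forall>B\<in>\<B>. points k B \<omega> \<in> b' B}"
proof -
  define S where "S = \<A> \<union> \<B>"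
  have S: "finite S" "S \<subseteq> sets borel" using A B by (auto simp: S_def)
  \<comment> \<open>Two points are in the same atom if they lie in the same members of
    \<open>S\<close>; atoms are thus indexed by subsets of \<open>S\<close>, numbered by
    \<open>e\<close> to form a sequence.\<close>
  define type where "type x = {A\<in>S. x \<in> A}" for x :: "real \<times> real"
  define atom where "atom R = {x. type x = R}" for R
  have "card (Pow S) = card {0..<card (Pow S)}" by simp
  obtain e :: "nat \<Rightarrow> (real \<times> real) set set" and c where e: "bij_betw e {0..<c} (Pow S)"
    using ex_bij_betw_nat_finite[of "Pow S"] S(1) by auto
  define D where "D i = (if i < c then atom (e i) else {})" for i
  have atom_meas: "atom R \<in> sets borel" if "R \<subseteq> S" for R
  proof -
    have "atom R = (\<Inter>A\<in>S. if A \<in> R then A else - A)"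
      using that by (auto simp: atom_def type_def split: if_splits)
    also have "\<dots> \<in> sets borel"
    proof (cases "S = {}")
      case False
      then show ?thesis by (rule sets.finite_INT[OF S(1)]) (use S(2) in \<open>auto intro: borel_comp\<close>)
    qed simp
    finally show ?thesis .
  qed
  have eS: "e i \<subseteq> S" if "i < c" for i using e that by (auto simp: bij_betw_def)
  have Dm: "D i \<in> sets borel" for i using atom_meas[OF eS] by (simp add: D_def)
  have e_inj: "i = j" if "i < c" "j < c" "e i = e j" for i j
    using e that by (auto simp: bij_betw_def inj_on_def)
  have dis: "disjoint_family D"
    unfolding disjoint_family_on_def
  proof (intro ballI impI)
    fix i j :: nat assume "i \<noteq> j"
    then show "D i \<inter> D j = {}" using e_inj[of i j] by (auto simp: D_def atom_def)
  qed
  have ex: "\<exists>i<c. x \<in> D i \<and> e i = type x" for x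
  proof -
    have "type x \<in> Pow S" by (auto simp: type_def)
    then obtain i where "i < c" "e i = type x" using e unfolding bij_betw_def by (metis atLeastLessThan_iff imageE)
    then show ?thesis by (intro exI[of _ i]) (auto simp: D_def atom_def)
  qed
  \<comment> \<open>\<open>K1\<close> numbers the atoms inside some member of \<open>\<A>\<close>,
    \<open>K2\<close> the others. As \<open>P\<close> and \<open>Q\<close> are disjoint, a member of
    \<open>\<B>\<close> is a union of atoms from \<open>K2\<close>, so the two families use disjoint
    blocks of independent counts.\<close>
  define K1 where "K1 = {i. i < c \<and> e i \<inter> \<A> \<noteq> {}}"
  define K2 where "K2 = {i. i < c \<and> e i \<inter> \<A> = {}}"
  have K: "finite K1" "finite K2" "K1 \<inter> K2 = {}" by (auto simp: K1_def K2_def)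
  have sum1: "points k A \<omega> = (\<Sum>i | i \<in> K1 \<and> A \<in> e i. points k (D i) \<omega>)" if "A \<in> \<A>" "\<omega> \<in> space M" for A \<omega>
  proof -
    have eq: "A = (\<Union>i\<in>{i. i \<in> K1 \<and> A \<in> e i}. D i)"
    proof (intro equalityI subsetI)
      fix x assume "x \<in> A"
      obtain i where "i < c" "x \<in> D i" "e i = type x" using ex by blast
      then show "x \<in> (\<Union>i\<in>{i. i \<in> K1 \<and> A \<in> e i}. D i)"
        using \<open>x \<in> A\<close> that(1) by (auto simp: K1_def type_def S_def)
    qed (auto simp: D_def atom_def type_def K1_def)
    have "D ` {i. i \<in> K1 \<and> A \<in> e i} \<subseteq> sets (\<pi> k \<omega>)"
      using Dm sets_\<pi>[OF that(2)] by auto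
    from sum_emeasure[OF this disjoint_family_on_mono[OF _ dis]] show ?thesis
      using K(1) eq by simp
  qed
  have sum2: "points k B \<omega> = (\<Sum>i | i \<in> K2 \<and> B \<in> e i. points k (D i) \<omega>)" if "B \<in> \<B>" "\<omega> \<in> space M" for B \<omega>
  proof -
    have eq: "B = (\<Union>i\<in>{i. i \<in> K2 \<and> B \<in> e i}. D i)"
    proof (intro equalityI subsetI)
      fix x assume x: "x \<in> B"
      obtain i where i: "i < c" "x \<in> D i" "e i = type x" using ex by blast
      have "type x \<inter> \<A> = {}" using x A(3) B(3)[OF that(1)] PQ by (auto simp: type_def)
      then show "x \<in> (\<Union>i\<in>{i. i \<in> K2 \<and> B \<in> e i}. D i)"
        using i x that(1) by (auto simp: K2_def type_def S_def)
    qed (auto simp: D_def atom_def type_def K2_def)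
    have "D ` {i. i \<in> K2 \<and> B \<in> e i} \<subseteq> sets (\<pi> k \<omega>)"
      using Dm sets_\<pi>[OF that(2)] by auto
    from sum_emeasure[OF this disjoint_family_on_mono[OF _ dis]] show ?thesis
      using K(2) eq by simp
  qed
  have "indep_vars (\<lambda>_. borel) (\<lambda>i. points k (D i)) UNIV"
    by (rule points_indep) (use Dm dis in auto)
  then have iv: "indep_var (PiM K1 (\<lambda>_. borel)) (\<lambda>\<omega>. restrict (\<lambda>i. points k (D i) \<omega>) K1)
      (PiM K2 (\<lambda>_. borel)) (\<lambda>\<omega>. restrict (\<lambda>i. points k (D i) \<omega>) K2)"
    by (rule indep_var_restrict) (use K in auto)
  define U where "U = {f \<in> space (PiM K1 (\<lambda>_. borel :: ennreal measure)). \<forall>A\<in>\<A>. (\<Sum>i | i \<in> K1 \<and> A \<in> e i. f i) \<in> b A}"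
  define V where "V = {f \<in> space (PiM K2 (\<lambda>_. borel :: ennreal measure)). \<forall>B\<in>\<B>. (\<Sum>i | i \<in> K2 \<and> B \<in> e i. f i) \<in> b' B}"
  have Um: "U \<in> sets (PiM K1 (\<lambda>_. borel))"
    unfolding U_def
  proof (rule sets.sets_Collect_finite_All)
    fix A :: "(real \<times> real) set"
    have "(\<lambda>f. \<Sum>i | i \<in> K1 \<and> A \<in> e i. f i) \<in> borel_measurable (PiM K1 (\<lambda>_. borel :: ennreal measure))"
      by (auto intro!: borel_measurable_sum measurable_component_singleton)
    from measurable_sets[OF this b(1)[of A]]
    show "{f \<in> space (PiM K1 (\<lambda>_. borel :: ennreal measure)). (\<Sum>i | i \<in> K1 \<and> A \<in> e i. f i) \<in> b A} \<in>
        sets (PiM K1 (\<lambda>_. borel))"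
      by (simp add: vimage_def Int_def conj_commute)
  qed (rule A(1))
  have Vm: "V \<in> sets (PiM K2 (\<lambda>_. borel))"
    unfolding V_def
  proof (rule sets.sets_Collect_finite_All)
    fix A :: "(real \<times> real) set"
    have "(\<lambda>f. \<Sum>i | i \<in> K2 \<and> A \<in> e i. f i) \<in> borel_measurable (PiM K2 (\<lambda>_. borel :: ennreal measure))"
      by (auto intro!: borel_measurable_sum measurable_component_singleton)
    from measurable_sets[OF this b(2)[of A]]
    show "{f \<in> space (PiM K2 (\<lambda>_. borel :: ennreal measure)). (\<Sum>i | i \<in> K2 \<and> A \<in> e i. f i) \<in> b' A} \<in>
        sets (PiM K2 (\<lambda>_. borel))"
      by (simp add: vimage_def Int_def conj_commute)
  qed (rule B(1))
  have preU: "restrict (\<lambda>i. points k (D i) \<omega>) K1 \<in> U \<longleftrightarrow> (\<forall>A\<in>\<A>. points k A \<omega> \<in> b A)" if "\<omega> \<in> space M" for \<omega>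
    using sum1[OF _ that] by (auto simp: U_def space_PiM)
  have preV: "restrict (\<lambda>i. points k (D i) \<omega>) K2 \<in> V \<longleftrightarrow> (\<forall>B\<in>\<B>. points k B \<omega> \<in> b' B)" if "\<omega> \<in> space M" for \<omega>
    using sum2[OF _ that] by (auto simp: V_def space_PiM)
  have 1: "(\<lambda>\<omega>. (restrict (\<lambda>i. points k (D i) \<omega>) K1, restrict (\<lambda>i. points k (D i) \<omega>) K2)) -` (U \<times> V) \<inter> space M =
      {\<omega>\<in>space M. (\<forall>A\<in>\<A>. points k A \<omega> \<in> b A) \<and> (\<forall>B\<in>\<B>. points k B \<omega> \<in> b' B)}"
    using preU preV by auto
  have 2: "(\<lambda>\<omega>. restrict (\<lambda>i. points k (D i) \<omega>) K1) -` U \<inter> space M = {\<omega>\<in>space M. \<forall>A\<in>\<A>. points k A \<omega> \<in> b A}"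
    using preU by auto
  have 3: "(\<lambda>\<omega>. restrict (\<lambda>i. points k (D i) \<omega>) K2) -` V \<inter> space M = {\<omega>\<in>space M. \<forall>B\<in>\<B>. points k B \<omega> \<in> b' B}"
    using preV by auto
  show ?thesis using indep_varD[OF iv Um Vm] unfolding 1 2 3 .
qed

end

section \<open>Filtration of the driving measures and independence of past and future\<close>

context prm_family
begin

definition cylinder :: "('k \<Rightarrow> (real \<times> real) set set) \<Rightarrow> ('k \<Rightarrow> (real \<times> real) set \<Rightarrow> ennreal set) \<Rightarrow> 'w set" where
  "cylinder \<A> b = {\<omega>\<in>space M. \<forall>k. \<forall>A\<in>\<A> k. points k A \<omega> \<in> b k A}"

lemma cylinder_events:
  assumes "\<And>k. finite (\<A> k)" "\<And>k. \<A> k \<subseteq> sets borel" "\<And>k A. b k A \<in> sets borel"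
  shows "{\<omega>\<in>space M. \<forall>A\<in>\<A> k. points k A \<omega> \<in> b k A} \<in> events" and "cylinder \<A> b \<in> events"
proof -
  have 1: "{\<omega>\<in>space M. points k A \<omega> \<in> b k A} \<in> events" if "A \<in> \<A> k" for k A
  proof -
    have "points k A -` b k A \<inter> space M \<in> events"
      by (rule measurable_sets[OF points_measurable assms(3)]) (use that assms(2) in auto)
    then show ?thesis by (simp add: vimage_def Int_def conj_commute)
  qed
  show 2: "{\<omega>\<in>space M. \<forall>A\<in>\<A> k. points k A \<omega> \<in> b k A} \<in> events" for k
    by (rule sets.sets_Collect_finite_All[OF 1 assms(1)])
  have "{\<omega>\<in>space M. \<forall>k\<in>UNIV. \<forall>A\<in>\<A> k. points k A \<omega> \<in> b k A} \<in> events"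
    by (rule sets.sets_Collect_finite_All[OF 2]) simp
  then show "cylinder \<A> b \<in> events" by (simp add: cylinder_def)
qed

text \<open>Carrying two families through one application of independence over \<open>k\<close>
  serves the joint event and, with one family empty, each of the marginal events.\<close>

lemma joint_prob:
  assumes fin: "\<And>k. finite (\<A> k)" "\<And>k. finite (\<B> k)"
    and sub: "\<And>k. \<A> k \<subseteq> sets borel" "\<And>k. \<B> k \<subseteq> sets borel"
    and b: "\<And>k A. b k A \<in> sets borel" "\<And>k A. b' k A \<in> sets borel"
  shows "prob {\<omega>\<in>space M. \<forall>k. (\<forall>A\<in>\<A> k. points k A \<omega> \<in> b k A) \<and> (\<forall>B\<in>\<B> k. points k B \<omega> \<in> b' k B)} =
    (\<Prod>k\<in>UNIV. prob {\<omega>\<in>space M. (\<forall>A\<in>\<A> k. points k A \<omega> \<in> b k A) \<and> (\<forall>B\<in>\<B> k. points k B \<omega> \<in> b' k B)})"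
proof -
  let ?P = "PiM (sets borel) (\<lambda>_. borel) :: ((real \<times> real) set \<Rightarrow> ennreal) measure"
  let ?X = "\<lambda>k \<omega>. \<lambda>A\<in>sets borel. points k A \<omega>"
  have iv: "indep_vars (\<lambda>_. ?P) ?X UNIV"
    using indep by (simp add: indep_random_measures_def)
  define C where "C k = {f\<in>space ?P. (\<forall>A\<in>\<A> k. f A \<in> b k A) \<and> (\<forall>B\<in>\<B> k. f B \<in> b' k B)}" for k
  have 1: "{f\<in>space ?P. f A \<in> U} \<in> sets ?P" if "A \<in> sets borel" "U \<in> sets borel" for A U
    using measurable_sets[OF measurable_component_singleton[OF that(1), of "\<lambda>_. borel"] that(2)]
    by (simp add: vimage_def Int_def conj_commute)
  have C: "C k \<in> sets ?P" for k
    unfolding C_def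
  proof (rule sets.sets_Collect_conj)
    show "{f\<in>space ?P. \<forall>A\<in>\<A> k. f A \<in> b k A} \<in> sets ?P"
      by (rule sets.sets_Collect_finite_All[OF 1 fin(1)]) (use sub b in auto)
    show "{f\<in>space ?P. \<forall>A\<in>\<B> k. f A \<in> b' k A} \<in> sets ?P"
      by (rule sets.sets_Collect_finite_All[OF 1 fin(2)]) (use sub b in auto)
  qed
  have pre: "?X k -` C k \<inter> space M =
      {\<omega>\<in>space M. (\<forall>A\<in>\<A> k. points k A \<omega> \<in> b k A) \<and> (\<forall>B\<in>\<B> k. points k B \<omega> \<in> b' k B)}" for k
  proof -
    have "restrict (\<lambda>A. points k A \<omega>) (sets borel) \<in> space ?P" for \<omega> by (auto simp: space_PiM)
    then show ?thesis using sub(1)[of k] sub(2)[of k] by (auto simp: C_def subset_eq)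
  qed
  have "prob (\<Inter>k\<in>UNIV. ?X k -` C k \<inter> space M) = (\<Prod>k\<in>UNIV. prob (?X k -` C k \<inter> space M))"
    by (rule indep_varsD_finite[OF iv]) (use C in auto)
  moreover have "(\<Inter>k\<in>UNIV. ?X k -` C k \<inter> space M) =
      {\<omega>\<in>space M. \<forall>k. (\<forall>A\<in>\<A> k. points k A \<omega> \<in> b k A) \<and> (\<forall>B\<in>\<B> k. points k B \<omega> \<in> b' k B)}"
    unfolding pre by blast
  ultimately show ?thesis unfolding pre by simp
qed

definition future_gen :: "real \<Rightarrow> 'w set set" where
  "future_gen a = {cylinder \<A> b | \<A> b. (\<forall>k. finite (\<A> k) \<and> \<A> k \<subseteq> {A \<in> sets borel. A \<subseteq> future a}) \<and>
     (\<forall>k A. b k A \<in> sets borel)}"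

text \<open>Including the events of probability one puts the almost sure finiteness of the point
  counts into every \<open>\<sigma>\<close>-algebra of the filtration, at no cost for independence.\<close>

definition past_gen :: "real \<Rightarrow> 'w set set" where
  "past_gen a = {cylinder \<A> b \<inter> Z | \<A> b Z. (\<forall>k. finite (\<A> k) \<and> \<A> k \<subseteq> {A \<in> sets borel. A \<subseteq> past a}) \<and>
     (\<forall>k A. b k A \<in> sets borel) \<and> Z \<in> events \<and> prob Z = 1}"

lemma cylinder_Int:
  "cylinder \<A> b \<inter> cylinder \<B> b' = cylinder (\<lambda>k. \<A> k \<union> \<B> k)
    (\<lambda>k A. {x. (A \<in> \<A> k \<longrightarrow> x \<in> b k A) \<and> (A \<in> \<B> k \<longrightarrow> x \<in> b' k A)})"
  unfolding cylinder_def by blast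

lemma past_gen_events: "past_gen a \<subseteq> events"
proof
  fix E assume "E \<in> past_gen a"
  then obtain \<A> b Z where "E = cylinder \<A> b \<inter> Z" "\<forall>k. finite (\<A> k) \<and> \<A> k \<subseteq> {A \<in> sets borel. A \<subseteq> past a}"
    "\<forall>k A. b k A \<in> sets borel" "Z \<in> events"
    unfolding past_gen_def by blast
  then show "E \<in> events" using cylinder_events(2)[of \<A> b] by (auto simp: subset_eq)
qed

lemma future_gen_events: "future_gen a \<subseteq> events"
proof
  fix E assume "E \<in> future_gen a"
  then obtain \<A> b where "E = cylinder \<A> b" "\<forall>k. finite (\<A> k) \<and> \<A> k \<subseteq> {A \<in> sets borel. A \<subseteq> future a}"
    "\<forall>k A. b k A \<in> sets borel"
    unfolding future_gen_def by blast
  then show "E \<in> events" using cylinder_events(2)[of \<A> b] by (auto simp: subset_eq)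
qed

lemma Int_stable_past_gen: "Int_stable (past_gen a)"
  unfolding Int_stable_def
proof (intro ballI)
  fix E E' assume "E \<in> past_gen a" "E' \<in> past_gen a"
  then obtain \<A> b Z \<A>' b' Z' where E: "E = cylinder \<A> b \<inter> Z" "E' = cylinder \<A>' b' \<inter> Z'"
    and A: "\<forall>k. finite (\<A> k) \<and> \<A> k \<subseteq> {A \<in> sets borel. A \<subseteq> past a}" "\<forall>k A. b k A \<in> sets borel"
    and A': "\<forall>k. finite (\<A>' k) \<and> \<A>' k \<subseteq> {A \<in> sets borel. A \<subseteq> past a}" "\<forall>k A. b' k A \<in> sets borel"
    and Z: "Z \<in> events" "prob Z = 1" "Z' \<in> events" "prob Z' = 1"
    unfolding past_gen_def by blast
  have eq: "E \<inter> E' = (cylinder \<A> b \<inter> cylinder \<A>' b') \<inter> (Z \<inter> Z')" unfolding E by blast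
  have "AE \<omega> in M. \<omega> \<in> Z" "AE \<omega> in M. \<omega> \<in> Z'" using Z by (simp_all add: prob_eq_1)
  then have "AE \<omega> in M. \<omega> \<in> Z \<inter> Z'" by eventually_elim simp
  then have ZZ: "prob (Z \<inter> Z') = 1" using Z by (simp add: prob_eq_1)
  show "E \<inter> E' \<in> past_gen a"
    unfolding past_gen_def eq cylinder_Int
  proof (intro CollectI exI[of _ "\<lambda>k. \<A> k \<union> \<A>' k"]
      exI[of _ "\<lambda>k A. {x. (A \<in> \<A> k \<longrightarrow> x \<in> b k A) \<and> (A \<in> \<A>' k \<longrightarrow> x \<in> b' k A)}"]
      exI[of _ "Z \<inter> Z'"] conjI allI)
    fix k
    show "finite (\<A> k \<union> \<A>' k)" "\<A> k \<union> \<A>' k \<subseteq> {A \<in> sets borel. A \<subseteq> past a}"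
      using A(1) A'(1) by blast+
    show "{x. (B \<in> \<A> k \<longrightarrow> x \<in> b k B) \<and> (B \<in> \<A>' k \<longrightarrow> x \<in> b' k B)} \<in> sets borel" for B
      using A(2) A'(2) by (cases "B \<in> \<A> k"; cases "B \<in> \<A>' k") (auto simp flip: Int_def)
  qed (use Z ZZ in auto)
qed

lemma Int_stable_future_gen: "Int_stable (future_gen a)"
  unfolding Int_stable_def
proof (intro ballI)
  fix E E' assume "E \<in> future_gen a" "E' \<in> future_gen a"
  then obtain \<A> b \<A>' b' where E: "E = cylinder \<A> b" "E' = cylinder \<A>' b'"
    and A: "\<forall>k. finite (\<A> k) \<and> \<A> k \<subseteq> {A \<in> sets borel. A \<subseteq> future a}" "\<forall>k A. b k A \<in> sets borel"
    and A': "\<forall>k. finite (\<A>' k) \<and> \<A>' k \<subseteq> {A \<in> sets borel. A \<subseteq> future a}" "\<forall>k A. b' k A \<in> sets borel"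
    unfolding future_gen_def by blast
  show "E \<inter> E' \<in> future_gen a"
    unfolding E future_gen_def cylinder_Int
  proof (intro CollectI exI[of _ "\<lambda>k. \<A> k \<union> \<A>' k"]
      exI[of _ "\<lambda>k A. {x. (A \<in> \<A> k \<longrightarrow> x \<in> b k A) \<and> (A \<in> \<A>' k \<longrightarrow> x \<in> b' k A)}"]
      conjI allI)
    fix k
    show "finite (\<A> k \<union> \<A>' k)" "\<A> k \<union> \<A>' k \<subseteq> {A \<in> sets borel. A \<subseteq> future a}"
      using A(1) A'(1) by blast+
    show "{x. (B \<in> \<A> k \<longrightarrow> x \<in> b k B) \<and> (B \<in> \<A>' k \<longrightarrow> x \<in> b' k B)} \<in> sets borel" for B
      using A(2) A'(2) by (cases "B \<in> \<A> k"; cases "B \<in> \<A>' k") (auto simp flip: Int_def)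
  qed (rule refl)
qed

text \<open>On cylinders the probability factorises over \<open>k\<close> because the
  \<open>\<pi> k\<close> are independent, and for each \<open>k\<close> between past and future by
  \<open>finite_families_indep\<close>; it remains to regroup the product. Both generators are
  stable under intersection, so the generated \<sigma>-algebras inherit independence.\<close>

lemma past_future_indep:
  "indep_set (sigma_sets (space M) (past_gen a)) (sigma_sets (space M) (future_gen a))"
proof (rule indep_set_sigma_sets[OF _ Int_stable_past_gen Int_stable_future_gen])
  show "indep_set (past_gen a) (future_gen a)"
    unfolding indep_sets2_eq
  proof (intro conjI ballI past_gen_events future_gen_events)
    fix G H assume "G \<in> past_gen a" "H \<in> future_gen a"
    from \<open>G \<in> past_gen a\<close> obtain \<A> b Z where G: "G = cylinder \<A> b \<inter> Z"
      and A': "\<forall>k. finite (\<A> k) \<and> \<A> k \<subseteq> {A \<in> sets borel. A \<subseteq> past a}" "\<forall>k A. b k A \<in> sets borel"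
      and Z: "Z \<in> events" "prob Z = 1"
      unfolding past_gen_def by blast
    from \<open>H \<in> future_gen a\<close> obtain \<B> b' where H: "H = cylinder \<B> b'"
      and B': "\<forall>k. finite (\<B> k) \<and> \<B> k \<subseteq> {A \<in> sets borel. A \<subseteq> future a}" "\<forall>k A. b' k A \<in> sets borel"
      unfolding future_gen_def by blast
    have A: "finite (\<A> k)" "\<A> k \<subseteq> {A \<in> sets borel. A \<subseteq> past a}" "b k A \<in> sets borel" for k A
      using A' by simp_all
    have B: "finite (\<B> k)" "\<B> k \<subseteq> {A \<in> sets borel. A \<subseteq> future a}" "b' k A \<in> sets borel" for k A
      using B' by simp_all
    have sub: "\<A> k \<subseteq> sets borel" "\<B> k \<subseteq> sets borel" for k using A(2) B(2) by blast+
    have ev: "cylinder \<A> b \<in> events" "cylinder \<B> b' \<in> events"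
      using cylinder_events(2) A(1,3) B(1,3) sub by auto
    have AEZ: "AE \<omega> in M. \<omega> \<in> Z" using Z by (simp add: prob_eq_1)
    have "prob (G \<inter> H) = prob (cylinder \<A> b \<inter> cylinder \<B> b')"
      unfolding G H by (rule finite_measure_eq_AE) (use AEZ ev Z in auto)
    also have "cylinder \<A> b \<inter> cylinder \<B> b' =
        {\<omega>\<in>space M. \<forall>k. (\<forall>A\<in>\<A> k. points k A \<omega> \<in> b k A) \<and> (\<forall>B\<in>\<B> k. points k B \<omega> \<in> b' k B)}"
      unfolding cylinder_def by blast
    also have "prob \<dots> = (\<Prod>k\<in>UNIV. prob {\<omega>\<in>space M. (\<forall>A\<in>\<A> k. points k A \<omega> \<in> b k A) \<and> (\<forall>B\<in>\<B> k. points k B \<omega> \<in> b' k B)})"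
      by (rule joint_prob) (use A B sub in auto)
    also have "\<dots> = (\<Prod>k\<in>UNIV. prob {\<omega>\<in>space M. \<forall>A\<in>\<A> k. points k A \<omega> \<in> b k A} *
        prob {\<omega>\<in>space M. \<forall>B\<in>\<B> k. points k B \<omega> \<in> b' k B})"
    proof (intro prod.cong refl finite_families_indep[where P="past a" and Q="future a"])
      show "A' \<subseteq> past a" if "A' \<in> \<A> k" for k A' using A(2)[of k] that by blast
      show "B' \<subseteq> future a" if "B' \<in> \<B> k" for k B' using B(2)[of k] that by blast
      show "past a \<inter> future a = {}" by (auto simp: past_def future_def)
    qed (rule A B sub)+
    also have "\<dots> = (\<Prod>k\<in>UNIV. prob {\<omega>\<in>space M. \<forall>A\<in>\<A> k. points k A \<omega> \<in> b k A}) *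
        (\<Prod>k\<in>UNIV. prob {\<omega>\<in>space M. \<forall>B\<in>\<B> k. points k B \<omega> \<in> b' k B})"
      by (rule prod.distrib)
    also have "(\<Prod>k\<in>UNIV. prob {\<omega>\<in>space M. \<forall>A\<in>\<A> k. points k A \<omega> \<in> b k A}) = prob (cylinder \<A> b)"
      using joint_prob[of \<A> "\<lambda>_. {}" b b'] A B sub by (simp add: cylinder_def)
    also have "(\<Prod>k\<in>UNIV. prob {\<omega>\<in>space M. \<forall>B\<in>\<B> k. points k B \<omega> \<in> b' k B}) = prob H"
      using joint_prob[of \<B> "\<lambda>_. {}" b' b] A B sub by (simp add: cylinder_def H)
    also have "prob (cylinder \<A> b) = prob G"
      unfolding G by (rule finite_measure_eq_AE) (use AEZ ev Z in auto)
    finally show "prob (G \<inter> H) = prob G * prob H" .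
  qed
qed

definition filt :: "real \<Rightarrow> 'w measure" where
  "filt a = sigma (space M) (past_gen a)"

lemma space_filt: "space (filt a) = space M"
  unfolding filt_def using past_gen_events sets.space_closed by (intro space_measure_of) blast

lemma sets_filt: "sets (filt a) = sigma_sets (space M) (past_gen a)"
  unfolding filt_def using past_gen_events sets.space_closed by (intro sets_measure_of) blast

lemma filt_events: "sets (filt a) \<subseteq> events"
  unfolding sets_filt by (rule sets.sigma_sets_subset[OF past_gen_events])

lemma filt_mono: "a \<le> c \<Longrightarrow> sets (filt a) \<subseteq> sets (filt c)"
  unfolding sets_filt
proof (rule sigma_sets_mono')
  assume "a \<le> c"
  then have "past a \<subseteq> past c" by (auto simp: past_def)
  then have sub: "{A \<in> sets borel. A \<subseteq> past a} \<subseteq> {A \<in> sets borel. A \<subseteq> past c}" by blast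
  show "past_gen a \<subseteq> past_gen c"
  proof
    fix E assume "E \<in> past_gen a"
    then obtain \<A> b Z where E: "E = cylinder \<A> b \<inter> Z"
      and A: "\<forall>k. finite (\<A> k) \<and> \<A> k \<subseteq> {A \<in> sets borel. A \<subseteq> past a}" "\<forall>k A. b k A \<in> sets borel"
      and Z: "Z \<in> events" "prob Z = 1"
      unfolding past_gen_def by blast
    show "E \<in> past_gen c"
      unfolding past_gen_def
    proof (intro CollectI exI[of _ \<A>] exI[of _ b] exI[of _ Z] conjI allI)
      show "\<A> k \<subseteq> {A \<in> sets borel. A \<subseteq> past c}" for k using A(1) sub by (meson order.trans)
    qed (use E A Z in auto)
  qed
qed

lemma almost_sure_filt:
  assumes Z: "Z \<in> events" "prob Z = 1"
  shows "Z \<in> sets (filt a)"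
proof -
  have "Z = cylinder (\<lambda>_. {}) (\<lambda>_ _. {}) \<inter> Z"
    using sets.sets_into_space[OF Z(1)] by (auto simp: cylinder_def)
  then have "Z \<in> past_gen a"
    unfolding past_gen_def using Z by (intro CollectI exI[of _ "\<lambda>_. {}"] exI[of _ "\<lambda>_ _. {}"] exI[of _ Z]) auto
  then show ?thesis unfolding sets_filt by (rule sigma_sets.Basic)
qed

lemma points_filt:
  assumes A: "A \<in> sets borel" "A \<subseteq> past a"
  shows "points k A \<in> borel_measurable (filt a)"
proof (rule measurableI)
  fix S :: "ennreal set" assume S: "S \<in> sets borel"
  have "points k A -` S \<inter> space (filt a) = cylinder (\<lambda>l. if l = k then {A} else {}) (\<lambda>_ _. S) \<inter> space M"
    by (auto simp: cylinder_def space_filt)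
  moreover have "\<dots> \<in> past_gen a"
    unfolding past_gen_def using A S prob_space
    by (intro CollectI exI[of _ "\<lambda>l. if l = k then {A} else {}"] exI[of _ "\<lambda>_ _. S"] exI[of _ "space M"]) auto
  ultimately show "points k A -` S \<inter> space (filt a) \<in> sets (filt a)"
    unfolding sets_filt by (simp add: sigma_sets.Basic)
qed simp

lemma points_future:
  assumes A: "A \<in> sets borel" "A \<subseteq> future a"
  shows "points k A \<in> borel_measurable (sigma (space M) (future_gen a))"
proof (rule measurableI)
  have sub: "future_gen a \<subseteq> Pow (space M)" using future_gen_events sets.space_closed by blast
  fix S :: "ennreal set" assume S: "S \<in> sets borel"
  have "points k A -` S \<inter> space M = cylinder (\<lambda>l. if l = k then {A} else {}) (\<lambda>_ _. S)"
    by (auto simp: cylinder_def)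
  moreover have "\<dots> \<in> future_gen a"
    unfolding future_gen_def using A S
    by (intro CollectI exI[of _ "\<lambda>l. if l = k then {A} else {}"] exI[of _ "\<lambda>_ _. S"]) auto
  ultimately show "points k A -` S \<inter> space (sigma (space M) (future_gen a)) \<in> sets (sigma (space M) (future_gen a))"
    using sub by (simp add: sigma_sets.Basic space_measure_of sets_measure_of)
qed simp

lemma past_future_nn_integral:
  assumes Y: "Y \<in> borel_measurable (filt a)" and W: "W \<in> borel_measurable (sigma (space M) (future_gen a))"
  shows "(\<integral>\<^sup>+\<omega>. Y \<omega> * W \<omega> \<partial>M) = (\<integral>\<^sup>+\<omega>. Y \<omega> \<partial>M) * (\<integral>\<^sup>+\<omega>. W \<omega> \<partial>M :: ennreal)"
proof (rule indep_set_nn_integral[OF past_future_indep Y[unfolded filt_def] _ W])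
  show "past_gen a \<subseteq> Pow (space M)" "future_gen a \<subseteq> Pow (space M)"
    using past_gen_events[of a] future_gen_events[of a] sets.space_closed[of M] by blast+
qed

definition finite_points :: "'w set" where
  "finite_points = {\<omega>\<in>space M. \<forall>k n. points k (cube n) \<omega> < \<infinity>}"

text \<open>A Poisson random measure may be infinite on bounded sets on a null event, whereas
  \<open>adapted_kernel\<close> asks for finiteness at every outcome. Adaptedness survives the
  change because \<open>finite_points\<close> has probability one and so belongs to every
  \<open>filt a\<close>.\<close>

definition finite_\<pi> :: "'k \<Rightarrow> 'w \<Rightarrow> (real \<times> real) measure" where
  "finite_\<pi> k \<omega> = (if \<omega> \<in> finite_points then \<pi> k \<omega> else null_measure borel)"

lemma finite_points_events: "finite_points \<in> events"
proof -
  have 1: "{\<omega>\<in>space M. points k (cube n) \<omega> < \<infinity>} \<in> events" for k n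
    using points_measurable[OF cube_sets, of k n] by measurable
  have "{\<omega>\<in>space M. \<forall>k\<in>UNIV. \<forall>n. points k (cube n) \<omega> < \<infinity>} \<in> events"
    by (rule sets.sets_Collect_finite_All[OF sets.sets_Collect_countable_All[OF 1]]) simp
  then show ?thesis by (simp add: finite_points_def)
qed

lemma AE_finite_points: "AE \<omega> in M. \<omega> \<in> finite_points"
proof -
  have "AE \<omega> in M. points k (cube n) \<omega> < \<infinity>" for k n
  proof -
    have fin: "emeasure lborel (cube n) < \<infinity>" by (rule emeasure_bounded_finite) simp
    have "(\<integral>\<^sup>+\<omega>. points k (cube n) \<omega> \<partial>M) \<noteq> \<infinity>"
      unfolding points_moments(2)[OF cube_sets fin] using fin by (rule less_imp_neq)
    then have "AE \<omega> in M. points k (cube n) \<omega> \<noteq> \<infinity>"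
      by (rule nn_integral_PInf_AE[OF points_measurable[OF cube_sets]])
    then show ?thesis by (simp add: less_top)
  qed
  then have "AE \<omega> in M. \<forall>k n. points k (cube n) \<omega> < \<infinity>"
    by (simp add: AE_all_countable eventually_all_finite)
  then show ?thesis unfolding finite_points_def by (auto intro: AE_mp AE_I2)
qed

lemma prob_finite_points: "prob finite_points = 1"
  using AE_finite_points finite_points_events by (simp add: prob_eq_1)

lemma emeasure_finite_\<pi>: "emeasure (finite_\<pi> k \<omega>) A = points k A \<omega> * indicator finite_points \<omega>"
  by (simp add: finite_\<pi>_def split: split_indicator)

lemma AE_finite_\<pi>: "AE \<omega> in M. emeasure (finite_\<pi> k \<omega>) A = points k A \<omega>"
  using AE_finite_points by (rule AE_mp) (auto intro!: AE_I2 simp: finite_\<pi>_def)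

theorem adapted_kernel_finite_\<pi>: "adapted_kernel M finite_\<pi> filt"
proof unfold_locales
  fix a c :: real and k n \<omega> and A D D' :: "(real \<times> real) set" and Y :: "'w \<Rightarrow> ennreal"
  show "sets (finite_\<pi> k \<omega>) = sets borel" if "\<omega> \<in> space M"
    using sets_\<pi>[OF that] by (simp add: finite_\<pi>_def)
  show "emeasure (finite_\<pi> k \<omega>) (cube n) < \<infinity>"
    by (auto simp: emeasure_finite_\<pi> finite_points_def split: split_indicator)
  show "(\<lambda>\<omega>. emeasure (finite_\<pi> k \<omega>) A) \<in> borel_measurable M" if "A \<in> sets borel"
    unfolding emeasure_finite_\<pi> using points_measurable[OF that] finite_points_events by measurable
  show "space (filt a) = space M" by (rule space_filt)
  show "sets (filt a) \<subseteq> events" by (rule filt_events)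
  show "sets (filt a) \<subseteq> sets (filt c)" if "a \<le> c" by (rule filt_mono[OF that])
  show "(\<lambda>\<omega>. emeasure (finite_\<pi> k \<omega>) A) \<in> borel_measurable (filt a)" if "A \<in> sets borel" "A \<subseteq> UNIV \<times> {..a}"
  proof -
    have "points k A \<in> borel_measurable (filt a)" using points_filt that by (simp add: past_def)
    moreover have "finite_points \<in> sets (filt a)"
      by (rule almost_sure_filt[OF finite_points_events prob_finite_points])
    ultimately show ?thesis unfolding emeasure_finite_\<pi> by measurable
  qed
  assume Y: "Y \<in> borel_measurable (filt a)" and D: "D \<in> sets borel" "bounded D" "D \<subseteq> UNIV \<times> {a<..}"
  have fin: "emeasure lborel D < \<infinity>" using emeasure_bounded_finite[OF D(2)] .
  have D_fut: "points k D \<in> borel_measurable (sigma (space M) (future_gen a))"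
    by (rule points_future) (use D in \<open>auto simp: future_def\<close>)
  have "(\<integral>\<^sup>+\<omega>. Y \<omega> * emeasure (finite_\<pi> k \<omega>) D \<partial>M) = (\<integral>\<^sup>+\<omega>. Y \<omega> * points k D \<omega> \<partial>M)"
    using AE_finite_\<pi>[of k D] by (intro nn_integral_cong_AE) auto
  also have "\<dots> = (\<integral>\<^sup>+\<omega>. Y \<omega> \<partial>M) * emeasure lborel D"
    unfolding past_future_nn_integral[OF Y D_fut] points_moments(2)[OF D(1) fin] ..
  finally show "(\<integral>\<^sup>+\<omega>. Y \<omega> * emeasure (finite_\<pi> k \<omega>) D \<partial>M) = (\<integral>\<^sup>+\<omega>. Y \<omega> \<partial>M) * emeasure lborel D" .
  assume D': "D' \<in> sets borel" "bounded D'" "D' \<subseteq> UNIV \<times> {a<..}"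
  have fin': "emeasure lborel D' < \<infinity>" using emeasure_bounded_finite[OF D'(2)] .
  have D'_fut: "points k D' \<in> borel_measurable (sigma (space M) (future_gen a))"
    by (rule points_future) (use D' in \<open>auto simp: future_def\<close>)
  have "(\<integral>\<^sup>+\<omega>. Y \<omega> * (emeasure (finite_\<pi> k \<omega>) D * emeasure (finite_\<pi> k \<omega>) D') \<partial>M) =
      (\<integral>\<^sup>+\<omega>. Y \<omega> * (points k D \<omega> * points k D' \<omega>) \<partial>M)"
    using AE_finite_\<pi>[of k D] AE_finite_\<pi>[of k D'] by (intro nn_integral_cong_AE) auto
  also have "\<dots> = (\<integral>\<^sup>+\<omega>. Y \<omega> \<partial>M) * (emeasure lborel D * emeasure lborel D' + emeasure lborel (D \<inter> D'))"
    unfolding past_future_nn_integral[OF Y borel_measurable_times_ennreal[OF D_fut D'_fut]]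
      points_covariance[OF D(1) fin D'(1) fin'] ..
  finally show "(\<integral>\<^sup>+\<omega>. Y \<omega> * (emeasure (finite_\<pi> k \<omega>) D * emeasure (finite_\<pi> k \<omega>) D') \<partial>M) =
      (\<integral>\<^sup>+\<omega>. Y \<omega> \<partial>M) * (emeasure lborel D * emeasure lborel D' + emeasure lborel (D \<inter> D'))" .
qed

end

section \<open>Thinning by a predictable intensity\<close>

lemma nn_integral_shift:
  fixes f :: "real \<Rightarrow> ennreal"
  assumes f: "f \<in> borel_measurable borel"
  shows "(\<integral>\<^sup>+t. f (t - s) \<partial>lborel) = (\<integral>\<^sup>+t. f t \<partial>lborel)"
    and "(\<integral>\<^sup>+s. f (t - s) \<partial>lborel) = (\<integral>\<^sup>+t. f t \<partial>lborel)"
  using nn_integral_real_affine[OF f, of 1 "- s"] nn_integral_real_affine[OF f, of "-1" t]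
  by (simp_all add: one_ennreal_def[symmetric])

lemma emeasure_levels: "emeasure lborel {x. 0 \<le> x \<and> ennreal x < c} = c"
proof (cases c)
  case (real r)
  then have "{x. 0 \<le> x \<and> ennreal x < c} = {0..<r}" by (auto simp: ennreal_less_iff)
  then show ?thesis using real by simp
next
  case top
  then have "{x. 0 \<le> x \<and> ennreal x < c} = {0..}" by auto
  moreover have "emeasure lborel {0::real..} = \<infinity>"
  proof (rule ccontr)
    assume "emeasure lborel {0::real..} \<noteq> \<infinity>"
    then obtain r where r: "emeasure lborel {0::real..} = ennreal r" "0 \<le> r"
      by (cases "emeasure lborel {0::real..}") auto
    have "emeasure lborel {0..r + 1} \<le> emeasure lborel {0::real..}" by (rule emeasure_mono) auto
    then show False using r by simp
  qed
  ultimately show ?thesis using top by simp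
qed

context adapted_kernel
begin

lemma measurable_snd_Pred: "snd \<in> borel_measurable Pred"
proof (rule borel_measurable_iff_greater[THEN iffD2], rule allI)
  fix a
  have "{w \<in> space Pred. a < snd w} = space M \<times> {a<..}" by auto
  then show "{w \<in> space Pred. a < snd w} \<in> sets Pred" using Pred_after_set[OF space_M_F] by simp
qed

lemma measurable_time: "f \<in> borel_measurable borel \<Longrightarrow> (\<lambda>p. f (snd p)) \<in> borel_measurable Pred"
  by (rule measurable_compose[OF measurable_snd_Pred])

lemma Pred_joint:
  "f \<in> borel_measurable Pred \<Longrightarrow> f \<in> borel_measurable (M \<Otimes>\<^sub>M borel)"
  by (rule measurable_compose[OF measurable_Pred_id])

text \<open>A point at level \<open>x\<close> is kept if \<open>x\<close> is strictly below the
  intensity. Strictness makes thinning commute with increasing suprema; the non-strict rule does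
  not.\<close>

definition thin :: "('w \<times> real \<Rightarrow> ennreal) \<Rightarrow> ('w \<times> real) \<times> real \<Rightarrow> ennreal" where
  "thin L q = (if 0 \<le> snd q \<and> ennreal (snd q) < L (fst q) then 1 else 0)"

lemma thin_measurable:
  assumes [measurable]: "L \<in> borel_measurable Pred"
  shows "thin L \<in> borel_measurable MPred"
  unfolding thin_def[abs_def] by measurable

lemma thin_mono: "L p \<le> L' p \<Longrightarrow> thin L (p, x) \<le> thin L' (p, x)"
  by (auto simp: thin_def dest: less_le_trans)

lemma thin_SUP:
  assumes "incseq L"
  shows "thin (\<lambda>p. SUP n. L n p) q = (SUP n::nat. thin (L n) q)"
proof (cases "0 \<le> snd q \<and> (\<exists>n. ennreal (snd q) < L n (fst q))")
  case True
  then obtain n where n: "0 \<le> snd q" "ennreal (snd q) < L n (fst q)" by blast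
  have "thin (L n) q = 1" using n by (simp add: thin_def)
  then have "1 \<le> (SUP n. thin (L n) q)" by (intro SUP_upper2[of n]) auto
  moreover have "(SUP n. thin (L n) q) \<le> 1" by (rule SUP_least) (auto simp: thin_def)
  moreover have "thin (\<lambda>p. SUP n. L n p) q = 1" using n by (auto simp: thin_def less_SUP_iff)
  ultimately show ?thesis by simp
qed (auto simp: thin_def less_SUP_iff)

text \<open>For fixed time the accepted levels form a set whose Lebesgue measure is the intensity,
  so integrating out the level replaces \<open>thin L\<close> by \<open>L\<close>.\<close>

lemma thin_path_integral:
  assumes L: "L \<in> borel_measurable Pred" and v: "v \<in> borel_measurable borel" and \<omega>: "\<omega> \<in> space M"
  shows "(\<integral>\<^sup>+z. v (snd z) * thin L (mark \<omega> z) \<partial>lborel) = (\<integral>\<^sup>+s. v s * L (\<omega>, s) \<partial>lborel)"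
proof -
  have m: "(\<lambda>z. v (snd z) * thin L (mark \<omega> z)) \<in> borel_measurable (lborel \<Otimes>\<^sub>M lborel)"
  proof -
    have "(\<lambda>z. thin L (mark \<omega> z)) \<in> borel_measurable (borel :: (real \<times> real) measure)"
      by (rule measurable_compose[OF measurable_mark[OF \<omega>] thin_measurable[OF L]])
    moreover have "(\<lambda>z. v (snd z)) \<in> borel_measurable (borel :: (real \<times> real) measure)"
      by (rule measurable_compose[OF _ v]) (auto intro!: borel_measurable_continuous_onI continuous_intros)
    ultimately show ?thesis by (simp add: lborel_prod borel_measurable_times_ennreal)
  qed
  have "(\<integral>\<^sup>+z. v (snd z) * thin L (mark \<omega> z) \<partial>(lborel \<Otimes>\<^sub>M lborel)) =
      (\<integral>\<^sup>+s. \<integral>\<^sup>+x. v s * thin L ((\<omega>, s), x) \<partial>lborel \<partial>lborel)"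
    by (subst lborel_pair.nn_integral_snd[symmetric]) (use m in \<open>simp_all add: mark_def\<close>)
  also have "\<dots> = (\<integral>\<^sup>+s. v s * L (\<omega>, s) \<partial>lborel)"
  proof (rule nn_integral_cong)
    fix s
    have lv: "{x. 0 \<le> x \<and> ennreal x < L (\<omega>, s)} \<in> sets lborel" by measurable
    have "(\<integral>\<^sup>+x. v s * thin L ((\<omega>, s), x) \<partial>lborel) =
        (\<integral>\<^sup>+x. v s * indicator {x. 0 \<le> x \<and> ennreal x < L (\<omega>, s)} x \<partial>lborel)"
      by (intro nn_integral_cong) (auto simp: thin_def)
    also have "\<dots> = v s * L (\<omega>, s)"
      unfolding nn_integral_cmult_indicator[OF lv] emeasure_levels ..
    finally show "(\<integral>\<^sup>+x. v s * thin L ((\<omega>, s), x) \<partial>lborel) = v s * L (\<omega>, s)" .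
  qed
  finally show ?thesis by (simp add: lborel_prod)
qed

text \<open>The thinned points and the intensity have the same mean when tested with a deterministic
  \<open>v\<close>; both are reduced to the mean intensity by \<open>first_moment\<close> and
  Fubini.\<close>

lemma thin_mean:
  assumes L: "L \<in> borel_measurable Pred" and v: "v \<in> borel_measurable borel"
  shows "(\<integral>\<^sup>+\<omega>. \<integral>\<^sup>+z. v (snd z) * thin L (mark \<omega> z) \<partial>\<kappa> k \<omega> \<partial>M) = (\<integral>\<^sup>+s. v s * (\<integral>\<^sup>+\<omega>. L (\<omega>, s) \<partial>M) \<partial>lborel)"
    and "(\<integral>\<^sup>+\<omega>. \<integral>\<^sup>+s. v s * L (\<omega>, s) \<partial>lborel \<partial>M) = (\<integral>\<^sup>+s. v s * (\<integral>\<^sup>+\<omega>. L (\<omega>, s) \<partial>M) \<partial>lborel)"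
proof -
  interpret pair_sigma_finite M "lborel :: real measure" ..
  have Lj: "L \<in> borel_measurable (M \<Otimes>\<^sub>M borel)" by (rule Pred_joint[OF L])
  have "(\<lambda>q. v (snd (fst q)) * thin L q) \<in> borel_measurable MPred"
    by (intro borel_measurable_times_ennreal thin_measurable[OF L]
        measurable_compose[OF measurable_fst measurable_time[OF v]])
  from first_moment[OF this, of k]
  have "(\<integral>\<^sup>+\<omega>. \<integral>\<^sup>+z. v (snd z) * thin L (mark \<omega> z) \<partial>\<kappa> k \<omega> \<partial>M) =
      (\<integral>\<^sup>+\<omega>. \<integral>\<^sup>+z. v (snd z) * thin L (mark \<omega> z) \<partial>lborel \<partial>M)"
    by (simp add: mark_def)
  also have "\<dots> = (\<integral>\<^sup>+\<omega>. \<integral>\<^sup>+s. v s * L (\<omega>, s) \<partial>lborel \<partial>M)"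
    by (intro nn_integral_cong thin_path_integral[OF L v])
  finally have 1: "(\<integral>\<^sup>+\<omega>. \<integral>\<^sup>+z. v (snd z) * thin L (mark \<omega> z) \<partial>\<kappa> k \<omega> \<partial>M) =
      (\<integral>\<^sup>+\<omega>. \<integral>\<^sup>+s. v s * L (\<omega>, s) \<partial>lborel \<partial>M)" .
  have "(\<lambda>(\<omega>, s). v s * L (\<omega>, s)) \<in> borel_measurable (M \<Otimes>\<^sub>M lborel)"
  proof -
    have eq: "borel_measurable (M \<Otimes>\<^sub>M lborel) = borel_measurable (M \<Otimes>\<^sub>M (borel :: real measure))"
      by (intro measurable_cong_sets sets_pair_measure_cong) simp_all
    have "(\<lambda>x. v (snd x) * L x) \<in> borel_measurable (M \<Otimes>\<^sub>M borel)"
      by (rule borel_measurable_times_ennreal[OF measurable_compose[OF measurable_snd v] Lj])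
    then show ?thesis unfolding eq by (simp add: case_prod_beta')
  qed
  then have "(\<integral>\<^sup>+\<omega>. \<integral>\<^sup>+s. v s * L (\<omega>, s) \<partial>lborel \<partial>M) = (\<integral>\<^sup>+s. \<integral>\<^sup>+\<omega>. v s * L (\<omega>, s) \<partial>M \<partial>lborel)"
    by (rule Fubini'[symmetric])
  also have "\<dots> = (\<integral>\<^sup>+s. v s * (\<integral>\<^sup>+\<omega>. L (\<omega>, s) \<partial>M) \<partial>lborel)"
  proof (rule nn_integral_cong)
    fix s
    have "(\<lambda>\<omega>. (\<omega>, s)) \<in> measurable M (M \<Otimes>\<^sub>M (borel :: real measure))" by (rule measurable_Pair2') simp
    then have "(\<lambda>\<omega>. L (\<omega>, s)) \<in> borel_measurable M" by (rule measurable_compose[OF _ Lj])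
    then show "(\<integral>\<^sup>+\<omega>. v s * L (\<omega>, s) \<partial>M) = v s * (\<integral>\<^sup>+\<omega>. L (\<omega>, s) \<partial>M)" by (rule nn_integral_cmult)
  qed
  finally show 2: "(\<integral>\<^sup>+\<omega>. \<integral>\<^sup>+s. v s * L (\<omega>, s) \<partial>lborel \<partial>M) = (\<integral>\<^sup>+s. v s * (\<integral>\<^sup>+\<omega>. L (\<omega>, s) \<partial>M) \<partial>lborel)" .
  show "(\<integral>\<^sup>+\<omega>. \<integral>\<^sup>+z. v (snd z) * thin L (mark \<omega> z) \<partial>\<kappa> k \<omega> \<partial>M) = (\<integral>\<^sup>+s. v s * (\<integral>\<^sup>+\<omega>. L (\<omega>, s) \<partial>M) \<partial>lborel)"
    unfolding 1 by (rule 2)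
qed

lemma \<kappa>_sigma_finite:
  assumes \<omega>: "\<omega> \<in> space M" shows "sigma_finite_measure (\<kappa> k \<omega>)"
proof
  have sp: "space (\<kappa> k \<omega>) = UNIV" using sets_eq_imp_space_eq[OF sets_\<kappa>[OF \<omega>]] by simp
  show "\<exists>A. countable A \<and> A \<subseteq> sets (\<kappa> k \<omega>) \<and> \<Union> A = space (\<kappa> k \<omega>) \<and> (\<forall>a\<in>A. emeasure (\<kappa> k \<omega>) a \<noteq> \<infinity>)"
    using \<kappa>_cube[OF \<omega>] UN_cube by (intro exI[of _ "range cube"]) (auto simp: sets_\<kappa>[OF \<omega>] sp less_top)
qed

lemma \<kappa>_Fubini:
  fixes f :: "real \<Rightarrow> real \<times> real \<Rightarrow> ennreal"
  assumes f: "(\<lambda>(s, z). f s z) \<in> borel_measurable (borel \<Otimes>\<^sub>M borel)" and \<omega>: "\<omega> \<in> space M"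
  shows "(\<integral>\<^sup>+s. \<integral>\<^sup>+z. f s z \<partial>\<kappa> k \<omega> \<partial>lborel) = (\<integral>\<^sup>+z. \<integral>\<^sup>+s. f s z \<partial>lborel \<partial>\<kappa> k \<omega>)"
proof -
  interpret pair_sigma_finite lborel "\<kappa> k \<omega>"
    by (intro pair_sigma_finite.intro \<kappa>_sigma_finite[OF \<omega>] lborel.sigma_finite_measure_axioms)
  have eq: "sets (lborel \<Otimes>\<^sub>M \<kappa> k \<omega>) = sets (borel \<Otimes>\<^sub>M borel)"
    by (rule sets_pair_measure_cong) (simp_all add: sets_\<kappa>[OF \<omega>])
  have "(\<lambda>(s, z). f s z) \<in> borel_measurable (lborel \<Otimes>\<^sub>M \<kappa> k \<omega>)"
    unfolding measurable_cong_sets[OF eq refl] by (rule f)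
  then show ?thesis by (rule Fubini'[symmetric])
qed

end

section \<open>The minimal Hawkes process at one time scale\<close>

text \<open>\<open>mm\<close>, \<open>ga\<close> and \<open>ph\<close> are baseline, reproduction
  function and kernel as functions of unscaled time. The vanishing of \<open>ph\<close> at
  nonpositive delays restricts excitation to strictly earlier points. \<open>gb\<close> bounds
  \<open>ga\<close>, and \<open>\<zeta>\<close> expresses subcriticality of \<open>gb\<close> times
  the kernel masses.\<close>

locale hawkes_minimal = adapted_kernel M \<kappa> F
  for M :: "'w measure" and \<kappa> :: "'p::finite \<Rightarrow> 'w \<Rightarrow> (real \<times> real) measure" and F +
  fixes mm :: "'p \<Rightarrow> real \<Rightarrow> ennreal" and ga :: "real \<Rightarrow> ennreal"
    and ph :: "'p \<Rightarrow> 'p \<Rightarrow> real \<Rightarrow> ennreal" and gb :: ennreal and \<zeta> :: "'p \<Rightarrow> ennreal"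
  assumes mm: "mm k \<in> borel_measurable borel" and ga: "ga \<in> borel_measurable borel"
    and ph: "ph k l \<in> borel_measurable borel" and ph0: "t \<le> 0 \<Longrightarrow> ph k l t = 0"
    and ga_le: "ga t \<le> gb"
    and \<zeta>: "1 + (\<Sum>k\<in>UNIV. \<zeta> k * (gb * (\<integral>\<^sup>+t. ph k l t \<partial>lborel))) \<le> \<zeta> l"
    and \<zeta>_fin: "\<zeta> l < \<infinity>"
    and mm_fin: "(\<integral>\<^sup>+t. mm k t \<partial>lborel) < \<infinity>"
    and gK_fin: "gb * (\<integral>\<^sup>+t. ph k l t \<partial>lborel) < \<infinity>"
begin

definition influence :: "('p \<Rightarrow> 'w \<times> real \<Rightarrow> ennreal) \<Rightarrow> 'p \<Rightarrow> 'w \<times> real \<Rightarrow> ennreal" where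
  "influence L k p = mm k (snd p) + ga (snd p) *
     (\<Sum>l\<in>UNIV. \<integral>\<^sup>+z. ph k l (snd p - snd z) * thin (L l) (mark (fst p) z) \<partial>\<kappa> l (fst p))"

text \<open>Picard iteration from zero. Its increasing limit \<open>Lam\<close> is predictable and
  lies below every other solution, which is why comparisons from below can be made by induction on
  \<open>n\<close>.\<close>

primrec lam :: "nat \<Rightarrow> 'p \<Rightarrow> 'w \<times> real \<Rightarrow> ennreal" where
  "lam 0 = (\<lambda>k p. 0)"
| "lam (Suc n) = influence (lam n)"

definition Lam :: "'p \<Rightarrow> 'w \<times> real \<Rightarrow> ennreal" where
  "Lam k p = (SUP n. lam n k p)"

text \<open>\<open>predictable_integral\<close> cuts off the points at or after the current time;
  the vanishing of \<open>ph\<close> at nonpositive delays makes this cut invisible in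
  \<open>influence\<close>.\<close>

lemma influence_predictable:
  assumes L: "\<And>l. L l \<in> borel_measurable Pred"
  shows "influence L k \<in> borel_measurable Pred"
proof -
  have "(\<lambda>p. \<integral>\<^sup>+z. ph k l (snd p - snd z) * thin (L l) (mark (fst p) z) \<partial>\<kappa> l (fst p)) \<in> borel_measurable Pred" for l
  proof -
    have "(\<lambda>(p, q). ph k l (snd p - snd (fst q)) * thin (L l) q) \<in> borel_measurable (Pred \<Otimes>\<^sub>M MPred)"
    proof -
      have a: "(\<lambda>x. snd (fst x)) \<in> borel_measurable (Pred \<Otimes>\<^sub>M MPred)"
        by (rule measurable_compose[OF measurable_fst measurable_snd_Pred])
      have "(\<lambda>x. fst (snd x)) \<in> measurable (Pred \<Otimes>\<^sub>M MPred) Pred"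
        by (rule measurable_compose[OF measurable_snd measurable_fst])
      then have b: "(\<lambda>x. snd (fst (snd x))) \<in> borel_measurable (Pred \<Otimes>\<^sub>M MPred)"
        by (rule measurable_compose[OF _ measurable_snd_Pred])
      have "(\<lambda>x. ph k l (snd (fst x) - snd (fst (snd x)))) \<in> borel_measurable (Pred \<Otimes>\<^sub>M MPred)"
        by (rule measurable_compose[OF borel_measurable_diff[OF a b] ph])
      moreover have "(\<lambda>x. thin (L l) (snd x)) \<in> borel_measurable (Pred \<Otimes>\<^sub>M MPred)"
        by (rule measurable_compose[OF measurable_snd thin_measurable[OF L]])
      ultimately show ?thesis by (simp add: case_prod_beta' borel_measurable_times_ennreal)
    qed
    from predictable_integral[OF this, of l]
    have "(\<lambda>p. \<integral>\<^sup>+z. indicator {..<snd p} (snd z) * (ph k l (snd p - snd (fst (mark (fst p) z))) *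
        thin (L l) (mark (fst p) z)) \<partial>\<kappa> l (fst p)) \<in> borel_measurable Pred" .
    moreover have "indicator {..<snd p} (snd z) * (ph k l (snd p - snd (fst (mark (fst p) z))) *
        thin (L l) (mark (fst p) z)) = ph k l (snd p - snd z) * thin (L l) (mark (fst p) z)" for p z
      using ph0[of "snd p - snd z" k l] by (auto simp: mark_def split: split_indicator)
    ultimately show ?thesis by (simp only:)
  qed
  then show ?thesis
    unfolding influence_def[abs_def]
    by (intro borel_measurable_add borel_measurable_times_ennreal borel_measurable_sum measurable_time mm ga)
qed

lemma lam_predictable: "lam n k \<in> borel_measurable Pred"
  by (induction n arbitrary: k) (simp_all add: influence_predictable)

lemma Lam_predictable: "Lam k \<in> borel_measurable Pred"
  unfolding Lam_def[abs_def] by (rule borel_measurable_SUP) (simp_all add: lam_predictable)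

lemma influence_mono:
  assumes "\<And>l q. L l q \<le> L' l q"
  shows "influence L k p \<le> influence L' k p"
  unfolding influence_def
  by (intro add_mono mult_left_mono sum_mono nn_integral_mono) (auto simp: mark_def intro: thin_mono assms)

lemma lam_Suc_le: "lam n k p \<le> lam (Suc n) k p"
proof (induction n arbitrary: k p)
  case (Suc n)
  have "influence (lam n) k p \<le> influence (lam (Suc n)) k p" by (rule influence_mono) (rule Suc)
  then show ?case by simp
qed simp

lemma incseq_lam: "incseq (\<lambda>n. lam n k)"
  by (rule incseq_SucI) (simp add: le_fun_def lam_Suc_le del: lam.simps)

lemma thin_integrand_measurable:
  assumes "L \<in> borel_measurable Pred" "v \<in> borel_measurable borel" "\<omega> \<in> space M"
  shows "(\<lambda>z. v (snd z) * thin L (mark \<omega> z)) \<in> borel_measurable (\<kappa> l \<omega>)"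
proof -
  have m: "(\<lambda>q. v (snd (fst q)) * thin L q) \<in> borel_measurable MPred"
    by (intro borel_measurable_times_ennreal thin_measurable assms
        measurable_compose[OF measurable_fst measurable_time[OF assms(2)]])
  from mark_integrand_measurable(1)[OF m fin_kernel_\<kappa> assms(3)] show ?thesis by (simp add: mark_def)
qed

lemma ph_shift_measurable: "(\<lambda>s. ph k l (t - s)) \<in> borel_measurable borel" "(\<lambda>s. ph k l (s - t)) \<in> borel_measurable borel"
  by (rule measurable_compose[OF _ ph], simp)+

lemma thin_Lam: "thin (Lam l) q = (SUP n. thin (lam n l) q)"
  unfolding Lam_def[abs_def] by (rule thin_SUP[OF incseq_lam])

text \<open>Monotone convergence passes through the thinning by \<open>thin_SUP\<close>, so the
  intensity equation holds at every outcome and every time, infinite values included.\<close>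

theorem Lam_eq:
  assumes \<omega>: "\<omega> \<in> space M"
  shows "Lam k (\<omega>, t) = mm k t + ga t *
     (\<Sum>l\<in>UNIV. \<integral>\<^sup>+z. ph k l (t - snd z) * thin (Lam l) (mark \<omega> z) \<partial>\<kappa> l \<omega>)"
proof -
  define J where "J n l = (\<integral>\<^sup>+z. ph k l (t - snd z) * thin (lam n l) (mark \<omega> z) \<partial>\<kappa> l \<omega>)" for n l
  have inc: "thin (lam n l) q \<le> thin (lam (Suc n) l) q" for n l q
    using thin_mono[of "lam n l" "fst q" "lam (Suc n) l" "snd q"] lam_Suc_le by simp
  have J_inc: "incseq (\<lambda>n. J n l)" for l
    unfolding J_def by (intro incseq_SucI nn_integral_mono mult_left_mono inc) simp
  have J_SUP: "(SUP n. J n l) = (\<integral>\<^sup>+z. ph k l (t - snd z) * thin (Lam l) (mark \<omega> z) \<partial>\<kappa> l \<omega>)" for l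
  proof -
    have "(\<integral>\<^sup>+z. ph k l (t - snd z) * thin (Lam l) (mark \<omega> z) \<partial>\<kappa> l \<omega>) =
        (\<integral>\<^sup>+z. (SUP n. ph k l (t - snd z) * thin (lam n l) (mark \<omega> z)) \<partial>\<kappa> l \<omega>)"
      unfolding thin_Lam SUP_mult_left_ennreal ..
    also have "\<dots> = (SUP n. J n l)"
      unfolding J_def
      by (rule nn_integral_monotone_convergence_SUP)
        (auto intro!: incseq_SucI le_funI mult_left_mono inc thin_integrand_measurable[OF lam_predictable ph_shift_measurable(1) \<omega>] simp del: lam.simps)
    finally show ?thesis ..
  qed
  have "Lam k (\<omega>, t) = (SUP n. lam (Suc n) k (\<omega>, t))"
    unfolding Lam_def
  proof (rule antisym)
    show "(SUP n. lam n k (\<omega>, t)) \<le> (SUP n. lam (Suc n) k (\<omega>, t))"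
      by (rule SUP_mono) (use lam_Suc_le in blast)
    show "(SUP n. lam (Suc n) k (\<omega>, t)) \<le> (SUP n. lam n k (\<omega>, t))"
      by (rule SUP_mono) blast
  qed
  also have "\<dots> = (SUP n. mm k t + ga t * (\<Sum>l\<in>UNIV. J n l))"
    by (simp add: influence_def J_def)
  also have "\<dots> = mm k t + ga t * (\<Sum>l\<in>UNIV. SUP n. J n l)"
    by (simp add: ennreal_SUP_add_right[symmetric] SUP_mult_left_ennreal[symmetric] ennreal_SUP_sum J_inc)
  finally show ?thesis unfolding J_SUP .
qed

end

section \<open>Mean and fluctuations of the minimal process\<close>

lemma sum_finite_ennreal:
  "(\<And>i. f i < \<infinity>) \<Longrightarrow> (\<Sum>i\<in>S. f i) < (\<infinity> :: ennreal)"
  by (induction S rule: infinite_finite_induct) simp_all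

lemma nn_integral_convolution:
  fixes p f :: "real \<Rightarrow> ennreal"
  assumes p: "p \<in> borel_measurable borel" and f: "f \<in> borel_measurable borel"
  shows "(\<integral>\<^sup>+t. \<integral>\<^sup>+s. p (t - s) * f s \<partial>lborel \<partial>lborel) = (\<integral>\<^sup>+t. p t \<partial>lborel) * (\<integral>\<^sup>+s. f s \<partial>lborel)"
    and "(\<lambda>t. \<integral>\<^sup>+s. p (t - s) * f s \<partial>lborel) \<in> borel_measurable borel"
proof -
  have eq: "borel_measurable (lborel \<Otimes>\<^sub>M lborel) = borel_measurable (borel \<Otimes>\<^sub>M (borel :: real measure))"
    "borel_measurable (borel \<Otimes>\<^sub>M lborel) = borel_measurable (borel \<Otimes>\<^sub>M (borel :: real measure))"
    by (intro measurable_cong_sets sets_pair_measure_cong; simp)+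
  have m: "(\<lambda>(t, s). p (t - s) * f s) \<in> borel_measurable (borel \<Otimes>\<^sub>M borel)"
    unfolding case_prod_beta'
    by (intro borel_measurable_times_ennreal measurable_compose[OF _ p] measurable_compose[OF measurable_snd f]) simp
  have shift: "(\<lambda>t. p (t - s)) \<in> borel_measurable borel" for s by (rule measurable_compose[OF _ p]) simp
  have "(\<integral>\<^sup>+t. \<integral>\<^sup>+s. p (t - s) * f s \<partial>lborel \<partial>lborel) = (\<integral>\<^sup>+s. \<integral>\<^sup>+t. p (t - s) * f s \<partial>lborel \<partial>lborel)"
    by (rule lborel_pair.Fubini'[symmetric]) (unfold eq, rule m)
  also have "\<dots> = (\<integral>\<^sup>+s. (\<integral>\<^sup>+t. p t \<partial>lborel) * f s \<partial>lborel)"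
    using shift by (intro nn_integral_cong) (simp add: nn_integral_multc nn_integral_shift(1)[OF p])
  also have "\<dots> = (\<integral>\<^sup>+t. p t \<partial>lborel) * (\<integral>\<^sup>+s. f s \<partial>lborel)"
    by (rule nn_integral_cmult) (use f in simp)
  finally show "(\<integral>\<^sup>+t. \<integral>\<^sup>+s. p (t - s) * f s \<partial>lborel \<partial>lborel) = (\<integral>\<^sup>+t. p t \<partial>lborel) * (\<integral>\<^sup>+s. f s \<partial>lborel)" .
  show "(\<lambda>t. \<integral>\<^sup>+s. p (t - s) * f s \<partial>lborel) \<in> borel_measurable borel"
    by (rule lborel.borel_measurable_nn_integral) (unfold eq, rule m)
qed

text \<open>The argument of \<open>weighted_sum_bound\<close> without subtraction: the common term,
  with \<open>c l\<close> for the column sum, appears on both sides and is cancelled, for which the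
  \<open>E l\<close> have to be finite.\<close>

lemma weighted_sum_bound_ennreal:
  fixes \<zeta> E r :: "'n::finite \<Rightarrow> ennreal"
  assumes E: "\<And>k. E k \<le> r k + (\<Sum>l\<in>UNIV. B k l * E l)" and fin: "\<And>k. E k < \<infinity>"
    and \<zeta>: "\<And>l. 1 + (\<Sum>k\<in>UNIV. \<zeta> k * B k l) \<le> \<zeta> l" "\<And>l. \<zeta> l < \<infinity>"
  shows "(\<Sum>l\<in>UNIV. E l) \<le> (\<Sum>k\<in>UNIV. \<zeta> k * r k)"
proof -
  define c where "c l = (\<Sum>k\<in>UNIV. \<zeta> k * B k l)" for l
  have c_fin: "c l < \<infinity>" for l
  proof -
    have "c l \<le> 1 + c l" by (simp add: add_increasing)
    also have "\<dots> \<le> \<zeta> l" unfolding c_def by (rule \<zeta>)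
    finally show ?thesis using \<zeta>(2)[of l] by (rule order.strict_trans1)
  qed
  have "(\<Sum>l\<in>UNIV. c l * E l) + (\<Sum>l\<in>UNIV. E l) = (\<Sum>l\<in>UNIV. (1 + c l) * E l)"
    by (simp add: distrib_right sum.distrib add.commute)
  also have "\<dots> \<le> (\<Sum>l\<in>UNIV. \<zeta> l * E l)"
    unfolding c_def by (intro sum_mono mult_right_mono \<zeta>) simp
  also have "\<dots> \<le> (\<Sum>l\<in>UNIV. \<zeta> l * (r l + (\<Sum>j\<in>UNIV. B l j * E j)))"
    by (intro sum_mono mult_left_mono E) simp
  also have "\<dots> = (\<Sum>k\<in>UNIV. \<zeta> k * r k) + (\<Sum>l\<in>UNIV. \<Sum>j\<in>UNIV. \<zeta> l * B l j * E j)"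
    by (simp add: distrib_left sum.distrib sum_distrib_left mult.assoc)
  also have "(\<Sum>l\<in>UNIV. \<Sum>j\<in>UNIV. \<zeta> l * B l j * E j) = (\<Sum>j\<in>UNIV. c j * E j)"
    by (subst sum.swap) (simp add: c_def sum_distrib_right)
  finally have "(\<Sum>l\<in>UNIV. c l * E l) + (\<Sum>l\<in>UNIV. E l) \<le> (\<Sum>l\<in>UNIV. c l * E l) + (\<Sum>k\<in>UNIV. \<zeta> k * r k)"
    by (simp only: add.commute)
  moreover have "(\<Sum>l\<in>UNIV. c l * E l) \<noteq> \<infinity>"
  proof -
    have "c l * E l < \<infinity>" for l using c_fin[of l] fin[of l] by (simp add: ennreal_mult_less_top)
    from sum_finite_ennreal[of "\<lambda>l. c l * E l", OF this] show ?thesis by (rule less_imp_neq)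
  qed
  ultimately show ?thesis unfolding ennreal_add_left_cancel_le by blast
qed

lemma enn2real_sum_finite:
  "(\<And>i. f i < \<infinity>) \<Longrightarrow> enn2real (\<Sum>i\<in>S. f i) = (\<Sum>i\<in>S. enn2real (f i))"
  by (induction S rule: infinite_finite_induct) (simp_all add: enn2real_plus)

lemma (in prob_space) mean_measurable:
  assumes L: "L \<in> borel_measurable (M \<Otimes>\<^sub>M borel)"
  shows "(\<lambda>t. \<integral>\<^sup>+\<omega>. L (\<omega>, t) \<partial>M :: ennreal) \<in> borel_measurable borel"
proof -
  have "(\<lambda>(t, \<omega>). L (\<omega>, t)) \<in> borel_measurable (borel \<Otimes>\<^sub>M M)"
    using measurable_compose[OF measurable_pair_swap' L] by (simp add: case_prod_beta')
  then show ?thesis by (rule borel_measurable_nn_integral)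
qed

context hawkes_minimal
begin

abbreviation ph_mass :: "'p \<Rightarrow> 'p \<Rightarrow> ennreal" where
  "ph_mass k l \<equiv> \<integral>\<^sup>+t. ph k l t \<partial>lborel"

lemma ph_pair_measurable:
  assumes "f \<in> borel_measurable borel" "h \<in> borel_measurable borel"
  shows "(\<lambda>(t, s). h t * ph k l (t - s) * f s) \<in> borel_measurable (borel \<Otimes>\<^sub>M borel)"
proof -
  have "(\<lambda>x. ph k l (fst x - snd x)) \<in> borel_measurable (borel \<Otimes>\<^sub>M borel)"
    by (rule measurable_compose[OF _ ph]) simp
  moreover have "(\<lambda>x. h (fst x)) \<in> borel_measurable (borel \<Otimes>\<^sub>M borel)"
    "(\<lambda>x. f (snd x)) \<in> borel_measurable (borel \<Otimes>\<^sub>M borel)"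
    using assms by (auto intro: measurable_compose[OF measurable_fst] measurable_compose[OF measurable_snd])
  ultimately show ?thesis unfolding case_prod_beta' by (intro borel_measurable_times_ennreal)
qed

lemma thin_integral_measurable:
  assumes "L \<in> borel_measurable Pred" "v \<in> borel_measurable borel"
  shows "(\<lambda>\<omega>. \<integral>\<^sup>+z. v (snd z) * thin L (mark \<omega> z) \<partial>\<kappa> l \<omega>) \<in> borel_measurable M"
    and "(\<lambda>\<omega>. \<integral>\<^sup>+s. v s * L (\<omega>, s) \<partial>lborel) \<in> borel_measurable M"
proof -
  have m: "(\<lambda>q. v (snd (fst q)) * thin L q) \<in> borel_measurable MPred"
    by (intro borel_measurable_times_ennreal thin_measurable assms
        measurable_compose[OF measurable_fst measurable_time[OF assms(2)]])
  from mark_integrand_measurable(2)[OF m fin_kernel_\<kappa>]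
  show "(\<lambda>\<omega>. \<integral>\<^sup>+z. v (snd z) * thin L (mark \<omega> z) \<partial>\<kappa> l \<omega>) \<in> borel_measurable M" by (simp add: mark_def)
  from mark_integrand_measurable(2)[OF m fin_kernel_lborel]
  have "(\<lambda>\<omega>. \<integral>\<^sup>+z. v (snd z) * thin L (mark \<omega> z) \<partial>lborel) \<in> borel_measurable M" by (simp add: mark_def)
  then show "(\<lambda>\<omega>. \<integral>\<^sup>+s. v s * L (\<omega>, s) \<partial>lborel) \<in> borel_measurable M"
    by (rule measurable_cong[THEN iffD1, rotated]) (rule thin_path_integral[OF assms])
qed

lemma influence_mean:
  assumes L: "\<And>l. L l \<in> borel_measurable Pred"
  shows "(\<integral>\<^sup>+\<omega>. influence L k (\<omega>, t) \<partial>M) = mm k t + ga t *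
    (\<Sum>l\<in>UNIV. \<integral>\<^sup>+s. ph k l (t - s) * (\<integral>\<^sup>+\<omega>. L l (\<omega>, s) \<partial>M) \<partial>lborel)"
proof -
  let ?J = "\<lambda>l \<omega>. \<integral>\<^sup>+z. ph k l (t - snd z) * thin (L l) (mark \<omega> z) \<partial>\<kappa> l \<omega>"
  have J[measurable]: "?J l \<in> borel_measurable M" for l
    by (rule thin_integral_measurable(1)[OF L ph_shift_measurable(1)])
  have "(\<integral>\<^sup>+\<omega>. influence L k (\<omega>, t) \<partial>M) = (\<integral>\<^sup>+\<omega>. mm k t + ga t * (\<Sum>l\<in>UNIV. ?J l \<omega>) \<partial>M)"
    by (simp add: influence_def)
  also have "\<dots> = mm k t + ga t * (\<integral>\<^sup>+\<omega>. (\<Sum>l\<in>UNIV. ?J l \<omega>) \<partial>M)"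
    by (subst nn_integral_add) (simp_all add: emeasure_space_1 nn_integral_cmult)
  also have "(\<integral>\<^sup>+\<omega>. (\<Sum>l\<in>UNIV. ?J l \<omega>) \<partial>M) = (\<Sum>l\<in>UNIV. \<integral>\<^sup>+\<omega>. ?J l \<omega> \<partial>M)"
    by (rule nn_integral_sum) simp
  also have "\<dots> = (\<Sum>l\<in>UNIV. \<integral>\<^sup>+s. ph k l (t - s) * (\<integral>\<^sup>+\<omega>. L l (\<omega>, s) \<partial>M) \<partial>lborel)"
    by (intro sum.cong refl thin_mean(1)[OF L ph_shift_measurable(1)])
  finally show ?thesis .
qed

definition mean_rate :: "'p \<Rightarrow> real \<Rightarrow> ennreal" where
  "mean_rate k t = (\<integral>\<^sup>+\<omega>. Lam k (\<omega>, t) \<partial>M)"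

lemma mean_rate_measurable: "mean_rate k \<in> borel_measurable borel"
  unfolding mean_rate_def[abs_def] by (rule mean_measurable[OF Pred_joint[OF Lam_predictable]])

lemma mean_rate_eq:
  "mean_rate k t = mm k t + ga t * (\<Sum>l\<in>UNIV. \<integral>\<^sup>+s. ph k l (t - s) * mean_rate l s \<partial>lborel)"
proof -
  have "mean_rate k t = (\<integral>\<^sup>+\<omega>. influence Lam k (\<omega>, t) \<partial>M)"
    unfolding mean_rate_def by (rule nn_integral_cong) (simp add: Lam_eq influence_def)
  then show ?thesis using influence_mean[where L=Lam and k=k and t=t, OF Lam_predictable] by (simp add: mean_rate_def)
qed

text \<open>The weighted bound presupposes finite integrals, which are not known in advance for
  \<open>Lam\<close>. For each \<open>lam n\<close> they follow by induction on \<open>n\<close>;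
  the bound is uniform in \<open>n\<close> and passes to the supremum.\<close>

lemma mean_rate_total: "(\<Sum>l\<in>UNIV. \<integral>\<^sup>+t. mean_rate l t \<partial>lborel) \<le> (\<Sum>k\<in>UNIV. \<zeta> k * (\<integral>\<^sup>+t. mm k t \<partial>lborel))"
proof -
  define a where "a n l t = (\<integral>\<^sup>+\<omega>. lam n l (\<omega>, t) \<partial>M)" for n l t
  have am: "a n l \<in> borel_measurable borel" for n l
    unfolding a_def[abs_def] by (rule mean_measurable[OF Pred_joint[OF lam_predictable]])
  define I where "I n l = (\<integral>\<^sup>+t. a n l t \<partial>lborel)" for n l
  define R where "R = (\<Sum>k\<in>UNIV. \<zeta> k * (\<integral>\<^sup>+t. mm k t \<partial>lborel))"
  have a_mono: "a n l t \<le> a (Suc n) l t" for n l t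
    unfolding a_def by (intro nn_integral_mono lam_Suc_le)
  have I_mono: "I n l \<le> I (Suc n) l" for n l
    unfolding I_def by (intro nn_integral_mono a_mono)
  have step: "I (Suc n) k \<le> (\<integral>\<^sup>+t. mm k t \<partial>lborel) + (\<Sum>l\<in>UNIV. gb * ph_mass k l * I n l)" for n k
  proof -
    have "I (Suc n) k = (\<integral>\<^sup>+t. mm k t + ga t * (\<Sum>l\<in>UNIV. \<integral>\<^sup>+s. ph k l (t - s) * a n l s \<partial>lborel) \<partial>lborel)"
      using influence_mean[where L="lam n" and k=k, OF lam_predictable] by (simp add: I_def a_def)
    also have "\<dots> \<le> (\<integral>\<^sup>+t. mm k t + gb * (\<Sum>l\<in>UNIV. \<integral>\<^sup>+s. ph k l (t - s) * a n l s \<partial>lborel) \<partial>lborel)"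
      by (intro nn_integral_mono add_mono mult_right_mono ga_le order.refl) simp
    also have "\<dots> = (\<integral>\<^sup>+t. mm k t \<partial>lborel) +
        gb * (\<integral>\<^sup>+t. (\<Sum>l\<in>UNIV. \<integral>\<^sup>+s. ph k l (t - s) * a n l s \<partial>lborel) \<partial>lborel)"
      using mm nn_integral_convolution(2)[OF ph am] by (simp add: nn_integral_add nn_integral_cmult)
    also have "(\<integral>\<^sup>+t. (\<Sum>l\<in>UNIV. \<integral>\<^sup>+s. ph k l (t - s) * a n l s \<partial>lborel) \<partial>lborel) =
        (\<Sum>l\<in>UNIV. ph_mass k l * I n l)"
      using nn_integral_convolution(2)[OF ph am] by (simp add: nn_integral_sum nn_integral_convolution(1)[OF ph am] I_def)
    finally show ?thesis by (simp add: sum_distrib_left mult.assoc)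
  qed
  have fin: "I n l < \<infinity>" for n l
  proof (induction n arbitrary: l)
    case 0
    then show ?case by (simp add: I_def a_def)
  next
    case (Suc n)
    have "(\<integral>\<^sup>+t. mm l t \<partial>lborel) + (\<Sum>j\<in>UNIV. gb * ph_mass l j * I n j) < \<infinity>"
    proof -
      have "gb * ph_mass l j * I n j < \<infinity>" for j using gK_fin[of l j] Suc[of j] by (simp add: ennreal_mult_less_top)
      then show ?thesis using mm_fin[of l] by simp
    qed
    with step show ?case by (rule order.strict_trans1)
  qed
  \<comment> \<open>As \<open>I n \<le> I (Suc n)\<close>, the recursive estimate turns into a
    self-bounding inequality for \<open>I n\<close> alone.\<close>
  have bound: "(\<Sum>l\<in>UNIV. I n l) \<le> R" for n
    unfolding R_def by (rule weighted_sum_bound_ennreal[OF order.trans[OF I_mono step] fin \<zeta> \<zeta>_fin])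
  have "(\<integral>\<^sup>+t. mean_rate l t \<partial>lborel) = (SUP n. I n l)" for l
  proof -
    have "mean_rate l t = (SUP n. a n l t)" for t
    proof -
      have meas: "(\<lambda>\<omega>. lam n l (\<omega>, t)) \<in> borel_measurable M" for n
      proof -
        have "(\<lambda>\<omega>. (\<omega>, t)) \<in> measurable M (M \<Otimes>\<^sub>M (borel :: real measure))" by (rule measurable_Pair2') simp
        then show ?thesis by (rule measurable_compose[OF _ Pred_joint[OF lam_predictable]])
      qed
      show ?thesis
        unfolding mean_rate_def Lam_def a_def
        by (rule nn_integral_monotone_convergence_SUP[OF _ meas])
          (auto intro!: incseq_SucI le_funI lam_Suc_le simp del: lam.simps)
    qed
    then have "(\<integral>\<^sup>+t. mean_rate l t \<partial>lborel) = (\<integral>\<^sup>+t. (SUP n. a n l t) \<partial>lborel)" by simp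
    also have "\<dots> = (SUP n. I n l)"
      unfolding I_def by (rule nn_integral_monotone_convergence_SUP)
        (use am a_mono in \<open>auto intro!: incseq_SucI le_funI\<close>)
    finally show ?thesis .
  qed
  then have "(\<Sum>l\<in>UNIV. \<integral>\<^sup>+t. mean_rate l t \<partial>lborel) = (SUP n. \<Sum>l\<in>UNIV. I n l)"
    using I_mono by (simp add: ennreal_SUP_sum incseq_SucI)
  also have "\<dots> \<le> R" by (rule SUP_least) (rule bound)
  finally show ?thesis unfolding R_def .
qed

text \<open>The adjoint renewal equation: integrating the intensity equation against the weight
  \<open>weight k t\<close> leaves only \<open>N\<^sub>k[0,t]\<close>, a deterministic term and a compensated integral.\<close>

primrec weight_n :: "'p \<Rightarrow> real \<Rightarrow> nat \<Rightarrow> 'p \<Rightarrow> real \<Rightarrow> ennreal" where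
  "weight_n k t 0 = (\<lambda>l r. 0)"
| "weight_n k t (Suc n) = (\<lambda>l r. (if l = k \<and> r \<le> t then 1 else 0) +
     (\<Sum>j\<in>UNIV. \<integral>\<^sup>+s. weight_n k t n j s * ga s * ph j l (s - r) \<partial>lborel))"

text \<open>In the branching picture this is the mean number of points of component \<open>k\<close>
  up to time \<open>t\<close> in the cluster founded by one point of component \<open>l\<close> at
  time \<open>r\<close>, the founder included.\<close>

definition weight :: "'p \<Rightarrow> real \<Rightarrow> 'p \<Rightarrow> real \<Rightarrow> ennreal" where
  "weight k t l r = (SUP n. weight_n k t n l r)"

lemma weight_step_measurable:
  assumes v: "v \<in> borel_measurable borel"
  shows "(\<lambda>s. v s * ga s * ph j l (s - r)) \<in> borel_measurable borel"
    and "(\<lambda>r. \<integral>\<^sup>+s. v s * ga s * ph j l (s - r) \<partial>lborel) \<in> borel_measurable borel"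
proof -
  show "(\<lambda>s. v s * ga s * ph j l (s - r)) \<in> borel_measurable borel"
    by (intro borel_measurable_times_ennreal v ga ph_shift_measurable)
  have "(\<lambda>(s, r). v s * ga s * ph j l (s - r) * 1) \<in> borel_measurable (borel \<Otimes>\<^sub>M borel)"
    by (rule ph_pair_measurable) (intro borel_measurable_times_ennreal v ga borel_measurable_const)+
  then have "(\<lambda>x. case (snd x, fst x) of (s, r) \<Rightarrow> v s * ga s * ph j l (s - r) * 1) \<in>
      borel_measurable (borel \<Otimes>\<^sub>M borel)"
    by (rule measurable_compose[rotated]) simp
  then have "(\<lambda>(r, s). v s * ga s * ph j l (s - r)) \<in> borel_measurable (borel \<Otimes>\<^sub>M borel)"
    by (simp add: case_prod_beta')
  moreover have "borel_measurable (borel \<Otimes>\<^sub>M lborel) = borel_measurable (borel \<Otimes>\<^sub>M (borel :: real measure))"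
    by (intro measurable_cong_sets sets_pair_measure_cong) simp_all
  ultimately have "(\<lambda>(r, s). v s * ga s * ph j l (s - r)) \<in> borel_measurable (borel \<Otimes>\<^sub>M lborel)" by simp
  then show "(\<lambda>r. \<integral>\<^sup>+s. v s * ga s * ph j l (s - r) \<partial>lborel) \<in> borel_measurable borel"
    by (rule lborel.borel_measurable_nn_integral)
qed

lemma weight_n_measurable: "weight_n k t n l \<in> borel_measurable borel"
proof (induction n arbitrary: l)
  case (Suc n)
  have "(\<lambda>r. if l = k \<and> r \<le> t then 1 else 0 :: ennreal) \<in> borel_measurable borel" by measurable
  moreover have "(\<lambda>r. \<Sum>j\<in>UNIV. \<integral>\<^sup>+s. weight_n k t n j s * ga s * ph j l (s - r) \<partial>lborel) \<in> borel_measurable borel"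
    by (intro borel_measurable_sum weight_step_measurable(2) Suc)
  ultimately show ?case by (simp add: borel_measurable_add)
qed simp

lemma weight_measurable: "weight k t l \<in> borel_measurable borel"
  unfolding weight_def[abs_def] by (rule borel_measurable_SUP) (simp_all add: weight_n_measurable)

lemma weight_n_Suc_le: "weight_n k t n l r \<le> weight_n k t (Suc n) l r"
proof (induction n arbitrary: l r)
  case (Suc n)
  show ?case
    unfolding weight_n.simps(2)[of k t "Suc n"] unfolding weight_n.simps(2)[of k t n]
    by (intro add_mono order.refl sum_mono nn_integral_mono mult_right_mono Suc[unfolded weight_n.simps(2)[of k t n]]) simp_all
qed simp

lemma weight_eq:
  "weight k t l r = (if l = k \<and> r \<le> t then 1 else 0) +
     (\<Sum>j\<in>UNIV. \<integral>\<^sup>+s. weight k t j s * ga s * ph j l (s - r) \<partial>lborel)"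
proof -
  let ?J = "\<lambda>n j. \<integral>\<^sup>+s. weight_n k t n j s * ga s * ph j l (s - r) \<partial>lborel"
  have inc: "incseq (\<lambda>n. ?J n j)" for j
    by (intro incseq_SucI nn_integral_mono mult_right_mono weight_n_Suc_le) simp_all
  have J: "(\<integral>\<^sup>+s. weight k t j s * ga s * ph j l (s - r) \<partial>lborel) = (SUP n. ?J n j)" for j
  proof -
    have "(\<integral>\<^sup>+s. weight k t j s * ga s * ph j l (s - r) \<partial>lborel) =
        (\<integral>\<^sup>+s. (SUP n. weight_n k t n j s * ga s * ph j l (s - r)) \<partial>lborel)"
      unfolding weight_def SUP_mult_right_ennreal ..
    also have "\<dots> = (SUP n. ?J n j)"
      by (rule nn_integral_monotone_convergence_SUP)
        (auto intro!: incseq_SucI le_funI mult_right_mono weight_n_Suc_le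
          weight_step_measurable(1)[OF weight_n_measurable] simp del: weight_n.simps)
    finally show ?thesis .
  qed
  have "weight k t l r = (SUP n. weight_n k t (Suc n) l r)"
    unfolding weight_def
  proof (rule antisym)
    show "(SUP n. weight_n k t n l r) \<le> (SUP n. weight_n k t (Suc n) l r)"
      by (rule SUP_mono) (use weight_n_Suc_le in blast)
    show "(SUP n. weight_n k t (Suc n) l r) \<le> (SUP n. weight_n k t n l r)"
      by (rule SUP_mono) blast
  qed
  also have "\<dots> = (SUP n. (if l = k \<and> r \<le> t then 1 else 0) + (\<Sum>j\<in>UNIV. ?J n j))" by simp
  also have "\<dots> = (if l = k \<and> r \<le> t then 1 else 0) + (\<Sum>j\<in>UNIV. SUP n. ?J n j)"
    by (simp only: ennreal_SUP_add_right[symmetric, OF UNIV_not_empty] ennreal_SUP_sum[OF inc])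
  finally show ?thesis unfolding J .
qed

text \<open>\<open>\<zeta>\<close> is a supersolution of the adjoint equation, and the iteration
  starts at zero, so it never rises above \<open>\<zeta>\<close>.\<close>

lemma weight_le: "weight k t l r \<le> \<zeta> l"
  unfolding weight_def
proof (rule SUP_least)
  fix n show "weight_n k t n l r \<le> \<zeta> l"
  proof (induction n arbitrary: l r)
    case (Suc n)
    have "(\<integral>\<^sup>+s. weight_n k t n j s * ga s * ph j l (s - r) \<partial>lborel) \<le> \<zeta> j * (gb * ph_mass j l)" for j
    proof -
      have "(\<integral>\<^sup>+s. weight_n k t n j s * ga s * ph j l (s - r) \<partial>lborel) \<le>
          (\<integral>\<^sup>+s. \<zeta> j * gb * ph j l (s - r) \<partial>lborel)"
        by (intro nn_integral_mono mult_mono Suc ga_le) simp_all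
      also have "\<dots> = \<zeta> j * gb * ph_mass j l"
        by (subst nn_integral_cmult) (simp_all add: ph_shift_measurable nn_integral_shift(1)[OF ph])
      finally show ?thesis by (simp add: mult.assoc)
    qed
    then have "weight_n k t (Suc n) l r \<le> 1 + (\<Sum>j\<in>UNIV. \<zeta> j * (gb * ph_mass j l))"
      unfolding weight_n.simps(2) by (intro add_mono sum_mono) auto
    then show ?case using \<zeta>[of l] by (rule order.trans)
  qed simp
qed

definition point_count :: "'p \<Rightarrow> real \<Rightarrow> 'w \<Rightarrow> ennreal" where
  "point_count k t \<omega> = (\<integral>\<^sup>+z. indicator {..t} (snd z) * thin (Lam k) (mark \<omega> z) \<partial>\<kappa> k \<omega>)"

definition mean_count :: "'p \<Rightarrow> real \<Rightarrow> ennreal" where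
  "mean_count k t = (\<integral>\<^sup>+s. indicator {..t} s * mean_rate k s \<partial>lborel)"

lemma point_count_measurable: "point_count k t \<in> borel_measurable M"
  unfolding point_count_def[abs_def] by (rule thin_integral_measurable(1)[OF Lam_predictable]) simp

lemma point_count_mean: "(\<integral>\<^sup>+\<omega>. point_count k t \<omega> \<partial>M) = mean_count k t"
  unfolding point_count_def mean_count_def mean_rate_def by (rule thin_mean(1)[OF Lam_predictable]) simp

abbreviation total_mass :: ennreal where
  "total_mass \<equiv> \<Sum>k\<in>UNIV. \<zeta> k * (\<integral>\<^sup>+t. mm k t \<partial>lborel)"

lemma total_mass_finite: "total_mass < \<infinity>"
proof -
  have "\<zeta> k * (\<integral>\<^sup>+t. mm k t \<partial>lborel) < \<infinity>" for k
    using \<zeta>_fin[of k] mm_fin[of k] by (simp add: ennreal_mult_less_top)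
  then show ?thesis by (rule sum_finite_ennreal)
qed

lemma mean_rate_finite: "(\<integral>\<^sup>+t. mean_rate l t \<partial>lborel) < \<infinity>"
proof -
  have "(\<integral>\<^sup>+t. mean_rate l t \<partial>lborel) \<le> (\<Sum>l\<in>UNIV. \<integral>\<^sup>+t. mean_rate l t \<partial>lborel)"
    by (rule member_le_sum) auto
  also have "\<dots> \<le> total_mass" by (rule mean_rate_total)
  finally show ?thesis using total_mass_finite by (rule order.strict_trans1)
qed

lemma mean_count_finite: "mean_count k t < \<infinity>"
proof -
  have "mean_count k t \<le> (\<integral>\<^sup>+t. mean_rate k t \<partial>lborel)"
    unfolding mean_count_def by (intro nn_integral_mono) (auto split: split_indicator)
  then show ?thesis using mean_rate_finite by (rule order.strict_trans1)
qed

lemma point_count_AE_finite: "AE \<omega> in M. point_count k t \<omega> < \<infinity>"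
proof -
  have "(\<integral>\<^sup>+\<omega>. point_count k t \<omega> \<partial>M) \<noteq> \<infinity>"
    unfolding point_count_mean using mean_count_finite by (rule less_imp_neq)
  then have "AE \<omega> in M. point_count k t \<omega> \<noteq> \<infinity>"
    by (rule nn_integral_PInf_AE[OF point_count_measurable])
  then show ?thesis by (simp add: less_top)
qed

text \<open>Let \<open>NW l\<close> be the sum of the weight over the accepted points of component
  \<open>l\<close> and \<open>AW l\<close> its compensator. The adjoint equation gives
  \<open>point_count k t + X'\<close> for the sum of the \<open>NW l\<close>; the intensity equation
  with Fubini gives \<open>c + X'\<close> for the sum of the \<open>AW l\<close>, with the same
  \<open>X'\<close>. Subtraction leaves the centred count as a sum of compensated integrals, whose
  second moments are controlled by \<open>weight_le\<close> and \<open>mean_rate_total\<close>. The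
  factor \<open>CARD('p)\<close> comes from Cauchy-Schwarz.\<close>

theorem point_count_fluctuation:
  "(\<integral>\<^sup>+\<omega>. ennreal ((enn2real (point_count k t \<omega>) - enn2real (mean_count k t))\<^sup>2) \<partial>M) \<le>
    of_nat CARD('p) * ((\<Sum>l\<in>UNIV. \<zeta> l)\<^sup>2 * total_mass)"
proof -
  define W where "W = weight k t"
  have W: "W l \<in> borel_measurable borel" for l unfolding W_def by (rule weight_measurable)
  define V where "V j l r = (\<integral>\<^sup>+s. W j s * ga s * ph j l (s - r) \<partial>lborel)" for j l r
  have V: "V j l \<in> borel_measurable borel" for j l
    unfolding V_def[abs_def] by (rule weight_step_measurable(2)[OF W])
  define NW where "NW l \<omega> = (\<integral>\<^sup>+z. W l (snd z) * thin (Lam l) (mark \<omega> z) \<partial>\<kappa> l \<omega>)" for l \<omega>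
  define AW where "AW l \<omega> = (\<integral>\<^sup>+s. W l s * Lam l (\<omega>, s) \<partial>lborel)" for l \<omega>
  define X where "X j l \<omega> = (\<integral>\<^sup>+z. V j l (snd z) * thin (Lam l) (mark \<omega> z) \<partial>\<kappa> l \<omega>)" for j l \<omega>
  define X' where "X' \<omega> = (\<Sum>l\<in>UNIV. \<Sum>j\<in>UNIV. X j l \<omega>)" for \<omega>
  define c where "c = (\<Sum>l\<in>UNIV. \<integral>\<^sup>+s. W l s * mm l s \<partial>lborel)"
  have NWm[measurable]: "NW l \<in> borel_measurable M" for l
    unfolding NW_def[abs_def] by (rule thin_integral_measurable(1)[OF Lam_predictable W])
  have AWm[measurable]: "AW l \<in> borel_measurable M" for l
    unfolding AW_def[abs_def] by (rule thin_integral_measurable(2)[OF Lam_predictable W])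
  have Xm[measurable]: "X j l \<in> borel_measurable M" for j l
    unfolding X_def[abs_def] by (rule thin_integral_measurable(1)[OF Lam_predictable V])
  have X'm[measurable]: "X' \<in> borel_measurable M" unfolding X'_def[abs_def] by measurable
  note cm[measurable] = point_count_measurable[of k t]
  have id1: "(\<Sum>l\<in>UNIV. NW l \<omega>) = point_count k t \<omega> + X' \<omega>" if \<omega>: "\<omega> \<in> space M" for \<omega>
  proof -
    have "NW l \<omega> = (if l = k then point_count k t \<omega> else 0) + (\<Sum>j\<in>UNIV. X j l \<omega>)" for l
    proof -
      have "NW l \<omega> = (\<integral>\<^sup>+z. (if l = k then indicator {..t} (snd z) else 0) * thin (Lam l) (mark \<omega> z) +
          (\<Sum>j\<in>UNIV. V j l (snd z) * thin (Lam l) (mark \<omega> z)) \<partial>\<kappa> l \<omega>)"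
        unfolding NW_def
      proof (rule nn_integral_cong)
        fix z
        show "W l (snd z) * thin (Lam l) (mark \<omega> z) =
            (if l = k then indicator {..t} (snd z) else 0) * thin (Lam l) (mark \<omega> z) +
            (\<Sum>j\<in>UNIV. V j l (snd z) * thin (Lam l) (mark \<omega> z))"
          unfolding W_def weight_eq[of k t l "snd z"] V_def
          by (simp add: distrib_right sum_distrib_right split: split_indicator)
      qed
      also have "\<dots> = (\<integral>\<^sup>+z. (if l = k then indicator {..t} (snd z) else 0) * thin (Lam l) (mark \<omega> z) \<partial>\<kappa> l \<omega>) +
          (\<Sum>j\<in>UNIV. X j l \<omega>)"
      proof -
        have "(\<lambda>z. (if l = k then indicator {..t} (snd z) else 0) * thin (Lam l) (mark \<omega> z)) \<in> borel_measurable (\<kappa> l \<omega>)"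
          by (rule thin_integrand_measurable[OF Lam_predictable _ \<omega>, of "\<lambda>s. if l = k then indicator {..t} s else 0"]) simp
        moreover have "(\<lambda>z. V j l (snd z) * thin (Lam l) (mark \<omega> z)) \<in> borel_measurable (\<kappa> l \<omega>)" for j
          by (rule thin_integrand_measurable[OF Lam_predictable V \<omega>])
        ultimately show ?thesis
          by (simp only: X_def nn_integral_add borel_measurable_sum nn_integral_sum)
      qed
      also have "(\<integral>\<^sup>+z. (if l = k then indicator {..t} (snd z) else 0) * thin (Lam l) (mark \<omega> z) \<partial>\<kappa> l \<omega>) =
          (if l = k then point_count k t \<omega> else 0)"
        by (cases "l = k") (simp_all add: point_count_def)
      finally show ?thesis .
    qed
    then show ?thesis by (simp add: sum.distrib X'_def)
  qed
  have id2: "(\<Sum>l\<in>UNIV. AW l \<omega>) = c + X' \<omega>" if \<omega>: "\<omega> \<in> space M" for \<omega>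
  proof -
    have "AW l \<omega> = (\<integral>\<^sup>+s. W l s * mm l s \<partial>lborel) + (\<Sum>j\<in>UNIV. X l j \<omega>)" for l
    proof -
      define J where "J j s = (\<integral>\<^sup>+z. ph l j (s - snd z) * thin (Lam j) (mark \<omega> z) \<partial>\<kappa> j \<omega>)" for j s
      have joint: "(\<lambda>(s, z). W l s * ga s * (ph l j (s - snd z) * thin (Lam j) (mark \<omega> z))) \<in>
          borel_measurable (borel \<Otimes>\<^sub>M (borel :: (real \<times> real) measure))" for j
      proof -
        have snd: "snd \<in> borel_measurable (borel :: (real \<times> real) measure)"
          by (auto intro!: borel_measurable_continuous_onI continuous_intros)
        have "(\<lambda>x. ph l j (fst x - snd (snd x))) \<in> borel_measurable (borel \<Otimes>\<^sub>M (borel :: (real \<times> real) measure))"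
          by (rule measurable_compose[OF borel_measurable_diff[OF measurable_fst measurable_compose[OF measurable_snd snd]] ph])
        moreover have "(\<lambda>x. thin (Lam j) (mark \<omega> (snd x))) \<in> borel_measurable (borel \<Otimes>\<^sub>M (borel :: (real \<times> real) measure))"
          by (rule measurable_compose[OF measurable_snd measurable_compose[OF measurable_mark[OF \<omega>] thin_measurable[OF Lam_predictable]]])
        moreover have "(\<lambda>x. W l (fst x) * ga (fst x)) \<in> borel_measurable (borel \<Otimes>\<^sub>M (borel :: (real \<times> real) measure))"
          by (intro borel_measurable_times_ennreal measurable_compose[OF measurable_fst W] measurable_compose[OF measurable_fst ga])
        ultimately show ?thesis unfolding case_prod_beta'
          by (rule borel_measurable_times_ennreal[rotated, OF borel_measurable_times_ennreal])
      qed
      have slice: "(\<lambda>z. ph l j (s - snd z) * thin (Lam j) (mark \<omega> z)) \<in> borel_measurable (\<kappa> j \<omega>)" for j s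
        by (rule thin_integrand_measurable[OF Lam_predictable ph_shift_measurable(1) \<omega>])
      have J_inner: "W l s * ga s * J j s =
          (\<integral>\<^sup>+z. W l s * ga s * (ph l j (s - snd z) * thin (Lam j) (mark \<omega> z)) \<partial>\<kappa> j \<omega>)" for j s
        unfolding J_def by (rule nn_integral_cmult[symmetric, OF slice])
      have Jm: "(\<lambda>s. W l s * ga s * J j s) \<in> borel_measurable borel" for j
      proof -
        interpret sigma_finite_measure "\<kappa> j \<omega>" by (rule \<kappa>_sigma_finite[OF \<omega>])
        have "sets (borel \<Otimes>\<^sub>M \<kappa> j \<omega>) = sets (borel \<Otimes>\<^sub>M borel)"
          by (rule sets_pair_measure_cong) (simp_all add: sets_\<kappa>[OF \<omega>])
        note eq = measurable_cong_sets[OF this refl]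
        show ?thesis unfolding J_inner
          by (rule borel_measurable_nn_integral) (unfold eq, rule joint)
      qed
      \<comment> \<open>Integrating first over the time \<open>s\<close> of the excited intensity
        and then over the exciting point \<open>z\<close> turns weight times kernel into
        \<open>V\<close>. This produces exactly the terms of \<open>X'\<close>, with the two indices
        interchanged.\<close>
      have Xj: "(\<integral>\<^sup>+s. W l s * ga s * J j s \<partial>lborel) = X l j \<omega>" for j
      proof -
        have "(\<integral>\<^sup>+s. W l s * ga s * J j s \<partial>lborel) =
            (\<integral>\<^sup>+z. \<integral>\<^sup>+s. W l s * ga s * (ph l j (s - snd z) * thin (Lam j) (mark \<omega> z)) \<partial>lborel \<partial>\<kappa> j \<omega>)"
          unfolding J_inner by (rule \<kappa>_Fubini[OF joint \<omega>])
        also have "\<dots> = X l j \<omega>"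
          unfolding X_def V_def
        proof (rule nn_integral_cong)
          fix z
          show "(\<integral>\<^sup>+s. W l s * ga s * (ph l j (s - snd z) * thin (Lam j) (mark \<omega> z)) \<partial>lborel) =
              (\<integral>\<^sup>+s. W l s * ga s * ph l j (s - snd z) \<partial>lborel) * thin (Lam j) (mark \<omega> z)"
            unfolding mult.assoc[symmetric, of _ _ "thin _ _"]
            by (rule nn_integral_multc) (simp add: weight_step_measurable(1)[OF W])
        qed
        finally show ?thesis .
      qed
      have "AW l \<omega> = (\<integral>\<^sup>+s. W l s * mm l s + (\<Sum>j\<in>UNIV. W l s * ga s * J j s) \<partial>lborel)"
        unfolding AW_def Lam_eq[OF \<omega>] J_def by (simp add: distrib_left sum_distrib_left mult.assoc)
      also have "\<dots> = (\<integral>\<^sup>+s. W l s * mm l s \<partial>lborel) + (\<Sum>j\<in>UNIV. \<integral>\<^sup>+s. W l s * ga s * J j s \<partial>lborel)"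
        using Jm borel_measurable_times_ennreal[OF W[of l] mm[of l]]
        by (subst nn_integral_add) (simp_all add: nn_integral_sum)
      finally show ?thesis by (simp only: Xj)
    qed
    then have "(\<Sum>l\<in>UNIV. AW l \<omega>) = c + (\<Sum>l\<in>UNIV. \<Sum>j\<in>UNIV. X l j \<omega>)" by (simp add: sum.distrib c_def)
    then show ?thesis unfolding X'_def by (subst sum.swap)
  qed
  have mean_NW: "(\<integral>\<^sup>+\<omega>. NW l \<omega> \<partial>M) = (\<integral>\<^sup>+s. W l s * mean_rate l s \<partial>lborel)" for l
    unfolding NW_def mean_rate_def by (rule thin_mean(1)[OF Lam_predictable W])
  have mean_AW: "(\<integral>\<^sup>+\<omega>. AW l \<omega> \<partial>M) = (\<integral>\<^sup>+s. W l s * mean_rate l s \<partial>lborel)" for l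
    unfolding AW_def mean_rate_def by (rule thin_mean(2)[OF Lam_predictable W])
  have mean_fin: "(\<integral>\<^sup>+s. W l s * mean_rate l s \<partial>lborel) < \<infinity>" for l
  proof -
    have "(\<integral>\<^sup>+s. W l s * mean_rate l s \<partial>lborel) \<le> (\<integral>\<^sup>+s. \<zeta> l * mean_rate l s \<partial>lborel)"
      unfolding W_def by (intro nn_integral_mono mult_right_mono weight_le) simp
    also have "\<dots> = \<zeta> l * (\<integral>\<^sup>+s. mean_rate l s \<partial>lborel)"
      by (rule nn_integral_cmult) (simp add: mean_rate_measurable)
    also have "\<dots> < \<infinity>" using \<zeta>_fin[of l] mean_rate_finite[of l] by (simp add: ennreal_mult_less_top)
    finally show ?thesis .
  qed
  have S_fin: "(\<Sum>l\<in>UNIV. \<integral>\<^sup>+s. W l s * mean_rate l s \<partial>lborel) < \<infinity>"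
    using mean_fin by (rule sum_finite_ennreal)
  have e1: "(\<Sum>l\<in>UNIV. \<integral>\<^sup>+s. W l s * mean_rate l s \<partial>lborel) = mean_count k t + (\<integral>\<^sup>+\<omega>. X' \<omega> \<partial>M)"
  proof -
    have "(\<Sum>l\<in>UNIV. \<integral>\<^sup>+s. W l s * mean_rate l s \<partial>lborel) = (\<integral>\<^sup>+\<omega>. (\<Sum>l\<in>UNIV. NW l \<omega>) \<partial>M)"
      by (simp add: nn_integral_sum mean_NW)
    also have "\<dots> = (\<integral>\<^sup>+\<omega>. point_count k t \<omega> + X' \<omega> \<partial>M)" by (rule nn_integral_cong) (rule id1)
    also have "\<dots> = mean_count k t + (\<integral>\<^sup>+\<omega>. X' \<omega> \<partial>M)"
      by (simp add: nn_integral_add point_count_mean)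
    finally show ?thesis .
  qed
  have e2: "(\<Sum>l\<in>UNIV. \<integral>\<^sup>+s. W l s * mean_rate l s \<partial>lborel) = c + (\<integral>\<^sup>+\<omega>. X' \<omega> \<partial>M)"
  proof -
    have "(\<Sum>l\<in>UNIV. \<integral>\<^sup>+s. W l s * mean_rate l s \<partial>lborel) = (\<integral>\<^sup>+\<omega>. (\<Sum>l\<in>UNIV. AW l \<omega>) \<partial>M)"
      by (simp add: nn_integral_sum mean_AW)
    also have "\<dots> = (\<integral>\<^sup>+\<omega>. c + X' \<omega> \<partial>M)" by (rule nn_integral_cong) (rule id2)
    also have "\<dots> = c + (\<integral>\<^sup>+\<omega>. X' \<omega> \<partial>M)"
      by (simp add: nn_integral_add emeasure_space_1)
    finally show ?thesis .
  qed
  have X'_fin: "(\<integral>\<^sup>+\<omega>. X' \<omega> \<partial>M) < \<infinity>" using S_fin unfolding e2 by simp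
  \<comment> \<open>The two identities have the same expectation on the left, and \<open>X'\<close>
    has finite mean, so the deterministic term must be the mean count.\<close>
  have c_eq: "c = mean_count k t"
  proof -
    have "(\<integral>\<^sup>+\<omega>. X' \<omega> \<partial>M) + c = (\<integral>\<^sup>+\<omega>. X' \<omega> \<partial>M) + mean_count k t"
      using e1 e2 by (simp add: add.commute)
    then show ?thesis using X'_fin unfolding ennreal_add_left_cancel by auto
  qed
  have "AE \<omega> in M. NW l \<omega> \<noteq> \<infinity>" for l
    by (rule nn_integral_PInf_AE[OF NWm]) (unfold mean_NW, rule less_imp_neq[OF mean_fin])
  then have AE_NW: "AE \<omega> in M. \<forall>l. NW l \<omega> \<noteq> \<infinity>" by (rule eventually_all_finite)
  have "AE \<omega> in M. AW l \<omega> \<noteq> \<infinity>" for l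
    by (rule nn_integral_PInf_AE[OF AWm]) (unfold mean_AW, rule less_imp_neq[OF mean_fin])
  then have AE_AW: "AE \<omega> in M. \<forall>l. AW l \<omega> \<noteq> \<infinity>" by (rule eventually_all_finite)
  have AE_X': "AE \<omega> in M. X' \<omega> \<noteq> \<infinity>"
    by (rule nn_integral_PInf_AE[OF X'm]) (rule less_imp_neq[OF X'_fin])
  note AE1 = AE_NW AE_AW AE_X'
  have diff: "AE \<omega> in M. enn2real (point_count k t \<omega>) - enn2real (mean_count k t) =
      (\<Sum>l\<in>UNIV. enn2real (NW l \<omega>) - enn2real (AW l \<omega>))"
    using AE1 AE_space point_count_AE_finite[of k t]
  proof eventually_elim
    case (elim \<omega>)
    have "enn2real (\<Sum>l\<in>UNIV. NW l \<omega>) = (\<Sum>l\<in>UNIV. enn2real (NW l \<omega>))"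
      by (rule enn2real_sum_finite) (use elim in \<open>auto simp: less_top\<close>)
    moreover have "enn2real (\<Sum>l\<in>UNIV. AW l \<omega>) = (\<Sum>l\<in>UNIV. enn2real (AW l \<omega>))"
      by (rule enn2real_sum_finite) (use elim in \<open>auto simp: less_top\<close>)
    moreover have "enn2real (point_count k t \<omega> + X' \<omega>) = enn2real (point_count k t \<omega>) + enn2real (X' \<omega>)"
      by (rule enn2real_plus) (use elim in \<open>auto simp: less_top\<close>)
    moreover have "enn2real (c + X' \<omega>) = enn2real c + enn2real (X' \<omega>)"
      by (rule enn2real_plus) (use elim mean_count_finite[of k t] c_eq in \<open>auto simp: less_top\<close>)
    ultimately show ?case
      using id1[OF elim(4)] id2[OF elim(4)] c_eq by (simp add: sum_subtractf)
  qed
  have comp: "(\<integral>\<^sup>+\<omega>. ennreal ((enn2real (NW l \<omega>) - enn2real (AW l \<omega>))\<^sup>2) \<partial>M) \<le>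
      (\<zeta> l)\<^sup>2 * (\<integral>\<^sup>+s. mean_rate l s \<partial>lborel)" for l
  proof -
    let ?f = "\<lambda>q. W l (snd (fst q)) * thin (Lam l) q"
    have fm: "?f \<in> borel_measurable MPred"
      by (intro borel_measurable_times_ennreal thin_measurable Lam_predictable
          measurable_compose[OF measurable_fst measurable_time[OF W]])
    have f_mark: "?f (mark \<omega> z) = W l (snd z) * thin (Lam l) (mark \<omega> z)" for \<omega> z by (simp add: mark_def)
    have f_path: "(\<integral>\<^sup>+z. ?f (mark \<omega> z) \<partial>lborel) = AW l \<omega>" if "\<omega> \<in> space M" for \<omega>
      unfolding f_mark AW_def by (rule thin_path_integral[OF Lam_predictable W that])
    have "(\<integral>\<^sup>+\<omega>. \<integral>\<^sup>+z. ?f (mark \<omega> z) \<partial>lborel \<partial>M) = (\<integral>\<^sup>+\<omega>. AW l \<omega> \<partial>M)"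
      by (rule nn_integral_cong) (rule f_path)
    then have fin: "(\<integral>\<^sup>+\<omega>. \<integral>\<^sup>+z. ?f (mark \<omega> z) \<partial>lborel \<partial>M) < \<infinity>" using mean_AW mean_fin by simp
    have "(\<integral>\<^sup>+\<omega>. ennreal ((enn2real (NW l \<omega>) - enn2real (AW l \<omega>))\<^sup>2) \<partial>M) =
        (\<integral>\<^sup>+\<omega>. ennreal ((enn2real (\<integral>\<^sup>+z. ?f (mark \<omega> z) \<partial>\<kappa> l \<omega>) - enn2real (\<integral>\<^sup>+z. ?f (mark \<omega> z) \<partial>lborel))\<^sup>2) \<partial>M)"
      by (rule nn_integral_cong) (simp only: f_path, simp only: f_mark NW_def)
    also have "\<dots> \<le> (\<integral>\<^sup>+\<omega>. \<integral>\<^sup>+z. (?f (mark \<omega> z))\<^sup>2 \<partial>lborel \<partial>M)"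
      by (rule compensated_second_moment[OF fm fin])
    \<comment> \<open>\<open>thin\<close> takes the values zero and one, so squaring affects the
      weight alone.\<close>
    also have "\<dots> = (\<integral>\<^sup>+\<omega>. \<integral>\<^sup>+z. (W l (snd z))\<^sup>2 * thin (Lam l) (mark \<omega> z) \<partial>lborel \<partial>M)"
      by (intro nn_integral_cong) (simp add: mark_def power_mult_distrib thin_def)
    also have "\<dots> = (\<integral>\<^sup>+\<omega>. \<integral>\<^sup>+s. (W l s)\<^sup>2 * Lam l (\<omega>, s) \<partial>lborel \<partial>M)"
      by (intro nn_integral_cong thin_path_integral[OF Lam_predictable]) (use W in simp)
    also have "\<dots> = (\<integral>\<^sup>+s. (W l s)\<^sup>2 * mean_rate l s \<partial>lborel)"
      unfolding mean_rate_def by (rule thin_mean(2)[OF Lam_predictable]) (use W in simp)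
    also have "\<dots> \<le> (\<integral>\<^sup>+s. (\<zeta> l)\<^sup>2 * mean_rate l s \<partial>lborel)"
      unfolding W_def by (intro nn_integral_mono mult_right_mono power_mono weight_le) simp_all
    also have "\<dots> = (\<zeta> l)\<^sup>2 * (\<integral>\<^sup>+s. mean_rate l s \<partial>lborel)"
      by (rule nn_integral_cmult) (simp add: mean_rate_measurable)
    finally show ?thesis .
  qed
  have "(\<integral>\<^sup>+\<omega>. ennreal ((enn2real (point_count k t \<omega>) - enn2real (mean_count k t))\<^sup>2) \<partial>M) =
      (\<integral>\<^sup>+\<omega>. ennreal ((\<Sum>l\<in>UNIV. enn2real (NW l \<omega>) - enn2real (AW l \<omega>))\<^sup>2) \<partial>M)"
    by (rule nn_integral_cong_AE) (use diff in eventually_elim, simp)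
  also have "\<dots> \<le> (\<integral>\<^sup>+\<omega>. of_nat CARD('p) * (\<Sum>l\<in>UNIV. ennreal ((enn2real (NW l \<omega>) - enn2real (AW l \<omega>))\<^sup>2)) \<partial>M)"
  proof (rule nn_integral_mono)
    fix \<omega>
    have "ennreal ((\<Sum>l\<in>UNIV. enn2real (NW l \<omega>) - enn2real (AW l \<omega>))\<^sup>2) \<le>
        ennreal (real CARD('p) * (\<Sum>l\<in>UNIV. (enn2real (NW l \<omega>) - enn2real (AW l \<omega>))\<^sup>2))"
      using sum_squared_le_sum_of_squares[of "\<lambda>l. enn2real (NW l \<omega>) - enn2real (AW l \<omega>)" UNIV]
      by (intro ennreal_leI) (simp add: mult.commute)
    then show "ennreal ((\<Sum>l\<in>UNIV. enn2real (NW l \<omega>) - enn2real (AW l \<omega>))\<^sup>2) \<le>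
        of_nat CARD('p) * (\<Sum>l\<in>UNIV. ennreal ((enn2real (NW l \<omega>) - enn2real (AW l \<omega>))\<^sup>2))"
      by (simp add: ennreal_mult sum_nonneg ennreal_of_nat_eq_real_of_nat)
  qed
  also have "\<dots> = of_nat CARD('p) * (\<Sum>l\<in>UNIV. \<integral>\<^sup>+\<omega>. ennreal ((enn2real (NW l \<omega>) - enn2real (AW l \<omega>))\<^sup>2) \<partial>M)"
    by (simp add: nn_integral_cmult nn_integral_sum del: sum_ennreal)
  also have "\<dots> \<le> of_nat CARD('p) * (\<Sum>l\<in>UNIV. (\<Sum>l\<in>UNIV. \<zeta> l)\<^sup>2 * (\<integral>\<^sup>+s. mean_rate l s \<partial>lborel))"
    by (intro mult_left_mono sum_mono order.trans[OF comp] mult_right_mono power_mono member_le_sum) simp_all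
  also have "\<dots> \<le> of_nat CARD('p) * ((\<Sum>l\<in>UNIV. \<zeta> l)\<^sup>2 * total_mass)"
    unfolding sum_distrib_left[symmetric] by (intro mult_left_mono mean_rate_total) simp_all
  finally show ?thesis .
qed

end

section \<open>The limiting linear system and data stretched to a time horizon\<close>

text \<open>The deterministic side: \<open>y\<close> solves the limiting linear system at each
  macroscopic time \<open>x\<close>. \<open>c\<close> and \<open>\<zeta>\<close> are parameters of
  their own, not computed from \<open>g\<close>, so that perturbed data can share them and all
  constants stay fixed under perturbation.\<close>

locale limit_data =
  fixes m :: "'p::finite \<Rightarrow> real \<Rightarrow> real" and g :: "real \<Rightarrow> real" and \<phi> :: "'p \<Rightarrow> 'p \<Rightarrow> real \<Rightarrow> real"
    and K :: "'p \<Rightarrow> 'p \<Rightarrow> real" and c :: real and \<zeta> :: "'p \<Rightarrow> real" and y :: "'p \<Rightarrow> real \<Rightarrow> real"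
  assumes m_cont: "continuous_on {0..1} (m k)" and m_nonneg: "x \<in> {0..1} \<Longrightarrow> 0 \<le> m k x"
    and g_cont: "continuous_on {0..1} g" and g_nonneg: "x \<in> {0..1} \<Longrightarrow> 0 \<le> g x"
    and g_le: "x \<in> {0..1} \<Longrightarrow> g x \<le> c" and c_nonneg: "0 \<le> c"
    and \<phi>_nonneg: "0 \<le> t \<Longrightarrow> 0 \<le> \<phi> k l t" and \<phi>_int: "set_integrable lborel {0..} (\<phi> k l)"
    and K_def: "K k l = (LBINT t:{0..}. \<phi> k l t)"
    and \<zeta>: "1 + (\<Sum>k\<in>UNIV. \<zeta> k * (c * K k l)) \<le> \<zeta> l" and \<zeta>_nonneg: "0 \<le> \<zeta> l"
    and y_eq: "x \<in> {0..1} \<Longrightarrow> y k x = m k x + g x * (\<Sum>l\<in>UNIV. K k l * y l x)"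
begin

lemma K_nonneg: "0 \<le> K k l"
  unfolding K_def set_lebesgue_integral_def
  by (rule integral_nonneg_AE) (auto intro!: AE_I2 simp: \<phi>_nonneg split: split_indicator)

lemma perturbation:
  assumes d: "\<And>k. \<bar>d k\<bar> \<le> r k + c * (\<Sum>l\<in>UNIV. K k l * \<bar>d l\<bar>)"
  shows "(\<Sum>l\<in>UNIV. \<bar>d l\<bar>) \<le> (\<Sum>k\<in>UNIV. \<zeta> k * r k)"
  by (rule weighted_sum_bound[where B="\<lambda>k l. c * K k l"])
    (use d \<zeta> \<zeta>_nonneg in \<open>simp_all add: sum_distrib_left mult.assoc\<close>)

lemma perturbation_at:
  assumes x: "x \<in> {0..1}" and d: "\<And>k. \<bar>d k\<bar> \<le> r k + g x * (\<Sum>l\<in>UNIV. K k l * \<bar>d l\<bar>)"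
  shows "(\<Sum>l\<in>UNIV. \<bar>d l\<bar>) \<le> (\<Sum>k\<in>UNIV. \<zeta> k * r k)"
proof (rule perturbation)
  fix k
  have "g x * (\<Sum>l\<in>UNIV. K k l * \<bar>d l\<bar>) \<le> c * (\<Sum>l\<in>UNIV. K k l * \<bar>d l\<bar>)"
    by (intro mult_right_mono g_le x sum_nonneg mult_nonneg_nonneg K_nonneg abs_ge_zero)
  with d[of k] show "\<bar>d k\<bar> \<le> r k + c * (\<Sum>l\<in>UNIV. K k l * \<bar>d l\<bar>)" by linarith
qed

lemma abs_weighted_sum: "\<bar>\<Sum>l\<in>UNIV. K k l * v l\<bar> \<le> (\<Sum>l\<in>UNIV. K k l * \<bar>v l\<bar>)"
  by (rule order.trans[OF sum_abs]) (simp add: abs_mult K_nonneg)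

text \<open>Subtract the systems at \<open>x\<close> and \<open>x0\<close>: the difference of the
  solutions solves a system of the same kind with residual \<open>r k x\<close>, which tends to zero
  with the increments of \<open>m\<close> and \<open>g\<close>.\<close>

lemma y_cont: "continuous_on {0..1} (y k)"
  unfolding continuous_on_def
proof
  fix x0 :: real assume x0: "x0 \<in> {0..1}"
  define r where "r k x = \<bar>m k x - m k x0\<bar> + \<bar>g x - g x0\<bar> * (\<Sum>l\<in>UNIV. K k l * \<bar>y l x0\<bar>)" for k x
  have bound: "\<bar>y k x - y k x0\<bar> \<le> (\<Sum>k\<in>UNIV. \<zeta> k * r k x)" if x: "x \<in> {0..1}" for x
  proof -
    have "\<bar>y k x - y k x0\<bar> \<le> (\<Sum>l\<in>UNIV. \<bar>y l x - y l x0\<bar>)"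
      by (rule member_le_sum[of k UNIV "\<lambda>l. \<bar>y l x - y l x0\<bar>"]) auto
    also have "\<dots> \<le> (\<Sum>k\<in>UNIV. \<zeta> k * r k x)"
    proof (rule perturbation_at[OF x])
      fix k
      have "y k x - y k x0 = (m k x - m k x0) + (g x - g x0) * (\<Sum>l\<in>UNIV. K k l * y l x0) +
          g x * (\<Sum>l\<in>UNIV. K k l * (y l x - y l x0))"
        unfolding y_eq[OF x, of k] y_eq[OF x0, of k] by (simp add: algebra_simps sum_subtractf)
      also have "\<bar>\<dots>\<bar> \<le> \<bar>m k x - m k x0\<bar> + \<bar>g x - g x0\<bar> * \<bar>\<Sum>l\<in>UNIV. K k l * y l x0\<bar> +
          g x * \<bar>\<Sum>l\<in>UNIV. K k l * (y l x - y l x0)\<bar>"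
        by (rule order.trans[OF abs_triangle_ineq add_mono[OF abs_triangle_ineq[THEN order.trans]]])
          (simp_all add: abs_mult g_nonneg[OF x])
      also have "\<dots> \<le> r k x + g x * (\<Sum>l\<in>UNIV. K k l * \<bar>y l x - y l x0\<bar>)"
        unfolding r_def by (intro add_mono mult_left_mono abs_weighted_sum order.refl g_nonneg[OF x]) simp
      finally show "\<bar>y k x - y k x0\<bar> \<le> r k x + g x * (\<Sum>l\<in>UNIV. K k l * \<bar>y l x - y l x0\<bar>)" .
    qed
    finally show ?thesis .
  qed
  have "((\<lambda>x. \<Sum>k\<in>UNIV. \<zeta> k * r k x) \<longlongrightarrow> (\<Sum>k\<in>UNIV. \<zeta> k * r k x0)) (at x0 within {0..1})"
    unfolding r_def using m_cont g_cont x0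
    by (intro tendsto_intros) (auto simp: continuous_on_def)
  then have lim: "((\<lambda>x. \<Sum>k\<in>UNIV. \<zeta> k * r k x) \<longlongrightarrow> 0) (at x0 within {0..1})" by (simp add: r_def)
  have "((\<lambda>x. y k x - y k x0) \<longlongrightarrow> 0) (at x0 within {0..1})"
    by (rule Lim_null_comparison[OF _ lim]) (use bound in \<open>auto simp: eventually_at_filter\<close>)
  then show "(y k \<longlongrightarrow> y k x0) (at x0 within {0..1})" by (simp add: LIM_zero_iff)
qed

lemma y_bounded: obtains B where "0 \<le> B" "\<And>k x. x \<in> {0..1} \<Longrightarrow> \<bar>y k x\<bar> \<le> B"
proof -
  have "\<exists>b. \<forall>x\<in>{0..1}. \<bar>y k x\<bar> \<le> b" for k
  proof -
    have "compact (y k ` {0..1})" by (intro compact_continuous_image y_cont) simp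
    then have "bounded (y k ` {0..1})" by (rule compact_imp_bounded)
    then show ?thesis by (auto simp: bounded_iff)
  qed
  then obtain b where b: "\<And>k x. x \<in> {0..1} \<Longrightarrow> \<bar>y k x\<bar> \<le> b k" by metis
  show ?thesis
  proof (rule that[of "\<Sum>k\<in>UNIV. \<bar>b k\<bar>"])
    fix k and x :: real assume "x \<in> {0..1}"
    from b[OF this, of k] have "\<bar>y k x\<bar> \<le> \<bar>b k\<bar>" by simp
    also have "\<dots> \<le> (\<Sum>k\<in>UNIV. \<bar>b k\<bar>)" by (rule member_le_sum[of k UNIV "\<lambda>k. \<bar>b k\<bar>"]) auto
    finally show "\<bar>y k x\<bar> \<le> (\<Sum>k\<in>UNIV. \<bar>b k\<bar>)" .
  qed (simp add: sum_nonneg)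
qed

text \<open>The delay zero is removed, in accordance with the integral over \<open>{0..<t}\<close>
  in \<open>hawkes_intensity\<close>. A single point does not change the mass
  \<open>K k l\<close>.\<close>

definition ph :: "'p \<Rightarrow> 'p \<Rightarrow> real \<Rightarrow> ennreal" where
  "ph k l t = ennreal (indicator {0<..} t * \<phi> k l t)"

definition mmH :: "real \<Rightarrow> 'p \<Rightarrow> real \<Rightarrow> ennreal" where
  "mmH H k t = ennreal (indicator {0..H} t * m k (t / H))"

definition gaH :: "real \<Rightarrow> real \<Rightarrow> ennreal" where
  "gaH H t = ennreal (indicator {0..H} t * g (t / H))"

lemma phr_measurable: "(\<lambda>t. indicator {0<..} t * \<phi> k l t) \<in> borel_measurable borel"
proof -
  have "(\<lambda>t. indicator {0..} t *\<^sub>R \<phi> k l t) \<in> borel_measurable borel"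
  proof -
    have "(\<lambda>t. indicator {0..} t *\<^sub>R \<phi> k l t) \<in> borel_measurable lborel"
      using \<phi>_int[of k l] unfolding set_integrable_def by (rule borel_measurable_integrable)
    then show ?thesis by simp
  qed
  then have "(\<lambda>t. indicator {0<..} t * (indicator {0..} t *\<^sub>R \<phi> k l t)) \<in> borel_measurable borel" by measurable
  moreover have "indicator {0<..} t * (indicator {0..} t *\<^sub>R \<phi> k l t) = indicator {0<..} t * \<phi> k l t" for t
    by (auto split: split_indicator)
  ultimately show ?thesis by (simp only:)
qed

lemma ph_measurable: "ph k l \<in> borel_measurable borel"
  unfolding ph_def[abs_def] by (rule measurable_compose[OF phr_measurable measurable_ennreal])

lemma ph_mass: "(\<integral>\<^sup>+t. ph k l t \<partial>lborel) = ennreal (K k l)"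
proof -
  have "(\<integral>\<^sup>+t. ph k l t \<partial>lborel) = (\<integral>\<^sup>+t. ennreal (indicator {0..} t *\<^sub>R \<phi> k l t) \<partial>lborel)"
  proof (rule nn_integral_cong_AE)
    show "AE t in lborel. ph k l t = ennreal (indicator {0..} t *\<^sub>R \<phi> k l t)"
      using AE_lborel_singleton[of 0] by eventually_elim (auto simp: ph_def split: split_indicator)
  qed
  also have "\<dots> = ennreal (\<integral>t. indicator {0..} t *\<^sub>R \<phi> k l t \<partial>lborel)"
    by (rule nn_integral_eq_integral)
      (use \<phi>_int[of k l] in \<open>auto simp: set_integrable_def \<phi>_nonneg split: split_indicator\<close>)
  finally show ?thesis by (simp add: K_def set_lebesgue_integral_def)
qed

lemma phr_nonneg: "0 \<le> indicator {0<..} t * \<phi> k l t"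
  by (auto simp: \<phi>_nonneg split: split_indicator)

lemma scaled_measurable:
  fixes f :: "real \<Rightarrow> real"
  assumes f: "continuous_on {0..1} f"
  shows "(\<lambda>t. indicator {0..H} t * f (t / H) :: real) \<in> borel_measurable borel"
proof (cases "H > 0")
  case True
  have "continuous_on {0..H} (\<lambda>t. f (t / H))"
  proof (rule continuous_on_compose2[OF f])
    show "continuous_on {0..H} (\<lambda>t. t / H)"
      unfolding divide_inverse by (intro continuous_intros)
    show "(\<lambda>t. t / H) ` {0..H} \<subseteq> {0..1}" using True by (auto simp: field_simps)
  qed
  then show ?thesis
    using borel_measurable_continuous_on_indicator[of "{0..H}" "\<lambda>t. f (t / H)"] by simp
next
  case False
  have eq: "indicator {0..H} t * f (t / H) = indicator {0..H} t * f 0" for t :: real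
  proof (cases "t \<in> {0..H}")
    case True
    then have "t = 0" using False by auto
    then show ?thesis by simp
  qed simp
  have "(\<lambda>t. indicator {0..H} t * f 0) \<in> borel_measurable borel" by measurable
  then show ?thesis by (simp only: eq)
qed

lemma mmH_measurable: "mmH H k \<in> borel_measurable borel"
  unfolding mmH_def[abs_def] by (rule measurable_compose[OF scaled_measurable[OF m_cont] measurable_ennreal])

lemma gaH_measurable: "gaH H \<in> borel_measurable borel"
  unfolding gaH_def[abs_def] by (rule measurable_compose[OF scaled_measurable[OF g_cont] measurable_ennreal])

lemma gaH_le: assumes "H > 0" shows "gaH H t \<le> ennreal c"
  unfolding gaH_def using assms c_nonneg g_le[of "t / H"] by (intro ennreal_leI) (auto split: split_indicator)

lemma m_bounded: obtains B where "0 \<le> B" "\<And>k x. x \<in> {0..1} \<Longrightarrow> m k x \<le> B"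
proof -
  have "\<exists>b. \<forall>x\<in>{0..1}. \<bar>m k x\<bar> \<le> b" for k
  proof -
    have "compact (m k ` {0..1})" by (intro compact_continuous_image m_cont) simp
    then have "bounded (m k ` {0..1})" by (rule compact_imp_bounded)
    then show ?thesis by (auto simp: bounded_iff)
  qed
  then obtain b where b: "\<And>k x. x \<in> {0..1} \<Longrightarrow> \<bar>m k x\<bar> \<le> b k" by metis
  show ?thesis
  proof (rule that[of "\<Sum>k\<in>UNIV. \<bar>b k\<bar>"])
    fix k and x :: real assume "x \<in> {0..1}"
    from b[OF this, of k] have "m k x \<le> \<bar>b k\<bar>" by simp
    also have "\<dots> \<le> (\<Sum>k\<in>UNIV. \<bar>b k\<bar>)" by (rule member_le_sum[of k UNIV "\<lambda>k. \<bar>b k\<bar>"]) auto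
    finally show "m k x \<le> (\<Sum>k\<in>UNIV. \<bar>b k\<bar>)" .
  qed (simp add: sum_nonneg)
qed

text \<open>Cutting the stretched baseline off outside \<open>{0..H}\<close> gives it mass of order
  \<open>H\<close>. This is where the linear growth of the variances originates.\<close>

lemma mmH_mass: obtains B where "0 \<le> B" "\<And>H k. H > 0 \<Longrightarrow> (\<integral>\<^sup>+t. mmH H k t \<partial>lborel) \<le> ennreal (B * H)"
proof -
  obtain B where B: "0 \<le> B" "\<And>k x. x \<in> {0..1} \<Longrightarrow> m k x \<le> B" by (rule m_bounded) blast
  have "(\<integral>\<^sup>+t. mmH H k t \<partial>lborel) \<le> ennreal (B * H)" if H: "H > 0" for H k
  proof -
    have "(\<integral>\<^sup>+t. mmH H k t \<partial>lborel) \<le> (\<integral>\<^sup>+t. ennreal B * indicator {0..H} t \<partial>lborel)"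
      unfolding mmH_def using H B
      by (intro nn_integral_mono) (auto intro!: ennreal_leI split: split_indicator)
    also have "\<dots> = ennreal (B * H)" using H B by (simp add: nn_integral_cmult_indicator ennreal_mult)
    finally show ?thesis .
  qed
  with B(1) that show ?thesis by blast
qed

lemma hawkes_minimal_scaled:
  assumes H: "H > 0" and adk: "adapted_kernel M \<kappa> F"
  shows "hawkes_minimal M \<kappa> F (mmH H) (gaH H) ph (ennreal c) (\<lambda>l. ennreal (\<zeta> l))"
proof -
  interpret adapted_kernel M \<kappa> F by (rule adk)
  show ?thesis
  proof unfold_locales
    show "mmH H k \<in> borel_measurable borel" for k by (rule mmH_measurable)
    show "gaH H \<in> borel_measurable borel" by (rule gaH_measurable)
    show "ph k l \<in> borel_measurable borel" for k l by (rule ph_measurable)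
    show "ph k l t = 0" if "t \<le> 0" for k l t using that by (simp add: ph_def)
    show "gaH H t \<le> ennreal c" for t by (rule gaH_le[OF H])
    show "1 + (\<Sum>k\<in>UNIV. ennreal (\<zeta> k) * (ennreal c * (\<integral>\<^sup>+t. ph k l t \<partial>lborel))) \<le> ennreal (\<zeta> l)" for l
    proof -
      have "1 + (\<Sum>k\<in>UNIV. ennreal (\<zeta> k) * (ennreal c * (\<integral>\<^sup>+t. ph k l t \<partial>lborel))) =
          ennreal (1 + (\<Sum>k\<in>UNIV. \<zeta> k * (c * K k l)))"
        using c_nonneg \<zeta>_nonneg K_nonneg
        by (simp add: ph_mass ennreal_plus sum_nonneg flip: ennreal_mult)
      then show ?thesis using \<zeta>[of l] by (simp add: ennreal_leI)
    qed
    show "ennreal (\<zeta> l) < \<infinity>" for l by simp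
    obtain B where "\<And>H k. H > 0 \<Longrightarrow> (\<integral>\<^sup>+t. mmH H k t \<partial>lborel) \<le> ennreal (B * H)" by (rule mmH_mass) blast
    from this[OF H] show "(\<integral>\<^sup>+t. mmH H k t \<partial>lborel) < \<infinity>" for k
      by (rule order.strict_trans1) simp
    show "ennreal c * (\<integral>\<^sup>+t. ph k l t \<partial>lborel) < \<infinity>" for k l
      by (simp add: ph_mass ennreal_mult_less_top)
  qed
qed

end

section \<open>Asymptotics of the renewal equation\<close>

lemma nn_integral_tail:
  fixes p :: "real \<Rightarrow> ennreal"
  assumes p: "p \<in> borel_measurable borel" and fin: "(\<integral>\<^sup>+t. p t \<partial>lborel) < \<infinity>"
  shows "(\<lambda>n::nat. \<integral>\<^sup>+t. p t * indicator {real n<..} t \<partial>lborel) \<longlonglongrightarrow> 0"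
proof -
  have "(\<lambda>n::nat. \<integral>\<^sup>+t. p t * indicator {real n<..} t \<partial>lborel) \<longlonglongrightarrow> (\<integral>\<^sup>+t. 0 \<partial>(lborel :: real measure))"
  proof (rule nn_integral_dominated_convergence[where w=p])
    show "AE t in lborel. (\<lambda>n::nat. p t * indicator {real n<..} t) \<longlonglongrightarrow> 0"
    proof (rule AE_I2)
      fix t :: real
      obtain n0 where "t < real n0" using reals_Archimedean2 by blast
      then have "\<forall>\<^sub>F n in sequentially. p t * indicator {real n<..} t = 0"
        by (intro eventually_sequentiallyI[of n0]) (auto split: split_indicator)
      then show "(\<lambda>n::nat. p t * indicator {real n<..} t) \<longlonglongrightarrow> 0" by (rule tendsto_eventually)
    qed
  qed (use p fin in \<open>auto split: split_indicator\<close>)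
  then show ?thesis by simp
qed

context limit_data
begin

definition Yst :: "real \<Rightarrow> 'p \<Rightarrow> real \<Rightarrow> real" where
  "Yst H k t = indicator {0..H} t * y k (t / H)"

text \<open>Measures how far the slowly varying \<open>Yst H\<close> is from solving the renewal
  equation: the integrated error of replacing its value at \<open>s\<close> by its value at
  \<open>t\<close> under the kernel.\<close>

definition residual :: "real \<Rightarrow> 'p \<Rightarrow> 'p \<Rightarrow> ennreal" where
  "residual H k l = (\<integral>\<^sup>+t. indicator {0..H} t * (\<integral>\<^sup>+s. ph k l (t - s) * ennreal \<bar>Yst H l s - Yst H l t\<bar> \<partial>lborel) \<partial>lborel)"

lemma Yst_measurable: "Yst H k \<in> borel_measurable borel"
  unfolding Yst_def[abs_def] by (rule scaled_measurable[OF y_cont])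

lemma residual_joint:
  "(\<lambda>(t, s). indicator {0..H} t * (ph k l (t - s) * ennreal \<bar>Yst H l s - Yst H l t\<bar>)) \<in>
    borel_measurable (borel \<Otimes>\<^sub>M borel)"
  unfolding case_prod_beta'
  by (intro borel_measurable_times_ennreal measurable_compose[OF _ ph_measurable]
      measurable_compose[OF measurable_fst borel_measurable_indicator] measurable_compose[OF _ measurable_ennreal]
      borel_measurable_abs borel_measurable_diff measurable_compose[OF measurable_fst Yst_measurable]
      measurable_compose[OF measurable_snd Yst_measurable] measurable_fst measurable_snd) simp_all

text \<open>Split the delay at \<open>S\<close>. For delays up to \<open>S\<close> the values of
  \<open>y\<close> differ by at most \<open>\<epsilon>\<close>, except for times less than the
  delay, where one of the two values is cut off to zero: a set of length at most \<open>S\<close>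
  with error at most \<open>B\<close>. Longer delays cost at most \<open>2 * B\<close> per unit time
  and are weighted by the tail of the kernel.\<close>

lemma residual_bound:
  assumes H: "H > 0" and S: "S > 0" and \<epsilon>: "0 \<le> \<epsilon>" and B: "0 \<le> B" "\<And>k x. x \<in> {0..1} \<Longrightarrow> \<bar>y k x\<bar> \<le> B"
    and uc: "\<And>x x'. x \<in> {0..1} \<Longrightarrow> x' \<in> {0..1} \<Longrightarrow> \<bar>x - x'\<bar> \<le> S / H \<Longrightarrow> \<bar>y l x - y l x'\<bar> \<le> \<epsilon>"
  shows "residual H k l \<le> ennreal (K k l * (\<epsilon> * H + B * S)) +
    ennreal (2 * B * H) * (\<integral>\<^sup>+t. ph k l t * indicator {S<..} t \<partial>lborel)"
proof -
  let ?Y = "Yst H l"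
  have eqm: "borel_measurable (lborel \<Otimes>\<^sub>M lborel) = borel_measurable (borel \<Otimes>\<^sub>M (borel :: real measure))"
    by (intro measurable_cong_sets sets_pair_measure_cong) simp_all
  have YB: "\<bar>?Y t\<bar> \<le> B" for t
    using B(2)[of "t / H" l] B(1) H by (auto simp: Yst_def split: split_indicator)
  have Y0: "?Y t = 0" if "t < 0" for t using that by (simp add: Yst_def)
  have joint: "(\<lambda>(t, \<sigma>). ph k l \<sigma> * (indicator {0..H} t * ennreal \<bar>?Y (t - \<sigma>) - ?Y t\<bar>)) \<in>
      borel_measurable (borel \<Otimes>\<^sub>M borel)"
    unfolding case_prod_beta'
    by (intro borel_measurable_times_ennreal measurable_compose[OF measurable_snd ph_measurable]
        measurable_compose[OF measurable_fst borel_measurable_indicator] measurable_compose[OF _ measurable_ennreal]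
        borel_measurable_abs borel_measurable_diff measurable_compose[OF measurable_fst Yst_measurable]
        measurable_compose[OF _ Yst_measurable] measurable_fst measurable_snd) simp_all
  have slice: "(\<lambda>\<sigma>. ph k l \<sigma> * ennreal \<bar>?Y (t - \<sigma>) - ?Y t\<bar>) \<in> borel_measurable borel" for t
    by (intro borel_measurable_times_ennreal ph_measurable measurable_compose[OF _ measurable_ennreal]
        borel_measurable_abs borel_measurable_diff measurable_compose[OF _ Yst_measurable]) simp_all
  have slice': "(\<lambda>t. indicator {0..H} t * ennreal \<bar>?Y (t - \<sigma>) - ?Y t\<bar>) \<in> borel_measurable borel" for \<sigma>
    by (intro borel_measurable_times_ennreal measurable_compose[OF _ measurable_ennreal]
        borel_measurable_abs borel_measurable_diff measurable_compose[OF _ Yst_measurable]) simp_all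
  have "residual H k l = (\<integral>\<^sup>+t. \<integral>\<^sup>+\<sigma>. ph k l \<sigma> * (indicator {0..H} t * ennreal \<bar>?Y (t - \<sigma>) - ?Y t\<bar>) \<partial>lborel \<partial>lborel)"
    unfolding residual_def
  proof (rule nn_integral_cong)
    fix t
    have "(\<integral>\<^sup>+s. ph k l (t - s) * ennreal \<bar>?Y s - ?Y t\<bar> \<partial>lborel) = (\<integral>\<^sup>+\<sigma>. ph k l \<sigma> * ennreal \<bar>?Y (t - \<sigma>) - ?Y t\<bar> \<partial>lborel)"
      using nn_integral_shift(2)[OF slice[of t], of t] by simp
    then have "indicator {0..H} t * (\<integral>\<^sup>+s. ph k l (t - s) * ennreal \<bar>?Y s - ?Y t\<bar> \<partial>lborel) =
        (\<integral>\<^sup>+\<sigma>. indicator {0..H} t * (ph k l \<sigma> * ennreal \<bar>?Y (t - \<sigma>) - ?Y t\<bar>) \<partial>lborel)"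
      using slice[of t] by (simp add: nn_integral_cmult)
    then show "indicator {0..H} t * (\<integral>\<^sup>+s. ph k l (t - s) * ennreal \<bar>?Y s - ?Y t\<bar> \<partial>lborel) =
        (\<integral>\<^sup>+\<sigma>. ph k l \<sigma> * (indicator {0..H} t * ennreal \<bar>?Y (t - \<sigma>) - ?Y t\<bar>) \<partial>lborel)"
      by (simp only: mult.left_commute)
  qed
  also have "\<dots> = (\<integral>\<^sup>+\<sigma>. \<integral>\<^sup>+t. ph k l \<sigma> * (indicator {0..H} t * ennreal \<bar>?Y (t - \<sigma>) - ?Y t\<bar>) \<partial>lborel \<partial>lborel)"
    by (rule lborel_pair.Fubini'[symmetric]) (unfold eqm, rule joint)
  also have "\<dots> \<le> (\<integral>\<^sup>+\<sigma>. ennreal (\<epsilon> * H + B * S) * ph k l \<sigma> + ennreal (2 * B * H) * (ph k l \<sigma> * indicator {S<..} \<sigma>) \<partial>lborel)"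
  proof (rule nn_integral_mono)
    fix \<sigma> :: real
    have pull: "(\<integral>\<^sup>+t. ph k l \<sigma> * (indicator {0..H} t * ennreal \<bar>?Y (t - \<sigma>) - ?Y t\<bar>) \<partial>lborel) =
        ph k l \<sigma> * (\<integral>\<^sup>+t. indicator {0..H} t * ennreal \<bar>?Y (t - \<sigma>) - ?Y t\<bar> \<partial>lborel)"
      by (rule nn_integral_cmult) (use slice'[of \<sigma>] in simp)
    consider "\<sigma> \<le> 0" | "0 < \<sigma>" "\<sigma> \<le> S" | "S < \<sigma>" by linarith
    then show "(\<integral>\<^sup>+t. ph k l \<sigma> * (indicator {0..H} t * ennreal \<bar>?Y (t - \<sigma>) - ?Y t\<bar>) \<partial>lborel) \<le>
        ennreal (\<epsilon> * H + B * S) * ph k l \<sigma> + ennreal (2 * B * H) * (ph k l \<sigma> * indicator {S<..} \<sigma>)"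
    proof cases
      case 1
      then show ?thesis by (simp add: ph_def)
    next
      case 2
      have "(\<integral>\<^sup>+t. indicator {0..H} t * ennreal \<bar>?Y (t - \<sigma>) - ?Y t\<bar> \<partial>lborel) \<le>
          (\<integral>\<^sup>+t. ennreal \<epsilon> * indicator {0..H} t + ennreal B * indicator {0..\<sigma>} t \<partial>lborel)"
      proof (rule nn_integral_mono)
        fix t :: real
        consider "t \<notin> {0..H}" | "t \<in> {0..H}" "t < \<sigma>" | "t \<in> {0..H}" "\<sigma> \<le> t" by linarith
        then show "indicator {0..H} t * ennreal \<bar>?Y (t - \<sigma>) - ?Y t\<bar> \<le>
            ennreal \<epsilon> * indicator {0..H} t + ennreal B * indicator {0..\<sigma>} t"
        proof cases
          case 2
          then have "ennreal \<bar>?Y (t - \<sigma>) - ?Y t\<bar> \<le> ennreal B" using YB[of t] Y0[of "t - \<sigma>"] by (intro ennreal_leI) simp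
          then show ?thesis using 2 by (simp add: add_increasing)
        next
          case 3
          then have "\<bar>y l ((t - \<sigma>) / H) - y l (t / H)\<bar> \<le> \<epsilon>"
            using H \<open>0 < \<sigma>\<close> \<open>\<sigma> \<le> S\<close> by (intro uc) (auto simp: field_simps abs_if)
          then have "ennreal \<bar>?Y (t - \<sigma>) - ?Y t\<bar> \<le> ennreal \<epsilon>"
            using 3 \<open>0 < \<sigma>\<close> by (intro ennreal_leI) (simp add: Yst_def)
          then show ?thesis using 3 by (simp add: add_increasing2)
        qed simp
      qed
      also have "\<dots> = ennreal \<epsilon> * ennreal H + ennreal B * ennreal \<sigma>"
        using H 2 by (simp add: nn_integral_add nn_integral_cmult_indicator)
      also have "\<dots> = ennreal (\<epsilon> * H + B * \<sigma>)"
        using \<epsilon> H B(1) 2 by (simp add: ennreal_plus ennreal_mult)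
      also have "\<dots> \<le> ennreal (\<epsilon> * H + B * S)"
        using B(1) 2 by (intro ennreal_leI add_left_mono mult_left_mono)
      finally show ?thesis unfolding pull by (subst mult.commute) (intro add_increasing2 mult_right_mono, simp_all)
    next
      case 3
      have "(\<integral>\<^sup>+t. indicator {0..H} t * ennreal \<bar>?Y (t - \<sigma>) - ?Y t\<bar> \<partial>lborel) \<le>
          (\<integral>\<^sup>+t. ennreal (2 * B) * indicator {0..H} t \<partial>lborel)"
      proof (rule nn_integral_mono)
        fix t :: real
        have "\<bar>?Y (t - \<sigma>) - ?Y t\<bar> \<le> 2 * B" using YB[of t] YB[of "t - \<sigma>"] by linarith
        then show "indicator {0..H} t * ennreal \<bar>?Y (t - \<sigma>) - ?Y t\<bar> \<le> ennreal (2 * B) * indicator {0..H} t"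
          by (auto split: split_indicator intro: ennreal_leI)
      qed
      also have "\<dots> = ennreal (2 * B * H)" using H B(1) by (simp add: nn_integral_cmult_indicator ennreal_mult)
      finally show ?thesis unfolding pull using 3
        by (subst mult.commute) (simp add: add_increasing mult_right_mono)
    qed
  qed
  also have "\<dots> = ennreal (\<epsilon> * H + B * S) * ennreal (K k l) +
      ennreal (2 * B * H) * (\<integral>\<^sup>+t. ph k l t * indicator {S<..} t \<partial>lborel)"
    using ph_measurable[of k l] by (simp add: nn_integral_add nn_integral_cmult ph_mass)
  also have "ennreal (\<epsilon> * H + B * S) * ennreal (K k l) = ennreal (K k l * (\<epsilon> * H + B * S))"
    using K_nonneg \<epsilon> H B(1) S by (simp add: ennreal_mult mult.commute)
  finally show ?thesis .
qed

lemma residual_small: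
  assumes \<delta>: "\<delta> > 0"
  shows "\<forall>\<^sub>F H in at_top. \<forall>k l. residual H k l \<le> ennreal (\<delta> * H)"
proof -
  obtain B where B: "0 \<le> B" "\<And>k x. x \<in> {0..1} \<Longrightarrow> \<bar>y k x\<bar> \<le> B" by (rule y_bounded) blast
  define Q where "Q = (\<Sum>k\<in>UNIV. \<Sum>l\<in>UNIV. K k l) + 1"
  have KQ: "K k l \<le> Q" for k l
  proof -
    have "K k l \<le> (\<Sum>l\<in>UNIV. K k l)" by (rule member_le_sum) (auto simp: K_nonneg)
    also have "\<dots> \<le> (\<Sum>k\<in>UNIV. \<Sum>l\<in>UNIV. K k l)"
      by (rule member_le_sum[of k UNIV "\<lambda>k. \<Sum>l\<in>UNIV. K k l"]) (auto simp: K_nonneg sum_nonneg)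
    finally show ?thesis by (simp add: Q_def)
  qed
  have "0 \<le> (\<Sum>k\<in>UNIV. \<Sum>l\<in>UNIV. K k l)" by (intro sum_nonneg K_nonneg)
  then have Q: "Q > 0" unfolding Q_def by linarith
  \<comment> \<open>The oscillation, the boundary layer near time zero and the tail each get a third
    of \<open>\<delta> * H\<close>. The summand one in \<open>Q\<close> and in
    \<open>2 * B + 1\<close> keeps denominators positive.\<close>
  define \<epsilon> where "\<epsilon> = \<delta> / (3 * Q)"
  have \<epsilon>: "\<epsilon> > 0" using \<delta> Q by (simp add: \<epsilon>_def)
  define \<tau> where "\<tau> = \<delta> / (3 * (2 * B + 1))"
  have \<tau>: "\<tau> > 0" using \<delta> B by (simp add: \<tau>_def)
  have "\<forall>\<^sub>F n in sequentially. (\<integral>\<^sup>+t. ph k l t * indicator {real n<..} t \<partial>lborel) < ennreal \<tau>" for k l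
    by (rule order_tendstoD(2)[OF nn_integral_tail[OF ph_measurable]]) (simp_all add: ph_mass \<tau>)
  then have "\<forall>\<^sub>F n in sequentially. \<forall>k l. (\<integral>\<^sup>+t. ph k l t * indicator {real n<..} t \<partial>lborel) < ennreal \<tau>"
    by (intro eventually_all_finite)
  then have "\<forall>\<^sub>F n in sequentially. 0 < n \<and> (\<forall>k l. (\<integral>\<^sup>+t. ph k l t * indicator {real n<..} t \<partial>lborel) < ennreal \<tau>)"
    using eventually_gt_at_top[of 0] by eventually_elim simp
  then obtain n :: nat where n: "0 < n" "\<And>k l. (\<integral>\<^sup>+t. ph k l t * indicator {real n<..} t \<partial>lborel) < ennreal \<tau>"
    by (auto simp: eventually_sequentially)
  define S where "S = real n"
  have S: "S > 0" using n by (simp add: S_def)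
  have "\<exists>\<eta>>0. \<forall>x\<in>{0..1}. \<forall>x'\<in>{0..1}. \<bar>x - x'\<bar> < \<eta> \<longrightarrow> \<bar>y l x - y l x'\<bar> \<le> \<epsilon>" for l
  proof -
    have "uniformly_continuous_on {0..1} (y l)" by (rule compact_uniformly_continuous[OF y_cont]) simp
    from uniformly_continuous_onE[OF this \<epsilon>] obtain \<eta> where
      "\<eta> > 0" "\<And>x x'. x \<in> {0..1} \<Longrightarrow> x' \<in> {0..1} \<Longrightarrow> dist x' x < \<eta> \<Longrightarrow> dist (y l x') (y l x) < \<epsilon>" by blast
    then show ?thesis by (intro exI[of _ \<eta>]) (auto simp: dist_real_def abs_minus_commute less_imp_le)
  qed
  then obtain \<eta> where \<eta>: "\<And>l. \<eta> l > 0" "\<And>l x x'. x \<in> {0..1} \<Longrightarrow> x' \<in> {0..1} \<Longrightarrow> \<bar>x - x'\<bar> < \<eta> l \<Longrightarrow> \<bar>y l x - y l x'\<bar> \<le> \<epsilon>"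
    by metis
  have "\<forall>\<^sub>F H in at_top. S / H < \<eta> l" for l
  proof -
    have "((\<lambda>H. S / H) \<longlongrightarrow> 0) at_top" by real_asymp
    from order_tendstoD(2)[OF this \<eta>(1)] show ?thesis .
  qed
  then have "\<forall>\<^sub>F H in at_top. \<forall>l. S / H < \<eta> l" by (rule eventually_all_finite)
  moreover have "\<forall>\<^sub>F H in at_top. H > max 1 (3 * Q * B * S / \<delta>)" by (rule eventually_gt_at_top)
  ultimately show ?thesis
  proof eventually_elim
    case (elim H)
    then have H: "H > 0" and H2: "3 * Q * B * S < \<delta> * H" using \<delta> by (auto simp: field_simps)
    show ?case
    proof (intro allI)
      fix k l
      have "residual H k l \<le> ennreal (K k l * (\<epsilon> * H + B * S)) +
          ennreal (2 * B * H) * (\<integral>\<^sup>+t. ph k l t * indicator {S<..} t \<partial>lborel)"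
      proof (rule residual_bound[OF H S less_imp_le[OF \<epsilon>] B])
        fix x x' :: real assume x: "x \<in> {0..1}" "x' \<in> {0..1}" "\<bar>x - x'\<bar> \<le> S / H"
        have "S / H < \<eta> l" using elim(1) by blast
        with x(3) have "\<bar>x - x'\<bar> < \<eta> l" by (rule order.strict_trans1)
        then show "\<bar>y l x - y l x'\<bar> \<le> \<epsilon>" by (rule \<eta>(2)[OF x(1,2)])
      qed
      also have "\<dots> \<le> ennreal (Q * (\<epsilon> * H + B * S)) + ennreal (2 * B * H) * ennreal \<tau>"
        using n(2)[of k l] KQ[of k l] \<epsilon> H B(1) S
        by (intro add_mono ennreal_leI mult_right_mono mult_left_mono) (auto simp: S_def)
      also have "\<dots> = ennreal (Q * (\<epsilon> * H + B * S) + 2 * B * H * \<tau>)"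
        using \<epsilon> H B(1) S Q \<tau> by (simp add: ennreal_plus ennreal_mult)
      also have "\<dots> \<le> ennreal (\<delta> * H)"
      proof (rule ennreal_leI)
        have "Q * (\<epsilon> * H) = \<delta> * H / 3" using Q by (simp add: \<epsilon>_def)
        moreover have "Q * (B * S) \<le> \<delta> * H / 3" using H2 by (simp add: mult.assoc)
        moreover have "2 * B * H * \<tau> \<le> \<delta> * H / 3"
        proof -
          have "2 * B * \<tau> \<le> (2 * B + 1) * \<tau>" using \<tau> by (intro mult_right_mono) auto
          also have "\<dots> = \<delta> / 3"
          proof -
            have "x * (\<delta> / (3 * x)) = \<delta> / 3" if "x \<noteq> 0" for x :: real using that by simp
            then show ?thesis unfolding \<tau>_def using B(1) by (smt (verit))
          qed
          finally have "2 * B * \<tau> * H \<le> \<delta> / 3 * H" using H by (intro mult_right_mono) auto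
          then show ?thesis by (simp add: ac_simps)
        qed
        ultimately show "Q * (\<epsilon> * H + B * S) + 2 * B * H * \<tau> \<le> \<delta> * H"
          unfolding distrib_left by linarith
      qed
      finally show "residual H k l \<le> ennreal (\<delta> * H)" .
    qed
  qed
qed

end

context limit_data
begin

definition renewal_solution :: "real \<Rightarrow> ('p \<Rightarrow> real \<Rightarrow> ennreal) \<Rightarrow> bool" where
  "renewal_solution H a \<longleftrightarrow> (\<forall>k. a k \<in> borel_measurable borel) \<and> (\<forall>k. (\<integral>\<^sup>+t. a k t \<partial>lborel) < \<infinity>) \<and>
     (\<forall>k t. a k t = mmH H k t + gaH H t * (\<Sum>l\<in>UNIV. \<integral>\<^sup>+s. ph k l (t - s) * a l s \<partial>lborel))"

text \<open>The pointwise deviation \<open>e\<close> from \<open>Yst\<close> satisfies a renewal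
  inequality whose source is the integrand of \<open>residual\<close>. Integrated over time,
  convolution becomes multiplication by \<open>K k l\<close>, and the weights \<open>\<zeta>\<close>
  resolve the resulting system.\<close>

lemma renewal_deviation:
  assumes H: "H > 0" and sol: "renewal_solution H a"
  shows "(\<Sum>l\<in>UNIV. \<integral>\<^sup>+t. ennreal \<bar>enn2real (a l t) - Yst H l t\<bar> \<partial>lborel) \<le>
    (\<Sum>k\<in>UNIV. ennreal (\<zeta> k) * (ennreal c * (\<Sum>l\<in>UNIV. residual H k l)))"
proof -
  have am: "a k \<in> borel_measurable borel" and a_fin: "(\<integral>\<^sup>+t. a k t \<partial>lborel) < \<infinity>"
    and a_eq: "a k t = mmH H k t + gaH H t * (\<Sum>l\<in>UNIV. \<integral>\<^sup>+s. ph k l (t - s) * a l s \<partial>lborel)" for k t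
    using sol unfolding renewal_solution_def by blast+
  define A where "A l t = enn2real (a l t)" for l t
  have Am: "A l \<in> borel_measurable borel" for l
    unfolding A_def[abs_def] by (rule measurable_compose[OF am]) simp
  define e where "e l t = ennreal \<bar>A l t - Yst H l t\<bar>" for l t
  have em: "e l \<in> borel_measurable borel" for l
    unfolding e_def[abs_def] using Am[of l] Yst_measurable[of H l] by measurable
  define cv where "cv k l t = (\<integral>\<^sup>+s. ph k l (t - s) * a l s \<partial>lborel)" for k l t
  have "AE t in lborel. a l t \<noteq> \<infinity>" for l
    by (rule nn_integral_PInf_AE) (use am a_fin less_imp_neq in auto)
  then have AE_a: "AE t in lborel. \<forall>l. a l t \<noteq> \<infinity>" by (rule eventually_all_finite)
  have "AE t in lborel. cv k l t \<noteq> \<infinity>" for k l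
  proof (rule nn_integral_PInf_AE)
    show "cv k l \<in> borel_measurable lborel"
      using nn_integral_convolution(2)[OF ph_measurable am] by (simp add: cv_def[abs_def])
    have "(\<integral>\<^sup>+t. cv k l t \<partial>lborel) = ennreal (K k l) * (\<integral>\<^sup>+t. a l t \<partial>lborel)"
      unfolding cv_def by (simp add: nn_integral_convolution(1)[OF ph_measurable am] ph_mass)
    also have "\<dots> < \<infinity>" using a_fin[of l] by (simp add: ennreal_mult_less_top)
    finally show "(\<integral>\<^sup>+t. cv k l t \<partial>lborel) \<noteq> \<infinity>" by (rule less_imp_neq)
  qed
  then have AE_cv: "AE t in lborel. \<forall>k l. cv k l t \<noteq> \<infinity>" by (intro eventually_all_finite)
  let ?\<rho> = "\<lambda>k l t. indicator {0..H} t * (\<integral>\<^sup>+s. ph k l (t - s) * ennreal \<bar>Yst H l s - Yst H l t\<bar> \<partial>lborel)"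
  have shift: "(\<lambda>s. ph k l (t - s)) \<in> borel_measurable borel" for k l t
    by (rule measurable_compose[OF _ ph_measurable]) simp
  \<comment> \<open>The mass of the kernel is \<open>K k l\<close>, so the left side is one integral
    of \<open>A l s - Yst H l t\<close> against the kernel; inserting \<open>Yst H l s\<close>
    splits it into propagated deviation and residual.\<close>
  have key: "ennreal \<bar>enn2real (cv k l t) - K k l * Yst H l t\<bar> \<le>
      (\<integral>\<^sup>+s. ph k l (t - s) * e l s \<partial>lborel) + (\<integral>\<^sup>+s. ph k l (t - s) * ennreal \<bar>Yst H l s - Yst H l t\<bar> \<partial>lborel)"
    if cv: "cv k l t \<noteq> \<infinity>" for k l t
  proof -
    define p where "p s = indicator {0<..} (t - s) * \<phi> k l (t - s)" for s
    have p: "p \<in> borel_measurable borel" "0 \<le> p s" "ennreal (p s) = ph k l (t - s)" for s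
      unfolding p_def[abs_def] by (rule measurable_compose[OF _ phr_measurable], simp, rule phr_nonneg, simp add: ph_def)
    have pA: "integrable lborel (\<lambda>s. p s * A l s)" "(\<integral>s. p s * A l s \<partial>lborel) = enn2real (cv k l t)"
    proof -
      have "(\<integral>\<^sup>+s. ennreal (p s * A l s) \<partial>lborel) = (\<integral>\<^sup>+s. ph k l (t - s) * a l s \<partial>lborel)"
      proof (rule nn_integral_cong_AE)
        show "AE s in lborel. ennreal (p s * A l s) = ph k l (t - s) * a l s"
          using AE_a
        proof eventually_elim
          case (elim s)
          then have "ennreal (A l s) = a l s" by (simp add: A_def less_top)
          moreover have "0 \<le> A l s" by (simp add: A_def)
          ultimately show ?case using p(2,3)[of s] by (simp add: ennreal_mult)
        qed
      qed
      also have "\<dots> = ennreal (enn2real (cv k l t))" using cv by (simp add: cv_def less_top)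
      finally have "(\<integral>\<^sup>+s. ennreal (p s * A l s) \<partial>lborel) = ennreal (enn2real (cv k l t))" .
      moreover have "(\<lambda>s. p s * A l s) \<in> borel_measurable lborel" using p(1) Am[of l] by simp
      moreover have "AE s in lborel. 0 \<le> p s * A l s"
        using p(2) by (intro AE_I2 mult_nonneg_nonneg) (auto simp: A_def)
      ultimately have "integrable lborel (\<lambda>s. p s * A l s) \<and> (\<integral>s. p s * A l s \<partial>lborel) = enn2real (cv k l t)"
        using nn_integral_eq_integrable[of "\<lambda>s. p s * A l s" lborel "enn2real (cv k l t)"] enn2real_nonneg by blast
      then show "integrable lborel (\<lambda>s. p s * A l s)" "(\<integral>s. p s * A l s \<partial>lborel) = enn2real (cv k l t)" by auto
    qed
    have p1: "integrable lborel p" "(\<integral>s. p s \<partial>lborel) = K k l"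
    proof -
      have "(\<integral>\<^sup>+s. ennreal (p s) \<partial>lborel) = ennreal (K k l)"
        unfolding p(3) nn_integral_shift(2)[OF ph_measurable] by (rule ph_mass)
      then have "integrable lborel p \<and> (\<integral>s. p s \<partial>lborel) = K k l"
        using p(1,2) K_nonneg by (subst (asm) nn_integral_eq_integrable) auto
      then show "integrable lborel p" "(\<integral>s. p s \<partial>lborel) = K k l" by auto
    qed
    have int: "integrable lborel (\<lambda>s. p s * A l s - p s * Yst H l t)"
      using pA(1) p1(1) by (intro Bochner_Integration.integrable_diff) auto
    have "enn2real (cv k l t) - K k l * Yst H l t = (\<integral>s. p s * A l s - p s * Yst H l t \<partial>lborel)"
      using pA p1 by (subst Bochner_Integration.integral_diff) auto
    then have "ennreal \<bar>enn2real (cv k l t) - K k l * Yst H l t\<bar> \<le> (\<integral>\<^sup>+s. ennreal (norm (p s * A l s - p s * Yst H l t)) \<partial>lborel)"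
      using integral_norm_bound_ennreal[OF int] by simp
    also have "\<dots> \<le> (\<integral>\<^sup>+s. ph k l (t - s) * e l s + ph k l (t - s) * ennreal \<bar>Yst H l s - Yst H l t\<bar> \<partial>lborel)"
    proof (rule nn_integral_mono)
      fix s
      have "norm (p s * A l s - p s * Yst H l t) = p s * \<bar>A l s - Yst H l t\<bar>"
        using p(2)[of s] by (simp add: abs_mult flip: right_diff_distrib)
      also have "\<dots> \<le> p s * (\<bar>A l s - Yst H l s\<bar> + \<bar>Yst H l s - Yst H l t\<bar>)"
        using p(2)[of s] by (intro mult_left_mono) auto
      finally have "ennreal (norm (p s * A l s - p s * Yst H l t)) \<le>
          ennreal (p s * (\<bar>A l s - Yst H l s\<bar> + \<bar>Yst H l s - Yst H l t\<bar>))" by (rule ennreal_leI)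
      also have "\<dots> = ph k l (t - s) * e l s + ph k l (t - s) * ennreal \<bar>Yst H l s - Yst H l t\<bar>"
        using p(2)[of s] by (simp add: e_def ennreal_mult ennreal_plus distrib_left flip: p(3))
      finally show "ennreal (norm (p s * A l s - p s * Yst H l t)) \<le>
          ph k l (t - s) * e l s + ph k l (t - s) * ennreal \<bar>Yst H l s - Yst H l t\<bar>" .
    qed
    also have "\<dots> = (\<integral>\<^sup>+s. ph k l (t - s) * e l s \<partial>lborel) + (\<integral>\<^sup>+s. ph k l (t - s) * ennreal \<bar>Yst H l s - Yst H l t\<bar> \<partial>lborel)"
      using shift[of k l t] em[of l] Yst_measurable[of H l] by (intro nn_integral_add) simp_all
    finally show ?thesis .
  qed
  have pointwise: "AE t in lborel. e k t \<le> ennreal c * (\<Sum>l\<in>UNIV. (\<integral>\<^sup>+s. ph k l (t - s) * e l s \<partial>lborel) + ?\<rho> k l t)" for k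
    using AE_a AE_cv
  proof eventually_elim
    case (elim t)
    show ?case
    proof (cases "t \<in> {0..H}")
      case False
      then have "a k t = 0" "Yst H k t = 0" by (simp_all add: a_eq[of k t] mmH_def gaH_def Yst_def)
      then show ?thesis by (simp add: e_def A_def)
    next
      case True
      define x where "x = t / H"
      have x: "x \<in> {0..1}" using True H by (simp add: x_def)
      have "a k t = ennreal (m k x) + ennreal (g x) * (\<Sum>l\<in>UNIV. ennreal (enn2real (cv k l t)))"
        using a_eq[of k t] True elim(2) by (simp add: mmH_def gaH_def x_def cv_def[symmetric] less_top)
      also have "\<dots> = ennreal (m k x + g x * (\<Sum>l\<in>UNIV. enn2real (cv k l t)))"
        using m_nonneg[OF x, of k] g_nonneg[OF x] by (simp add: ennreal_plus ennreal_mult sum_nonneg)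
      finally have Ak: "A k t = m k x + g x * (\<Sum>l\<in>UNIV. enn2real (cv k l t))"
        unfolding A_def
        by (simp only:) (rule enn2real_ennreal, intro add_nonneg_nonneg mult_nonneg_nonneg sum_nonneg m_nonneg g_nonneg x enn2real_nonneg)
      have Yk: "Yst H k t = m k x + g x * (\<Sum>l\<in>UNIV. K k l * Yst H l t)"
        using True y_eq[OF x, of k] by (simp add: Yst_def x_def)
      have "\<bar>A k t - Yst H k t\<bar> = g x * \<bar>\<Sum>l\<in>UNIV. enn2real (cv k l t) - K k l * Yst H l t\<bar>"
        unfolding Ak Yk using g_nonneg[OF x] by (simp add: abs_mult sum_subtractf flip: right_diff_distrib)
      also have "\<dots> \<le> c * (\<Sum>l\<in>UNIV. \<bar>enn2real (cv k l t) - K k l * Yst H l t\<bar>)"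
        using g_le[OF x] c_nonneg by (intro mult_mono sum_abs) auto
      finally have "e k t \<le> ennreal (c * (\<Sum>l\<in>UNIV. \<bar>enn2real (cv k l t) - K k l * Yst H l t\<bar>))"
        unfolding e_def by (rule ennreal_leI)
      also have "\<dots> = ennreal c * (\<Sum>l\<in>UNIV. ennreal \<bar>enn2real (cv k l t) - K k l * Yst H l t\<bar>)"
        using c_nonneg by (simp add: ennreal_mult sum_nonneg)
      also have "\<dots> \<le> ennreal c * (\<Sum>l\<in>UNIV. (\<integral>\<^sup>+s. ph k l (t - s) * e l s \<partial>lborel) +
          (\<integral>\<^sup>+s. ph k l (t - s) * ennreal \<bar>Yst H l s - Yst H l t\<bar> \<partial>lborel))"
        by (intro mult_left_mono sum_mono key) (use elim in auto)
      finally show ?thesis using True by simp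
    qed
  qed
  have \<rho>m: "?\<rho> k l \<in> borel_measurable borel" for k l
  proof -
    have "(\<lambda>t. \<integral>\<^sup>+s. indicator {0..H} t * (ph k l (t - s) * ennreal \<bar>Yst H l s - Yst H l t\<bar>) \<partial>lborel) \<in> borel_measurable borel"
    proof (rule lborel.borel_measurable_nn_integral)
      have "borel_measurable (borel \<Otimes>\<^sub>M lborel) = borel_measurable (borel \<Otimes>\<^sub>M (borel :: real measure))"
        by (intro measurable_cong_sets sets_pair_measure_cong) simp_all
      then show "(\<lambda>(t, s). indicator {0..H} t * (ph k l (t - s) * ennreal \<bar>Yst H l s - Yst H l t\<bar>)) \<in>
          borel_measurable (borel \<Otimes>\<^sub>M lborel)" using residual_joint by blast
    qed
    moreover have "(\<integral>\<^sup>+s. indicator {0..H} t * (ph k l (t - s) * ennreal \<bar>Yst H l s - Yst H l t\<bar>) \<partial>lborel) = ?\<rho> k l t" for t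
      using shift[of k l t] Yst_measurable[of H l] by (intro nn_integral_cmult) simp
    ultimately show ?thesis by (simp only:)
  qed
  define E where "E l = (\<integral>\<^sup>+t. e l t \<partial>lborel)" for l
  have E_le: "E k \<le> ennreal c * (\<Sum>l\<in>UNIV. residual H k l) + (\<Sum>l\<in>UNIV. ennreal c * ennreal (K k l) * E l)" for k
  proof -
    have "E k \<le> (\<integral>\<^sup>+t. ennreal c * (\<Sum>l\<in>UNIV. (\<integral>\<^sup>+s. ph k l (t - s) * e l s \<partial>lborel) + ?\<rho> k l t) \<partial>lborel)"
      unfolding E_def by (rule nn_integral_mono_AE[OF pointwise])
    also have "\<dots> = ennreal c * (\<integral>\<^sup>+t. (\<Sum>l\<in>UNIV. (\<integral>\<^sup>+s. ph k l (t - s) * e l s \<partial>lborel) + ?\<rho> k l t) \<partial>lborel)"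
      using nn_integral_convolution(2)[OF ph_measurable em] \<rho>m by (intro nn_integral_cmult) simp
    also have "(\<integral>\<^sup>+t. (\<Sum>l\<in>UNIV. (\<integral>\<^sup>+s. ph k l (t - s) * e l s \<partial>lborel) + ?\<rho> k l t) \<partial>lborel) =
        (\<Sum>l\<in>UNIV. \<integral>\<^sup>+t. (\<integral>\<^sup>+s. ph k l (t - s) * e l s \<partial>lborel) + ?\<rho> k l t \<partial>lborel)"
      using nn_integral_convolution(2)[OF ph_measurable em] \<rho>m by (intro nn_integral_sum) simp
    also have "\<dots> = (\<Sum>l\<in>UNIV. ennreal (K k l) * E l + residual H k l)"
    proof (rule sum.cong[OF refl])
      fix l
      have "(\<integral>\<^sup>+t. (\<integral>\<^sup>+s. ph k l (t - s) * e l s \<partial>lborel) + ?\<rho> k l t \<partial>lborel) =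
          (\<integral>\<^sup>+t. \<integral>\<^sup>+s. ph k l (t - s) * e l s \<partial>lborel \<partial>lborel) + (\<integral>\<^sup>+t. ?\<rho> k l t \<partial>lborel)"
        using nn_integral_convolution(2)[OF ph_measurable em, of k l l] \<rho>m[of k l] by (intro nn_integral_add) simp_all
      then show "(\<integral>\<^sup>+t. (\<integral>\<^sup>+s. ph k l (t - s) * e l s \<partial>lborel) + ?\<rho> k l t \<partial>lborel) = ennreal (K k l) * E l + residual H k l"
        by (simp only: nn_integral_convolution(1)[OF ph_measurable em] ph_mass E_def residual_def)
    qed
    finally show ?thesis by (simp add: sum.distrib distrib_left sum_distrib_left mult.assoc add.commute)
  qed
  obtain B where B: "0 \<le> B" "\<And>k x. x \<in> {0..1} \<Longrightarrow> \<bar>y k x\<bar> \<le> B" by (rule y_bounded) blast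
  \<comment> \<open>The a priori finiteness that the weighted bound needs for its cancellation:
    \<open>a\<close> is integrable and \<open>Yst\<close> is bounded with bounded support.\<close>
  have E_fin: "E l < \<infinity>" for l
  proof -
    have "E l \<le> (\<integral>\<^sup>+t. a l t + ennreal B * indicator {0..H} t \<partial>lborel)"
      unfolding E_def
    proof (rule nn_integral_mono_AE)
      show "AE t in lborel. e l t \<le> a l t + ennreal B * indicator {0..H} t"
        using AE_a
      proof eventually_elim
        case (elim t)
        have "\<bar>Yst H l t\<bar> \<le> B * indicator {0..H} t"
          using B(2)[of "t / H" l] H by (auto simp: Yst_def split: split_indicator)
        then have "\<bar>A l t - Yst H l t\<bar> \<le> A l t + B * indicator {0..H} t"
          using enn2real_nonneg[of "a l t"] unfolding A_def by linarith
        then have "e l t \<le> ennreal (A l t + B * indicator {0..H} t)" unfolding e_def by (rule ennreal_leI)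
        also have "\<dots> = a l t + ennreal B * indicator {0..H} t"
          using elim B(1) by (simp add: A_def ennreal_plus ennreal_mult less_top ennreal_indicator split: split_indicator)
        finally show ?case .
      qed
    qed
    also have "\<dots> = (\<integral>\<^sup>+t. a l t \<partial>lborel) + ennreal B * ennreal H"
      using am[of l] H by (simp add: nn_integral_add nn_integral_cmult_indicator)
    also have "\<dots> < \<infinity>" using a_fin[of l] by (simp add: ennreal_mult_less_top)
    finally show ?thesis .
  qed
  have "(\<Sum>l\<in>UNIV. E l) \<le> (\<Sum>k\<in>UNIV. ennreal (\<zeta> k) * (ennreal c * (\<Sum>l\<in>UNIV. residual H k l)))"
  proof (rule weighted_sum_bound_ennreal[OF E_le E_fin])
    fix l
    have "1 + (\<Sum>k\<in>UNIV. ennreal (\<zeta> k) * (ennreal c * ennreal (K k l))) = ennreal (1 + (\<Sum>k\<in>UNIV. \<zeta> k * (c * K k l)))"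
      using c_nonneg \<zeta>_nonneg K_nonneg by (simp add: ennreal_plus sum_nonneg flip: ennreal_mult)
    then show "1 + (\<Sum>k\<in>UNIV. ennreal (\<zeta> k) * (ennreal c * ennreal (K k l))) \<le> ennreal (\<zeta> l)"
      using \<zeta>[of l] by (simp add: ennreal_leI)
  qed simp
  then show ?thesis unfolding E_def e_def A_def .
qed

lemma y_integral_scaled:
  assumes H: "H > 0" and u: "u \<in> {0..1}"
  shows "(\<integral>t. indicator {..H * u} t * Yst H k t \<partial>lborel) = H * (LBINT x:{0..u}. y k x)"
proof -
  have "(\<integral>t. indicator {..H * u} t * Yst H k t \<partial>lborel) =
      \<bar>H\<bar> *\<^sub>R (\<integral>x. indicator {..H * u} (0 + H * x) * Yst H k (0 + H * x) \<partial>lborel)"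
    by (rule lborel_integral_real_affine) (use H in simp)
  also have "(\<integral>x. indicator {..H * u} (0 + H * x) * Yst H k (0 + H * x) \<partial>lborel) = (LBINT x:{0..u}. y k x)"
    unfolding set_lebesgue_integral_def
    by (rule Bochner_Integration.integral_cong)
      (use H u in \<open>auto simp: Yst_def zero_le_mult_iff mult_le_cancel_left1 split: split_indicator\<close>)
  finally show ?thesis using H by simp
qed

theorem renewal_limit:
  assumes \<epsilon>: "\<epsilon> > 0"
  shows "\<forall>\<^sub>F H in at_top. \<forall>a. renewal_solution H a \<longrightarrow> (\<forall>k. \<forall>u\<in>{0..1}.
    \<bar>enn2real (\<integral>\<^sup>+t. indicator {..H * u} t * a k t \<partial>lborel) / H - (LBINT x:{0..u}. y k x)\<bar> \<le> \<epsilon>)"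
proof -
  define C where "C = (\<Sum>k\<in>UNIV. \<zeta> k * (c * (\<Sum>l\<in>(UNIV :: 'p set). 1))) + 1"
  have C: "C > 0"
  proof -
    have "0 \<le> (\<Sum>k\<in>UNIV. \<zeta> k * (c * (\<Sum>l\<in>(UNIV :: 'p set). 1)))"
      by (intro sum_nonneg mult_nonneg_nonneg \<zeta>_nonneg c_nonneg) auto
    then show ?thesis unfolding C_def by linarith
  qed
  have "\<forall>\<^sub>F H in at_top. \<forall>k l. residual H k l \<le> ennreal (\<epsilon> / C * H)"
    by (rule residual_small) (use \<epsilon> C in simp)
  then show ?thesis
    using eventually_gt_at_top[of 0]
  proof eventually_elim
    case (elim H)
    then have H: "H > 0" by simp
    show ?case
    proof (intro allI impI ballI)
      fix a k u assume sol: "renewal_solution H a" and u: "u \<in> {0..1 :: real}"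
      have am: "a k \<in> borel_measurable borel" and a_fin: "(\<integral>\<^sup>+t. a k t \<partial>lborel) < \<infinity>"
        using sol unfolding renewal_solution_def by blast+
      define A where "A t = enn2real (a k t)" for t
      have A_int: "integrable lborel A"
      proof (rule integrableI_nonneg)
        show "A \<in> borel_measurable lborel"
          unfolding A_def[abs_def] using am by simp
        have "(\<integral>\<^sup>+t. ennreal (A t) \<partial>lborel) \<le> (\<integral>\<^sup>+t. a k t \<partial>lborel)"
          by (intro nn_integral_mono) (simp add: A_def ennreal_enn2real_if)
        then show "(\<integral>\<^sup>+t. ennreal (A t) \<partial>lborel) < \<infinity>" using a_fin by (rule order.strict_trans1)
      qed (simp add: A_def)
      have Y_int: "integrable lborel (Yst H k)"
      proof -
        obtain B where B: "0 \<le> B" "\<And>k x. x \<in> {0..1} \<Longrightarrow> \<bar>y k x\<bar> \<le> B" by (rule y_bounded) blast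
        show ?thesis
        proof (rule Bochner_Integration.integrable_bound)
          have "integrable lborel (indicator {0..H} :: real \<Rightarrow> real)"
            by (rule integrable_real_indicator) (use H in simp_all)
          then show "integrable lborel (\<lambda>t. B * indicator {0..H} t)" by (intro integrable_mult_right)
          show "AE t in lborel. norm (Yst H k t) \<le> norm (B * indicator {0..H} t)"
            using B(1) B(2)[of "_ / H" k] H by (auto simp: Yst_def split: split_indicator)
        qed (use Yst_measurable in simp)
      qed
      have iA: "integrable lborel (\<lambda>t. indicator {..H * u} t * A t)"
        "integrable lborel (\<lambda>t. indicator {..H * u} t * Yst H k t)"
        using integrable_real_mult_indicator[OF _ A_int, of "{..H * u}"]
          integrable_real_mult_indicator[OF _ Y_int, of "{..H * u}"] by (simp_all add: mult.commute)
      have "(\<integral>\<^sup>+t. indicator {..H * u} t * a k t \<partial>lborel) = (\<integral>\<^sup>+t. ennreal (indicator {..H * u} t * A t) \<partial>lborel)"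
      proof (rule nn_integral_cong_AE)
        have "AE t in lborel. a k t \<noteq> \<infinity>"
          by (rule nn_integral_PInf_AE) (use am a_fin less_imp_neq in auto)
        then show "AE t in lborel. indicator {..H * u} t * a k t = ennreal (indicator {..H * u} t * A t)"
          by eventually_elim (auto simp: A_def less_top split: split_indicator)
      qed
      also have "\<dots> = ennreal (\<integral>t. indicator {..H * u} t * A t \<partial>lborel)"
        by (rule nn_integral_eq_integral[OF iA(1)]) (simp add: A_def)
      finally have enn: "enn2real (\<integral>\<^sup>+t. indicator {..H * u} t * a k t \<partial>lborel) = (\<integral>t. indicator {..H * u} t * A t \<partial>lborel)"
        by (simp add: A_def)
      have "ennreal \<bar>(\<integral>t. indicator {..H * u} t * A t \<partial>lborel) - (\<integral>t. indicator {..H * u} t * Yst H k t \<partial>lborel)\<bar> =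
          ennreal (norm (\<integral>t. indicator {..H * u} t * A t - indicator {..H * u} t * Yst H k t \<partial>lborel))"
        using iA by simp
      also have "\<dots> \<le> (\<integral>\<^sup>+t. ennreal (norm (indicator {..H * u} t * A t - indicator {..H * u} t * Yst H k t)) \<partial>lborel)"
        by (rule integral_norm_bound_ennreal) (use iA in simp)
      also have "\<dots> \<le> (\<integral>\<^sup>+t. ennreal \<bar>enn2real (a k t) - Yst H k t\<bar> \<partial>lborel)"
        by (intro nn_integral_mono ennreal_leI) (auto simp: A_def split: split_indicator)
      also have "\<dots> \<le> (\<Sum>l\<in>UNIV. \<integral>\<^sup>+t. ennreal \<bar>enn2real (a l t) - Yst H l t\<bar> \<partial>lborel)"
        by (rule member_le_sum[of k UNIV "\<lambda>l. \<integral>\<^sup>+t. ennreal \<bar>enn2real (a l t) - Yst H l t\<bar> \<partial>lborel"]) auto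
      also have "\<dots> \<le> (\<Sum>k\<in>UNIV. ennreal (\<zeta> k) * (ennreal c * (\<Sum>l\<in>UNIV. residual H k l)))"
        by (rule renewal_deviation[OF H sol])
      also have "\<dots> \<le> (\<Sum>k\<in>UNIV. ennreal (\<zeta> k) * (ennreal c * (\<Sum>l\<in>(UNIV :: 'p set). ennreal (\<epsilon> / C * H))))"
        using elim(1) by (intro sum_mono mult_left_mono) auto
      also have "\<dots> = ennreal ((\<Sum>k\<in>UNIV. \<zeta> k * (c * (\<Sum>l\<in>(UNIV :: 'p set). 1))) * (\<epsilon> / C * H))"
      proof -
        have nn: "0 \<le> \<epsilon> / C * H" using \<epsilon> C H by simp
        have "(\<Sum>k\<in>UNIV. ennreal (\<zeta> k) * (ennreal c * (\<Sum>l\<in>(UNIV :: 'p set). ennreal (\<epsilon> / C * H)))) =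
            ennreal (\<Sum>k\<in>UNIV. \<zeta> k * (c * (\<Sum>l\<in>(UNIV :: 'p set). \<epsilon> / C * H)))"
          using nn \<zeta>_nonneg c_nonneg
          by (subst sum_ennreal[symmetric])
            (auto simp del: sum_constant simp: ennreal_mult sum_nonneg intro!: sum.cong mult_nonneg_nonneg sum_nonneg)
        also have "(\<Sum>k\<in>UNIV. \<zeta> k * (c * (\<Sum>l\<in>(UNIV :: 'p set). \<epsilon> / C * H))) =
            (\<Sum>k\<in>UNIV. \<zeta> k * (c * (\<Sum>l\<in>(UNIV :: 'p set). 1))) * (\<epsilon> / C * H)"
          by (simp add: sum_distrib_right mult.assoc sum_divide_distrib)
        finally show ?thesis .
      qed
      also have "\<dots> \<le> ennreal (C * (\<epsilon> / C * H))"
        unfolding C_def[symmetric] using \<epsilon> C H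
        by (intro ennreal_leI mult_right_mono) (simp_all add: C_def)
      also have "C * (\<epsilon> / C * H) = \<epsilon> * H" using C by simp
      finally have "\<bar>(\<integral>t. indicator {..H * u} t * A t \<partial>lborel) - H * (LBINT x:{0..u}. y k x)\<bar> \<le> \<epsilon> * H"
        using \<epsilon> H by (simp add: y_integral_scaled[OF H u])
      then have "\<bar>(\<integral>t. indicator {..H * u} t * A t \<partial>lborel) - H * (LBINT x:{0..u}. y k x)\<bar> / H \<le> \<epsilon>"
        using H by (simp add: divide_le_eq)
      then show "\<bar>enn2real (\<integral>\<^sup>+t. indicator {..H * u} t * a k t \<partial>lborel) / H - (LBINT x:{0..u}. y k x)\<bar> \<le> \<epsilon>"
      proof -
        have "X / H - L = (X - H * L) / H" for X L using H by (simp add: diff_divide_distrib)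
        moreover assume "\<bar>(\<integral>t. indicator {..H * u} t * A t \<partial>lborel) - H * (LBINT x:{0..u}. y k x)\<bar> / H \<le> \<epsilon>"
        ultimately show ?thesis unfolding enn by (simp only: abs_divide abs_of_pos[OF H])
      qed
    qed
  qed
qed

end

section \<open>Pathwise comparison with minimal processes\<close>

text \<open>One fixed outcome, two systems driven by the same points: the counting measures
  \<open>n\<close>, which solve the equation with data \<open>b\<close> and \<open>q\<close> on
  \<open>{0..T}\<close>, and the minimal process with data \<open>mm\<close> and \<open>ga\<close>.
  The kernel \<open>ph\<close> is common to both.\<close>

locale hawkes_path = hawkes_minimal M \<kappa> F mm ga ph gb \<zeta>
  for M :: "'w measure" and \<kappa> :: "'p::finite \<Rightarrow> 'w \<Rightarrow> (real \<times> real) measure" and F mm ga ph gb \<zeta> +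
  fixes \<omega> :: 'w and T :: real and n :: "'p \<Rightarrow> real measure"
    and b :: "'p \<Rightarrow> real \<Rightarrow> ennreal" and q :: "real \<Rightarrow> ennreal" and h :: "'p \<Rightarrow> real \<Rightarrow> ennreal"
  assumes \<omega>: "\<omega> \<in> space M"
    and n_sets: "sets (n k) = sets borel"
    and n_supp: "emeasure (n k) (- {0..T}) = 0"
    and n_nat: "A \<in> sets borel \<Longrightarrow> \<exists>i::nat. emeasure (n k) A = of_nat i"
    and b_meas: "b k \<in> borel_measurable borel" and q_meas: "q \<in> borel_measurable borel"
    and h_eq: "h k t = b k t + q t * (\<Sum>l\<in>UNIV. \<integral>\<^sup>+s. ph k l (t - s) \<partial>n l)"
    and n_eq: "t \<in> {0..T} \<Longrightarrow> emeasure (n k) {0..t} =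
      emeasure (\<kappa> k \<omega>) {(x, s). 0 \<le> s \<and> s \<le> t \<and> 0 \<le> x \<and> ennreal x \<le> h k s}"
    and T: "0 < T"
begin

lemma n_finite: "emeasure (n k) A < \<infinity>"
proof (cases "A \<in> sets borel")
  case True
  from n_nat[OF this] obtain i :: nat where "emeasure (n k) A = of_nat i" by blast
  then show ?thesis by (simp add: of_nat_less_top)
next
  case False
  then show ?thesis by (simp add: emeasure_notin_sets n_sets)
qed

lemma n_finite_measure: "finite_measure (n k)"
  by (rule finite_measureI) (use n_finite in \<open>auto simp: less_top\<close>)

lemma h_meas: "h k \<in> borel_measurable borel"
proof -
  have "(\<lambda>t. \<integral>\<^sup>+s. ph k l (t - s) \<partial>n l) \<in> borel_measurable borel" for l
  proof -
    interpret finite_measure "n l" by (rule n_finite_measure)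
    have "sets (borel \<Otimes>\<^sub>M n l) = sets (borel \<Otimes>\<^sub>M (borel :: real measure))"
      by (rule sets_pair_measure_cong) (simp_all add: n_sets)
    note eq = measurable_cong_sets[OF this refl]
    have "(\<lambda>(t, s). ph k l (t - s)) \<in> borel_measurable (borel \<Otimes>\<^sub>M borel)"
      unfolding case_prod_beta' by (rule measurable_compose[OF _ ph]) simp
    then have "(\<lambda>(t, s). ph k l (t - s)) \<in> borel_measurable (borel \<Otimes>\<^sub>M n l)" unfolding eq .
    then show ?thesis by (rule borel_measurable_nn_integral)
  qed
  then have "(\<lambda>t. b k t + q t * (\<Sum>l\<in>UNIV. \<integral>\<^sup>+s. ph k l (t - s) \<partial>n l)) \<in> borel_measurable borel"
    by (intro borel_measurable_add borel_measurable_times_ennreal borel_measurable_sum b_meas q_meas)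
  then show ?thesis unfolding h_eq[abs_def] .
qed

definition accepted :: "'p \<Rightarrow> (real \<times> real) set" where
  "accepted k = {(x, s). 0 \<le> s \<and> s \<le> T \<and> 0 \<le> x \<and> ennreal x \<le> h k s}"

lemma snd_meas: "snd \<in> borel_measurable (borel :: (real \<times> real) measure)"
  and fst_meas: "fst \<in> borel_measurable (borel :: (real \<times> real) measure)"
  by (auto intro!: borel_measurable_continuous_onI continuous_intros)

lemma accepted_sets: "accepted k \<in> sets borel"
proof -
  note [measurable] = snd_meas fst_meas h_meas[of k] measurable_compose[OF snd_meas h_meas[of k]]
  have "{z \<in> space borel. 0 \<le> snd z \<and> snd z \<le> T \<and> 0 \<le> fst z \<and> ennreal (fst z) \<le> h k (snd z)} \<in> sets borel"
    by measurable
  then show ?thesis by (simp add: accepted_def case_prod_beta')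
qed

text \<open>The equation prescribes the counts of the intervals \<open>{0..t}\<close>; these
  determine \<open>n k\<close> as the time projection of the accepted points. Integrals against
  \<open>n\<close> thereby become integrals over the points from which \<open>thin\<close> selects,
  and the two intensities can be compared integrand by integrand.\<close>

lemma n_transfer:
  assumes f: "f \<in> borel_measurable borel"
  shows "(\<integral>\<^sup>+s. f s \<partial>n k) = (\<integral>\<^sup>+z. f (snd z) * indicator (accepted k) z \<partial>\<kappa> k \<omega>)"
proof -
  note s\<kappa> = sets_\<kappa>[OF \<omega>, of k]
  define N' where "N' = distr (density (\<kappa> k \<omega>) (indicator (accepted k))) borel snd"
  have acc: "accepted k \<in> sets (\<kappa> k \<omega>)" using accepted_sets by (simp add: s\<kappa>)
  have ind: "indicator (accepted k) \<in> borel_measurable (\<kappa> k \<omega>)" by (rule borel_measurable_indicator[OF acc])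
  have "sets (density (\<kappa> k \<omega>) (indicator (accepted k))) = sets borel" by (simp add: s\<kappa>)
  then have sndm: "snd \<in> measurable (density (\<kappa> k \<omega>) (indicator (accepted k))) borel"
    using snd_meas measurable_cong_sets[OF _ refl] by blast
  have int: "(\<integral>\<^sup>+s. f s \<partial>N') = (\<integral>\<^sup>+z. f (snd z) * indicator (accepted k) z \<partial>\<kappa> k \<omega>)" if "f \<in> borel_measurable borel" for f
  proof -
    have "(\<integral>\<^sup>+s. f s \<partial>N') = (\<integral>\<^sup>+z. f (snd z) \<partial>density (\<kappa> k \<omega>) (indicator (accepted k)))"
      unfolding N'_def by (rule nn_integral_distr[OF sndm]) (simp add: that)
    also have "\<dots> = (\<integral>\<^sup>+z. indicator (accepted k) z * f (snd z) \<partial>\<kappa> k \<omega>)"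
    proof (rule nn_integral_density[OF ind])
      show "(\<lambda>z. f (snd z)) \<in> borel_measurable (\<kappa> k \<omega>)"
        unfolding measurable_cong_sets[OF s\<kappa> refl] by (rule measurable_compose[OF snd_meas that])
    qed
    finally show ?thesis by (simp add: mult.commute)
  qed
  have emN': "emeasure N' {..t} = emeasure (\<kappa> k \<omega>) ({z. snd z \<le> t} \<inter> accepted k)" for t
  proof -
    have "emeasure N' {..t} = (\<integral>\<^sup>+s. indicator {..t} s \<partial>N')"
      by (rule nn_integral_indicator[symmetric]) (simp add: N'_def)
    also have "\<dots> = (\<integral>\<^sup>+z. indicator {..t} (snd z) * indicator (accepted k) z \<partial>\<kappa> k \<omega>)" by (rule int) simp
    also have "\<dots> = (\<integral>\<^sup>+z. indicator ({z. snd z \<le> t} \<inter> accepted k) z \<partial>\<kappa> k \<omega>)"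
      by (intro nn_integral_cong) (auto split: split_indicator)
    also have "\<dots> = emeasure (\<kappa> k \<omega>) ({z. snd z \<le> t} \<inter> accepted k)"
    proof (rule nn_integral_indicator)
      have "snd -` {..t} \<inter> space (borel :: (real \<times> real) measure) \<in> sets borel"
        by (rule measurable_sets[OF snd_meas]) simp
      then have "{z. snd z \<le> t} \<in> sets (\<kappa> k \<omega>)" by (simp add: vimage_def s\<kappa>)
      then show "{z. snd z \<le> t} \<inter> accepted k \<in> sets (\<kappa> k \<omega>)" using acc by (rule sets.Int)
    qed
    finally show ?thesis .
  qed
  have em_n: "emeasure (n k) {..t} = emeasure (n k) ({..t} \<inter> {0..T})" for t
  proof (rule emeasure_eq_AE)
    show "AE s in n k. s \<in> {..t} \<longleftrightarrow> s \<in> {..t} \<inter> {0..T}"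
      by (rule AE_I[where N="- {0..T}"]) (auto simp: n_supp n_sets)
  qed (auto simp: n_sets)
  have "n k = N'"
  proof (rule measure_eqI_generator_eq[where E="range (\<lambda>a::real. {..a})" and \<Omega>=UNIV and A="\<lambda>i. {..real i}"])
    show "Int_stable (range (\<lambda>a::real. {..a}))"
      unfolding Int_stable_def
    proof (intro ballI)
      fix A B :: "real set" assume "A \<in> range (\<lambda>a. {..a})" "B \<in> range (\<lambda>a. {..a})"
      then obtain a b where "A = {..a}" "B = {..b}" by blast
      then have "A \<inter> B = {..min a b}" by auto
      then show "A \<inter> B \<in> range (\<lambda>a. {..a})" by blast
    qed
    have "sets (borel :: real measure) = sigma_sets UNIV (range (\<lambda>a::real. {..a}))"
      by (subst borel_eq_atMost) simp
    then show "sets (n k) = sigma_sets UNIV (range (\<lambda>a. {..a}))" "sets N' = sigma_sets UNIV (range (\<lambda>a. {..a}))"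
      by (simp_all add: n_sets N'_def)
    show "(\<Union>i. {..real i}) = UNIV" using real_arch_simple by auto
    show "emeasure (n k) {..real i} \<noteq> \<infinity>" for i using n_finite by (simp add: less_top)
    fix X :: "real set" assume "X \<in> range (\<lambda>a. {..a})"
    then obtain t where X: "X = {..t}" by blast
    consider "t < 0" | "0 \<le> t" "t \<le> T" | "T < t" by linarith
    then show "emeasure (n k) X = emeasure N' X"
    proof cases
      case 1
      then have "{..t} \<inter> {0..T} = {}" "{z. snd z \<le> t} \<inter> accepted k = {}" by (auto simp: accepted_def)
      then show ?thesis unfolding X em_n emN' by simp
    next
      case 2
      then have "{..t} \<inter> {0..T} = {0..t}"
        "{z. snd z \<le> t} \<inter> accepted k = {(x, s). 0 \<le> s \<and> s \<le> t \<and> 0 \<le> x \<and> ennreal x \<le> h k s}"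
        by (auto simp: accepted_def)
      then show ?thesis unfolding X em_n emN' using n_eq[of t k] 2 by simp
    next
      case 3
      then have "{..t} \<inter> {0..T} = {0..T}"
        "{z. snd z \<le> t} \<inter> accepted k = {(x, s). 0 \<le> s \<and> s \<le> T \<and> 0 \<le> x \<and> ennreal x \<le> h k s}"
        by (auto simp: accepted_def)
      then show ?thesis unfolding X em_n emN' using n_eq[of T k] T by simp
    qed
  qed auto
  then show ?thesis using int[OF f] by simp
qed

lemma n_count: "t \<in> {0..T} \<Longrightarrow> emeasure (n k) {0..t} = (\<integral>\<^sup>+z. indicator {..t} (snd z) * indicator (accepted k) z \<partial>\<kappa> k \<omega>)"
proof -
  assume t: "t \<in> {0..T}"
  have "emeasure (n k) {0..t} = (\<integral>\<^sup>+s. indicator {0..t} s \<partial>n k)" by (simp add: n_sets)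
  also have "\<dots> = (\<integral>\<^sup>+z. indicator {0..t} (snd z) * indicator (accepted k) z \<partial>\<kappa> k \<omega>)" by (rule n_transfer) simp
  also have "\<dots> = (\<integral>\<^sup>+z. indicator {..t} (snd z) * indicator (accepted k) z \<partial>\<kappa> k \<omega>)"
    by (intro nn_integral_cong) (auto simp: accepted_def split: split_indicator)
  finally show ?thesis .
qed

text \<open>By induction each \<open>lam i\<close> stays below \<open>h\<close>: its accepted points
  then lie in \<open>accepted\<close>, hence excite \<open>n\<close> as well, and the larger data do
  the rest. The strict rule in \<open>thin\<close> implies the non-strict one in
  \<open>accepted\<close>, so equality of intensities is harmless.\<close>

theorem comparison_lower:
  assumes mm_le: "\<And>k t. t \<in> {0..T} \<Longrightarrow> mm k t \<le> b k t" and ga_le': "\<And>t. t \<in> {0..T} \<Longrightarrow> ga t \<le> q t"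
    and neg: "\<And>k t. t < 0 \<Longrightarrow> mm k t = 0" "\<And>t. t < 0 \<Longrightarrow> ga t = 0" and t: "t \<in> {0..T}"
  shows "point_count k t \<omega> \<le> emeasure (n k) {0..t}"
proof -
  \<comment> \<open>\<open>accepted\<close> has no points before time zero, so the minimal process
    must not have any there either.\<close>
  have lam_neg: "lam i k (\<omega>, s) = 0" if "s < 0" for i k s
    using that neg by (cases i) (simp_all add: influence_def)
  have lam_le: "lam i k (\<omega>, s) \<le> h k s" if "s \<in> {0..T}" for i k s
    using that
  proof (induction i arbitrary: k s)
    case (Suc i)
    have "(\<integral>\<^sup>+z. ph k l (s - snd z) * thin (lam i l) (mark \<omega> z) \<partial>\<kappa> l \<omega>) \<le> (\<integral>\<^sup>+r. ph k l (s - r) \<partial>n l)" for l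
      unfolding n_transfer[OF ph_shift_measurable(1)]
    proof (rule nn_integral_mono)
      fix z :: "real \<times> real"
      obtain x r where z: "z = (x, r)" by (cases z)
      show "ph k l (s - snd z) * thin (lam i l) (mark \<omega> z) \<le> ph k l (s - snd z) * indicator (accepted l) z"
      proof (cases "s \<le> r \<or> \<not> (0 \<le> x \<and> ennreal x < lam i l (\<omega>, r))")
        case True
        then show ?thesis using ph0[of "s - r" k l] by (auto simp: z mark_def thin_def)
      next
        case False
        then have "0 \<le> r" using lam_neg[of r i l] by (cases "r < 0") auto
        then have "z \<in> accepted l"
          using False Suc.IH[of r l] Suc.prems by (auto simp: accepted_def z)
        then show ?thesis by (simp add: thin_def)
      qed
    qed
    then show ?case
      unfolding lam.simps influence_def h_eq[of k s] fst_conv snd_conv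
      using Suc.prems by (intro add_mono mult_mono sum_mono mm_le ga_le') simp_all
  qed simp
  have Lam_le: "Lam k (\<omega>, s) \<le> h k s" if "s \<in> {0..T}" for k s
    unfolding Lam_def by (rule SUP_least) (rule lam_le[OF that])
  have Lam_neg: "Lam k (\<omega>, s) = 0" if "s < 0" for k s
    unfolding Lam_def by (simp add: lam_neg[OF that])
  show ?thesis
    unfolding point_count_def n_count[OF t]
  proof (rule nn_integral_mono)
    fix z :: "real \<times> real"
    obtain x r where z: "z = (x, r)" by (cases z)
    show "indicator {..t} (snd z) * thin (Lam k) (mark \<omega> z) \<le> indicator {..t} (snd z) * indicator (accepted k) z"
    proof (cases "r \<le> t \<and> 0 \<le> x \<and> ennreal x < Lam k (\<omega>, r)")
      case True
      then have "0 \<le> r" using Lam_neg[of r k] by (cases "r < 0") auto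
      then have "z \<in> accepted k" using True t Lam_le[of r k] by (auto simp: accepted_def z)
      then show ?thesis by (simp add: thin_def)
    qed (auto simp: z mark_def thin_def split: split_indicator)
  qed
qed

text \<open>The first time at which the larger intensity fails to exceed \<open>h\<close> leads to a contradiction,
  because \<open>n\<close> is finite and integer valued, hence has no point right after that time.\<close>

theorem comparison_upper:
  assumes mm_gt: "\<And>k t. t \<in> {0..T} \<Longrightarrow> b k t < mm k t" and ga_ge: "\<And>t. t \<in> {0..T} \<Longrightarrow> q t \<le> ga t"
    and t: "t \<in> {0..T}"
  shows "emeasure (n k) {0..t} \<le> point_count k t \<omega>"
proof -
  \<comment> \<open>The comparison is made level by level instead of as
    \<open>h k s < Lam k (\<omega>, s)\<close>, so that both intensities may be infinite.\<close>
  define good where "good s \<longleftrightarrow> (\<forall>k x. ennreal x \<le> h k s \<longrightarrow> ennreal x < Lam k (\<omega>, s))" for s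
  \<comment> \<open>It is enough to be good on a set \<open>U\<close> that carries all points of
    \<open>n\<close> before \<open>s\<close>, since the intensity at \<open>s\<close> does not see
    other times.\<close>
  have step: "good s" if s: "s \<in> {0..T}" and U: "U \<in> sets borel" "\<And>r. r \<in> U \<Longrightarrow> r \<in> {0..T} \<Longrightarrow> good r"
    and null: "\<And>l. emeasure (n l) ({..<s} - U) = 0" for s U
    unfolding good_def
  proof (intro allI impI)
    fix k and x :: real assume x: "ennreal x \<le> h k s"
    define J where "J = (\<Sum>l\<in>UNIV. \<integral>\<^sup>+r. ph k l (s - r) \<partial>n l)"
    define J' where "J' = (\<Sum>l\<in>UNIV. \<integral>\<^sup>+z. ph k l (s - snd z) * thin (Lam l) (mark \<omega> z) \<partial>\<kappa> l \<omega>)"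
    have "J \<le> J'"
      unfolding J_def J'_def
    proof (rule sum_mono)
      fix l
      have "(\<integral>\<^sup>+r. ph k l (s - r) \<partial>n l) = (\<integral>\<^sup>+r. ph k l (s - r) * indicator U r \<partial>n l)"
      proof (rule nn_integral_cong_AE)
        have "AE r in n l. r \<notin> {..<s} - U"
          by (rule AE_I[where N="{..<s} - U"]) (use null U in \<open>auto simp: n_sets\<close>)
        then show "AE r in n l. ph k l (s - r) = ph k l (s - r) * indicator U r"
        proof eventually_elim
          case (elim r)
          then show ?case using ph0[of "s - r" k l] by (cases "r < s") (auto split: split_indicator)
        qed
      qed
      also have "\<dots> = (\<integral>\<^sup>+z. ph k l (s - snd z) * indicator U (snd z) * indicator (accepted l) z \<partial>\<kappa> l \<omega>)"
        by (rule n_transfer) (intro borel_measurable_times_ennreal ph_shift_measurable borel_measurable_indicator U)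
      also have "\<dots> \<le> (\<integral>\<^sup>+z. ph k l (s - snd z) * thin (Lam l) (mark \<omega> z) \<partial>\<kappa> l \<omega>)"
      proof (rule nn_integral_mono)
        fix z :: "real \<times> real"
        obtain y r where z: "z = (y, r)" by (cases z)
        show "ph k l (s - snd z) * indicator U (snd z) * indicator (accepted l) z \<le>
            ph k l (s - snd z) * thin (Lam l) (mark \<omega> z)"
        proof (cases "r \<in> U \<and> z \<in> accepted l")
          case True
          then have "0 \<le> y" "ennreal y < Lam l (\<omega>, r)" using U(2)[of r] by (auto simp: accepted_def z good_def)
          then show ?thesis using True by (simp add: z mark_def thin_def)
        qed (auto simp: z split: split_indicator)
      qed
      finally show "(\<integral>\<^sup>+r. ph k l (s - r) \<partial>n l) \<le> (\<integral>\<^sup>+z. ph k l (s - snd z) * thin (Lam l) (mark \<omega> z) \<partial>\<kappa> l \<omega>)" .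
    qed
    then have JJ: "q s * J \<le> ga s * J'" using ga_ge[OF s] by (intro mult_mono) simp_all
    show "ennreal x < Lam k (\<omega>, s)"
    \<comment> \<open>The strict gap between the baselines survives the addition of the excitation
      term when this is finite; otherwise \<open>Lam\<close> is infinite and exceeds every real
      level.\<close>
    proof (cases "ga s * J' = \<infinity>")
      case True
      then show ?thesis unfolding Lam_eq[OF \<omega>, of k s] J'_def[symmetric] by simp
    next
      case False
      have "ennreal x \<le> b k s + q s * J" using x unfolding h_eq[of k s] J_def .
      also have "\<dots> \<le> ga s * J' + b k s" using JJ by (simp add: add.commute add_mono)
      also have "\<dots> < ga s * J' + mm k s"
        using False mm_gt[OF s, of k] by (simp add: ennreal_add_left_cancel_less)
      also have "\<dots> = Lam k (\<omega>, s)" unfolding Lam_eq[OF \<omega>, of k s] J'_def by (simp add: add.commute)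
      finally show ?thesis .
    qed
  qed
  have all_good: "good s" if "s \<in> {0..T}" for s
  proof (rule ccontr)
    assume "\<not> good s"
    define bad where "bad = {s\<in>{0..T}. \<not> good s}"
    have ne: "bad \<noteq> {}" using that \<open>\<not> good s\<close> by (auto simp: bad_def)
    have bdd: "bdd_below bad" by (rule bdd_belowI[of _ 0]) (auto simp: bad_def)
    define \<tau> where "\<tau> = Inf bad"
    have \<tau>0: "0 \<le> \<tau>" unfolding \<tau>_def by (rule cInf_greatest[OF ne]) (auto simp: bad_def)
    have "\<tau> \<le> s" unfolding \<tau>_def by (rule cInf_lower[OF _ bdd]) (use that \<open>\<not> good s\<close> in \<open>auto simp: bad_def\<close>)
    then have \<tau>: "\<tau> \<in> {0..T}" using \<tau>0 that by auto
    have before: "good r" if "r \<in> {0..T}" "r < \<tau>" for r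
      using that cInf_lower[OF _ bdd, of r] by (force simp: bad_def \<tau>_def)
    \<comment> \<open>Intensities at \<open>\<tau>\<close> depend on points strictly before
      \<open>\<tau>\<close>, so goodness extends to the infimum itself.\<close>
    have at: "good \<tau>" by (rule step[OF \<tau>, of "{..<\<tau>}"]) (use before in auto)
    have upto: "good r" if "r \<in> {..\<tau>}" "r \<in> {0..T}" for r
      using before[of r] at that by (cases "r = \<tau>") auto
    have "\<forall>\<^sub>F i in sequentially. emeasure (n l) {\<tau><..<\<tau> + 1 / real (Suc i)} < 1" for l
    proof -
      have "(\<lambda>i. emeasure (n l) {\<tau><..<\<tau> + 1 / real (Suc i)}) \<longlonglongrightarrow> emeasure (n l) (\<Inter>i. {\<tau><..<\<tau> + 1 / real (Suc i)})"
      proof (rule Lim_emeasure_decseq)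
        show "decseq (\<lambda>i. {\<tau><..<\<tau> + 1 / real (Suc i)})"
        proof (rule decseq_SucI)
          fix i
          have "1 / real (Suc (Suc i)) \<le> 1 / real (Suc i)" by (rule frac_le) auto
          then show "{\<tau><..<\<tau> + 1 / real (Suc (Suc i))} \<subseteq> {\<tau><..<\<tau> + 1 / real (Suc i)}" by auto
        qed
        show "emeasure (n l) {\<tau><..<\<tau> + 1 / real (Suc i)} \<noteq> \<infinity>" for i
          using n_finite[of l] by (rule less_imp_neq)
      qed (auto simp: n_sets)
      also have "(\<Inter>i. {\<tau><..<\<tau> + 1 / real (Suc i)}) = {}"
      proof (rule equals0I)
        fix r assume r: "r \<in> (\<Inter>i. {\<tau><..<\<tau> + 1 / real (Suc i)})"
        have mem: "\<tau> < r \<and> r < \<tau> + 1 / real (Suc i)" for i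
          using INT_D[OF r UNIV_I, of i] by simp
        then have "0 < r - \<tau>" by simp
        then obtain i where "inverse (real (Suc i)) < r - \<tau>" using reals_Archimedean by metis
        moreover have "r < \<tau> + 1 / real (Suc i)" using mem by (rule conjunct2)
        ultimately show False by (simp add: inverse_eq_divide)
      qed
      finally have lim: "(\<lambda>i. emeasure (n l) {\<tau><..<\<tau> + 1 / real (Suc i)}) \<longlonglongrightarrow> 0"
        by (simp only: emeasure_empty)
      show ?thesis by (rule order_tendstoD(2)[OF lim ennreal_zero_less_one])
    qed
    then have "\<forall>\<^sub>F i in sequentially. \<forall>l. emeasure (n l) {\<tau><..<\<tau> + 1 / real (Suc i)} < 1"
      by (rule eventually_all_finite)
    then obtain i where i: "\<And>l. emeasure (n l) {\<tau><..<\<tau> + 1 / real (Suc i)} < 1"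
      by (auto simp: eventually_sequentially)
    have null: "emeasure (n l) {\<tau><..<\<tau> + 1 / real (Suc i)} = 0" for l
    proof -
      obtain j :: nat where j: "emeasure (n l) {\<tau><..<\<tau> + 1 / real (Suc i)} = of_nat j" using n_nat[of "{\<tau><..<\<tau> + 1 / real (Suc i)}" l] by auto
      then have "of_nat j < (of_nat 1 :: ennreal)" using i[of l] by simp
      then have "j = 0" unfolding of_nat_less_iff by simp
      then show ?thesis using j by simp
    qed
    have "Inf bad < \<tau> + 1 / real (Suc i)" unfolding \<tau>_def by simp
    then obtain r where r: "r \<in> bad" "r < \<tau> + 1 / real (Suc i)" using cInf_less_iff[OF ne bdd] by blast
    \<comment> \<open>There is no point between \<open>\<tau>\<close> and \<open>r\<close>, so
      \<open>{..\<tau>}\<close> carries the whole past of \<open>r\<close>, whether or not times in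
      between are good.\<close>
    have "good r"
    proof (rule step[of r "{..\<tau>}"])
      show "emeasure (n l) ({..<r} - {..\<tau>}) = 0" for l
        by (rule emeasure_eq_0[OF _ null[of l]]) (use r in \<open>auto simp: n_sets\<close>)
    qed (use r upto in \<open>auto simp: bad_def\<close>)
    then show False using r by (simp add: bad_def)
  qed
  show ?thesis
    unfolding point_count_def n_count[OF t]
  proof (rule nn_integral_mono)
    fix z :: "real \<times> real"
    obtain x r where z: "z = (x, r)" by (cases z)
    show "indicator {..t} (snd z) * indicator (accepted k) z \<le> indicator {..t} (snd z) * thin (Lam k) (mark \<omega> z)"
    proof (cases "z \<in> accepted k")
      case True
      then have "0 \<le> x" "ennreal x < Lam k (\<omega>, r)" using all_good[of r] by (auto simp: accepted_def z good_def)
      then show ?thesis using True by (simp add: z mark_def thin_def)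
    qed simp
  qed
qed

end

section \<open>Perturbation of the limit and asymptotics of minimal counts\<close>

lemma matrix_mult_matrix_inv:
  fixes A :: "real ^ 'n ^ 'n"
  assumes "invertible A"
  shows "A ** matrix_inv A = mat 1"
  using someI_ex[OF assms[unfolded invertible_def]] unfolding matrix_inv_def by blast

lemma matrix_inv_solves:
  fixes A :: "real ^ 'n ^ 'n"
  assumes "invertible (mat 1 - a *\<^sub>R A)"
  shows "(matrix_inv (mat 1 - a *\<^sub>R A) *v b) $ k =
    b $ k + a * (\<Sum>l\<in>UNIV. A $ k $ l * (matrix_inv (mat 1 - a *\<^sub>R A) *v b) $ l)"
proof -
  define v where "v = matrix_inv (mat 1 - a *\<^sub>R A) *v b"
  have "(mat 1 - a *\<^sub>R A) *v v = b"
    unfolding v_def by (simp add: matrix_vector_mul_assoc matrix_mult_matrix_inv[OF assms])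
  then have "v - a *\<^sub>R (A *v v) = b"
    by (simp add: matrix_vector_mult_diff_rdistrib scaleR_matrix_vector_assoc[symmetric])
  then have "v $ k - a * (\<Sum>l\<in>UNIV. A $ k $ l * v $ l) = b $ k"
    by (simp add: vec_eq_iff matrix_vector_mult_def)
  then have "v $ k = b $ k + a * (\<Sum>l\<in>UNIV. A $ k $ l * v $ l)" by (rule iffD1[OF diff_eq_eq])
  then show ?thesis unfolding v_def .
qed

lemma LBINT_Lipschitz:
  fixes f :: "real \<Rightarrow> real"
  assumes f: "continuous_on {0..1} f" "\<And>x. x \<in> {0..1} \<Longrightarrow> \<bar>f x\<bar> \<le> B" and u: "u \<in> {0..1}" "v \<in> {0..1}"
  shows "\<bar>(LBINT x:{0..u}. f x) - (LBINT x:{0..v}. f x)\<bar> \<le> B * \<bar>u - v\<bar>"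
proof -
  have *: "\<bar>(LBINT x:{0..u}. f x) - (LBINT x:{0..v}. f x)\<bar> \<le> B * \<bar>u - v\<bar>" if uv: "u \<le> v" "0 \<le> u" "v \<le> 1" for u v
  proof -
    have int: "set_integrable lborel {0..w} f" if "w \<le> 1" for w
      by (rule borel_integrable_atLeastAtMost') (use that in \<open>auto intro: continuous_on_subset[OF f(1)]\<close>)
    have eq: "(LBINT x:{0..w}. f x) = integral {0..w} f" if "w \<le> 1" for w
      by (rule set_borel_integral_eq_integral(2)[OF int[OF that]])
    have "integral {0..u} f + integral {u..v} f = integral {0..v} f"
      using uv set_borel_integral_eq_integral(1)[OF int[of v]] by (intro Henstock_Kurzweil_Integration.integral_combine) auto
    moreover have "norm (integral {u..v} f) \<le> B * (v - u)"
      by (rule integral_bound) (use uv f in \<open>auto intro: continuous_on_subset[OF f(1)]\<close>)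
    ultimately show ?thesis using uv by (simp add: eq)
  qed
  show ?thesis
  proof (cases "u \<le> v")
    case True
    then show ?thesis using *[of u v] u by auto
  next
    case False
    then show ?thesis using *[of v u] u by (auto simp: abs_minus_commute)
  qed
qed

lemma (in hawkes_minimal) point_count_mono:
  "t \<le> t' \<Longrightarrow> point_count k t \<omega> \<le> point_count k t' \<omega>"
  unfolding point_count_def by (intro nn_integral_mono mult_right_mono) (auto split: split_indicator)

context limit_data
begin

abbreviation limit :: "'p \<Rightarrow> real \<Rightarrow> real" where
  "limit k u \<equiv> (LBINT x:{0..u}. y k x)"

text \<open>A quantitative form of the continuity argument for \<open>y\<close>. The change of the
  reproduction function is multiplied by the unperturbed solution, so the constant depends on the
  bound \<open>B\<close> for \<open>y\<close> and not on \<open>y'\<close>.\<close>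

lemma limit_perturbation:
  assumes x: "x \<in> {0..1}" and y': "\<And>k. y' k = m' k + g' * (\<Sum>l\<in>UNIV. K k l * y' l)"
    and m': "\<And>k. \<bar>m' k - m k x\<bar> \<le> \<delta>" and g': "\<bar>g' - g x\<bar> \<le> \<delta>" "0 \<le> g'" "g' \<le> c"
    and B: "\<And>k. \<bar>y k x\<bar> \<le> B"
  shows "\<bar>y' k - y k x\<bar> \<le> \<delta> * (\<Sum>k\<in>UNIV. \<zeta> k * (1 + (\<Sum>l\<in>UNIV. K k l * B)))"
proof -
  have \<delta>: "0 \<le> \<delta>" using g'(1) by simp
  have "\<bar>y' k - y k x\<bar> \<le> (\<Sum>l\<in>UNIV. \<bar>y' l - y l x\<bar>)"
    by (rule member_le_sum[of k UNIV "\<lambda>l. \<bar>y' l - y l x\<bar>"]) auto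
  also have "\<dots> \<le> (\<Sum>k\<in>UNIV. \<zeta> k * (\<delta> * (1 + (\<Sum>l\<in>UNIV. K k l * B))))"
  proof (rule perturbation)
    fix k
    define S S' where "S = (\<Sum>l\<in>UNIV. K k l * y l x)" and "S' = (\<Sum>l\<in>UNIV. K k l * y' l)"
    have S: "y' k = m' k + g' * S'" "y k x = m k x + g x * S"
      unfolding S_def S'_def by (rule y', rule y_eq[OF x])
    define D where "D = (\<Sum>l\<in>UNIV. K k l * (y' l - y l x))"
    have D: "D = S' - S" unfolding D_def S_def S'_def by (simp only: right_diff_distrib sum_subtractf)
    have tri: "\<bar>a + (d * s + g' * r)\<bar> \<le> \<bar>a\<bar> + (\<bar>d\<bar> * \<bar>s\<bar> + g' * \<bar>r\<bar>)" for a d s r :: real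
    proof -
      have "g' * \<bar>r\<bar> = \<bar>g' * r\<bar>" "\<bar>d\<bar> * \<bar>s\<bar> = \<bar>d * s\<bar>" using g'(2) by (simp_all add: abs_mult)
      then show ?thesis by linarith
    qed
    have "y' k - y k x = (m' k - m k x) + ((g' - g x) * S + g' * D)"
      unfolding S D by (simp add: algebra_simps)
    then have "\<bar>y' k - y k x\<bar> \<le> \<bar>m' k - m k x\<bar> + (\<bar>g' - g x\<bar> * \<bar>\<Sum>l\<in>UNIV. K k l * y l x\<bar> +
        g' * \<bar>\<Sum>l\<in>UNIV. K k l * (y' l - y l x)\<bar>)"
      using tri[of "m' k - m k x" "g' - g x" S D] unfolding S_def D_def by simp
    also have "\<dots> \<le> \<delta> + (\<delta> * (\<Sum>l\<in>UNIV. K k l * B) + c * (\<Sum>l\<in>UNIV. K k l * \<bar>y' l - y l x\<bar>))"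
    proof (intro add_mono mult_mono m' g')
      show "\<bar>\<Sum>l\<in>UNIV. K k l * y l x\<bar> \<le> (\<Sum>l\<in>UNIV. K k l * B)"
        by (rule order.trans[OF abs_weighted_sum]) (intro sum_mono mult_left_mono B K_nonneg)
    qed (use \<delta> c_nonneg abs_weighted_sum in auto)
    finally show "\<bar>y' k - y k x\<bar> \<le> \<delta> * (1 + (\<Sum>l\<in>UNIV. K k l * B)) + c * (\<Sum>l\<in>UNIV. K k l * \<bar>y' l - y l x\<bar>)"
      by (simp add: distrib_left)
  qed
  also have "\<dots> = \<delta> * (\<Sum>k\<in>UNIV. \<zeta> k * (1 + (\<Sum>l\<in>UNIV. K k l * B)))"
    by (simp add: sum_distrib_left mult.left_commute)
  finally show ?thesis .
qed

lemma linear_system_solvable: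
  assumes g': "0 \<le> g'" "g' \<le> c"
  shows "\<exists>y'. \<forall>k. y' k = m' k + g' * (\<Sum>l\<in>UNIV. K k l * y' l)"
proof -
  define Km :: "real ^ 'p ^ 'p" where "Km = (\<chi> k l. K k l)"
  have "invertible (mat 1 - g' *\<^sub>R Km)"
  proof (rule invertible_of_weights[OF _ g'(1)])
    show "1 + (\<Sum>k\<in>UNIV. \<zeta> k * (g' * Km $ k $ l)) \<le> \<zeta> l" for l
    proof -
      have "(\<Sum>k\<in>UNIV. \<zeta> k * (g' * Km $ k $ l)) \<le> (\<Sum>k\<in>UNIV. \<zeta> k * (c * K k l))"
        using g'(2) by (intro sum_mono mult_left_mono \<zeta>_nonneg) (simp add: Km_def K_nonneg mult_right_mono)
      then show ?thesis using \<zeta>[of l] by linarith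
    qed
  qed (simp_all add: Km_def K_nonneg \<zeta>_nonneg)
  note inv = this
  have Km: "Km $ k $ l = K k l" for k l by (simp add: Km_def)
  define v where "v = matrix_inv (mat 1 - g' *\<^sub>R Km) *v (\<chi> k. m' k)"
  note sol = matrix_inv_solves[OF inv, of "\<chi> k. m' k", folded v_def, unfolded Km vec_lambda_beta]
  show ?thesis by (rule exI[of _ "\<lambda>k. v $ k"], rule allI, rule sol)
qed

text \<open>The system is solved separately at each \<open>x\<close> and the solutions are collected
  by choice; their continuity is then a theorem of \<open>limit_data\<close>.\<close>

lemma perturbed_data:
  assumes m': "\<And>k. continuous_on {0..1} (m' k)" "\<And>k x. x \<in> {0..1} \<Longrightarrow> 0 \<le> m' k x"
    and g': "continuous_on {0..1} g'" "\<And>x. x \<in> {0..1} \<Longrightarrow> 0 \<le> g' x" "\<And>x. x \<in> {0..1} \<Longrightarrow> g' x \<le> c"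
  obtains y' where "limit_data m' g' \<phi> K c \<zeta> y'"
proof -
  have "\<forall>x\<in>{0..1}. \<exists>y'. \<forall>k. y' k = m' k x + g' x * (\<Sum>l\<in>UNIV. K k l * y' l)"
    by (rule ballI, rule linear_system_solvable[OF g'(2) g'(3)])
  from bchoice[OF this] obtain Y where
    Y: "\<forall>x\<in>{0..1}. \<forall>k. Y x k = m' k x + g' x * (\<Sum>l\<in>UNIV. K k l * Y x l)" by (rule exE)
  have "limit_data m' g' \<phi> K c \<zeta> (\<lambda>k x. Y x k)"
    by (rule limit_data.intro; fact m' g' c_nonneg \<phi>_nonneg \<phi>_int K_def \<zeta> \<zeta>_nonneg Y[rule_format])
  then show ?thesis by (rule that)
qed

text \<open>Collects, for the stretched data at every horizon \<open>H\<close>, the variance bound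
  and the convergence of the means, so that the processes can be used outside their locale.
  \<open>C\<close> is the constant of \<open>point_count_fluctuation\<close> with the total mass
  bounded linearly in \<open>H\<close>, hence is independent of \<open>t\<close>.\<close>

theorem minimal_counts:
  assumes adk: "adapted_kernel M \<kappa> F"
  obtains C :: real and cnt :: "real \<Rightarrow> 'p \<Rightarrow> real \<Rightarrow> 'w \<Rightarrow> ennreal" and mc :: "real \<Rightarrow> 'p \<Rightarrow> real \<Rightarrow> real"
  where "0 \<le> C"
    and "\<And>H k t. H > 0 \<Longrightarrow> cnt H k t \<in> borel_measurable M"
    and "\<And>H k t. H > 0 \<Longrightarrow> AE \<omega> in M. cnt H k t \<omega> < \<infinity>"
    and "\<And>H k t. H > 0 \<Longrightarrow> (\<integral>\<^sup>+\<omega>. ennreal ((enn2real (cnt H k t \<omega>) - mc H k t)\<^sup>2) \<partial>M) \<le> ennreal (C * H)"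
    and "\<And>\<epsilon>. \<epsilon> > 0 \<Longrightarrow> \<forall>\<^sub>F H in at_top. \<forall>k. \<forall>u\<in>{0..1}. \<bar>mc H k (H * u) / H - limit k u\<bar> \<le> \<epsilon>"
    and "\<And>H k t t' \<omega>. H > 0 \<Longrightarrow> t \<le> t' \<Longrightarrow> cnt H k t \<omega> \<le> cnt H k t' \<omega>"
    and "\<And>H k. cnt H k = hawkes_minimal.point_count \<kappa> (mmH H) (gaH H) ph k"
proof -
  obtain B where B: "0 \<le> B" "\<And>H k. H > 0 \<Longrightarrow> (\<integral>\<^sup>+t. mmH H k t \<partial>lborel) \<le> ennreal (B * H)" by (rule mmH_mass) blast
  define C where "C = real CARD('p) * ((\<Sum>l\<in>UNIV. \<zeta> l)\<^sup>2 * (\<Sum>k\<in>(UNIV :: 'p set). \<zeta> k * B))"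
  define cnt where "cnt H k t \<omega> = hawkes_minimal.point_count \<kappa> (mmH H) (gaH H) ph k t \<omega>" for H k t \<omega>
  define mc where "mc H k t = enn2real (hawkes_minimal.mean_count M \<kappa> (mmH H) (gaH H) ph k t)" for H k t
  note hm = hawkes_minimal_scaled[OF _ adk]
  show ?thesis
  proof (rule that[of C cnt mc])
    show "0 \<le> C" unfolding C_def by (intro mult_nonneg_nonneg sum_nonneg) (auto simp: \<zeta>_nonneg B(1))
    show "cnt H k = hawkes_minimal.point_count \<kappa> (mmH H) (gaH H) ph k" for H k
      by (simp add: cnt_def fun_eq_iff)
    fix H :: real and k t t' assume H: "H > 0"
    interpret hm: hawkes_minimal M \<kappa> F "mmH H" "gaH H" ph "ennreal c" "\<lambda>l. ennreal (\<zeta> l)" by (rule hm[OF H])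
    show "cnt H k t \<in> borel_measurable M" unfolding cnt_def[abs_def] by (rule hm.point_count_measurable)
    show "AE \<omega> in M. cnt H k t \<omega> < \<infinity>" unfolding cnt_def by (rule hm.point_count_AE_finite)
    show "cnt H k t \<omega> \<le> cnt H k t' \<omega>" if "t \<le> t'" for \<omega> unfolding cnt_def by (rule hm.point_count_mono[OF that])
    have "(\<integral>\<^sup>+\<omega>. ennreal ((enn2real (cnt H k t \<omega>) - mc H k t)\<^sup>2) \<partial>M) \<le>
        of_nat CARD('p) * ((\<Sum>l\<in>UNIV. ennreal (\<zeta> l))\<^sup>2 * (\<Sum>k\<in>UNIV. ennreal (\<zeta> k) * (\<integral>\<^sup>+t. mmH H k t \<partial>lborel)))"
      unfolding cnt_def mc_def by (rule hm.point_count_fluctuation)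
    also have "\<dots> \<le> of_nat CARD('p) * ((\<Sum>l\<in>UNIV. ennreal (\<zeta> l))\<^sup>2 * (\<Sum>k\<in>(UNIV :: 'p set). ennreal (\<zeta> k) * ennreal (B * H)))"
      by (intro mult_left_mono sum_mono B(2) H) simp_all
    also have "\<dots> = ennreal (C * H)"
    proof -
      have "(\<Sum>k\<in>(UNIV :: 'p set). ennreal (\<zeta> k) * ennreal (B * H)) = ennreal ((\<Sum>k\<in>(UNIV :: 'p set). \<zeta> k * B) * H)"
        using \<zeta>_nonneg B(1) H by (simp add: sum_distrib_right mult.assoc flip: ennreal_mult)
      moreover have "(\<Sum>l\<in>UNIV. ennreal (\<zeta> l))\<^sup>2 = ennreal ((\<Sum>l\<in>UNIV. \<zeta> l)\<^sup>2)"
        using \<zeta>_nonneg by (simp add: ennreal_power sum_nonneg)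
      ultimately show ?thesis
        using \<zeta>_nonneg B(1) H unfolding C_def
        by (simp add: ennreal_of_nat_eq_real_of_nat sum_nonneg mult.assoc flip: ennreal_mult)
    qed
    finally show "(\<integral>\<^sup>+\<omega>. ennreal ((enn2real (cnt H k t \<omega>) - mc H k t)\<^sup>2) \<partial>M) \<le> ennreal (C * H)" .
  next
    fix \<epsilon> :: real assume "\<epsilon> > 0"
    from renewal_limit[OF this] show "\<forall>\<^sub>F H in at_top. \<forall>k. \<forall>u\<in>{0..1}. \<bar>mc H k (H * u) / H - limit k u\<bar> \<le> \<epsilon>"
      using eventually_gt_at_top[of 0]
    proof eventually_elim
      case (elim H)
      interpret hm: hawkes_minimal M \<kappa> F "mmH H" "gaH H" ph "ennreal c" "\<lambda>l. ennreal (\<zeta> l)" by (rule hm[OF elim(2)])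
      have "renewal_solution H hm.mean_rate"
        unfolding renewal_solution_def using hm.mean_rate_measurable hm.mean_rate_finite hm.mean_rate_eq by blast
      with elim(1) show ?case unfolding mc_def hm.mean_count_def by blast
    qed
  qed
qed

end

lemma LBINT_diff_bound:
  fixes f f' :: "real \<Rightarrow> real"
  assumes f: "continuous_on {0..1} f" "continuous_on {0..1} f'" "\<And>x. x \<in> {0..1} \<Longrightarrow> \<bar>f x - f' x\<bar> \<le> e"
    and u: "u \<in> {0..1}" and e: "0 \<le> e"
  shows "\<bar>(LBINT x:{0..u}. f x) - (LBINT x:{0..u}. f' x)\<bar> \<le> e"
proof -
  have int: "set_integrable lborel {0..u} f" "set_integrable lborel {0..u} f'"
    by (rule borel_integrable_atLeastAtMost', use u in \<open>auto intro: continuous_on_subset[OF f(1)] continuous_on_subset[OF f(2)]\<close>)+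
  have d: "continuous_on {0..u} (\<lambda>x. f x - f' x)"
    using u by (intro continuous_on_diff) (auto intro: continuous_on_subset[OF f(1)] continuous_on_subset[OF f(2)])
  have "(LBINT x:{0..u}. f x) - (LBINT x:{0..u}. f' x) = (LBINT x:{0..u}. f x - f' x)"
    by (rule set_integral_diff(2)[symmetric, OF int])
  also have "\<dots> = integral {0..u} (\<lambda>x. f x - f' x)"
    by (rule set_borel_integral_eq_integral(2)[OF borel_integrable_atLeastAtMost'[OF d]])
  also have "norm \<dots> \<le> e * (u - 0)"
    by (rule integral_bound) (use u d f(3) in auto)
  also have "\<dots> \<le> e" using u e by (simp add: mult_left_le)
  finally show ?thesis by simp
qed

lemma grid_points:
  assumes v: "v \<in> {0..1 :: real}" and q: "0 < (q :: nat)"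
  obtains i j where "i \<le> q" "v \<le> real i / real q" "real i / real q \<le> v + 1 / real q"
    "j \<le> q" "real j / real q \<le> v" "v - 1 / real q \<le> real j / real q"
proof (rule that[of "nat \<lceil>real q * v\<rceil>" "nat \<lfloor>real q * v\<rfloor>"])
  have qv: "0 \<le> real q * v" "real q * v \<le> real q" using v q by (auto simp: mult_left_le)
  have up: "real (nat \<lceil>real q * v\<rceil>) = of_int \<lceil>real q * v\<rceil>" and dn: "real (nat \<lfloor>real q * v\<rfloor>) = of_int \<lfloor>real q * v\<rfloor>"
    using qv(1) by simp_all
  show "nat \<lceil>real q * v\<rceil> \<le> q" using qv(2) by (simp add: ceiling_le_iff)
  show "nat \<lfloor>real q * v\<rfloor> \<le> q"
  proof -
    have "\<lfloor>real q * v\<rfloor> \<le> int q" using qv(2) by linarith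
    then show ?thesis by simp
  qed
  have "real q * v \<le> of_int \<lceil>real q * v\<rceil>" "of_int \<lceil>real q * v\<rceil> \<le> real q * v + 1"
    "of_int \<lfloor>real q * v\<rfloor> \<le> real q * v" "real q * v - 1 \<le> of_int \<lfloor>real q * v\<rfloor>" by linarith+
  from this[THEN divide_right_mono, of "real q"] q
  show "v \<le> real (nat \<lceil>real q * v\<rceil>) / real q" "real (nat \<lceil>real q * v\<rceil>) / real q \<le> v + 1 / real q"
    "real (nat \<lfloor>real q * v\<rfloor>) / real q \<le> v" "v - 1 / real q \<le> real (nat \<lfloor>real q * v\<rfloor>) / real q"
    unfolding up dn by (simp_all add: add_divide_distrib diff_divide_distrib)
qed

section \<open>All scales in a window between two minimal processes\<close>

text \<open>The margin \<open>\<delta>0\<close> leaves room under \<open>c\<close> for the upward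
  shift of the reproduction function, so that the majorising process is still subcritical with the
  same \<open>\<zeta>\<close>.\<close>

locale hawkes_lln = adapted_kernel M \<kappa> F + limit_data m g \<phi> K c \<zeta> y
  for M :: "'w measure" and \<kappa> :: "'p::finite \<Rightarrow> 'w \<Rightarrow> (real \<times> real) measure" and F
    and m :: "'p \<Rightarrow> real \<Rightarrow> real" and g \<phi> K c \<zeta> y +
  fixes N :: "real \<Rightarrow> 'p \<Rightarrow> 'w \<Rightarrow> real measure" and \<delta>0 :: real
  assumes margin: "0 < \<delta>0" "x \<in> {0..1} \<Longrightarrow> g x + \<delta>0 \<le> c"
begin

definition rate :: "real \<Rightarrow> 'w \<Rightarrow> 'p \<Rightarrow> real \<Rightarrow> ennreal" where
  "rate T \<omega> k s = mmH T k s + gaH T s * (\<Sum>l\<in>UNIV. \<integral>\<^sup>+r. ph k l (s - r) \<partial>N T l \<omega>)"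

text \<open>Everything that the comparison uses about an outcome at scale \<open>T\<close>. The
  equation refers to \<open>\<kappa>\<close>, which will be the everywhere finite version of the
  Poisson measures.\<close>

definition good_path :: "'w \<Rightarrow> real \<Rightarrow> bool" where
  "good_path \<omega> T \<longleftrightarrow> (\<forall>k. sets (N T k \<omega>) = sets borel \<and> emeasure (N T k \<omega>) (- {0..T}) = 0 \<and>
      (\<forall>A\<in>sets borel. \<exists>i::nat. emeasure (N T k \<omega>) A = of_nat i)) \<and>
    (\<forall>k. \<forall>t\<in>{0..T}. emeasure (N T k \<omega>) {0..t} =
      emeasure (\<kappa> k \<omega>) {(x, s). 0 \<le> s \<and> s \<le> t \<and> 0 \<le> x \<and> ennreal x \<le> rate T \<omega> k s})"

lemma hawkes_path_scaled:
  assumes H: "0 < H" and T: "0 < T" and \<omega>: "\<omega> \<in> space M" and good: "good_path \<omega> T"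
    and data: "limit_data m' g' \<phi> K c \<zeta> y'"
  shows "hawkes_path M \<kappa> F (limit_data.mmH m' H) (limit_data.gaH g' H) ph (ennreal c) (\<lambda>l. ennreal (\<zeta> l))
    \<omega> T (\<lambda>k. N T k \<omega>) (mmH T) (gaH T) (rate T \<omega>)"
proof -
  interpret d: limit_data m' g' \<phi> K c \<zeta> y' by (rule data)
  have "hawkes_minimal M \<kappa> F (d.mmH H) (d.gaH H) ph (ennreal c) (\<lambda>l. ennreal (\<zeta> l))"
    by (rule d.hawkes_minimal_scaled[OF H adapted_kernel_axioms])
  then show ?thesis
  proof (rule hawkes_path.intro, intro hawkes_path_axioms.intro)
    fix k l and s A t
    show "\<omega> \<in> space M" "0 < T" by (fact \<omega>, fact T)
    show "mmH T k \<in> borel_measurable borel" "gaH T \<in> borel_measurable borel" by (rule mmH_measurable, rule gaH_measurable)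
    show "rate T \<omega> k s = mmH T k s + gaH T s * (\<Sum>l\<in>UNIV. \<integral>\<^sup>+r. ph k l (s - r) \<partial>N T l \<omega>)" by (rule rate_def)
    show "sets (N T k \<omega>) = sets borel" "emeasure (N T k \<omega>) (- {0..T}) = 0"
      using good by (simp_all add: good_path_def)
    show "\<exists>i::nat. emeasure (N T k \<omega>) A = of_nat i" if "A \<in> sets borel" using good that unfolding good_path_def by blast
    show "emeasure (N T k \<omega>) {0..t} = emeasure (\<kappa> k \<omega>) {(x, s). 0 \<le> s \<and> s \<le> t \<and> 0 \<le> x \<and> ennreal x \<le> rate T \<omega> k s}"
      if "t \<in> {0..T}" using good that unfolding good_path_def by blast
  qed
qed

text \<open>The horizons differ: since \<open>T \<le> H\<close>, the data of the minimal process are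
  not yet cut off on \<open>{0..T}\<close>, and beyond \<open>T\<close> nothing is compared.\<close>

lemma counts_below:
  assumes H: "0 < T" "T \<le> H" and \<omega>: "\<omega> \<in> space M" and good: "good_path \<omega> T"
    and data: "limit_data m' g' \<phi> K c \<zeta> y'"
    and le: "\<And>k t. t \<in> {0..T} \<Longrightarrow> m' k (t / H) \<le> m k (t / T)" "\<And>t. t \<in> {0..T} \<Longrightarrow> g' (t / H) \<le> g (t / T)"
    and t: "t \<in> {0..T}"
  shows "hawkes_minimal.point_count \<kappa> (limit_data.mmH m' H) (limit_data.gaH g' H) ph k t \<omega> \<le> emeasure (N T k \<omega>) {0..t}"
proof -
  have H0: "0 < H" using H by simp
  interpret d: limit_data m' g' \<phi> K c \<zeta> y' by (rule data)
  interpret hp: hawkes_path M \<kappa> F "d.mmH H" "d.gaH H" ph "ennreal c" "\<lambda>l. ennreal (\<zeta> l)" \<omega> T "\<lambda>k. N T k \<omega>" "mmH T" "gaH T" "rate T \<omega>"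
    by (rule hawkes_path_scaled[OF H0 H(1) \<omega> good data])
  show ?thesis
  proof (rule hp.comparison_lower[OF _ _ _ _ t])
    show "d.mmH H k s \<le> mmH T k s" if "s \<in> {0..T}" for k s
      unfolding d.mmH_def mmH_def using that le(1)[OF that, of k] H by (intro ennreal_leI) auto
    show "d.gaH H s \<le> gaH T s" if "s \<in> {0..T}" for s
      unfolding d.gaH_def gaH_def using that le(2)[OF that] H by (intro ennreal_leI) auto
  qed (simp_all add: d.mmH_def d.gaH_def)
qed

lemma counts_above:
  assumes H: "0 < T" "T \<le> H" and \<omega>: "\<omega> \<in> space M" and good: "good_path \<omega> T"
    and data: "limit_data m' g' \<phi> K c \<zeta> y'"
    and le: "\<And>k t. t \<in> {0..T} \<Longrightarrow> m k (t / T) < m' k (t / H)" "\<And>t. t \<in> {0..T} \<Longrightarrow> g (t / T) \<le> g' (t / H)"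
    and t: "t \<in> {0..T}"
  shows "emeasure (N T k \<omega>) {0..t} \<le> hawkes_minimal.point_count \<kappa> (limit_data.mmH m' H) (limit_data.gaH g' H) ph k t \<omega>"
proof -
  have H0: "0 < H" using H by simp
  interpret d: limit_data m' g' \<phi> K c \<zeta> y' by (rule data)
  interpret hp: hawkes_path M \<kappa> F "d.mmH H" "d.gaH H" ph "ennreal c" "\<lambda>l. ennreal (\<zeta> l)" \<omega> T "\<lambda>k. N T k \<omega>" "mmH T" "gaH T" "rate T \<omega>"
    by (rule hawkes_path_scaled[OF H0 H(1) \<omega> good data])
  show ?thesis
  proof (rule hp.comparison_upper[OF _ _ t])
    show "mmH T k s < d.mmH H k s" if "s \<in> {0..T}" for k s
    proof -
      have "0 \<le> m k (s / T)" by (rule m_nonneg) (use that H in auto)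
      then show ?thesis unfolding d.mmH_def mmH_def using that le(1)[OF that, of k] H by (simp add: ennreal_less_iff)
    qed
    show "gaH T s \<le> d.gaH H s" if "s \<in> {0..T}" for s
      unfolding d.gaH_def gaH_def using that le(2)[OF that] H by (intro ennreal_leI) auto
  qed
qed

lemma modulus:
  assumes \<delta>: "0 < \<delta>"
  obtains \<eta> where "0 < \<eta>" "\<And>k x x'. x \<in> {0..1} \<Longrightarrow> x' \<in> {0..1} \<Longrightarrow> \<bar>x - x'\<bar> < \<eta> \<Longrightarrow> \<bar>m k x - m k x'\<bar> < \<delta> \<and> \<bar>g x - g x'\<bar> < \<delta>"
proof -
  have uc: "\<exists>\<eta>>0. \<forall>x\<in>{0..1}. \<forall>x'\<in>{0..1}. \<bar>x - x'\<bar> < \<eta> \<longrightarrow> \<bar>f x - f x'\<bar> < \<delta>"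
    if "continuous_on {0..1} f" for f :: "real \<Rightarrow> real"
  proof -
    have "uniformly_continuous_on {0..1} f" by (rule compact_uniformly_continuous[OF that]) simp
    from uniformly_continuous_onE[OF this \<delta>] obtain \<eta> where
      "\<eta> > 0" "\<And>x x'. x \<in> {0..1} \<Longrightarrow> x' \<in> {0..1} \<Longrightarrow> dist x' x < \<eta> \<Longrightarrow> dist (f x') (f x) < \<delta>" by blast
    then show ?thesis by (intro exI[of _ \<eta>]) (auto simp: dist_real_def abs_minus_commute)
  qed
  obtain e where e: "e > 0" "\<forall>x\<in>{0..1}. \<forall>x'\<in>{0..1}. \<bar>x - x'\<bar> < e \<longrightarrow> \<bar>g x - g x'\<bar> < \<delta>" using uc[OF g_cont] by blast
  from uc[OF m_cont] have "\<forall>k. \<exists>\<eta>>0. \<forall>x\<in>{0..1}. \<forall>x'\<in>{0..1}. \<bar>x - x'\<bar> < \<eta> \<longrightarrow> \<bar>m k x - m k x'\<bar> < \<delta>" by blast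
  then obtain E where E: "\<And>k. E k > 0" "\<And>k. \<forall>x\<in>{0..1}. \<forall>x'\<in>{0..1}. \<bar>x - x'\<bar> < E k \<longrightarrow> \<bar>m k x - m k x'\<bar> < \<delta>" by metis
  define \<eta> where "\<eta> = Min (insert e (range E))"
  have pos: "0 < \<eta>" unfolding \<eta>_def using e(1) E(1) by (subst Min_gr_iff) auto
  have le: "\<eta> \<le> e" "\<eta> \<le> E k" for k unfolding \<eta>_def by (rule Min_le, simp, simp)+
  show ?thesis
  proof (rule that[OF pos])
    fix k and x x' :: real assume x: "x \<in> {0..1}" "x' \<in> {0..1}" "\<bar>x - x'\<bar> < \<eta>"
    then have "\<bar>x - x'\<bar> < e" "\<bar>x - x'\<bar> < E k" using le(1) le(2)[of k] by linarith+
    then show "\<bar>m k x - m k x'\<bar> < \<delta> \<and> \<bar>g x - g x'\<bar> < \<delta>" using e(2) E(2)[of k] x by blast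
  qed
qed

text \<open>One time scale \<open>H\<close> controls all \<open>T\<close> in \<open>[H / b, H]\<close>: the processes at scale \<open>T\<close> lie between
  the minimal processes at scale \<open>H\<close> whose data are shifted by \<open>\<plusminus>\<delta>\<close>.\<close>

theorem sandwich:
  assumes \<eta>: "0 < \<eta>"
  obtains b C H0 :: real and Z :: "real \<Rightarrow> 'w \<Rightarrow> real" where "1 < b" "0 \<le> C" "0 < H0"
    "\<And>H. 0 < H \<Longrightarrow> Z H \<in> borel_measurable M" "\<And>H \<omega>. 0 < H \<Longrightarrow> 0 \<le> Z H \<omega>"
    "\<And>H. 0 < H \<Longrightarrow> (\<integral>\<^sup>+\<omega>. ennreal ((Z H \<omega>)\<^sup>2) \<partial>M) \<le> ennreal (C / H)"
    "\<And>H. H0 \<le> H \<Longrightarrow> AE \<omega> in M. \<forall>T. H / b \<le> T \<longrightarrow> T \<le> H \<longrightarrow> good_path \<omega> T \<longrightarrow>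
       (\<forall>k. \<forall>u\<in>{0..1}. \<bar>measure (N T k \<omega>) {0..T * u} / T - limit k u\<bar> \<le> 2 * Z H \<omega> + \<eta>)"
proof -
  obtain B0 where B0: "0 \<le> B0" "\<And>k x. x \<in> {0..1} \<Longrightarrow> \<bar>y k x\<bar> \<le> B0" by (rule y_bounded) blast
  define B where "B = B0 + 1"
  have B: "0 < B" "\<And>k x. x \<in> {0..1} \<Longrightarrow> \<bar>y k x\<bar> \<le> B" using B0 by (auto simp: B_def intro: add_increasing2)
  define C' where "C' = (\<Sum>k\<in>UNIV. \<zeta> k * (1 + (\<Sum>l\<in>UNIV. K k l * B)))"
  have C': "0 \<le> C'" unfolding C'_def
    using B by (intro sum_nonneg mult_nonneg_nonneg \<zeta>_nonneg add_nonneg_nonneg K_nonneg) auto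
  \<comment> \<open>Small enough for the shifted reproduction function to stay below
    \<open>c\<close>, and for the limits to move by at most \<open>\<eta> / 10\<close>.\<close>
  define \<delta> where "\<delta> = min \<delta>0 (\<eta> / (10 * (C' + 1)))"
  have \<delta>: "0 < \<delta>" "\<delta> \<le> \<delta>0" using \<eta> C' margin by (auto simp: \<delta>_def)
  have \<delta>C: "\<delta> * C' \<le> \<eta> / 10"
  proof -
    have "\<delta> * C' \<le> \<eta> / (10 * (C' + 1)) * (C' + 1)" using C' \<eta> by (intro mult_mono) (auto simp: \<delta>_def)
    also have "\<dots> = \<eta> / 10" using C' by (simp add: field_simps)
    finally show ?thesis .
  qed
  define mp where "mp k x = m k x + \<delta>" for k x
  define gp where "gp x = g x + \<delta>" for x
  \<comment> \<open>Data must be nonnegative, hence the truncation at zero; it does not increase the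
    distance to \<open>m\<close>, which is itself nonnegative.\<close>
  define ml where "ml k x = max 0 (m k x - \<delta>)" for k x
  define gl where "gl x = max 0 (g x - \<delta>)" for x
  obtain yp where up: "limit_data mp gp \<phi> K c \<zeta> yp"
  proof (rule perturbed_data[of mp gp])
    show "gp x \<le> c" if "x \<in> {0..1}" for x using margin(2)[OF that] \<delta> by (simp add: gp_def)
  qed (use \<delta> m_nonneg g_nonneg in \<open>auto simp: mp_def[abs_def] gp_def[abs_def] intro!: continuous_intros m_cont g_cont add_nonneg_nonneg\<close>)
  obtain yl where lo: "limit_data ml gl \<phi> K c \<zeta> yl"
  proof (rule perturbed_data[of ml gl])
    show "gl x \<le> c" if "x \<in> {0..1}" for x using g_le[OF that] \<delta> c_nonneg by (simp add: gl_def)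
  qed (auto simp: ml_def[abs_def] gl_def[abs_def] intro!: continuous_intros m_cont g_cont)
  interpret up: limit_data mp gp \<phi> K c \<zeta> yp by (rule up)
  interpret lo: limit_data ml gl \<phi> K c \<zeta> yl by (rule lo)
  have yp: "\<bar>yp k x - y k x\<bar> \<le> \<delta> * C'" if x: "x \<in> {0..1}" for k x
    unfolding C'_def
  proof (rule limit_perturbation[OF x, of "\<lambda>k. yp k x" "\<lambda>k. mp k x" "gp x"])
    show "yp k x = mp k x + gp x * (\<Sum>l\<in>UNIV. K k l * yp l x)" for k by (rule up.y_eq[OF x])
    show "gp x \<le> c" by (rule up.g_le[OF x])
    show "0 \<le> gp x" by (rule up.g_nonneg[OF x])
  qed (use \<delta> B x in \<open>auto simp: mp_def gp_def\<close>)
  have yl: "\<bar>yl k x - y k x\<bar> \<le> \<delta> * C'" if x: "x \<in> {0..1}" for k x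
    unfolding C'_def
  proof (rule limit_perturbation[OF x, of "\<lambda>k. yl k x" "\<lambda>k. ml k x" "gl x"])
    show "yl k x = ml k x + gl x * (\<Sum>l\<in>UNIV. K k l * yl l x)" for k by (rule lo.y_eq[OF x])
    show "gl x \<le> c" by (rule lo.g_le[OF x])
    show "0 \<le> gl x" by (rule lo.g_nonneg[OF x])
    show "\<bar>ml k x - m k x\<bar> \<le> \<delta>" for k using m_nonneg[OF x, of k] \<delta> by (auto simp: ml_def)
    show "\<bar>gl x - g x\<bar> \<le> \<delta>" using g_nonneg[OF x] \<delta> by (auto simp: gl_def)
  qed (use B x in auto)
  have limp: "\<bar>up.limit k u - limit k u\<bar> \<le> \<eta> / 10" if "u \<in> {0..1}" for k u
    by (rule order.trans[OF LBINT_diff_bound[OF up.y_cont y_cont yp that] \<delta>C]) (use \<delta> C' in simp_all)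
  have liml: "\<bar>lo.limit k u - limit k u\<bar> \<le> \<eta> / 10" if "u \<in> {0..1}" for k u
    by (rule order.trans[OF LBINT_diff_bound[OF lo.y_cont y_cont yl that] \<delta>C]) (use \<delta> C' in simp_all)
  obtain Cp cp mp' where cp: "0 \<le> Cp" "\<And>H k t. H > 0 \<Longrightarrow> cp H k t \<in> borel_measurable M"
    "\<And>H k t. H > 0 \<Longrightarrow> AE \<omega> in M. cp H k t \<omega> < \<infinity>"
    "\<And>H k t. H > 0 \<Longrightarrow> (\<integral>\<^sup>+\<omega>. ennreal ((enn2real (cp H k t \<omega>) - mp' H k t)\<^sup>2) \<partial>M) \<le> ennreal (Cp * H)"
    "\<And>\<epsilon>. \<epsilon> > 0 \<Longrightarrow> \<forall>\<^sub>F H in at_top. \<forall>k. \<forall>u\<in>{0..1}. \<bar>mp' H k (H * u) / H - up.limit k u\<bar> \<le> \<epsilon>"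
    "\<And>H k t t' \<omega>. H > 0 \<Longrightarrow> t \<le> t' \<Longrightarrow> cp H k t \<omega> \<le> cp H k t' \<omega>"
    "\<And>H k. cp H k = hawkes_minimal.point_count \<kappa> (up.mmH H) (up.gaH H) ph k"
    by (rule up.minimal_counts[OF adapted_kernel_axioms]) blast
  obtain Cl cl ml' where cl: "0 \<le> Cl" "\<And>H k t. H > 0 \<Longrightarrow> cl H k t \<in> borel_measurable M"
    "\<And>H k t. H > 0 \<Longrightarrow> AE \<omega> in M. cl H k t \<omega> < \<infinity>"
    "\<And>H k t. H > 0 \<Longrightarrow> (\<integral>\<^sup>+\<omega>. ennreal ((enn2real (cl H k t \<omega>) - ml' H k t)\<^sup>2) \<partial>M) \<le> ennreal (Cl * H)"
    "\<And>\<epsilon>. \<epsilon> > 0 \<Longrightarrow> \<forall>\<^sub>F H in at_top. \<forall>k. \<forall>u\<in>{0..1}. \<bar>ml' H k (H * u) / H - lo.limit k u\<bar> \<le> \<epsilon>"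
    "\<And>H k t t' \<omega>. H > 0 \<Longrightarrow> t \<le> t' \<Longrightarrow> cl H k t \<omega> \<le> cl H k t' \<omega>"
    "\<And>H k. cl H k = hawkes_minimal.point_count \<kappa> (lo.mmH H) (lo.gaH H) ph k"
    by (rule lo.minimal_counts[OF adapted_kernel_axioms]) blast
  obtain \<tau> where \<tau>: "0 < \<tau>" "\<And>k x x'. x \<in> {0..1} \<Longrightarrow> x' \<in> {0..1} \<Longrightarrow> \<bar>x - x'\<bar> < \<tau> \<Longrightarrow> \<bar>m k x - m k x'\<bar> < \<delta> \<and> \<bar>g x - g x'\<bar> < \<delta>"
    by (rule modulus[OF \<delta>(1)]) blast
  \<comment> \<open>For \<open>T\<close> in the window, \<open>t / T\<close> and
    \<open>t / H\<close> differ by at most \<open>b - 1\<close>. This has to lie below the modulus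
    \<open>\<tau>\<close> of the data and to be worth at most \<open>\<eta> / 10\<close> under the
    Lipschitz constant \<open>B\<close> of the limit; \<open>b \<le> 2\<close> is used when
    \<open>1 / H\<close> is exchanged for \<open>1 / T\<close>.\<close>
  define b where "b = 1 + min 1 (min (\<tau> / 2) (\<eta> / (10 * B)))"
  have b: "1 < b" "b \<le> 2" "b - 1 < \<tau>" "b - 1 \<le> \<eta> / (10 * B)" using \<tau>(1) \<eta> B(1) by (auto simp: b_def)
  have bB: "B * (b - 1) \<le> \<eta> / 10"
  proof -
    have "B * (b - 1) \<le> B * (\<eta> / (10 * B))" using b(4) B(1) by (intro mult_left_mono) auto
    then show ?thesis using B(1) by simp
  qed
  obtain q0 :: nat where q0: "10 * B / \<eta> < real q0" using reals_Archimedean2 by blast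
  \<comment> \<open>The number of grid cells, such that the limit varies by at most
    \<open>\<eta> / 10\<close> within one cell.\<close>
  define q where "q = Suc q0"
  have q: "0 < q" by (simp add: q_def)
  have Bq: "B * (1 / real q) \<le> \<eta> / 10"
  proof -
    have "10 * B / \<eta> < real q" using q0 by (simp add: q_def)
    then show ?thesis using \<eta> q by (simp add: field_simps)
  qed
  have "\<forall>\<^sub>F H in at_top. (\<forall>k. \<forall>u\<in>{0..1}. \<bar>mp' H k (H * u) / H - up.limit k u\<bar> \<le> \<eta> / 10) \<and>
      (\<forall>k. \<forall>u\<in>{0..1}. \<bar>ml' H k (H * u) / H - lo.limit k u\<bar> \<le> \<eta> / 10)"
    using cp(5)[of "\<eta> / 10"] cl(5)[of "\<eta> / 10"] \<eta> by (intro eventually_conj) auto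
  then obtain H1 where H1: "\<And>H k u. H1 \<le> H \<Longrightarrow> u \<in> {0..1} \<Longrightarrow> \<bar>mp' H k (H * u) / H - up.limit k u\<bar> \<le> \<eta> / 10"
    "\<And>H k u. H1 \<le> H \<Longrightarrow> u \<in> {0..1} \<Longrightarrow> \<bar>ml' H k (H * u) / H - lo.limit k u\<bar> \<le> \<eta> / 10"
    unfolding eventually_at_top_linorder by blast
  define H0 where "H0 = max 1 H1"
  \<comment> \<open>Components, grid points and a flag for the upper or lower process. Monotonicity
    of counts in time reduces the supremum over \<open>u\<close> to these finitely many variables,
    and their sum \<open>Z\<close> has second moment of order \<open>1 / H\<close>.\<close>
  define J where "J = (UNIV :: 'p set) \<times> {..q} \<times> (UNIV :: bool set)"
  define X where "X H j \<omega> = (case j of (k, i, s) \<Rightarrow>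
      \<bar>enn2real ((if s then cp else cl) H k (H * (real i / real q)) \<omega>) - (if s then mp' else ml') H k (H * (real i / real q))\<bar> / H)"
    for H :: real and j and \<omega> :: 'w
  define Z where "Z H \<omega> = (\<Sum>j\<in>J. X H j \<omega>)" for H \<omega>
  define C where "C = real (card J) * (real (card J) * (Cp + Cl))"
  have finJ: "finite J" by (simp add: J_def)
  have Xm: "X H j \<in> borel_measurable M" if "0 < H" for H j
  proof -
    obtain k i s where j: "j = (k, i, s)" by (cases j)
    show ?thesis
      using cp(2)[OF that, of k "H * (real i / real q)"] cl(2)[OF that, of k "H * (real i / real q)"]
      unfolding X_def j by (cases s) (simp_all, measurable)
  qed
  have X0: "0 \<le> X H j \<omega>" if "0 < H" for H j \<omega>
    using that by (cases j) (simp add: X_def)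
  have X2: "(\<integral>\<^sup>+\<omega>. ennreal ((X H j \<omega>)\<^sup>2) \<partial>M) \<le> ennreal ((Cp + Cl) / H)" if H: "0 < H" for H j
  proof -
    have gen: "(\<integral>\<^sup>+\<omega>. ennreal ((\<bar>enn2real (f \<omega>) - r\<bar> / H)\<^sup>2) \<partial>M) \<le> ennreal ((Cp + Cl) / H)"
      if f: "f \<in> borel_measurable M" "(\<integral>\<^sup>+\<omega>. ennreal ((enn2real (f \<omega>) - r)\<^sup>2) \<partial>M) \<le> ennreal (D * H)" and D: "D \<le> Cp + Cl" for f r D
    proof -
      have "(\<integral>\<^sup>+\<omega>. ennreal ((\<bar>enn2real (f \<omega>) - r\<bar> / H)\<^sup>2) \<partial>M) = (\<integral>\<^sup>+\<omega>. ennreal (1 / H\<^sup>2) * ennreal ((enn2real (f \<omega>) - r)\<^sup>2) \<partial>M)"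
        by (intro nn_integral_cong) (simp add: power_divide flip: ennreal_mult)
      also have "\<dots> = ennreal (1 / H\<^sup>2) * (\<integral>\<^sup>+\<omega>. ennreal ((enn2real (f \<omega>) - r)\<^sup>2) \<partial>M)"
        by (rule nn_integral_cmult) (use f(1) in measurable)
      also have "\<dots> \<le> ennreal (1 / H\<^sup>2) * ennreal ((Cp + Cl) * H)"
        using f(2) by (rule mult_left_mono[OF order.trans]) (use D H in \<open>auto intro!: ennreal_leI mult_right_mono\<close>)
      also have "\<dots> = ennreal ((Cp + Cl) / H)"
        using cp(1) cl(1) H by (simp add: power2_eq_square flip: ennreal_mult)
      finally show ?thesis .
    qed
    obtain k i s where j: "j = (k, i, s)" by (cases j)
    show ?thesis
    proof (cases s)
      case True
      then show ?thesis unfolding X_def j using gen[OF cp(2)[OF H] cp(4)[OF H]] cl(1) by simp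
    next
      case False
      then show ?thesis unfolding X_def j using gen[OF cl(2)[OF H] cl(4)[OF H]] cp(1) by simp
    qed
  qed
  show ?thesis
  proof (rule that[of b C H0 Z])
    show "1 < b" by (rule b)
    show "0 \<le> C" unfolding C_def using cp(1) cl(1) by simp
    show "0 < H0" by (simp add: H0_def)
    fix H :: real
    show "Z H \<in> borel_measurable M" if "0 < H" unfolding Z_def[abs_def] by (rule borel_measurable_sum[OF Xm[OF that]])
    show "0 \<le> Z H \<omega>" if "0 < H" for \<omega> unfolding Z_def by (rule sum_nonneg[OF X0[OF that]])
    show "(\<integral>\<^sup>+\<omega>. ennreal ((Z H \<omega>)\<^sup>2) \<partial>M) \<le> ennreal (C / H)" if H: "0 < H"
    proof -
      have "(\<integral>\<^sup>+\<omega>. ennreal ((Z H \<omega>)\<^sup>2) \<partial>M) \<le> (\<integral>\<^sup>+\<omega>. of_nat (card J) * (\<Sum>j\<in>J. ennreal ((X H j \<omega>)\<^sup>2)) \<partial>M)"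
      proof (rule nn_integral_mono)
        fix \<omega>
        have "(Z H \<omega>)\<^sup>2 \<le> real (card J) * (\<Sum>j\<in>J. (X H j \<omega>)\<^sup>2)"
          using sum_squared_le_sum_of_squares[of "\<lambda>j. X H j \<omega>" J] by (simp add: Z_def mult.commute)
        then have "ennreal ((Z H \<omega>)\<^sup>2) \<le> ennreal (real (card J) * (\<Sum>j\<in>J. (X H j \<omega>)\<^sup>2))" by (rule ennreal_leI)
        then show "ennreal ((Z H \<omega>)\<^sup>2) \<le> of_nat (card J) * (\<Sum>j\<in>J. ennreal ((X H j \<omega>)\<^sup>2))"
          by (simp add: ennreal_mult sum_nonneg ennreal_of_nat_eq_real_of_nat)
      qed
      also have "\<dots> = of_nat (card J) * (\<Sum>j\<in>J. \<integral>\<^sup>+\<omega>. ennreal ((X H j \<omega>)\<^sup>2) \<partial>M)"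
        using Xm[OF H] by (simp add: nn_integral_cmult nn_integral_sum del: sum_ennreal)
      also have "\<dots> \<le> of_nat (card J) * (\<Sum>j\<in>J. ennreal ((Cp + Cl) / H))"
        by (intro mult_left_mono sum_mono X2[OF H]) simp
      also have "\<dots> = ennreal (C / H)"
        using cp(1) cl(1) H by (simp add: C_def ennreal_of_nat_eq_real_of_nat flip: ennreal_mult)
      finally show ?thesis .
    qed
    assume HH: "H0 \<le> H"
    then have H: "0 < H" "H1 \<le> H" by (auto simp: H0_def)
    have "AE \<omega> in M. \<forall>k. \<forall>i\<in>{..q}. cp H k (H * (real i / real q)) \<omega> < \<infinity> \<and> cl H k (H * (real i / real q)) \<omega> < \<infinity>"
      by (intro eventually_all_finite AE_finite_allI AE_conjI cp(3) cl(3) H) simp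
    then show "AE \<omega> in M. \<forall>T. H / b \<le> T \<longrightarrow> T \<le> H \<longrightarrow> good_path \<omega> T \<longrightarrow>
       (\<forall>k. \<forall>u\<in>{0..1}. \<bar>measure (N T k \<omega>) {0..T * u} / T - limit k u\<bar> \<le> 2 * Z H \<omega> + \<eta>)"
      using AE_space
    proof eventually_elim
      case (elim \<omega>)
      show ?case
      proof (intro allI impI ballI)
        fix T k u assume T1: "H / b \<le> T" and T2: "T \<le> H" and good: "good_path \<omega> T" and u: "u \<in> {0..1 :: real}"
        have T: "0 < T" using T1 H(1) b(1) by (meson divide_pos_pos less_le_trans less_trans zero_less_one)
        have HT: "1 \<le> H / T" "H / T \<le> b" using T1 T2 T b(1) by (auto simp: field_simps)
        have close: "\<bar>t / T - t / H\<bar> \<le> b - 1" "t / T \<in> {0..1}" "t / H \<in> {0..1}" if t: "t \<in> {0..T}" for t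
        proof -
          have "t / H \<le> t / T" using t T T2 by (intro divide_left_mono) auto
          moreover have "t / T - t / H = t / H * (H / T - 1)" using T H(1) by (simp add: field_simps)
          moreover have "t / H * (H / T - 1) \<le> 1 * (b - 1)" using t T T2 HT H(1) by (intro mult_mono) auto
          ultimately show "\<bar>t / T - t / H\<bar> \<le> b - 1" by simp
          show "t / T \<in> {0..1}" "t / H \<in> {0..1}" using t T T2 H(1) by auto
        qed
        have osc: "\<bar>m k (t / T) - m k (t / H)\<bar> < \<delta>" "\<bar>g (t / T) - g (t / H)\<bar> < \<delta>" if t: "t \<in> {0..T}" for t k
          using \<tau>(2)[OF close(2)[OF t] close(3)[OF t], of k] close(1)[OF t] b(3) by auto
        define t where "t = T * u"
        have t: "t \<in> {0..T}" using u T by (auto simp: t_def mult_left_le)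
        have above: "emeasure (N T k \<omega>) {0..t} \<le> cp H k t \<omega>"
          unfolding cp(7)
        proof (rule counts_above[OF T T2 elim(2) good up _ _ t])
          show "m k (s / T) < mp k (s / H)" if "s \<in> {0..T}" for k s using osc(1)[OF that, of k] by (simp add: mp_def)
          show "g (s / T) \<le> gp (s / H)" if "s \<in> {0..T}" for s using osc(2)[OF that] by (simp add: gp_def)
        qed
        have below: "cl H k t \<omega> \<le> emeasure (N T k \<omega>) {0..t}"
          unfolding cl(7)
        proof (rule counts_below[OF T T2 elim(2) good lo _ _ t])
          show "ml k (s / H) \<le> m k (s / T)" if "s \<in> {0..T}" for k s
            using osc(1)[OF that, of k] m_nonneg[OF close(2)[OF that], of k] by (simp add: ml_def)
          show "gl (s / H) \<le> g (s / T)" if "s \<in> {0..T}" for s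
            using osc(2)[OF that] g_nonneg[OF close(2)[OF that]] by (simp add: gl_def)
        qed
        define v where "v = t / H"
        have v: "v \<in> {0..1}" unfolding v_def by (rule close(3)[OF t])
        have tv: "t = H * v" using H(1) by (simp add: v_def)
        have uv: "\<bar>u - v\<bar> \<le> b - 1" using close(1)[OF t] T by (simp add: t_def v_def)
        \<comment> \<open>Round \<open>v\<close> up for the upper bound and down for the lower one,
          as in the proof of the Glivenko-Cantelli theorem.\<close>
        obtain i j where i: "i \<le> q" "v \<le> real i / real q" "real i / real q \<le> v + 1 / real q"
          and j: "j \<le> q" "real j / real q \<le> v" "v - 1 / real q \<le> real j / real q"
          by (rule grid_points[OF v q])
        have i1: "real i / real q \<in> {0..1}" "real j / real q \<in> {0..1}" using i j q by auto
        have XZ: "X H (k', i', s) \<omega> \<le> Z H \<omega>" if "i' \<le> q" for k' i' s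
          unfolding Z_def using that by (intro member_le_sum[OF _ X0[OF H(1)] finJ]) (simp add: J_def)
        define n where "n = measure (N T k \<omega>) {0..t}"
        have n_fin: "emeasure (N T k \<omega>) {0..t} = ennreal n"
        proof -
          obtain w :: nat where w: "emeasure (N T k \<omega>) {0..t} = of_nat w" using good unfolding good_path_def by (metis atLeastAtMost_borel)
          then show ?thesis unfolding n_def by (intro emeasure_eq_ennreal_measure) (simp add: of_nat_less_top less_imp_neq)
        qed
        have n0: "0 \<le> n" by (simp add: n_def)
        have lip: "\<bar>limit k w - limit k u\<bar> \<le> B * \<bar>w - u\<bar>" if "w \<in> {0..1}" for w
          by (rule LBINT_Lipschitz[OF y_cont B(2) that u])
        \<comment> \<open>The four tenths: the mean count against its limit, the shift of the data,
          the mesh of the grid, and the difference between \<open>u\<close> and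
          \<open>v\<close>.\<close>
        have n_up: "n / H \<le> limit k u + Z H \<omega> + 4 / 10 * \<eta>"
        proof -
          let ?w = "real i / real q"
          have "ennreal n \<le> cp H k (H * ?w) \<omega>"
            unfolding n_fin[symmetric] by (rule order.trans[OF above cp(6)[OF H(1)]], unfold tv, rule mult_left_mono) (use i(2) H(1) in auto)
          moreover have "cp H k (H * ?w) \<omega> < \<infinity>" using elim(1) i(1) by blast
          ultimately have "n \<le> enn2real (cp H k (H * ?w) \<omega>)"
            by (metis enn2real_ennreal enn2real_mono n0 infinity_ennreal_def)
          moreover have "\<bar>enn2real (cp H k (H * ?w) \<omega>) - mp' H k (H * ?w)\<bar> / H \<le> Z H \<omega>"
            using XZ[OF i(1), of k True] by (simp add: X_def)
          moreover have "(enn2real (cp H k (H * ?w) \<omega>) - mp' H k (H * ?w)) / H \<le>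
              \<bar>enn2real (cp H k (H * ?w) \<omega>) - mp' H k (H * ?w)\<bar> / H" using H(1) by (intro divide_right_mono) auto
          moreover have "n / H \<le> enn2real (cp H k (H * ?w) \<omega>) / H" using calculation(1) H(1) by (intro divide_right_mono) auto
          ultimately have "n / H \<le> Z H \<omega> + mp' H k (H * ?w) / H" by (simp add: diff_divide_distrib)
          moreover have "mp' H k (H * ?w) / H \<le> up.limit k ?w + \<eta> / 10" using H1(1)[OF H(2) i1(1), of k] by linarith
          moreover have "up.limit k ?w \<le> limit k ?w + \<eta> / 10" using limp[OF i1(1), of k] by linarith
          moreover have "limit k ?w \<le> limit k u + (\<eta> / 10 + \<eta> / 10)"
          proof -
            have "\<bar>?w - u\<bar> \<le> 1 / real q + (b - 1)" using i uv by linarith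
            then have "B * \<bar>?w - u\<bar> \<le> B * (1 / real q + (b - 1))" using B(1) by (intro mult_left_mono) auto
            then show ?thesis using lip[OF i1(1)] Bq bB unfolding distrib_left by linarith
          qed
          ultimately show ?thesis by linarith
        qed
        have n_lo: "limit k u - Z H \<omega> - 4 / 10 * \<eta> \<le> n / H"
        proof -
          let ?w = "real j / real q"
          have le: "cl H k (H * ?w) \<omega> \<le> ennreal n"
            unfolding n_fin[symmetric] by (rule order.trans[OF cl(6)[OF H(1)] below], unfold tv, rule mult_left_mono) (use j(2) H(1) in auto)
          then have "enn2real (cl H k (H * ?w) \<omega>) \<le> n"
            by (metis enn2real_ennreal enn2real_mono n0 ennreal_less_top)
          then have "enn2real (cl H k (H * ?w) \<omega>) / H \<le> n / H" using H(1) by (intro divide_right_mono) auto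
          moreover have "\<bar>enn2real (cl H k (H * ?w) \<omega>) - ml' H k (H * ?w)\<bar> / H \<le> Z H \<omega>"
            using XZ[OF j(1), of k False] by (simp add: X_def)
          moreover have "(ml' H k (H * ?w) - enn2real (cl H k (H * ?w) \<omega>)) / H \<le>
              \<bar>enn2real (cl H k (H * ?w) \<omega>) - ml' H k (H * ?w)\<bar> / H" using H(1) by (intro divide_right_mono) auto
          ultimately have "ml' H k (H * ?w) / H - Z H \<omega> \<le> n / H" by (simp add: diff_divide_distrib)
          moreover have "lo.limit k ?w - \<eta> / 10 \<le> ml' H k (H * ?w) / H" using H1(2)[OF H(2) i1(2), of k] by linarith
          moreover have "limit k ?w - \<eta> / 10 \<le> lo.limit k ?w" using liml[OF i1(2), of k] by linarith
          moreover have "limit k u - (\<eta> / 10 + \<eta> / 10) \<le> limit k ?w"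
          proof -
            have "\<bar>?w - u\<bar> \<le> 1 / real q + (b - 1)" using j uv by linarith
            then have "B * \<bar>?w - u\<bar> \<le> B * (1 / real q + (b - 1))" using B(1) by (intro mult_left_mono) auto
            then show ?thesis using lip[OF i1(2)] Bq bB unfolding distrib_left by linarith
          qed
          ultimately show ?thesis by linarith
        qed
        have lim_b: "\<bar>limit k u\<bar> \<le> B"
        proof -
          have "\<bar>limit k u - (LBINT x:{0..u}. 0)\<bar> \<le> B"
            by (rule LBINT_diff_bound[OF y_cont continuous_on_const _ u]) (use B in auto)
          then show ?thesis by simp
        qed
        have Z0: "0 \<le> Z H \<omega>" unfolding Z_def by (rule sum_nonneg[OF X0[OF H(1)]])
        \<comment> \<open>Dividing by \<open>T\<close> instead of \<open>H\<close> costs the factor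
          \<open>H / T \<le> b\<close>. This adds a second \<open>Z H \<omega>\<close>, which is why
          the conclusion has \<open>2 * Z H \<omega>\<close>.\<close>
        have "n / T = n / H * (H / T)" using T H(1) by simp
        then have "n / T - n / H = n / H * (H / T - 1)" by (simp add: algebra_simps)
        also have "\<dots> \<le> (B + Z H \<omega> + 4 / 10 * \<eta>) * (b - 1)"
          using n_up lim_b HT n0 H(1) Z0 \<eta> B(1) by (intro mult_mono) auto
        also have "\<dots> = B * (b - 1) + (Z H \<omega> + 4 / 10 * \<eta>) * (b - 1)" by (simp add: algebra_simps)
        also have "\<dots> \<le> \<eta> / 10 + (Z H \<omega> + 4 / 10 * \<eta>) * 1"
        proof (intro add_mono mult_left_mono bB)
          show "0 \<le> Z H \<omega> + 4 / 10 * \<eta>" using \<eta> Z0 by simp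
        qed (use b(2) in simp)
        finally have d1: "n / T - n / H \<le> Z H \<omega> + 5 / 10 * \<eta>" by simp
        have d2: "n / H \<le> n / T" using T T2 n0 by (intro divide_left_mono) auto
        have "\<bar>n / T - limit k u\<bar> \<le> 2 * Z H \<omega> + \<eta>" using Z0 d1 d2 n_up n_lo \<eta> by (simp add: abs_le_iff)
        then show "\<bar>measure (N T k \<omega>) {0..T * u} / T - limit k u\<bar> \<le> 2 * Z H \<omega> + \<eta>" by (simp add: n_def t_def)
      qed
    qed
  qed
qed

end

section \<open>Convergence in mean square and almost surely\<close>

lemma ennreal_affine:
  "0 \<le> a \<Longrightarrow> 0 \<le> x \<Longrightarrow> 0 \<le> b \<Longrightarrow> ennreal (a * x + b) = ennreal a * ennreal x + ennreal b"
  by (simp add: ennreal_plus ennreal_mult)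

context hawkes_lln
begin

lemma limit_bounded:
  obtains B where "0 \<le> B" "\<And>k u. u \<in> {0..1} \<Longrightarrow> \<bar>limit k u\<bar> \<le> B"
proof -
  obtain B where B: "0 \<le> B" "\<And>k x. x \<in> {0..1} \<Longrightarrow> \<bar>y k x\<bar> \<le> B" by (rule y_bounded) blast
  have "\<bar>limit k u\<bar> \<le> B" if u: "u \<in> {0..1}" for k u
  proof -
    have "\<bar>limit k u - (LBINT x:{0..u}. 0)\<bar> \<le> B"
      by (rule LBINT_diff_bound[OF y_cont continuous_on_const _ u]) (use B in auto)
    then show ?thesis by simp
  qed
  with B(1) show ?thesis by (rule that)
qed

text \<open>\<open>sandwich\<close> speaks about large scales, but square integrability is claimed
  for every positive \<open>T\<close>. At a single scale the minimal process with data raised by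
  \<open>\<delta>0\<close> is a square integrable majorant.\<close>

lemma count_bound:
  assumes T: "0 < T"
  obtains Y where "Y \<in> borel_measurable M" "(\<integral>\<^sup>+\<omega>. ennreal ((Y \<omega>)\<^sup>2) \<partial>M) < \<infinity>"
    "AE \<omega> in M. good_path \<omega> T \<longrightarrow> (\<forall>k. measure (N T k \<omega>) {0..T} \<le> Y \<omega>)"
proof -
  define mp where "mp k x = m k x + \<delta>0" for k x
  define gp where "gp x = g x + \<delta>0" for x
  obtain yp where up: "limit_data mp gp \<phi> K c \<zeta> yp"
  proof (rule perturbed_data[of mp gp])
    show "gp x \<le> c" if "x \<in> {0..1}" for x using margin(2)[OF that] by (simp add: gp_def)
  qed (use margin(1) m_nonneg g_nonneg in \<open>auto simp: mp_def[abs_def] gp_def[abs_def] intro!: continuous_intros m_cont g_cont add_nonneg_nonneg\<close>)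
  interpret up: limit_data mp gp \<phi> K c \<zeta> yp by (rule up)
  obtain C cp mc where cp: "0 \<le> C" "\<And>H k t. H > 0 \<Longrightarrow> cp H k t \<in> borel_measurable M"
    "\<And>H k t. H > 0 \<Longrightarrow> AE \<omega> in M. cp H k t \<omega> < \<infinity>"
    "\<And>H k t. H > 0 \<Longrightarrow> (\<integral>\<^sup>+\<omega>. ennreal ((enn2real (cp H k t \<omega>) - mc H k t)\<^sup>2) \<partial>M) \<le> ennreal (C * H)"
    "\<And>\<epsilon>. \<epsilon> > 0 \<Longrightarrow> \<forall>\<^sub>F H in at_top. \<forall>k. \<forall>u\<in>{0..1}. \<bar>mc H k (H * u) / H - up.limit k u\<bar> \<le> \<epsilon>"
    "\<And>H k t t' \<omega>. H > 0 \<Longrightarrow> t \<le> t' \<Longrightarrow> cp H k t \<omega> \<le> cp H k t' \<omega>"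
    "\<And>H k. cp H k = hawkes_minimal.point_count \<kappa> (up.mmH H) (up.gaH H) ph k"
    by (rule up.minimal_counts[OF adapted_kernel_axioms]) blast
  define X where "X k \<omega> = enn2real (cp T k T \<omega>)" for k \<omega>
  have Xm: "X k \<in> borel_measurable M" for k
    unfolding X_def[abs_def] using cp(2)[OF T, of k T] by measurable
  have X2: "(\<integral>\<^sup>+\<omega>. ennreal ((X k \<omega>)\<^sup>2) \<partial>M) < \<infinity>" for k
  proof -
    define r where "r = mc T k T"
    have "(\<integral>\<^sup>+\<omega>. ennreal ((X k \<omega>)\<^sup>2) \<partial>M) \<le> (\<integral>\<^sup>+\<omega>. 2 * ennreal ((X k \<omega> - r)\<^sup>2) + ennreal (2 * r\<^sup>2) \<partial>M)"
    proof (rule nn_integral_mono)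
      fix \<omega>
      have "(X k \<omega>)\<^sup>2 \<le> 2 * (X k \<omega> - r)\<^sup>2 + 2 * r\<^sup>2"
        using zero_le_power2[of "X k \<omega> - 2 * r"] by (simp add: power2_eq_square algebra_simps)
      then have "ennreal ((X k \<omega>)\<^sup>2) \<le> ennreal (2 * (X k \<omega> - r)\<^sup>2 + 2 * r\<^sup>2)" by (rule ennreal_leI)
      also have "\<dots> = 2 * ennreal ((X k \<omega> - r)\<^sup>2) + ennreal (2 * r\<^sup>2)"
        by (simp add: ennreal_plus ennreal_mult)
      finally show "ennreal ((X k \<omega>)\<^sup>2) \<le> 2 * ennreal ((X k \<omega> - r)\<^sup>2) + ennreal (2 * r\<^sup>2)" .
    qed
    also have "\<dots> = 2 * (\<integral>\<^sup>+\<omega>. ennreal ((X k \<omega> - r)\<^sup>2) \<partial>M) + ennreal (2 * r\<^sup>2)"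
      using Xm[of k] by (simp add: nn_integral_add nn_integral_cmult emeasure_space_1)
    also have "\<dots> \<le> 2 * ennreal (C * T) + ennreal (2 * r\<^sup>2)"
      unfolding X_def r_def by (intro add_right_mono mult_left_mono cp(4) T) simp
    also have "\<dots> < \<infinity>" by (simp add: ennreal_mult_less_top)
    finally show ?thesis .
  qed
  show ?thesis
  proof (rule that[of "\<lambda>\<omega>. \<Sum>k\<in>UNIV. X k \<omega>"])
    show "(\<lambda>\<omega>. \<Sum>k\<in>UNIV. X k \<omega>) \<in> borel_measurable M" by (rule borel_measurable_sum[OF Xm])
    have "(\<integral>\<^sup>+\<omega>. ennreal ((\<Sum>k\<in>UNIV. X k \<omega>)\<^sup>2) \<partial>M) \<le> (\<integral>\<^sup>+\<omega>. of_nat CARD('p) * (\<Sum>k\<in>UNIV. ennreal ((X k \<omega>)\<^sup>2)) \<partial>M)"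
    proof (rule nn_integral_mono)
      fix \<omega>
      have "(\<Sum>k\<in>UNIV. X k \<omega>)\<^sup>2 \<le> real CARD('p) * (\<Sum>k\<in>UNIV. (X k \<omega>)\<^sup>2)"
        using sum_squared_le_sum_of_squares[of "\<lambda>k. X k \<omega>" UNIV] by (simp add: mult.commute)
      then have "ennreal ((\<Sum>k\<in>UNIV. X k \<omega>)\<^sup>2) \<le> ennreal (real CARD('p) * (\<Sum>k\<in>UNIV. (X k \<omega>)\<^sup>2))" by (rule ennreal_leI)
      then show "ennreal ((\<Sum>k\<in>UNIV. X k \<omega>)\<^sup>2) \<le> of_nat CARD('p) * (\<Sum>k\<in>UNIV. ennreal ((X k \<omega>)\<^sup>2))"
        by (simp add: ennreal_mult sum_nonneg ennreal_of_nat_eq_real_of_nat)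
    qed
    also have "\<dots> = of_nat CARD('p) * (\<Sum>k\<in>UNIV. \<integral>\<^sup>+\<omega>. ennreal ((X k \<omega>)\<^sup>2) \<partial>M)"
      using Xm by (simp add: nn_integral_cmult nn_integral_sum del: sum_ennreal)
    also have "\<dots> < \<infinity>"
      using X2 by (simp add: ennreal_mult_less_top of_nat_less_top)
    finally show "(\<integral>\<^sup>+\<omega>. ennreal ((\<Sum>k\<in>UNIV. X k \<omega>)\<^sup>2) \<partial>M) < \<infinity>" .
    have "AE \<omega> in M. \<forall>k. cp T k T \<omega> < \<infinity>"
      by (intro eventually_all_finite cp(3) T)
    then show "AE \<omega> in M. good_path \<omega> T \<longrightarrow> (\<forall>k. measure (N T k \<omega>) {0..T} \<le> (\<Sum>k\<in>UNIV. X k \<omega>))"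
      using AE_space
    proof eventually_elim
      case (elim \<omega>)
      show ?case
      proof (intro impI allI)
        fix k assume good: "good_path \<omega> T"
        have "emeasure (N T k \<omega>) {0..T} \<le> cp T k T \<omega>"
          unfolding cp(7)
        proof (rule counts_above[OF T order.refl elim(2) good up])
          show "m k (s / T) < mp k (s / T)" if "s \<in> {0..T}" for k s using margin(1) by (simp add: mp_def)
          show "g (s / T) \<le> gp (s / T)" if "s \<in> {0..T}" for s using margin(1) by (simp add: gp_def)
        qed (use T in auto)
        moreover have "cp T k T \<omega> < \<infinity>" using elim(1) by blast
        ultimately have "measure (N T k \<omega>) {0..T} \<le> X k \<omega>"
          unfolding X_def measure_def by (intro enn2real_mono) simp_all
        also have "\<dots> \<le> (\<Sum>k\<in>UNIV. X k \<omega>)" by (rule member_le_sum) (simp_all add: X_def)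
        finally show "measure (N T k \<omega>) {0..T} \<le> (\<Sum>k\<in>UNIV. X k \<omega>)" .
      qed
    qed
  qed
qed

text \<open>The deviation is treated as an abstract \<open>D\<close> dominated by a multiple of the
  uniform error in the coordinates. Norm and supremum are dealt with when \<open>D_le\<close> is
  verified.\<close>

context
  fixes D :: "real \<Rightarrow> 'w \<Rightarrow> real" and A :: real
  assumes A: "0 \<le> A"
    and D_meas: "\<And>T. 0 < T \<Longrightarrow> D T \<in> borel_measurable M"
    and D_le: "\<And>T \<omega> E. 0 < T \<Longrightarrow> \<omega> \<in> space M \<Longrightarrow>
      (\<And>k u. u \<in> {0..1} \<Longrightarrow> \<bar>measure (N T k \<omega>) {0..T * u} / T - limit k u\<bar> \<le> E) \<Longrightarrow> 0 \<le> D T \<omega> \<and> D T \<omega> \<le> A * E"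
    and good: "AE \<omega> in M. \<forall>T>0. good_path \<omega> T"
begin

lemma deviation_square_integrable:
  assumes T: "0 < T"
  shows "integrable M (\<lambda>\<omega>. (D T \<omega>)\<^sup>2)"
proof -
  obtain Y where Y: "Y \<in> borel_measurable M" "(\<integral>\<^sup>+\<omega>. ennreal ((Y \<omega>)\<^sup>2) \<partial>M) < \<infinity>"
    "AE \<omega> in M. good_path \<omega> T \<longrightarrow> (\<forall>k. measure (N T k \<omega>) {0..T} \<le> Y \<omega>)"
    by (rule count_bound[OF T])
  obtain B where B: "0 \<le> B" "\<And>k u. u \<in> {0..1} \<Longrightarrow> \<bar>limit k u\<bar> \<le> B" by (rule limit_bounded) blast
  have "AE \<omega> in M. ennreal ((D T \<omega>)\<^sup>2) \<le> ennreal (2 * A\<^sup>2 / T\<^sup>2) * ennreal ((Y \<omega>)\<^sup>2) + ennreal (2 * A\<^sup>2 * B\<^sup>2)"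
    using Y(3) good AE_space
  proof eventually_elim
    case (elim \<omega>)
    have g: "good_path \<omega> T" using elim(2) T by blast
    have "0 \<le> D T \<omega> \<and> D T \<omega> \<le> A * (Y \<omega> / T + B)"
    proof (rule D_le[OF T elim(3)])
      fix k and u :: real assume u: "u \<in> {0..1}"
      have "emeasure (N T k \<omega>) {0..T} < \<infinity>"
      proof -
        obtain i :: nat where "emeasure (N T k \<omega>) {0..T} = of_nat i" using g unfolding good_path_def by (metis atLeastAtMost_borel)
        then show ?thesis by (simp add: of_nat_less_top)
      qed
      then have "measure (N T k \<omega>) {0..T * u} \<le> measure (N T k \<omega>) {0..T}"
        unfolding measure_def using g u T
        by (intro enn2real_mono emeasure_mono) (auto simp: good_path_def mult_left_le)
      also have "\<dots> \<le> Y \<omega>" using elim(1) g by blast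
      finally have "measure (N T k \<omega>) {0..T * u} / T \<le> Y \<omega> / T" using T by (intro divide_right_mono) auto
      moreover have "0 \<le> measure (N T k \<omega>) {0..T * u} / T" using T by simp
      ultimately show "\<bar>measure (N T k \<omega>) {0..T * u} / T - limit k u\<bar> \<le> Y \<omega> / T + B"
        using B(2)[OF u, of k] by linarith
    qed
    then have "(D T \<omega>)\<^sup>2 \<le> (A * (Y \<omega> / T + B))\<^sup>2" by (intro power_mono) auto
    also have "\<dots> \<le> A\<^sup>2 * (2 * (Y \<omega> / T)\<^sup>2 + 2 * B\<^sup>2)"
      unfolding power_mult_distrib using zero_le_power2[of "Y \<omega> / T - B"]
      by (intro mult_left_mono) (simp_all add: power2_sum power2_diff)
    also have "\<dots> = 2 * A\<^sup>2 / T\<^sup>2 * (Y \<omega>)\<^sup>2 + 2 * A\<^sup>2 * B\<^sup>2" by (simp add: power_divide algebra_simps)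
    finally have "ennreal ((D T \<omega>)\<^sup>2) \<le> ennreal (2 * A\<^sup>2 / T\<^sup>2 * (Y \<omega>)\<^sup>2 + 2 * A\<^sup>2 * B\<^sup>2)" by (rule ennreal_leI)
    then show ?case by (subst (asm) ennreal_affine) simp_all
  qed
  then have "(\<integral>\<^sup>+\<omega>. ennreal ((D T \<omega>)\<^sup>2) \<partial>M) \<le> (\<integral>\<^sup>+\<omega>. ennreal (2 * A\<^sup>2 / T\<^sup>2) * ennreal ((Y \<omega>)\<^sup>2) + ennreal (2 * A\<^sup>2 * B\<^sup>2) \<partial>M)"
    by (rule nn_integral_mono_AE)
  also have "\<dots> = ennreal (2 * A\<^sup>2 / T\<^sup>2) * (\<integral>\<^sup>+\<omega>. ennreal ((Y \<omega>)\<^sup>2) \<partial>M) + ennreal (2 * A\<^sup>2 * B\<^sup>2)"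
    using Y(1) by (simp add: nn_integral_add nn_integral_cmult emeasure_space_1)
  also have "\<dots> < \<infinity>" using Y(2) by (simp add: ennreal_mult_less_top)
  finally show ?thesis
    using D_meas[OF T] by (intro integrableI_bounded) simp_all
qed

text \<open>With \<open>H = T\<close> in \<open>sandwich\<close> the second moment of
  \<open>D T\<close> is at most a term of order \<open>1 / T\<close> plus
  \<open>2 * A\<^sup>2 * \<eta>\<^sup>2\<close>, by the elementary bound \<open>(2 * Z +
  \<eta>)\<^sup>2 \<le> 8 * Z\<^sup>2 + 2 * \<eta>\<^sup>2\<close>.\<close>

lemma deviation_L2: "((\<lambda>T. \<integral>\<omega>. (D T \<omega>)\<^sup>2 \<partial>M) \<longlongrightarrow> 0) at_top"
proof (rule tendstoI)
  fix \<epsilon> :: real assume \<epsilon>: "0 < \<epsilon>"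
  \<comment> \<open>At most one, so that \<open>\<eta>\<^sup>2 \<le> \<eta>\<close>; the eight then
    makes the constant term at most \<open>\<epsilon> / 4\<close>.\<close>
  define \<eta> where "\<eta> = min 1 (\<epsilon> / (8 * (A\<^sup>2 + 1)))"
  have A2: "0 < A\<^sup>2 + 1" by (simp add: add_nonneg_pos)
  have \<eta>: "0 < \<eta>" "\<eta> \<le> 1" using \<epsilon> A2 by (auto simp: \<eta>_def)
  have small: "2 * A\<^sup>2 * \<eta>\<^sup>2 \<le> \<epsilon> / 4"
  proof -
    have "\<eta> \<le> \<epsilon> / (8 * (A\<^sup>2 + 1))" by (simp add: \<eta>_def)
    moreover have "\<eta>\<^sup>2 \<le> \<eta>" using \<eta> unfolding power2_eq_square by (intro mult_left_le) auto
    ultimately have "\<eta>\<^sup>2 \<le> \<epsilon> / (8 * (A\<^sup>2 + 1))" by linarith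
    then have "2 * A\<^sup>2 * \<eta>\<^sup>2 \<le> 2 * (A\<^sup>2 + 1) * (\<epsilon> / (8 * (A\<^sup>2 + 1)))" by (intro mult_mono) auto
    also have "\<dots> = \<epsilon> / 4"
    proof -
      have "2 * x * (\<epsilon> / (8 * x)) = \<epsilon> / 4" if "0 < x" for x using that by (simp add: field_simps)
      then show ?thesis using A2 by blast
    qed
    finally show ?thesis .
  qed
  obtain b C H0 Z where Z: "1 < b" "0 \<le> C" "0 < H0"
    "\<And>H. 0 < H \<Longrightarrow> Z H \<in> borel_measurable M" "\<And>H \<omega>. 0 < H \<Longrightarrow> 0 \<le> Z H \<omega>"
    "\<And>H. 0 < H \<Longrightarrow> (\<integral>\<^sup>+\<omega>. ennreal ((Z H \<omega>)\<^sup>2) \<partial>M) \<le> ennreal (C / H)"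
    "\<And>H. H0 \<le> H \<Longrightarrow> AE \<omega> in M. \<forall>T. H / b \<le> T \<longrightarrow> T \<le> H \<longrightarrow> good_path \<omega> T \<longrightarrow>
       (\<forall>k. \<forall>u\<in>{0..1}. \<bar>measure (N T k \<omega>) {0..T * u} / T - limit k u\<bar> \<le> 2 * Z H \<omega> + \<eta>)"
    by (rule sandwich[OF \<eta>(1)]) blast
  have bound: "(\<integral>\<omega>. (D T \<omega>)\<^sup>2 \<partial>M) \<le> 8 * A\<^sup>2 * C / T + 2 * A\<^sup>2 * \<eta>\<^sup>2" if HT: "H0 \<le> T" for T
  proof -
    have T: "0 < T" using HT Z(3) by linarith
    have "AE \<omega> in M. ennreal ((D T \<omega>)\<^sup>2) \<le> ennreal (8 * A\<^sup>2) * ennreal ((Z T \<omega>)\<^sup>2) + ennreal (2 * A\<^sup>2 * \<eta>\<^sup>2)"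
      using Z(7)[OF HT] good AE_space
    proof eventually_elim
      case (elim \<omega>)
      have g: "good_path \<omega> T" using elim(2) T by blast
      have Tb: "T / b \<le> T" using T Z(1) by (simp add: divide_le_eq)
      have "0 \<le> D T \<omega> \<and> D T \<omega> \<le> A * (2 * Z T \<omega> + \<eta>)"
        by (rule D_le[OF T elim(3)]) (use elim(1) g Tb in blast)
      then have "(D T \<omega>)\<^sup>2 \<le> (A * (2 * Z T \<omega> + \<eta>))\<^sup>2" by (intro power_mono) auto
      also have "\<dots> \<le> A\<^sup>2 * (8 * (Z T \<omega>)\<^sup>2 + 2 * \<eta>\<^sup>2)"
        unfolding power_mult_distrib using zero_le_power2[of "2 * Z T \<omega> - \<eta>"]
        by (intro mult_left_mono) (simp_all add: power2_sum power2_diff)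
      also have "\<dots> = 8 * A\<^sup>2 * (Z T \<omega>)\<^sup>2 + 2 * A\<^sup>2 * \<eta>\<^sup>2" by (simp add: algebra_simps)
      finally have "ennreal ((D T \<omega>)\<^sup>2) \<le> ennreal (8 * A\<^sup>2 * (Z T \<omega>)\<^sup>2 + 2 * A\<^sup>2 * \<eta>\<^sup>2)" by (rule ennreal_leI)
      then show ?case by (subst (asm) ennreal_affine) simp_all
    qed
    then have "(\<integral>\<^sup>+\<omega>. ennreal ((D T \<omega>)\<^sup>2) \<partial>M) \<le> (\<integral>\<^sup>+\<omega>. ennreal (8 * A\<^sup>2) * ennreal ((Z T \<omega>)\<^sup>2) + ennreal (2 * A\<^sup>2 * \<eta>\<^sup>2) \<partial>M)"
      by (rule nn_integral_mono_AE)
    also have "\<dots> = ennreal (8 * A\<^sup>2) * (\<integral>\<^sup>+\<omega>. ennreal ((Z T \<omega>)\<^sup>2) \<partial>M) + ennreal (2 * A\<^sup>2 * \<eta>\<^sup>2)"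
      using Z(4)[OF T] by (simp add: nn_integral_add nn_integral_cmult emeasure_space_1)
    also have "\<dots> \<le> ennreal (8 * A\<^sup>2) * ennreal (C / T) + ennreal (2 * A\<^sup>2 * \<eta>\<^sup>2)"
      by (intro add_right_mono mult_left_mono Z(6) T) simp
    also have "\<dots> = ennreal (8 * A\<^sup>2 * C / T + 2 * A\<^sup>2 * \<eta>\<^sup>2)"
      using Z(2) T by (simp add: ennreal_plus flip: ennreal_mult)
    finally have "(\<integral>\<^sup>+\<omega>. ennreal ((D T \<omega>)\<^sup>2) \<partial>M) \<le> ennreal (8 * A\<^sup>2 * C / T + 2 * A\<^sup>2 * \<eta>\<^sup>2)" .
    from this[unfolded nn_integral_eq_integral[OF deviation_square_integrable[OF T] AE_I2[OF zero_le_power2]]]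
    have "ennreal (\<integral>\<omega>. (D T \<omega>)\<^sup>2 \<partial>M) \<le> ennreal (8 * A\<^sup>2 * C / T + 2 * A\<^sup>2 * \<eta>\<^sup>2)" .
    moreover have "0 \<le> 8 * A\<^sup>2 * C / T + 2 * A\<^sup>2 * \<eta>\<^sup>2" using Z(2) T by simp
    ultimately show ?thesis by (simp only: ennreal_le_iff)
  qed
  have "((\<lambda>T. 8 * A\<^sup>2 * C / T) \<longlongrightarrow> 0) at_top"
    by (intro tendsto_divide_0[OF tendsto_const] filterlim_at_top_imp_at_infinity filterlim_ident)
  then have "\<forall>\<^sub>F T in at_top. 8 * A\<^sup>2 * C / T < \<epsilon> / 2"
    by (rule order_tendstoD) (use \<epsilon> in simp)
  then show "\<forall>\<^sub>F T in at_top. dist (\<integral>\<omega>. (D T \<omega>)\<^sup>2 \<partial>M) 0 < \<epsilon>"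
    using eventually_ge_at_top[of H0]
  proof eventually_elim
    case (elim T)
    have "0 \<le> (\<integral>\<omega>. (D T \<omega>)\<^sup>2 \<partial>M)" by simp
    then show ?case using bound[OF elim(2)] elim(1) small \<epsilon> by (simp add: dist_real_def)
  qed
qed

text \<open>The series of the \<open>(Z (b ^ n) \<omega>)\<^sup>2\<close> has finite mean, bounded
  by a geometric series, so it converges almost surely and its terms tend to zero. The windows for
  \<open>H = b ^ n\<close> leave no gaps.\<close>

lemma deviation_AE_eventually:
  assumes \<eta>: "0 < \<eta>"
  shows "AE \<omega> in M. \<forall>\<^sub>F T in at_top. 0 \<le> D T \<omega> \<and> D T \<omega> \<le> A * (3 * \<eta>)"
proof -
  obtain b C H0 Z where Z: "1 < b" "0 \<le> C" "0 < H0"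
    "\<And>H. 0 < H \<Longrightarrow> Z H \<in> borel_measurable M" "\<And>H \<omega>. 0 < H \<Longrightarrow> 0 \<le> Z H \<omega>"
    "\<And>H. 0 < H \<Longrightarrow> (\<integral>\<^sup>+\<omega>. ennreal ((Z H \<omega>)\<^sup>2) \<partial>M) \<le> ennreal (C / H)"
    "\<And>H. H0 \<le> H \<Longrightarrow> AE \<omega> in M. \<forall>T. H / b \<le> T \<longrightarrow> T \<le> H \<longrightarrow> good_path \<omega> T \<longrightarrow>
       (\<forall>k. \<forall>u\<in>{0..1}. \<bar>measure (N T k \<omega>) {0..T * u} / T - limit k u\<bar> \<le> 2 * Z H \<omega> + \<eta>)"
    by (rule sandwich[OF \<eta>]) blast
  have bn: "0 < b ^ n" for n using Z(1) by simp
  have geo: "summable (\<lambda>n. C / b ^ n)"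
  proof -
    have "summable (\<lambda>n. C * (1 / b) ^ n)" using Z(1) by (intro summable_mult summable_geometric) simp
    then show ?thesis by (simp add: power_divide)
  qed
  have "(\<integral>\<^sup>+\<omega>. (\<Sum>n. ennreal ((Z (b ^ n) \<omega>)\<^sup>2)) \<partial>M) = (\<Sum>n. \<integral>\<^sup>+\<omega>. ennreal ((Z (b ^ n) \<omega>)\<^sup>2) \<partial>M)"
    using Z(4)[OF bn] by (intro nn_integral_suminf) measurable
  also have "\<dots> \<le> (\<Sum>n. ennreal (C / b ^ n))" by (intro suminf_le Z(6) bn) auto
  also have "\<dots> = ennreal (\<Sum>n. C / b ^ n)"
    by (rule suminf_ennreal_eq[OF _ summable_sums[OF geo]]) (use Z(2) bn in \<open>auto simp: less_imp_le\<close>)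
  also have "\<dots> < \<infinity>" by simp
  finally have "(\<integral>\<^sup>+\<omega>. (\<Sum>n. ennreal ((Z (b ^ n) \<omega>)\<^sup>2)) \<partial>M) \<noteq> \<infinity>" by (rule less_imp_neq)
  then have sum: "AE \<omega> in M. (\<Sum>n. ennreal ((Z (b ^ n) \<omega>)\<^sup>2)) \<noteq> \<infinity>"
    using Z(4)[OF bn] by (intro nn_integral_PInf_AE) measurable
  have "AE \<omega> in M. \<forall>n. H0 \<le> b ^ n \<longrightarrow> (\<forall>T. b ^ n / b \<le> T \<longrightarrow> T \<le> b ^ n \<longrightarrow> good_path \<omega> T \<longrightarrow>
       (\<forall>k. \<forall>u\<in>{0..1}. \<bar>measure (N T k \<omega>) {0..T * u} / T - limit k u\<bar> \<le> 2 * Z (b ^ n) \<omega> + \<eta>))"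
    unfolding AE_all_countable
  proof
    fix n
    show "AE \<omega> in M. H0 \<le> b ^ n \<longrightarrow> (\<forall>T. b ^ n / b \<le> T \<longrightarrow> T \<le> b ^ n \<longrightarrow> good_path \<omega> T \<longrightarrow>
       (\<forall>k. \<forall>u\<in>{0..1}. \<bar>measure (N T k \<omega>) {0..T * u} / T - limit k u\<bar> \<le> 2 * Z (b ^ n) \<omega> + \<eta>))"
      by (cases "H0 \<le> b ^ n") (simp_all add: Z(7))
  qed
  then show ?thesis using sum good AE_space
  proof eventually_elim
    case (elim \<omega>)
    have "summable (\<lambda>n. (Z (b ^ n) \<omega>)\<^sup>2)"
      using elim(2) by (intro summable_suminf_not_top) simp_all
    then have "(\<lambda>n. (Z (b ^ n) \<omega>)\<^sup>2) \<longlonglongrightarrow> 0" by (rule summable_LIMSEQ_zero)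
    then have "\<forall>\<^sub>F n in sequentially. (Z (b ^ n) \<omega>)\<^sup>2 < \<eta>\<^sup>2"
      by (rule order_tendstoD) (use \<eta> in simp)
    moreover have "\<forall>\<^sub>F n in sequentially. H0 \<le> b ^ n"
    proof -
      obtain n1 where n1: "H0 < b ^ n1" using real_arch_pow[OF Z(1)] by blast
      have "H0 \<le> b ^ n" if "n1 \<le> n" for n
        using n1 power_increasing[OF that, of b] Z(1) by linarith
      then show ?thesis unfolding eventually_sequentially by blast
    qed
    ultimately have "\<forall>\<^sub>F n in sequentially. (Z (b ^ n) \<omega>)\<^sup>2 < \<eta>\<^sup>2 \<and> H0 \<le> b ^ n" by (rule eventually_conj)
    then obtain n0 where n0: "\<And>n. n0 \<le> n \<Longrightarrow> (Z (b ^ n) \<omega>)\<^sup>2 < \<eta>\<^sup>2 \<and> H0 \<le> b ^ n"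
      unfolding eventually_sequentially by blast
    show ?case
      using eventually_gt_at_top[of "b ^ n0"]
    proof eventually_elim
      fix T :: real assume T: "b ^ n0 < T"
      then have T0: "0 < T" using bn[of n0] by linarith
      obtain n' where n': "T < b ^ n'" using real_arch_pow[OF Z(1)] by blast
      \<comment> \<open>The least such exponent has \<open>b ^ (n - 1) < T \<le> b ^ n\<close>,
        which places \<open>T\<close> in the window of \<open>b ^ n\<close>; as \<open>T\<close>
        exceeds \<open>b ^ n0\<close>, also \<open>n0 < n\<close>.\<close>
      define n where "n = (LEAST n. T \<le> b ^ n)"
      have n: "T \<le> b ^ n" unfolding n_def by (rule LeastI[of _ n']) (use n' in simp)
      have "n0 < n"
      proof (rule ccontr)
        assume "\<not> n0 < n"
        then have "b ^ n \<le> b ^ n0" using Z(1) by (intro power_increasing) auto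
        with n T show False by linarith
      qed
      then obtain j where j: "n = Suc j" by (cases n) auto
      have "\<not> T \<le> b ^ j"
        using not_less_Least[of j "\<lambda>n. T \<le> b ^ n"] j unfolding n_def by simp
      then have lo: "b ^ n / b \<le> T" using j Z(1) by simp
      have Zn: "(Z (b ^ n) \<omega>)\<^sup>2 < \<eta>\<^sup>2" "H0 \<le> b ^ n" using n0[of n] \<open>n0 < n\<close> by auto
      have "Z (b ^ n) \<omega> < \<eta>" using Zn(1) \<eta> by (rule power_less_imp_less_base[OF _ less_imp_le])
      moreover have "good_path \<omega> T" using elim(3) T0 by blast
      ultimately have "\<bar>measure (N T k \<omega>) {0..T * u} / T - limit k u\<bar> \<le> 3 * \<eta>" if "u \<in> {0..1}" for k u
      proof -
        have "\<bar>measure (N T k \<omega>) {0..T * u} / T - limit k u\<bar> \<le> 2 * Z (b ^ n) \<omega> + \<eta>"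
          using elim(1) Zn(2) lo n \<open>good_path \<omega> T\<close> that by blast
        then show ?thesis using \<open>Z (b ^ n) \<omega> < \<eta>\<close> by linarith
      qed
      then show "0 \<le> D T \<omega> \<and> D T \<omega> \<le> A * (3 * \<eta>)" by (rule D_le[OF T0 elim(4)])
    qed
  qed
qed

text \<open>The exceptional set depends on the tolerance, so tolerances are taken from a sequence
  tending to zero.\<close>

lemma deviation_AE: "AE \<omega> in M. ((\<lambda>T. D T \<omega>) \<longlongrightarrow> 0) at_top"
proof -
  have "AE \<omega> in M. \<forall>j::nat. \<forall>\<^sub>F T in at_top. 0 \<le> D T \<omega> \<and> D T \<omega> \<le> A * (3 * (1 / real (Suc j)))"
    unfolding AE_all_countable by (intro allI deviation_AE_eventually) simp
  then show ?thesis
  proof eventually_elim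
    case (elim \<omega>)
    show ?case
    proof (rule tendstoI)
      fix \<epsilon> :: real assume \<epsilon>: "0 < \<epsilon>"
      obtain j :: nat where j: "3 * A / \<epsilon> < real j" using reals_Archimedean2 by blast
      have "3 * A < \<epsilon> * real (Suc j)" using j \<epsilon> by (simp add: field_simps)
      then have small: "A * (3 * (1 / real (Suc j))) < \<epsilon>" by (simp add: divide_less_eq mult.commute)
      from elim[rule_format, of j] show "\<forall>\<^sub>F T in at_top. dist (D T \<omega>) 0 < \<epsilon>"
      proof eventually_elim
        case (elim T)
        then show ?case using small by (simp add: dist_real_def)
      qed
    qed
  qed
qed

theorem deviation_tendsto_zero:
  "tendsto_L2_zero M D \<and> (AE \<omega> in M. ((\<lambda>T. D T \<omega>) \<longlongrightarrow> 0) at_top)"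
  using D_meas deviation_square_integrable deviation_L2 deviation_AE by (simp add: tendsto_L2_zero_def)

end

end

section \<open>Arbitrary norms, measurability of the supremum, and the theorem\<close>

lemma is_norm_bound:
  fixes \<nu> :: "real ^ 'p \<Rightarrow> real"
  assumes \<nu>: "is_norm \<nu>"
  shows "\<nu> v \<le> (\<Sum>k\<in>UNIV. \<nu> (axis k 1)) * (\<Sum>k\<in>UNIV. \<bar>v $ k\<bar>)"
proof -
  have sc: "\<nu> (a *\<^sub>R x) = \<bar>a\<bar> * \<nu> x" and tri: "\<nu> (x + x') \<le> \<nu> x + \<nu> x'" and nn: "0 \<le> \<nu> x" for a x x'
    using \<nu> by (auto simp: is_norm_def)
  have nu0: "\<nu> 0 = 0" using sc[of 0 0] by simp
  have sum: "\<nu> (\<Sum>k\<in>S. f k) \<le> (\<Sum>k\<in>S. \<nu> (f k))" if "finite S" for S and f :: "'p \<Rightarrow> real ^ 'p"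
    using that by (induction S rule: finite_induct) (auto simp: nu0 intro: order.trans[OF tri])
  have "v = (\<Sum>k\<in>UNIV. v $ k *\<^sub>R axis k 1)"
    by (simp add: vec_eq_iff axis_def if_distrib cong: if_cong)
  then have "\<nu> v \<le> (\<Sum>k\<in>UNIV. \<nu> (v $ k *\<^sub>R axis k 1))" using sum[of UNIV "\<lambda>k. v $ k *\<^sub>R axis k 1"] by simp
  also have "\<dots> = (\<Sum>k\<in>UNIV. \<nu> (axis k 1) * \<bar>v $ k\<bar>)" by (simp add: sc mult.commute)
  also have "\<dots> \<le> (\<Sum>k\<in>UNIV. (\<Sum>k\<in>UNIV. \<nu> (axis k 1)) * \<bar>v $ k\<bar>)"
    by (intro sum_mono mult_right_mono member_le_sum nn) simp_all
  finally show ?thesis by (simp add: sum_distrib_left)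
qed

lemma is_norm_continuous:
  fixes \<nu> :: "real ^ 'p \<Rightarrow> real"
  assumes \<nu>: "is_norm \<nu>"
  shows "continuous_on UNIV \<nu>"
proof -
  define L where "L = (\<Sum>k\<in>UNIV. \<nu> (axis k 1)) * real CARD('p)"
  have L: "0 \<le> L" using \<nu> by (simp add: L_def is_norm_def sum_nonneg)
  have bd: "\<nu> v \<le> L * norm v" for v
  proof -
    have "(\<Sum>k\<in>UNIV. \<bar>v $ k\<bar>) \<le> (\<Sum>k\<in>(UNIV :: 'p set). norm v)" by (intro sum_mono component_le_norm_cart)
    then have "(\<Sum>k\<in>UNIV. \<nu> (axis k 1)) * (\<Sum>k\<in>UNIV. \<bar>v $ k\<bar>) \<le> (\<Sum>k\<in>UNIV. \<nu> (axis k 1)) * (\<Sum>k\<in>(UNIV :: 'p set). norm v)"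
      using \<nu> by (intro mult_left_mono sum_nonneg) (auto simp: is_norm_def)
    then show ?thesis using is_norm_bound[OF \<nu>, of v] by (simp add: L_def mult.assoc)
  qed
  have tri: "\<nu> (x + x') \<le> \<nu> x + \<nu> x'" for x x' using \<nu> by (simp add: is_norm_def)
  have "L-lipschitz_on UNIV \<nu>"
  proof (rule lipschitz_onI[OF _ L])
    fix x z :: "real ^ 'p"
    have "\<nu> x \<le> \<nu> z + L * norm (x - z)" "\<nu> z \<le> \<nu> x + L * norm (x - z)"
      using tri[of z "x - z"] tri[of x "z - x"] bd[of "x - z"] bd[of "z - x"] by (simp_all add: norm_minus_commute)
    then show "dist (\<nu> x) (\<nu> z) \<le> L * dist x z" by (simp add: dist_norm abs_le_iff)
  qed
  then show ?thesis by (rule lipschitz_on_continuous_on)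
qed

text \<open>Makes the deviation measurable, as a supremum of countably many variables. A value at
  \<open>u < 1\<close> is approached from the right by values at rationals; the endpoint, where no
  right limit is available, is itself rational.\<close>

lemma SUP_right_continuous:
  fixes f :: "real \<Rightarrow> real"
  assumes bdd: "bdd_above (f ` {0..1})" and cont: "\<And>u. u \<in> {0..<1} \<Longrightarrow> (f \<longlongrightarrow> f u) (at_right u)"
  shows "(SUP u\<in>{0..1}. f u) = (SUP u\<in>{0..1} \<inter> \<rat>. f u)"
proof (rule antisym)
  have Q: "(0 :: real) \<in> {0..1} \<inter> \<rat>" by simp
  have bdd': "bdd_above (f ` ({0..1} \<inter> \<rat>))" by (rule bdd_above_mono[OF bdd]) auto
  show "(SUP u\<in>{0..1} \<inter> \<rat>. f u) \<le> (SUP u\<in>{0..1}. f u)" by (rule cSUP_subset_mono[OF _ bdd]) (use Q in \<open>blast\<close>, auto)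
  show "(SUP u\<in>{0..1}. f u) \<le> (SUP u\<in>{0..1} \<inter> \<rat>. f u)"
  proof (rule cSUP_least)
    fix u :: real assume u: "u \<in> {0..1}"
    show "f u \<le> (SUP u\<in>{0..1} \<inter> \<rat>. f u)"
    proof (cases "u = 1")
      case True
      then show ?thesis by (intro cSUP_upper[OF _ bdd']) simp
    next
      case False
      then have u1: "u \<in> {0..<1}" using u by auto
      show ?thesis
      proof (rule ccontr)
        assume "\<not> f u \<le> (SUP u\<in>{0..1} \<inter> \<rat>. f u)"
        then have "\<forall>\<^sub>F w in at_right u. (SUP u\<in>{0..1} \<inter> \<rat>. f u) < f w"
          by (intro order_tendstoD(1)[OF cont[OF u1]]) simp
        then obtain d where d: "u < d" "\<And>w. u < w \<Longrightarrow> w < d \<Longrightarrow> (SUP u\<in>{0..1} \<inter> \<rat>. f u) < f w"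
          unfolding eventually_at_right_field by blast
        have "u < min d 1" using d(1) u1 by simp
        from Rats_dense_in_real[OF this] obtain r where r: "r \<in> \<rat>" "u < r" "r < min d 1" by blast
        have "f r \<le> (SUP u\<in>{0..1} \<inter> \<rat>. f u)" by (rule cSUP_upper[OF _ bdd']) (use r u1 in auto)
        with d(2)[of r] r show False by simp
      qed
    qed
  qed simp
qed

lemma right_continuous_count:
  assumes n: "finite_measure n" "sets n = sets borel" "emeasure n (- {0..T :: real}) = 0" and T: "0 < T" and u: "0 \<le> u"
  shows "((\<lambda>w. measure n {0..T * w}) \<longlongrightarrow> measure n {0..T * u}) (at_right u)"
proof -
  interpret finite_borel_measure n
    by (rule finite_borel_measure.intro[OF n(1)]) (simp add: finite_borel_measure_axioms_def n(2))
  have eq: "cdf n t = measure n {0..t}" if "0 \<le> t" for t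
  proof -
    have "{..t} = {0..t} \<union> {..<0}" using that by auto
    then have "measure n {..t} = measure n {0..t} + measure n {..<0}"
      by (simp add: n(2) finite_measure_Union disjoint_iff)
    moreover have "emeasure n {..<0} \<le> emeasure n (- {0..T})" by (rule emeasure_mono) (auto simp: n(2))
    ultimately show ?thesis using n(3) by (simp add: cdf_def measure_def)
  qed
  have "(cdf n \<longlongrightarrow> cdf n (T * u)) (at_right (T * u))"
    using cdf_is_right_cont[of "T * u"] by (simp add: continuous_within)
  moreover have "filterlim (\<lambda>w. T * w) (at_right (T * u)) (at_right u)"
    by (rule filterlim_times_pos[OF filterlim_ident T refl])
  ultimately have "((\<lambda>w. cdf n (T * w)) \<longlongrightarrow> cdf n (T * u)) (at_right u)" by (rule filterlim_compose)
  then have "((\<lambda>w. cdf n (T * w)) \<longlongrightarrow> measure n {0..T * u}) (at_right u)" using T u by (simp add: eq)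
  then show ?thesis
  proof (rule Lim_transform_eventually)
    show "\<forall>\<^sub>F w in at_right u. cdf n (T * w) = measure n {0..T * w}"
      using eventually_at_right_less[of u] by eventually_elim (use T u in \<open>simp add: eq\<close>)
  qed
qed

text \<open>The restriction to \<open>{0..<s}\<close> turns into the vanishing of \<open>ph\<close>
  at nonpositive delays, negative times being null for \<open>N T l \<omega>\<close>. Splitting
  \<open>ennreal\<close> of the product uses that both factors are nonnegative.\<close>

lemma (in hawkes_lln) hawkes_intensity_eq_rate:
  assumes s: "s \<in> {0..T}" and T: "0 < T"
    and n: "\<And>l. sets (N T l \<omega>) = sets borel" "\<And>l. emeasure (N T l \<omega>) (- {0..T}) = 0"
    and m: "\<And>k x. m k x = \<mu> x $ k" and \<phi>: "\<And>k l t. \<phi> k l t = \<Phi> t $ k $ l"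
  shows "hawkes_intensity T \<mu> g \<Phi> (\<lambda>l. N T l \<omega>) k s = rate T \<omega> k s"
proof -
  have sT: "s / T \<in> {0..1}" using s T by auto
  have "(\<integral>\<^sup>+r\<in>{0..<s}. ennreal (g (s / T) * \<Phi> (s - r) $ k $ l) \<partial>N T l \<omega>) =
      gaH T s * (\<integral>\<^sup>+r. ph k l (s - r) \<partial>N T l \<omega>)" for l
  proof -
    have pm: "(\<lambda>r. ph k l (s - r)) \<in> borel_measurable (N T l \<omega>)"
      unfolding measurable_cong_sets[OF n(1) refl]
      by (rule measurable_compose[OF _ ph_measurable]) measurable
    have "AE r in N T l \<omega>. r \<in> {0..T}"
      by (rule AE_I[of _ _ "- {0..T}"]) (use n in auto)
    then have "AE r in N T l \<omega>. ennreal (g (s / T) * \<Phi> (s - r) $ k $ l) * indicator {0..<s} r = gaH T s * ph k l (s - r)"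
    proof eventually_elim
      case (elim r)
      show ?case
      proof (cases "r < s")
        case True
        then show ?thesis
          using elim s g_nonneg[OF sT] \<phi>_nonneg[of "s - r" k l]
          by (simp add: gaH_def ph_def \<phi> ennreal_mult)
      next
        case False
        then show ?thesis by (simp add: ph_def)
      qed
    qed
    then have "(\<integral>\<^sup>+r\<in>{0..<s}. ennreal (g (s / T) * \<Phi> (s - r) $ k $ l) \<partial>N T l \<omega>) = (\<integral>\<^sup>+r. gaH T s * ph k l (s - r) \<partial>N T l \<omega>)"
      by (rule nn_integral_cong_AE)
    also have "\<dots> = gaH T s * (\<integral>\<^sup>+r. ph k l (s - r) \<partial>N T l \<omega>)" by (rule nn_integral_cmult[OF pm])
    finally show ?thesis .
  qed
  then show ?thesis
    unfolding hawkes_intensity_def rate_def using s by (simp add: sum_distrib_left mmH_def m)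
qed

theorem theorem1:
  fixes M :: "'w measure"
    and \<pi> :: "'p::finite \<Rightarrow> 'w \<Rightarrow> (real \<times> real) measure"
    and \<mu> :: "real \<Rightarrow> real ^ 'p"
    and g :: "real \<Rightarrow> real"
    and \<phi> :: "real \<Rightarrow> real ^ 'p ^ 'p"
    and N :: "real \<Rightarrow> 'p \<Rightarrow> 'w \<Rightarrow> real measure"
    and \<nu> :: "real ^ 'p \<Rightarrow> real"
  assumes norm: "is_norm \<nu>"
    and prob: "prob_space M"
    and prm: "\<And>k. poisson_random_measure M lborel (\<pi> k)"
    and indep: "indep_random_measures M (lborel :: (real \<times> real) measure) \<pi>"
    and mu_nonneg: "\<And>x k. x \<in> {0..1} \<Longrightarrow> 0 \<le> \<mu> x $ k"
    and g_nonneg: "\<And>x. x \<in> {0..1} \<Longrightarrow> 0 \<le> g x"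
    and phi_nonneg: "\<And>t k l. 0 \<le> t \<Longrightarrow> 0 \<le> \<phi> t $ k $ l"
    and hawkes: "hawkes_family M \<pi> \<mu> g \<phi> N"
    and mu_cont: "continuous_on {0..1} \<mu>"
    and g_C1: "C1_on_interval 0 1 g"
    and phi_integrable: "\<And>k l. set_integrable lborel {0..} (\<lambda>t. \<phi> t $ k $ l)"
    and subcritical: "cart_spectral_radius ((SUP x\<in>{0..1}. g x) *\<^sub>R kernel_integral \<phi>) < 1"
  shows "tendsto_L2_zero M (hawkes_deviation \<nu> \<mu> g \<phi> N) \<and>
         (AE \<omega> in M. ((\<lambda>T. hawkes_deviation \<nu> \<mu> g \<phi> N T \<omega>) \<longlongrightarrow> 0) at_top)"
proof -
  interpret prm_family M \<pi>
    by (rule prm_family.intro[OF prob]) (unfold prm_family_axioms_def, intro conjI allI prm indep)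
  define G where "G = (SUP x\<in>{0..1}. g x)"
  define K where "K = kernel_integral \<phi>"
  have g_cont: "continuous_on {0..1} g"
    using g_C1 unfolding C1_on_interval_def by (auto intro: DERIV_continuous_on)
  have "bdd_above (g ` {0..1})"
    by (intro bounded_imp_bdd_above compact_imp_bounded compact_continuous_image g_cont) simp
  then have g_le: "g x \<le> G" if "x \<in> {0..1}" for x unfolding G_def using that by (intro cSUP_upper)
  have G: "0 \<le> G" using g_nonneg[of 0] g_le[of 0] by simp
  have K_eq: "K $ k $ l = (LBINT t:{0..}. \<phi> t $ k $ l)" for k l by (simp add: K_def kernel_integral_def)
  have K: "0 \<le> K $ k $ l" for k l
    unfolding K_eq set_lebesgue_integral_def
    by (rule integral_nonneg_AE) (auto intro!: AE_I2 simp: phi_nonneg split: split_indicator)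
  obtain \<zeta>0 where \<zeta>0: "\<And>l. 1 + (\<Sum>k\<in>UNIV. \<zeta>0 k * (G *\<^sub>R K) $ k $ l) \<le> \<zeta>0 l" "\<And>l. 0 \<le> \<zeta>0 l"
    by (rule subcritical_weights[of "G *\<^sub>R K"]) (use G K subcritical in \<open>auto simp: G_def K_def\<close>)
  define S where "S = (\<Sum>l\<in>UNIV. \<Sum>k\<in>UNIV. \<zeta>0 k * K $ k $ l)"
  have S: "0 \<le> S" unfolding S_def by (intro sum_nonneg mult_nonneg_nonneg \<zeta>0(2) K)
  \<comment> \<open>Doubling the weights creates slack: with \<open>\<zeta> = 2 * \<zeta>0\<close>
    and \<open>c = G + \<delta>0\<close>, one plus the weighted column sum is at most
    \<open>1 + 2 * (\<zeta>0 l - 1) + 2 * \<delta>0 * S\<close>, and this is at most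
    \<open>\<zeta> l\<close> as soon as \<open>\<delta>0 * S \<le> 1 / 2\<close>.\<close>
  define \<delta>0 where "\<delta>0 = 1 / (2 * (S + 1))"
  have \<delta>0: "0 < \<delta>0" "\<delta>0 * S \<le> 1 / 2" using S by (auto simp: \<delta>0_def field_simps)
  define c where "c = G + \<delta>0"
  define \<zeta> where "\<zeta> l = 2 * \<zeta>0 l" for l
  have \<zeta>: "1 + (\<Sum>k\<in>UNIV. \<zeta> k * (c * K $ k $ l)) \<le> \<zeta> l" for l
  proof -
    have "(\<Sum>k\<in>UNIV. \<zeta> k * (c * K $ k $ l)) = 2 * (\<Sum>k\<in>UNIV. \<zeta>0 k * (G * K $ k $ l)) + 2 * (\<delta>0 * (\<Sum>k\<in>UNIV. \<zeta>0 k * K $ k $ l))"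
      by (simp add: \<zeta>_def c_def sum_distrib_left sum.distrib algebra_simps)
    moreover have "\<delta>0 * (\<Sum>k\<in>UNIV. \<zeta>0 k * K $ k $ l) \<le> \<delta>0 * S"
      unfolding S_def using \<delta>0(1)
      by (intro mult_left_mono member_le_sum[of l UNIV "\<lambda>l. \<Sum>k\<in>UNIV. \<zeta>0 k * K $ k $ l"] sum_nonneg mult_nonneg_nonneg \<zeta>0(2) K) auto
    ultimately show ?thesis using \<zeta>0(1)[of l] \<delta>0(2) by (simp add: \<zeta>_def)
  qed
  have \<zeta>_nonneg: "0 \<le> \<zeta> l" for l using \<zeta>0(2)[of l] by (simp add: \<zeta>_def)
  define V where "V x = matrix_inv (mat 1 - g x *\<^sub>R K) *v \<mu> x" for x
  have V: "V x $ k = \<mu> x $ k + g x * (\<Sum>l\<in>UNIV. K $ k $ l * V x $ l)" if x: "x \<in> {0..1}" for x k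
    unfolding V_def
  proof (rule matrix_inv_solves, rule invertible_of_weights[OF K g_nonneg[OF x] _ \<zeta>_nonneg])
    fix l
    have "(\<Sum>k\<in>UNIV. \<zeta> k * (g x * K $ k $ l)) \<le> (\<Sum>k\<in>UNIV. \<zeta> k * (c * K $ k $ l))"
      using g_le[OF x] \<delta>0(1) by (intro sum_mono mult_left_mono mult_right_mono \<zeta>_nonneg K) (simp add: c_def)
    then show "1 + (\<Sum>k\<in>UNIV. \<zeta> k * (g x * K $ k $ l)) \<le> \<zeta> l" using \<zeta>[of l] by linarith
  qed
  have lln: "hawkes_lln M finite_\<pi> filt (\<lambda>k x. \<mu> x $ k) g (\<lambda>k l t. \<phi> t $ k $ l) (\<lambda>k l. K $ k $ l) c \<zeta> (\<lambda>k x. V x $ k) \<delta>0"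
  proof (rule hawkes_lln.intro[OF adapted_kernel_finite_\<pi>], rule limit_data.intro)
    show "continuous_on {0..1} (\<lambda>x. \<mu> x $ k)" for k by (intro continuous_intros mu_cont)
    show "hawkes_lln_axioms g c \<delta>0" using \<delta>0(1) g_le by (simp add: hawkes_lln_axioms_def c_def)
    show "g x \<le> c" if "x \<in> {0..1}" for x using g_le[OF that] \<delta>0(1) by (simp add: c_def)
    show "0 \<le> c" using G \<delta>0(1) by (simp add: c_def)
  qed (fact mu_nonneg g_cont g_nonneg phi_nonneg phi_integrable K_eq \<zeta> \<zeta>_nonneg V)+
  interpret h: hawkes_lln M finite_\<pi> filt "\<lambda>k x. \<mu> x $ k" g "\<lambda>k l t. \<phi> t $ k $ l" "\<lambda>k l. K $ k $ l" c \<zeta> "\<lambda>k x. V x $ k" N \<delta>0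
    by (rule lln)
  have N_sets: "sets (N T k \<omega>) = sets borel" and N_supp: "emeasure (N T k \<omega>) (- {0..T}) = 0"
    and N_nat: "A \<in> sets borel \<Longrightarrow> \<exists>i::nat. emeasure (N T k \<omega>) A = of_nat i"
    if "0 < T" "\<omega> \<in> space M" for T k \<omega> A
    using hawkes that unfolding hawkes_family_def point_process_on_def by blast+
  have N_meas: "(\<lambda>\<omega>. emeasure (N T k \<omega>) A) \<in> borel_measurable M" if "0 < T" "A \<in> sets borel" for T k A
    using hawkes that unfolding hawkes_family_def point_process_on_def by blast
  have N_finite: "finite_measure (N T k \<omega>)" if T\<omega>: "0 < T" "\<omega> \<in> space M" for T k \<omega>
  proof (rule finite_measureI)
    have "space (N T k \<omega>) \<in> sets borel" using sets_eq_imp_space_eq[OF N_sets[OF T\<omega>, of k]] by simp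
    then obtain i :: nat where "emeasure (N T k \<omega>) (space (N T k \<omega>)) = of_nat i" using N_nat[OF T\<omega>] by blast
    then show "emeasure (N T k \<omega>) (space (N T k \<omega>)) \<noteq> \<infinity>" by simp
  qed
  \<comment> \<open>Outside one null set, common to all \<open>T\<close>, the equation holds and
    \<open>finite_\<pi>\<close> agrees with \<open>\<pi>\<close>.\<close>
  have good: "AE \<omega> in M. \<forall>T>0. h.good_path \<omega> T"
  proof -
    have "AE \<omega> in M. \<forall>T>0. \<forall>k. \<forall>t\<in>{0..T}. emeasure (N T k \<omega>) {0..t} =
        emeasure (\<pi> k \<omega>) {(x, s). 0 \<le> s \<and> s \<le> t \<and> 0 \<le> x \<and>
          ennreal x \<le> hawkes_intensity T \<mu> g \<phi> (\<lambda>l. N T l \<omega>) k s}"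
      using hawkes by (simp add: hawkes_family_def)
    then show ?thesis using AE_finite_points AE_space
    proof eventually_elim
      case (elim \<omega>)
      show ?case
      proof (intro allI impI)
        fix T :: real assume T: "0 < T"
        have "emeasure (N T k \<omega>) {0..t} =
            emeasure (finite_\<pi> k \<omega>) {(x, s). 0 \<le> s \<and> s \<le> t \<and> 0 \<le> x \<and> ennreal x \<le> h.rate T \<omega> k s}"
          if t: "t \<in> {0..T}" for k t
        proof -
          have "hawkes_intensity T \<mu> g \<phi> (\<lambda>l. N T l \<omega>) k s = h.rate T \<omega> k s" if "s \<in> {0..T}" for s
            by (rule h.hawkes_intensity_eq_rate[OF that T N_sets[OF T elim(3)] N_supp[OF T elim(3)] refl refl])
          then have "{(x, s). 0 \<le> s \<and> s \<le> t \<and> 0 \<le> x \<and> ennreal x \<le> hawkes_intensity T \<mu> g \<phi> (\<lambda>l. N T l \<omega>) k s} =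
              {(x, s). 0 \<le> s \<and> s \<le> t \<and> 0 \<le> x \<and> ennreal x \<le> h.rate T \<omega> k s}"
            using t by auto
          moreover have "finite_\<pi> k \<omega> = \<pi> k \<omega>" using elim(2) by (simp add: finite_\<pi>_def)
          ultimately show ?thesis using elim(1)[rule_format, OF T t, of k] by simp
        qed
        then show "h.good_path \<omega> T"
          unfolding h.good_path_def using N_sets[OF T elim(3)] N_supp[OF T elim(3)] N_nat[OF T elim(3)] by blast
      qed
    qed
  qed
  define L where "L u = (LBINT x:{0..u}. V x)" for u
  have V_cont: "continuous_on {0..1} V"
    unfolding continuous_on_componentwise[of _ V] by (intro ballI) (auto simp: Basis_vec_def inner_axis intro: h.y_cont)
  have V_int: "set_integrable lborel {0..u} V" if "u \<in> {0..1}" for u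
    by (rule borel_integrable_atLeastAtMost', rule continuous_on_subset[OF V_cont]) (use that in auto)
  have L: "L u $ k = h.limit k u" if u: "u \<in> {0..1}" for u k
    unfolding L_def set_lebesgue_integral_def
    using integral_bounded_linear[OF bounded_linear_vec_nth[of k] V_int[OF u, unfolded set_integrable_def]] by simp
  have L_cont: "continuous_on {0..1} L"
    unfolding continuous_on_componentwise[of _ L]
  proof
    fix e :: "real ^ 'p" assume "e \<in> Basis"
    then obtain k where e: "e = axis k 1" by (auto simp: Basis_vec_def)
    obtain B where B: "0 \<le> B" "\<And>k x. x \<in> {0..1} \<Longrightarrow> \<bar>V x $ k\<bar> \<le> B" by (rule h.y_bounded) blast
    have "B-lipschitz_on {0..1} (\<lambda>u. h.limit k u)"
      by (rule lipschitz_onI[OF _ B(1)], unfold dist_real_def, rule LBINT_Lipschitz[OF h.y_cont B(2)])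
    then have "continuous_on {0..1} (\<lambda>u. h.limit k u)" by (rule lipschitz_on_continuous_on)
    then have "continuous_on {0..1} (\<lambda>u. L u $ k)" by (rule continuous_on_eq) (simp add: L)
    then show "continuous_on {0..1} (\<lambda>u. L u \<bullet> e)" by (simp add: e inner_axis)
  qed
  define f where "f T \<omega> u = \<nu> ((1 / T) *\<^sub>R (\<chi> k. measure (N T k \<omega>) {0..T * u}) - L u)" for T \<omega> u
  have D_eq: "hawkes_deviation \<nu> \<mu> g \<phi> N T \<omega> = (SUP u\<in>{0..1}. f T \<omega> u)" for T \<omega>
    unfolding hawkes_deviation_def f_def L_def V_def K_def ..
  define C\<nu> where "C\<nu> = (\<Sum>k\<in>UNIV. \<nu> (axis k 1))"
  have C\<nu>: "0 \<le> C\<nu>" unfolding C\<nu>_def using norm by (intro sum_nonneg) (simp add: is_norm_def)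
  have f_le: "f T \<omega> u \<le> C\<nu> * real CARD('p) * E"
    if E: "\<And>k. \<bar>measure (N T k \<omega>) {0..T * u} / T - h.limit k u\<bar> \<le> E" and u: "u \<in> {0..1}" for T \<omega> u E
  proof -
    have "f T \<omega> u \<le> C\<nu> * (\<Sum>k\<in>UNIV. \<bar>((1 / T) *\<^sub>R (\<chi> k. measure (N T k \<omega>) {0..T * u}) - L u) $ k\<bar>)"
      unfolding f_def C\<nu>_def by (rule is_norm_bound[OF norm])
    also have "\<dots> \<le> C\<nu> * (\<Sum>k\<in>(UNIV :: 'p set). E)"
      using E by (intro mult_left_mono sum_mono C\<nu>) (simp add: L[OF u])
    finally show ?thesis by (simp add: mult.assoc)
  qed
  have f_nonneg: "0 \<le> f T \<omega> u" for T \<omega> u unfolding f_def using norm by (simp add: is_norm_def)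
  have D_le: "0 \<le> hawkes_deviation \<nu> \<mu> g \<phi> N T \<omega> \<and> hawkes_deviation \<nu> \<mu> g \<phi> N T \<omega> \<le> C\<nu> * real CARD('p) * E"
    if E: "\<And>k u. u \<in> {0..1} \<Longrightarrow> \<bar>measure (N T k \<omega>) {0..T * u} / T - h.limit k u\<bar> \<le> E" for T \<omega> E
  proof -
    have le: "f T \<omega> u \<le> C\<nu> * real CARD('p) * E" if "u \<in> {0..1}" for u using E that by (intro f_le)
    then have "bdd_above (f T \<omega> ` {0..1})" by (intro bdd_aboveI2)
    then have "0 \<le> (SUP u\<in>{0..1}. f T \<omega> u)" by (rule cSUP_upper2[of _ _ 0]) (simp_all add: f_nonneg)
    moreover have "(SUP u\<in>{0..1}. f T \<omega> u) \<le> C\<nu> * real CARD('p) * E" by (rule cSUP_least) (use le in auto)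
    ultimately show ?thesis by (simp add: D_eq)
  qed
  \<comment> \<open>Counts are right-continuous in \<open>u\<close> and the limit is continuous, so
    the supremum may be taken over rational \<open>u\<close>. Finiteness of the counting measures
    bounds the values \<open>f T \<omega> u\<close>.\<close>
  have D_meas: "hawkes_deviation \<nu> \<mu> g \<phi> N T \<in> borel_measurable M" if T: "0 < T" for T
  proof -
    have bdd: "bdd_above (f T \<omega> ` {0..1})" if \<omega>: "\<omega> \<in> space M" for \<omega>
    proof -
      obtain B where B: "0 \<le> B" "\<And>k u. u \<in> {0..1} \<Longrightarrow> \<bar>h.limit k u\<bar> \<le> B" by (rule h.limit_bounded) blast
      define E where "E = (\<Sum>k\<in>UNIV. measure (N T k \<omega>) (space (N T k \<omega>)) / T) + B"
      have "f T \<omega> u \<le> C\<nu> * real CARD('p) * E" if u: "u \<in> {0..1}" for u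
      proof (rule f_le[OF _ u])
        fix k
        interpret finite_measure "N T k \<omega>" by (rule N_finite[OF T \<omega>])
        have "measure (N T k \<omega>) {0..T * u} / T \<le> measure (N T k \<omega>) (space (N T k \<omega>)) / T"
          using T by (intro divide_right_mono bounded_measure) simp
        also have "\<dots> \<le> (\<Sum>k\<in>UNIV. measure (N T k \<omega>) (space (N T k \<omega>)) / T)"
          using T by (intro member_le_sum[of k UNIV "\<lambda>k. measure (N T k \<omega>) (space (N T k \<omega>)) / T"]) auto
        finally have "measure (N T k \<omega>) {0..T * u} / T \<le> E - B" by (simp add: E_def)
        moreover have "0 \<le> measure (N T k \<omega>) {0..T * u} / T" using T by simp
        ultimately show "\<bar>measure (N T k \<omega>) {0..T * u} / T - h.limit k u\<bar> \<le> E"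
          using B(2)[OF u, of k] by linarith
      qed
      then show ?thesis by (intro bdd_aboveI2)
    qed
    have "(\<lambda>\<omega>. SUP u\<in>{0..1} \<inter> \<rat>. f T \<omega> u) \<in> borel_measurable M"
    proof (rule borel_measurable_cSUP)
      show "countable ({0..1} \<inter> \<rat> :: real set)" by (intro countable_Int2 countable_rat)
      show "bdd_above ((\<lambda>u. f T \<omega> u) ` ({0..1} \<inter> \<rat>))" if "\<omega> \<in> space M" for \<omega>
        by (rule bdd_above_mono[OF bdd[OF that]]) auto
      fix u :: real assume "u \<in> {0..1} \<inter> \<rat>"
      have "(\<lambda>\<omega>. (1 / T) *\<^sub>R (\<chi> k. measure (N T k \<omega>) {0..T * u}) - L u) \<in> borel_measurable M"
      proof (rule borel_measurable_euclidean_space[THEN iffD2], rule ballI)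
        fix e :: "real ^ 'p" assume "e \<in> Basis"
        then obtain k where e: "e = axis k 1" by (auto simp: Basis_vec_def)
        have "(\<lambda>\<omega>. measure (N T k \<omega>) {0..T * u}) \<in> borel_measurable M"
          unfolding measure_def by (rule measurable_compose[OF N_meas[OF T]]) simp_all
        then have "(\<lambda>\<omega>. (1 / T) * measure (N T k \<omega>) {0..T * u} - L u $ k) \<in> borel_measurable M" by measurable
        then show "(\<lambda>\<omega>. ((1 / T) *\<^sub>R (\<chi> k. measure (N T k \<omega>) {0..T * u}) - L u) \<bullet> e) \<in> borel_measurable M"
          by (simp add: e inner_axis)
      qed
      then show "(\<lambda>\<omega>. f T \<omega> u) \<in> borel_measurable M"
        unfolding f_def by (rule measurable_compose[OF _ borel_measurable_continuous_onI[OF is_norm_continuous[OF norm]]])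
    qed
    moreover have "hawkes_deviation \<nu> \<mu> g \<phi> N T \<omega> = (SUP u\<in>{0..1} \<inter> \<rat>. f T \<omega> u)" if \<omega>: "\<omega> \<in> space M" for \<omega>
      unfolding D_eq
    proof (rule SUP_right_continuous[OF bdd[OF \<omega>]])
      fix u :: real assume u: "u \<in> {0..<1}"
      have "((\<lambda>w. (1 / T) *\<^sub>R (\<chi> k. measure (N T k \<omega>) {0..T * w}) - L w) \<longlongrightarrow>
          (1 / T) *\<^sub>R (\<chi> k. measure (N T k \<omega>) {0..T * u}) - L u) (at_right u)"
      proof (intro tendsto_diff tendsto_scaleR tendsto_const tendsto_vec_lambda)
        show "((\<lambda>w. measure (N T k \<omega>) {0..T * w}) \<longlongrightarrow> measure (N T k \<omega>) {0..T * u}) (at_right u)" for k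
          by (rule right_continuous_count[OF N_finite[OF T \<omega>] N_sets[OF T \<omega>] N_supp[OF T \<omega>] T]) (use u in simp)
        have "(L \<longlongrightarrow> L u) (at u within {0..1})" using L_cont u by (simp add: continuous_on_def)
        then have "(L \<longlongrightarrow> L u) (at u within {u..1})" by (rule tendsto_within_subset) (use u in auto)
        then show "(L \<longlongrightarrow> L u) (at_right u)" using u by (simp add: at_within_Icc_at_right)
      qed
      moreover have "isCont \<nu> v" for v
        using is_norm_continuous[OF norm] by (simp add: continuous_on_eq_continuous_at)
      ultimately show "(f T \<omega> \<longlongrightarrow> f T \<omega> u) (at_right u)"
        unfolding f_def[abs_def] by (rule isCont_tendsto_compose[rotated])
    qed
    ultimately show ?thesis by (rule measurable_cong[THEN iffD2, rotated])
  qed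
  show ?thesis
    by (rule h.deviation_tendsto_zero[OF mult_nonneg_nonneg[OF C\<nu> of_nat_0_le_iff] D_meas D_le good])
qed

end
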